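(* Let $n\geq 5$, $H=SL_n$ and $\Gamma=SL_n(\mathbb{Z})$. Let $\Sigma$ be a finite generating set of $\Gamma$ and let $X_k$ be the $k$-th step of the corresponding random walk. Then for any pair $\mathcal{G}=(G_1,G_2)$ of subgroups of the alternating group $\mathrm{Alt}(n)$ there exist an algebraic extension $F_{\mathcal G}$ of $\mathbb{Q}$ and sequences of natural numbers $\{n_i(\mathcal G)\}_{i\ge1}$, $\{k_i(\mathcal G)\}_{i\ge1}$ such that for all $i$ $$\mathbb{P}\big(\mathrm{Gal}(F_{\mathcal G}(X_{n_i(\mathcal G)})/F_{\mathcal G})\simeq G_1\big)\geq 1-\frac{1}{2^i},\qquad \mathbb{P}\big(\mathrm{Gal}(F_{\mathcal G}(X_{k_i(\mathcal G)})/F_{\mathcal G})\simeq G_2\big)\geq 1-\frac{1}{2^i}.$$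
   Context: For a field $F$ of characteristic zero and $\gamma\in GL_n(F)$, $F(\gamma)$ denotes the splitting field over $F$ of the characteristic polynomial of $\gamma$. The random walk is $X_k=s_1\cdots s_k$ with $s_1,s_2,\dots$ independent uniformly distributed elements of $\Sigma$; $\mathbb P$ is the probability with respect to it. *)

theory Defs
  imports "HOL-Analysis.Analysis" "HOL-Computational_Algebra.Polynomial" "HOL-Algebra.Sym_Groups"
begin

(* Subfields of the complex numbers. Every algebraic extension of Q embeds in C. *)
definition subfield_C :: "complex set \<Rightarrow> bool" where
  "subfield_C K \<longleftrightarrow> 0 \<in> K \<and> 1 \<in> K \<and>
     (\<forall>x\<in>K. \<forall>y\<in>K. x + y \<in> K \<and> x - y \<in> K \<and> x * y \<in> K) \<and>
     (\<forall>x\<in>K. x \<noteq> 0 \<longrightarrow> inverse x \<in> K)"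

(* F is an algebraic extension of Q (realised inside C) *)
definition algebraic_ext_Q :: "complex set \<Rightarrow> bool" where
  "algebraic_ext_Q F \<longleftrightarrow> subfield_C F \<and> (\<forall>x\<in>F. algebraic x)"

(* the subfield of C generated by F and S *)
definition field_adjoin :: "complex set \<Rightarrow> complex set \<Rightarrow> complex set" where
  "field_adjoin F S = \<Inter> {K. subfield_C K \<and> F \<union> S \<subseteq> K}"

(* characteristic polynomial det(X I - A) of an integer matrix, as a complex polynomial *)
definition char_poly_int :: "int ^'n^'n \<Rightarrow> complex poly" where
  "char_poly_int A = det (\<chi> i j. (if i = j then [:0, 1:] else 0) - [: of_int (A $ i $ j) :])"

(* F(gamma): splitting field over F of the characteristic polynomial of gamma *)
definition split_field :: "complex set \<Rightarrow> int ^'n^'n \<Rightarrow> complex set" where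
  "split_field F A = field_adjoin F {z. poly (char_poly_int A) z = 0}"

(* Gal(K/F): automorphisms of the field K fixing F pointwise, as a group under composition *)
definition gal_auts :: "complex set \<Rightarrow> complex set \<Rightarrow> (complex \<Rightarrow> complex) set" where
  "gal_auts K F = {\<sigma>. \<sigma> \<in> extensional K \<and> bij_betw \<sigma> K K \<and>
      (\<forall>x\<in>K. \<forall>y\<in>K. \<sigma> (x + y) = \<sigma> x + \<sigma> y \<and> \<sigma> (x * y) = \<sigma> x * \<sigma> y) \<and>
      (\<forall>x\<in>F. \<sigma> x = x)}"

definition gal :: "complex set \<Rightarrow> complex set \<Rightarrow> (complex \<Rightarrow> complex) monoid" where
  "gal K F = \<lparr> carrier = gal_auts K F,
               mult = (\<lambda>\<sigma> \<tau>. restrict (\<sigma> \<circ> \<tau>) K),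
               one = restrict id K \<rparr>"

(* SL_n(Z) *)
definition SLZ :: "(int ^'n^'n) set" where
  "SLZ = {A. det A = 1}"

(* subgroup of the (integer) matrix group generated by Sigma *)
inductive_set gen_by :: "(int ^'n^'n) set \<Rightarrow> (int ^'n^'n) set" for \<Sigma> where
  gen_one: "mat 1 \<in> gen_by \<Sigma>"
| gen_mult: "x \<in> gen_by \<Sigma> \<Longrightarrow> s \<in> \<Sigma> \<Longrightarrow> x ** s \<in> gen_by \<Sigma>"
| gen_inv: "x \<in> gen_by \<Sigma> \<Longrightarrow> s \<in> \<Sigma> \<Longrightarrow> s ** y = mat 1 \<Longrightarrow> y ** s = mat 1
             \<Longrightarrow> x ** y \<in> gen_by \<Sigma>"

(* P(P(X_k)) for the random walk X_k = s_1 ... s_k, s_i iid uniform on Sigma *)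
definition walk_prob :: "(int ^'n^'n) set \<Rightarrow> nat \<Rightarrow> (int ^'n^'n \<Rightarrow> bool) \<Rightarrow> real" where
  "walk_prob \<Sigma> k P =
     real (card {xs. set xs \<subseteq> \<Sigma> \<and> length xs = k \<and> P (foldl (**) (mat 1) xs)})
     / real (card \<Sigma>) ^ k"

end

theory Submission
  imports Defs "HOL-Computational_Algebra.Fundamental_Theorem_Algebra" "HOL-Computational_Algebra.Primes"
begin

text \<open>
  The Galois group of a characteristic polynomial over \<open>F\<close> depends only on the action of the
  automorphism group of the algebraic numbers on its roots, and for a typical element of \<open>SL(n, \<int>)\<close>
  this action is the full symmetric group. For most elements \<open>X\<close> of a long walk there are primes \<open>p\<close>
  at which the characteristic polynomial has an \<open>(n-1)\<close>-cycle, respectively a transposition, as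
  Frobenius: modulo a prime \<open>p\<close> the walk equidistributes on \<open>SL(n, \<int>/p)\<close>, the reductions modulo
  different primes are independent, and the proportion of matrices with the required factorisation
  type is bounded below independently of \<open>p\<close>. A Frobenius of type \<open>(n-1)\<close> whose fixed root is
  irrational makes the group 2-transitive, and with a transposition it is symmetric.

  The same argument separates splitting fields. Given a matrix \<open>A\<close> one can choose for every prime
  \<open>p\<close> the type of Frobenius of \<open>X\<close> (cycle length \<open>n-1\<close> or \<open>2\<close>) so that its square is trivial on the
  roots of exactly one of \<open>A\<close>, \<open>X\<close>. Hence long walks avoid any given finite set of splitting fields,
  and one can choose an increasing sequence of stages such that the splitting fields arising at
  different stages are different.

  Finally, since nontrivial normal subgroups of the symmetric group contain the alternating group,
  the alternating groups of different splitting fields are realised independently (a Ribet-type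
  argument). The field \<open>F\<close> consists of the algebraic numbers fixed by all automorphisms which act,
  on finitely many of the splitting fields, through the subgroups prescribed at the respective
  stages.
\<close>

section \<open>Algebraic integers and algebraic numbers\<close>

lemma int_ideal_principal:
  fixes K :: "int set"
  assumes "0 \<in> K" and diff: "\<And>k l. k \<in> K \<Longrightarrow> l \<in> K \<Longrightarrow> k - l \<in> K"
    and mult: "\<And>k q. k \<in> K \<Longrightarrow> q * k \<in> K"
  obtains d where "d \<in> K" "\<And>k. k \<in> K \<Longrightarrow> d dvd k"
proof (cases "\<exists>n>0. int n \<in> K")
  case True
  define n where "n = (LEAST n. n > 0 \<and> int n \<in> K)"
  have n: "n > 0" "int n \<in> K" using LeastI_ex[OF True] by (auto simp: n_def)
  show ?thesis
  proof (rule that[OF n(2)])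
    fix k assume "k \<in> K"
    have "k mod int n = k - (k div int n) * int n" by (simp add: minus_div_mult_eq_mod)
    hence "k mod int n \<in> K" using diff mult \<open>k \<in> K\<close> n(2) by metis
    moreover have "0 \<le> k mod int n" "k mod int n < int n" using n(1) by simp_all
    ultimately have "\<not> nat (k mod int n) > 0"
      using not_less_Least[of "nat (k mod int n)" "\<lambda>n. n > 0 \<and> int n \<in> K"] by (simp add: n_def)
    thus "int n dvd k" using \<open>0 \<le> k mod int n\<close> by (simp add: dvd_eq_mod_eq_0)
  qed
next
  case False
  have "k = 0" if "k \<in> K" for k
    using False that mult[OF that, of "-1"] by (metis int_nat_eq mult_minus1 neg_0_less_iff_less
        not_less_iff_gr_or_eq order_less_imp_le zero_less_nat_eq)
  thus ?thesis using that[of 0] \<open>0 \<in> K\<close> by auto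
qed

definition int_combination :: "nat \<Rightarrow> 'a::comm_ring_1 \<Rightarrow> (nat \<Rightarrow> int) \<Rightarrow> 'a" where
  "int_combination n x c = (\<Sum>i<n. of_int (c i) * x ^ i)"

lemma algebraic_int_iff_int_combination:
  fixes x :: "'a::field_char_0"
  shows "algebraic_int x \<longleftrightarrow> (\<exists>n c. x ^ n = int_combination n x c)"
proof
  assume "algebraic_int x"
  then obtain q where q: "poly (map_poly of_int q) x = 0" "lead_coeff q = 1"
    by (auto simp: algebraic_int_altdef_ipoly)
  hence "(\<Sum>i\<le>degree q. of_int (coeff q i) * x ^ i) = 0"
    by (simp add: poly_altdef degree_map_poly coeff_map_poly)
  hence "x ^ degree q = int_combination (degree q) x (\<lambda>i. - coeff q i)"
    using q(2) by (simp add: int_combination_def lessThan_Suc_atMost[symmetric] sum_negf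
        eq_neg_iff_add_eq_0 add.commute)
  thus "\<exists>n c. x ^ n = int_combination n x c" by blast
next
  assume "\<exists>n c. x ^ n = int_combination n x c"
  then obtain n c where c: "x ^ n = int_combination n x c" by blast
  define q where "q = monom (1::'a) n - (\<Sum>i<n. monom (of_int (c i)) i)"
  have coeff_q: "coeff q i = (if i = n then 1 else if i < n then - of_int (c i) else 0)" for i
    by (auto simp: q_def coeff_sum)
  hence "degree q = n" by (intro antisym degree_le le_degree) auto
  moreover have "poly q x = 0" using c by (simp add: q_def int_combination_def poly_sum poly_monom)
  ultimately show "algebraic_int x"
    by (intro algebraic_int.intros[of q]) (simp_all add: coeff_q)
qed

context
begin

interpretation int_module: module "\<lambda>(k::int) (x::'a::comm_ring_1). of_int k * x"
  by unfold_locales (auto simp: algebra_simps)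

private abbreviation int_span :: "'a::comm_ring_1 set \<Rightarrow> 'a set" where
  "int_span \<equiv> int_module.span"

lemma int_submodule_least_coefficient:
  assumes N: "int_module.subspace N"
  obtains w d where "w \<in> N" "w - of_int d * g \<in> int_span B"
    "\<And>x k. x \<in> N \<Longrightarrow> x - of_int k * g \<in> int_span B \<Longrightarrow> d dvd k"
proof -
  define K where "K = {k. \<exists>x\<in>N. x - of_int k * g \<in> int_span B}"
  obtain d where d: "d \<in> K" "\<And>k. k \<in> K \<Longrightarrow> d dvd k"
  proof (rule int_ideal_principal)
    show "0 \<in> K" using int_module.subspace_0[OF N] by (force simp: K_def int_module.span_zero)
    fix k assume "k \<in> K"
    then obtain x where x: "x \<in> N" "x - of_int k * g \<in> int_span B" by (auto simp: K_def)
    show "q * k \<in> K" for q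
    proof -
      have "of_int q * x - of_int (q * k) * g = of_int q * (x - of_int k * g)" by (simp add: algebra_simps)
      also have "\<dots> \<in> int_span B" by (rule int_module.span_scale[OF x(2)])
      finally show ?thesis
        using int_module.subspace_scale[OF N x(1)] unfolding K_def by (intro CollectI bexI[of _ "of_int q * x"])
    qed
    fix l assume "l \<in> K"
    then obtain y where y: "y \<in> N" "y - of_int l * g \<in> int_span B" by (auto simp: K_def)
    have "(x - y) - of_int (k - l) * g = (x - of_int k * g) - (y - of_int l * g)"
      by (simp add: algebra_simps)
    also have "\<dots> \<in> int_span B" by (rule int_module.span_diff[OF x(2) y(2)])
    finally show "k - l \<in> K"
      using int_module.subspace_diff[OF N x(1) y(1)] unfolding K_def by (intro CollectI bexI[of _ "x - y"])
  qed blast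
  obtain w where "w \<in> N" "w - of_int d * g \<in> int_span B" using d(1) by (auto simp: K_def)
  thus ?thesis by (rule that) (use d(2) in \<open>auto simp: K_def\<close>)
qed

lemma int_submodule_finitely_generated:
  assumes "finite B" "int_module.subspace N" "N \<subseteq> int_span B"
  shows "\<exists>C. finite C \<and> int_span C = N"
  using assms
proof (induction B arbitrary: N rule: finite_induct)
  case empty
  hence "N = {0}" using int_module.subspace_0 by auto
  thus ?case by (intro exI[of _ "{}"]) simp
next
  case (insert g B)
  obtain w d where w: "w \<in> N" "w - of_int d * g \<in> int_span B"
    and d: "\<And>x k. x \<in> N \<Longrightarrow> x - of_int k * g \<in> int_span B \<Longrightarrow> d dvd k"
    using int_submodule_least_coefficient[OF insert.prems(1)] by blast
  obtain C where C: "finite C" "int_span C = N \<inter> int_span B"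
    using insert.IH[of "N \<inter> int_span B"] insert.prems(1) int_module.subspace_inter by blast
  have "int_span (insert w C) = N"
  proof
    show "int_span (insert w C) \<subseteq> N"
      using C(2) w(1) int_module.span_superset[of C] by (intro int_module.span_minimal insert.prems(1)) auto
    show "N \<subseteq> int_span (insert w C)"
    proof
      fix x assume x: "x \<in> N"
      then obtain k where k: "x - of_int k * g \<in> int_span B"
        using insert.prems(2) int_module.span_breakdown_eq by blast
      then obtain q where q: "k = d * q" using d[OF x] by (auto elim: dvdE)
      have "x - of_int q * w = (x - of_int k * g) - of_int q * (w - of_int d * g)"
        by (simp add: q algebra_simps)
      also have "\<dots> \<in> int_span B" by (intro int_module.span_diff int_module.span_scale k w)
      finally have "x - of_int q * w \<in> int_span C"
        using C(2) int_module.subspace_scale[OF insert.prems(1) w(1)]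
          int_module.subspace_diff[OF insert.prems(1) x] by blast
      thus "x \<in> int_span (insert w C)" unfolding int_module.span_breakdown_eq by blast
    qed
  qed
  thus ?case using C(1) by blast
qed

lemma int_span_mult:
  assumes "x \<in> int_span A" "y \<in> int_span B"
  shows "x * y \<in> int_span ((\<lambda>(a, b). a * b) ` (A \<times> B))" (is "_ \<in> ?S")
  using assms(1)
proof (induction rule: int_module.span_induct)
  case base
  show ?case
    by (rule int_module.subspaceI)
      (auto simp: distrib_right mult.assoc int_module.span_zero int_module.span_add int_module.span_scale)
next
  case (step a)
  show ?case
    using assms(2)
  proof (induction rule: int_module.span_induct)
    case base
    show ?case
      by (rule int_module.subspaceI)
        (auto simp: distrib_left mult.left_commute[of a] int_module.span_zero int_module.span_add
          int_module.span_scale)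
  next
    case (step b)
    thus ?case using \<open>a \<in> A\<close> by (intro int_module.span_base) auto
  qed
qed

lemma int_span_powers: "int_span ((\<lambda>i. x ^ i) ` {..<n}) = range (int_combination n x)"
proof
  have "int_module.subspace (range (int_combination n x))"
  proof (rule int_module.subspaceI; (elim rangeE)?)
    show "0 \<in> range (int_combination n x)"
      by (rule range_eqI[of _ _ "\<lambda>_. 0"]) (simp add: int_combination_def)
    show "y + z \<in> range (int_combination n x)"
      if "y = int_combination n x c" "z = int_combination n x d" for y z c d
      by (rule range_eqI[of _ _ "\<lambda>i. c i + d i"]) (simp add: that int_combination_def distrib_right sum.distrib)
    show "of_int k * y \<in> range (int_combination n x)" if "y = int_combination n x c" for k y c
      by (rule range_eqI[of _ _ "\<lambda>i. k * c i"]) (simp add: that int_combination_def sum_distrib_left)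
  qed
  moreover have "(\<lambda>i. x ^ i) ` {..<n} \<subseteq> range (int_combination n x)"
  proof (rule image_subsetI)
    fix i assume "i \<in> {..<n}"
    have "int_combination n x (\<lambda>j. of_bool (j = i)) = (\<Sum>j<n. if j = i then x ^ j else 0)"
      unfolding int_combination_def by (intro sum.cong) auto
    also have "\<dots> = x ^ i" using \<open>i \<in> {..<n}\<close> by simp
    finally show "x ^ i \<in> range (int_combination n x)" by (metis rangeI)
  qed
  ultimately show "int_span ((\<lambda>i. x ^ i) ` {..<n}) \<subseteq> range (int_combination n x)"
    by (rule int_module.span_minimal[rotated])
  show "range (int_combination n x) \<subseteq> int_span ((\<lambda>i. x ^ i) ` {..<n})"
    by (auto simp: int_combination_def intro!: int_module.span_sum int_module.span_scale
        intro: int_module.span_base)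
qed

lemma algebraic_int_imp_powers_in_span:
  fixes x :: "'a::field_char_0"
  assumes "algebraic_int x"
  obtains B where "finite B" "\<And>k. x ^ k \<in> int_span B"
proof -
  obtain n c where c: "x ^ n = int_combination n x c"
    using assms unfolding algebraic_int_iff_int_combination by blast
  let ?B = "(\<lambda>i. x ^ i) ` {..<n}"
  have "x ^ k \<in> int_span ?B" for k
  proof (induction k rule: less_induct)
    case (less k)
    show ?case
    proof (cases "k < n")
      case False
      then obtain j where j: "k = n + j" using le_Suc_ex not_less by blast
      hence "x ^ k = (\<Sum>i<n. of_int (c i) * x ^ (i + j))"
        by (simp add: power_add c int_combination_def sum_distrib_right mult.assoc)
      also have "\<dots> \<in> int_span ?B"
        using less.IH j by (intro int_module.span_sum int_module.span_scale) auto
      finally show ?thesis .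
    qed (auto intro: int_module.span_base)
  qed
  thus ?thesis using that[of ?B] by auto
qed

text \<open>The subgroup generated by all powers of \<open>x\<close> is finitely generated, hence already by finitely
  many powers.\<close>

lemma algebraic_int_if_powers_in_span:
  fixes x :: "'a::field_char_0"
  assumes B: "finite B" "\<And>k. x ^ k \<in> int_span B"
  shows "algebraic_int x"
proof -
  define S where "S n = int_span ((\<lambda>k. x ^ k) ` {..<n})" for n
  have S_mono: "S m \<subseteq> S n" if "m \<le> n" for m n
    using that unfolding S_def by (intro int_module.span_mono image_mono) auto
  have "int_span (range (\<lambda>k. x ^ k)) \<subseteq> int_span B"
    using B(2) by (intro int_module.span_minimal) auto
  then obtain C where C: "finite C" "int_span C = int_span (range (\<lambda>k. x ^ k))"
    using int_submodule_finitely_generated[OF B(1) int_module.subspace_span] by blast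
  have "\<exists>n. y \<in> S n" if "y \<in> int_span (range (\<lambda>k. x ^ k))" for y
    using that
  proof (induction rule: int_module.span_induct)
    case base
    show ?case
    proof (rule int_module.subspaceI)
      show "0 \<in> {y. \<exists>n. y \<in> S n}" by (auto simp: S_def int_module.span_zero)
      fix y z k assume "y \<in> {y. \<exists>n. y \<in> S n}"
      then obtain m where m: "y \<in> S m" by blast
      show "of_int k * y \<in> {y. \<exists>n. y \<in> S n}" using m by (auto simp: S_def intro: int_module.span_scale)
      assume "z \<in> {y. \<exists>n. y \<in> S n}"
      then obtain n where "z \<in> S n" by blast
      hence "y + z \<in> S (max m n)"
        using m S_mono[of m "max m n"] S_mono[of n "max m n"] by (auto simp: S_def intro: int_module.span_add)
      thus "y + z \<in> {y. \<exists>n. y \<in> S n}" by blast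
    qed
  next
    case (step y)
    then obtain k where "y = x ^ k" by blast
    hence "y \<in> S (Suc k)" unfolding S_def by (auto intro: int_module.span_base)
    thus ?case by blast
  qed
  hence "\<forall>y\<in>C. \<exists>n. y \<in> S n" using C(2) int_module.span_superset[of C] by auto
  then obtain n where n: "\<And>y. y \<in> C \<Longrightarrow> y \<in> S (n y)" by metis
  have "C \<subseteq> S (sum n C)" using n S_mono C(1) member_le_sum[of _ C n] by blast
  hence "int_span C \<subseteq> S (sum n C)" unfolding S_def by (intro int_module.span_minimal) auto
  moreover have "x ^ sum n C \<in> int_span C" unfolding C(2) by (intro int_module.span_base) simp
  ultimately have "x ^ sum n C \<in> range (int_combination (sum n C) x)" by (auto simp: S_def int_span_powers)
  thus ?thesis unfolding algebraic_int_iff_int_combination by blast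
qed

lemma
  fixes x y :: "'a::field_char_0"
  assumes "algebraic_int x" "algebraic_int y"
  shows algebraic_int_add: "algebraic_int (x + y)" and algebraic_int_mult: "algebraic_int (x * y)"
proof -
  obtain A where A: "finite A" "\<And>k. x ^ k \<in> int_span A"
    using algebraic_int_imp_powers_in_span[OF assms(1)] by blast
  obtain B where B: "finite B" "\<And>k. y ^ k \<in> int_span B"
    using algebraic_int_imp_powers_in_span[OF assms(2)] by blast
  let ?M = "(\<lambda>(a, b). a * b) ` (A \<times> B)"
  have fin: "finite ?M" and xy: "x ^ i * y ^ j \<in> int_span ?M" for i j
    using A B by (auto intro: int_span_mult)
  show "algebraic_int (x * y)"
    using algebraic_int_if_powers_in_span[OF fin] xy by (simp add: power_mult_distrib)
  have "(x + y) ^ k \<in> int_span ?M" for k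
  proof -
    have "(x + y) ^ k = (\<Sum>i\<le>k. of_int (int (k choose i)) * (x ^ i * y ^ (k - i)))"
      by (simp add: binomial_ring mult.assoc)
    also have "\<dots> \<in> int_span ?M" by (intro int_module.span_sum int_module.span_scale xy)
    finally show ?thesis .
  qed
  thus "algebraic_int (x + y)" by (rule algebraic_int_if_powers_in_span[OF fin])
qed

end

lemma algebraic_if_algebraic_int_multiple:
  fixes x :: "'a::field_char_0"
  assumes "algebraic_int (of_int d * x)" "d \<noteq> 0"
  shows "algebraic x"
proof -
  obtain p where p: "poly (map_poly of_int p) (of_int d * x) = 0" "lead_coeff p = 1"
    using assms(1) by (auto simp: algebraic_int_altdef_ipoly)
  define q where "q = pcompose (map_poly of_int p) [:0, of_int d :: 'a:]"
  show ?thesis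
  proof (rule algebraicI)
    show "poly q x = 0" using p(1) by (simp add: q_def poly_pcompose mult.commute)
    have "map_poly of_int p \<noteq> (0 :: 'a poly)"
      using p(2) by (metis coeff_0 coeff_map_poly of_int_0 of_int_1 zero_neq_one)
    thus "q \<noteq> 0" using assms(2) by (simp add: q_def pcompose_eq_0_iff)
    have "coeff (pcompose (map_poly of_int f) [:0, of_int d :: 'a:]) i \<in> \<int>" for f :: "int poly" and i
      by (induction f arbitrary: i rule: pCons_induct)
        (auto simp: map_poly_pCons pcompose_pCons coeff_pCons split: nat.split)
    thus "coeff q i \<in> \<int>" for i by (simp add: q_def)
  qed
qed

lemma algebraic_imp_algebraic_int_multiple:
  fixes x :: "'a::field_char_0"
  assumes "algebraic x"
  obtains d where "d \<noteq> 0" "algebraic_int (of_int d * x)"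
proof -
  obtain p where p: "p \<noteq> 0" "poly (map_poly of_int p) x = 0" using algebraicE'[OF assms] by blast
  define d n where "d = lead_coeff p" and "n = degree p"
  have d: "d \<noteq> 0" using p(1) by (simp add: d_def)
  have n: "n \<noteq> 0"
  proof
    assume "n = 0"
    then obtain c where "p = [:c:]" by (auto simp: n_def elim: degree_eq_zeroE)
    thus False using p by (simp add: map_poly_pCons)
  qed
  have "(\<Sum>i\<le>n. of_int (coeff p i) * x ^ i) = 0"
    using p by (simp add: poly_altdef n_def degree_map_poly coeff_map_poly)
  hence lead: "of_int d * x ^ n = (\<Sum>i<n. of_int (- coeff p i) * x ^ i)"
    by (simp add: d_def n_def lessThan_Suc_atMost[symmetric] sum_negf eq_neg_iff_add_eq_0 add.commute)
  have "(of_int d :: 'a) ^ n = of_int d ^ (n - 1) * of_int d" using n by (metis power_minus_mult not_gr_zero)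
  hence "(of_int d * x) ^ n = of_int d ^ (n - 1) * (of_int d * x ^ n)"
    by (simp add: power_mult_distrib)
  also have "\<dots> = (\<Sum>i<n. of_int (- coeff p i * d ^ (n - 1 - i)) * (of_int d * x) ^ i)"
    unfolding lead sum_distrib_left
  proof (rule sum.cong)
    fix i assume "i \<in> {..<n}"
    hence "n - 1 = (n - 1 - i) + i" by simp
    hence "(of_int d :: 'a) ^ (n - 1) = of_int d ^ (n - 1 - i) * of_int d ^ i" by (metis power_add)
    thus "of_int d ^ (n - 1) * (of_int (- coeff p i) * x ^ i)
        = of_int (- coeff p i * d ^ (n - 1 - i)) * (of_int d * x) ^ i"
      by (simp add: power_mult_distrib mult_ac)
  qed simp
  finally have "algebraic_int (of_int d * x)"
    unfolding algebraic_int_iff_int_combination int_combination_def by (intro exI)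
  thus ?thesis using that d by blast
qed

lemma
  fixes x y :: "'a::field_char_0"
  assumes "algebraic x" "algebraic y"
  shows algebraic_add: "algebraic (x + y)" and algebraic_mult: "algebraic (x * y)"
proof -
  obtain c where c: "c \<noteq> 0" "algebraic_int (of_int c * x)"
    using algebraic_imp_algebraic_int_multiple[OF assms(1)] .
  obtain d where d: "d \<noteq> 0" "algebraic_int (of_int d * y)"
    using algebraic_imp_algebraic_int_multiple[OF assms(2)] .
  have "algebraic_int (of_int d * (of_int c * x) + of_int c * (of_int d * y))"
    by (intro algebraic_int_add algebraic_int_mult c d) auto
  hence "algebraic_int (of_int (c * d) * (x + y))" by (simp add: algebra_simps)
  thus "algebraic (x + y)" by (rule algebraic_if_algebraic_int_multiple) (use c d in simp)
  have "algebraic_int (of_int (c * d) * (x * y))"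
    using algebraic_int_mult[OF c(2) d(2)] by (simp add: mult_ac)
  thus "algebraic (x * y)" by (rule algebraic_if_algebraic_int_multiple) (use c d in simp)
qed

definition qbar :: "complex set" where "qbar = {x. algebraic x}"

lemma qbarE:
  assumes "x \<in> qbar"
  obtains p where "p \<noteq> 0" "poly (map_poly of_int p) x = 0"
  using assms algebraicE'[of x] unfolding qbar_def by blast

lemma qbar_closed [intro]:
  "x \<in> qbar \<Longrightarrow> y \<in> qbar \<Longrightarrow> x + y \<in> qbar"
  "x \<in> qbar \<Longrightarrow> y \<in> qbar \<Longrightarrow> x * y \<in> qbar"
  "x \<in> qbar \<Longrightarrow> - x \<in> qbar"
  "x \<in> qbar \<Longrightarrow> y \<in> qbar \<Longrightarrow> x - y \<in> qbar"
  "x \<in> qbar \<Longrightarrow> inverse x \<in> qbar"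
  using algebraic_add[of x y] algebraic_mult[of x y] algebraic_add[of x "- y"] by (auto simp: qbar_def)

lemma qbar_rat [intro, simp]: "of_rat q \<in> qbar" "0 \<in> qbar" "1 \<in> qbar" "of_int z \<in> qbar"
  by (auto simp: qbar_def intro: rat_imp_algebraic)

lemma qbar_power [intro]: "x \<in> qbar \<Longrightarrow> x ^ k \<in> qbar"
  by (induction k) auto

lemma qbar_sum [intro]: "(\<And>i. i \<in> I \<Longrightarrow> f i \<in> qbar) \<Longrightarrow> sum f I \<in> qbar"
  by (induction I rule: infinite_finite_induct) auto

section \<open>Automorphisms of the field of algebraic numbers\<close>

text \<open>Partial embeddings of the algebraic numbers into themselves are represented by their graphs.
  A subring that contains the rationals is automatically a field here, so that it is enough to
  extend graphs by single elements.\<close>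

locale hom_graph =
  fixes B :: "(complex \<times> complex) set"
  assumes graph_qbar: "(x, y) \<in> B \<Longrightarrow> x \<in> qbar \<and> y \<in> qbar"
    and graph_rat: "(of_rat q, of_rat q) \<in> B"
    and graph_add: "(x, y) \<in> B \<Longrightarrow> (x', y') \<in> B \<Longrightarrow> (x + x', y + y') \<in> B"
    and graph_mult: "(x, y) \<in> B \<Longrightarrow> (x', y') \<in> B \<Longrightarrow> (x * x', y * y') \<in> B"
    and graph_zero: "(0, y) \<in> B \<Longrightarrow> y = 0"
begin

lemma graph_0: "(0, 0) \<in> B" and graph_1: "(1, 1) \<in> B" and graph_of_int: "(of_int z, of_int z) \<in> B"
  using graph_rat[of 0] graph_rat[of 1] graph_rat[of "of_int z"] by simp_all

lemma graph_minus: "(x, y) \<in> B \<Longrightarrow> (- x, - y) \<in> B"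
  using graph_mult[of x y "-1" "-1"] graph_rat[of "-1"] by (simp add: of_rat_minus)

lemma graph_diff: "(x, y) \<in> B \<Longrightarrow> (x', y') \<in> B \<Longrightarrow> (x - x', y - y') \<in> B"
  using graph_add[of x y "- x'" "- y'"] graph_minus by simp

lemma graph_unique: "(x, y) \<in> B \<Longrightarrow> (x, y') \<in> B \<Longrightarrow> y = y'"
  using graph_diff[of x y x y'] graph_zero by fastforce

lemma graph_power: "(x, y) \<in> B \<Longrightarrow> (x ^ k, y ^ k) \<in> B"
  by (induction k) (auto simp: graph_1 graph_mult)

lemma graph_sum: "(\<And>i. i \<in> I \<Longrightarrow> (f i, g i) \<in> B) \<Longrightarrow> (sum f I, sum g I) \<in> B"
  by (induction I rule: infinite_finite_induct) (auto simp: graph_0 graph_add)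

definition coeffs_related :: "complex poly \<Rightarrow> complex poly \<Rightarrow> bool" where
  "coeffs_related u v \<longleftrightarrow> (\<forall>i. (coeff u i, coeff v i) \<in> B)"

lemma graph_poly:
  assumes "coeffs_related u v" "(a, b) \<in> B"
  shows "(poly u a, poly v b) \<in> B"
proof -
  let ?N = "max (degree u) (degree v)"
  have "poly u a = (\<Sum>i\<le>?N. coeff u i * a ^ i)" "poly v b = (\<Sum>i\<le>?N. coeff v i * b ^ i)"
    unfolding poly_altdef by (rule sum.mono_neutral_left; auto simp: coeff_eq_0)+
  thus ?thesis using assms by (auto intro!: graph_sum graph_mult graph_power simp: coeffs_related_def)
qed

lemma coeffs_related_int: "coeffs_related (map_poly of_int p) (map_poly of_int p)"
  by (auto simp: coeffs_related_def coeff_map_poly graph_of_int)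

lemma coeffs_related_add:
    "coeffs_related u v \<Longrightarrow> coeffs_related u' v' \<Longrightarrow> coeffs_related (u + u') (v + v')"
  and coeffs_related_diff:
    "coeffs_related u v \<Longrightarrow> coeffs_related u' v' \<Longrightarrow> coeffs_related (u - u') (v - v')"
  and coeffs_related_mult:
    "coeffs_related u v \<Longrightarrow> coeffs_related u' v' \<Longrightarrow> coeffs_related (u * u') (v * v')"
  and coeffs_related_const: "(x, y) \<in> B \<Longrightarrow> coeffs_related [:x:] [:y:]"
  and coeffs_related_monom: "(x, y) \<in> B \<Longrightarrow> coeffs_related (monom x k) (monom y k)"
  by (auto simp: coeffs_related_def coeff_mult coeff_pCons graph_0 graph_add graph_diff
      intro!: graph_sum graph_mult split: nat.splits)

lemma graph_inverse:
  assumes "(x, y) \<in> B" "x \<noteq> 0"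
  shows "(inverse x, inverse y) \<in> B" "y \<noteq> 0"
proof -
  have "algebraic x" using graph_qbar assms by (auto simp: qbar_def)
  then obtain p where p: "coeff p 0 \<noteq> 0" "poly (map_poly of_int p) x = 0"
    using algebraicE'_nonzero[of x] assms(2) by metis
  obtain a q where q: "p = pCons a q" by (cases p)
  have a: "a \<noteq> 0" "of_int a + x * poly (map_poly of_int q) x = 0"
    using p by (auto simp: q map_poly_pCons)
  define w where "w = - poly (map_poly of_int q) x / of_int a"
  define w' where "w' = - poly (map_poly of_int q) y / of_int a"
  have "(of_rat (- 1 / of_int a), of_rat (- 1 / of_int a)) \<in> B" by (rule graph_rat)
  hence ww': "(w, w') \<in> B"
    using graph_mult[OF graph_poly[OF coeffs_related_int assms(1), of q]] unfolding w_def w'_def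
    by (fastforce simp: of_rat_divide of_rat_minus)
  have xw: "x * w = 1" using a by (simp add: w_def field_simps add_eq_0_iff)
  hence "(1, y * w') \<in> B" using graph_mult[OF assms(1) ww'] by simp
  hence yw: "y * w' = 1" using graph_unique graph_1 by blast
  have "w = inverse x" "w' = inverse y" using xw yw by (simp_all add: inverse_unique)
  with ww' show "(inverse x, inverse y) \<in> B" by simp
  show "y \<noteq> 0" using yw by auto
qed

lemma coeffs_related_degree:
  assumes "coeffs_related u v" shows "degree v = degree u"
proof (rule antisym)
  show "degree v \<le> degree u"
    by (rule degree_le) (metis assms coeff_eq_0 coeffs_related_def graph_zero)
  show "degree u \<le> degree v"
    by (rule degree_le) (metis assms coeff_eq_0 coeffs_related_def graph_inverse(2))
qed

lemma coeffs_related_0: "coeffs_related 0 v \<Longrightarrow> v = 0"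
  using graph_zero by (auto simp: coeffs_related_def poly_eq_iff)

definition min_poly_pair :: "complex \<Rightarrow> complex poly \<Rightarrow> complex poly \<Rightarrow> bool" where
  "min_poly_pair \<alpha> f g \<longleftrightarrow> coeffs_related f g \<and> lead_coeff f = 1 \<and> poly f \<alpha> = 0 \<and>
     (\<forall>u v. coeffs_related u v \<longrightarrow> u \<noteq> 0 \<longrightarrow> degree u < degree f \<longrightarrow> poly u \<alpha> \<noteq> 0)"

lemma min_poly_pair_exists:
  assumes "\<alpha> \<in> qbar"
  obtains f g where "min_poly_pair \<alpha> f g"
proof -
  obtain h where h: "h \<noteq> 0" "poly (map_poly of_int h) \<alpha> = 0"
    using assms by (auto elim: qbarE)
  let ?P = "\<lambda>d. \<exists>u v. coeffs_related u v \<and> u \<noteq> 0 \<and> degree u = d \<and> poly u \<alpha> = 0"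
  have "(map_poly of_int h :: complex poly) \<noteq> 0"
    using h(1) by (metis coeff_0 coeff_map_poly leading_coeff_0_iff of_int_0 of_int_eq_0_iff)
  hence "?P (degree (map_poly of_int h :: complex poly))" using h coeffs_related_int by blast
  hence "?P (LEAST d. ?P d)" by (rule LeastI)
  then obtain u v where uv: "coeffs_related u v" "u \<noteq> 0" "degree u = (LEAST d. ?P d)" "poly u \<alpha> = 0"
    by blast
  have "(lead_coeff u, coeff v (degree u)) \<in> B" using uv by (auto simp: coeffs_related_def)
  hence inv: "(inverse (lead_coeff u), inverse (coeff v (degree u))) \<in> B"
    using uv(2) graph_inverse(1) leading_coeff_0_iff by blast
  let ?f = "[:inverse (lead_coeff u):] * u" and ?g = "[:inverse (coeff v (degree u)):] * v"
  have "min_poly_pair \<alpha> ?f ?g"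
    unfolding min_poly_pair_def
  proof (intro conjI allI impI)
    show "coeffs_related ?f ?g" using uv inv by (intro coeffs_related_mult coeffs_related_const)
    show "lead_coeff ?f = 1" "poly ?f \<alpha> = 0"
      using uv(2,4) by (auto simp del: mult_pCons_left simp: lead_coeff_mult)
    fix u' v' assume u': "coeffs_related u' v'" "u' \<noteq> 0" "degree u' < degree ?f"
    have "degree ?f = degree u" using uv(2) by simp
    hence "degree u' < (LEAST d. ?P d)" using uv(3) u'(3) by simp
    thus "poly u' \<alpha> \<noteq> 0" using not_less_Least[of "degree u'" ?P] u'(1,2) by blast
  qed
  thus ?thesis by (rule that)
qed

lemma min_poly_pair_root:
  assumes m: "min_poly_pair \<alpha> f g" and \<beta>: "poly g \<beta> = 0"
  shows "coeffs_related u v \<Longrightarrow> poly u \<alpha> = 0 \<Longrightarrow> poly v \<beta> = 0"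
proof (induction "degree u" arbitrary: u v rule: less_induct)
  case less
  show ?case
  proof (cases "u = 0")
    case True
    thus ?thesis using less.prems(1) coeffs_related_0[of v] by simp
  next
    case False
    define d where "d = degree f"
    let ?N = "degree u"
    have fg: "coeffs_related f g" "coeff f d = 1" using m by (auto simp: min_poly_pair_def d_def)
    have du: "d \<le> ?N" using m False less.prems by (force simp: min_poly_pair_def d_def)
    let ?u = "u - monom (coeff u ?N) (?N - d) * f" and ?v = "v - monom (coeff v ?N) (?N - d) * g"
    have rel: "coeffs_related ?u ?v"
      using less.prems fg by (intro coeffs_related_diff coeffs_related_mult coeffs_related_monom)
        (auto simp: coeffs_related_def)
    have root: "poly ?u \<alpha> = 0" using less.prems m by (simp add: min_poly_pair_def)
    have "poly ?v \<beta> = 0"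
    proof (cases "?u = 0")
      case True
      thus ?thesis using rel coeffs_related_0[of ?v] by (metis poly_0)
    next
      case nz: False
      have "degree (monom (coeff u ?N) (?N - d) * f) \<le> ?N"
        using degree_mult_le[of "monom (coeff u ?N) (?N - d)" f]
          degree_monom_le[of "coeff u ?N" "?N - d"] du by (simp add: d_def)
      hence "degree ?u \<le> ?N" by (intro degree_diff_le) auto
      moreover have "coeff ?u ?N = 0" using du fg by (simp add: coeff_monom_mult)
      hence "degree ?u \<noteq> ?N" using nz leading_coeff_0_iff by metis
      ultimately show ?thesis using less.hyps[of ?u ?v] rel root by simp
    qed
    thus ?thesis using \<beta> by simp
  qed
qed

lemma extend_by_root:
  assumes "\<alpha> \<in> qbar" and m: "min_poly_pair \<alpha> f g" and \<beta>: "poly g \<beta> = 0"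
  shows "\<exists>B'. hom_graph B' \<and> B \<subseteq> B' \<and> (\<alpha>, \<beta>) \<in> B'"
proof -
  let ?B' = "{(poly u \<alpha>, poly v \<beta>) | u v. coeffs_related u v}"
  obtain h where h: "h \<noteq> 0" "poly (map_poly of_int h) \<alpha> = 0"
    using assms by (auto elim: qbarE)
  have "poly (map_poly of_int h) \<beta> = 0" using min_poly_pair_root[OF m \<beta> coeffs_related_int h(2)] .
  hence bq: "\<beta> \<in> qbar" unfolding qbar_def mem_Collect_eq using h(1)
    by (intro algebraicI[of "map_poly of_int h"]) (auto simp: coeff_map_poly poly_eq_iff)
  have pq: "poly u z \<in> qbar" if "\<And>i. coeff u i \<in> qbar" "z \<in> qbar" for u z
    unfolding poly_altdef using that by auto
  have con: "(x, y) \<in> ?B'" if "(x, y) \<in> B" for x y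
    using coeffs_related_const[OF that] by (intro CollectI exI[of _ "[:x:]"] exI[of _ "[:y:]"]) simp
  have "hom_graph ?B'"
  proof
    show "x \<in> qbar \<and> y \<in> qbar" if "(x, y) \<in> ?B'" for x y
      using that bq assms(1) graph_qbar unfolding coeffs_related_def by (auto intro!: pq)
    show "(of_rat q, of_rat q) \<in> ?B'" for q using con[OF graph_rat] .
    show "y = 0" if "(0, y) \<in> ?B'" for y using that min_poly_pair_root[OF m \<beta>] by auto
    fix x y x' y' assume "(x, y) \<in> ?B'" "(x', y') \<in> ?B'"
    then obtain u v u' v' where uv: "coeffs_related u v" "x = poly u \<alpha>" "y = poly v \<beta>"
      and uv': "coeffs_related u' v'" "x' = poly u' \<alpha>" "y' = poly v' \<beta>" by blast
    have "(poly (u + u') \<alpha>, poly (v + v') \<beta>) \<in> ?B'" using coeffs_related_add[OF uv(1) uv'(1)] by blast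
    thus "(x + x', y + y') \<in> ?B'" using uv uv' by simp
    have "(poly (u * u') \<alpha>, poly (v * v') \<beta>) \<in> ?B'" using coeffs_related_mult[OF uv(1) uv'(1)] by blast
    thus "(x * x', y * y') \<in> ?B'" using uv uv' by simp
  qed
  moreover have "coeffs_related [:0, 1:] [:0, 1:]"
    by (auto simp: coeffs_related_def coeff_pCons graph_0 graph_1 split: nat.splits)
  hence "(\<alpha>, \<beta>) \<in> ?B'" by force
  moreover have "B \<subseteq> ?B'" using con by (intro subrelI)
  ultimately show ?thesis by (intro exI[of _ ?B'] conjI)
qed

lemma extend_to_element:
  assumes "x \<in> qbar"
  shows "\<exists>B' y. hom_graph B' \<and> B \<subseteq> B' \<and> (x, y) \<in> B'"
proof -
  obtain f g where fg: "min_poly_pair x f g" using min_poly_pair_exists[OF assms] .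
  have "degree f > 0"
  proof (rule ccontr)
    assume "\<not> degree f > 0"
    then obtain c where "f = [:c:]" by (auto elim: degree_eq_zeroE)
    thus False using fg by (auto simp: min_poly_pair_def)
  qed
  hence "degree g > 0" using coeffs_related_degree[of f g] fg by (auto simp: min_poly_pair_def)
  then obtain \<beta> where "poly g \<beta> = 0"
    using fundamental_theorem_of_algebra[of g] constant_degree[of g] by auto
  thus ?thesis using extend_by_root[OF assms fg] by blast
qed

end

definition autq :: "(complex \<Rightarrow> complex) set" where
  "autq = {\<sigma>. bij_betw \<sigma> qbar qbar \<and> (\<forall>x. x \<notin> qbar \<longrightarrow> \<sigma> x = x) \<and>
     (\<forall>x\<in>qbar. \<forall>y\<in>qbar. \<sigma> (x + y) = \<sigma> x + \<sigma> y \<and> \<sigma> (x * y) = \<sigma> x * \<sigma> y)}"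

lemma hom_graph_Union_chain:
  assumes C: "C \<noteq> {}" "subset.chain A C" and hom: "\<And>B. B \<in> C \<Longrightarrow> hom_graph B"
  shows "hom_graph (\<Union>C)"
proof
  have pair: "\<exists>B\<in>C. p \<in> B \<and> q \<in> B" if "p \<in> \<Union>C" "q \<in> \<Union>C" for p q
    using finite_subset_Union_chain[of "{p, q}" C A] C that by auto
  show "(of_rat q, of_rat q) \<in> \<Union>C" for q
    using C(1) hom hom_graph.graph_rat by blast
  show "x \<in> qbar \<and> y \<in> qbar" if "(x, y) \<in> \<Union>C" for x y
    using that hom hom_graph.graph_qbar by blast
  show "y = 0" if "(0, y) \<in> \<Union>C" for y
    using that hom hom_graph.graph_zero by blast
  fix x y x' y' assume "(x, y) \<in> \<Union>C" "(x', y') \<in> \<Union>C"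
  then obtain B where B: "B \<in> C" "(x, y) \<in> B" "(x', y') \<in> B" using pair by blast
  show "(x + x', y + y') \<in> \<Union>C" "(x * x', y * y') \<in> \<Union>C"
    using hom_graph.graph_add[OF hom[OF B(1)] B(2,3)] hom_graph.graph_mult[OF hom[OF B(1)] B(2,3)] B(1)
    by blast+
qed

lemma total_hom_graph_exists:
  assumes "hom_graph B"
  obtains M where "hom_graph M" "B \<subseteq> M" "\<And>x. x \<in> qbar \<Longrightarrow> \<exists>y. (x, y) \<in> M"
proof -
  let ?A = "{M. hom_graph M \<and> B \<subseteq> M}"
  have "\<exists>M\<in>?A. \<forall>X\<in>?A. M \<subseteq> X \<longrightarrow> X = M"
  proof (rule subset_Zorn_nonempty)
    show "?A \<noteq> {}" using assms by auto
    fix C assume C: "C \<noteq> {}" "subset.chain ?A C"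
    have "hom_graph (\<Union>C)" using C by (intro hom_graph_Union_chain[OF C]) (auto simp: subset.chain_def)
    moreover have "B \<subseteq> \<Union>C" using C unfolding subset.chain_def by blast
    ultimately show "\<Union>C \<in> ?A" by blast
  qed
  then obtain M where M: "hom_graph M" "B \<subseteq> M"
    and max: "\<And>X. hom_graph X \<Longrightarrow> M \<subseteq> X \<Longrightarrow> X = M" by auto
  have "\<exists>y. (x, y) \<in> M" if "x \<in> qbar" for x
    using hom_graph.extend_to_element[OF M(1) that] max by blast
  thus ?thesis using that M by blast
qed

lemma int_poly_roots_finite:
  assumes "p \<noteq> 0"
  shows "finite {z :: complex. poly (map_poly of_int p) z = 0}"
    and "{z. poly (map_poly of_int p) z = 0} \<subseteq> qbar"
proof -
  have nz: "(map_poly of_int p :: complex poly) \<noteq> 0"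
    using assms by (auto simp: poly_eq_iff coeff_map_poly)
  show "finite {z :: complex. poly (map_poly of_int p) z = 0}" by (rule poly_roots_finite[OF nz])
  show "{z. poly (map_poly of_int p) z = 0} \<subseteq> qbar"
    using nz by (auto simp: qbar_def coeff_map_poly intro!: algebraicI[of "map_poly of_int p"])
qed

lemma (in hom_graph) total_graph_aut:
  assumes total: "\<And>x. x \<in> qbar \<Longrightarrow> \<exists>y. (x, y) \<in> B"
  shows "\<exists>\<sigma>\<in>autq. \<forall>(x, y)\<in>B. \<sigma> x = y"
proof -
  define \<sigma> where "\<sigma> x = (if x \<in> qbar then SOME y. (x, y) \<in> B else x)" for x
  have \<sigma>: "(x, \<sigma> x) \<in> B" if "x \<in> qbar" for x
    using someI_ex[OF total[OF that]] that by (simp add: \<sigma>_def)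
  have eq: "\<sigma> x = y" if "(x, y) \<in> B" for x y
    using graph_unique[OF \<sigma> that] graph_qbar[OF that] by blast
  have hom: "\<sigma> (x + y) = \<sigma> x + \<sigma> y" "\<sigma> (x * y) = \<sigma> x * \<sigma> y" if "x \<in> qbar" "y \<in> qbar" for x y
    using eq[OF graph_add[OF \<sigma> \<sigma>]] eq[OF graph_mult[OF \<sigma> \<sigma>]] that by auto
  have inj: "inj_on \<sigma> qbar"
  proof (rule inj_onI)
    fix x y assume "x \<in> qbar" "y \<in> qbar" "\<sigma> x = \<sigma> y"
    hence "(x - y, 0) \<in> B" using graph_diff[OF \<sigma> \<sigma>, of x y] by simp
    thus "x = y" using graph_inverse(2) by fastforce
  qed
  have "x \<in> \<sigma> ` qbar" if "x \<in> qbar" for x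
  proof -
    obtain h where h: "h \<noteq> 0" "poly (map_poly of_int h) x = 0"
      using \<open>x \<in> qbar\<close> by (rule qbarE)
    let ?Z = "{z :: complex. poly (map_poly of_int h) z = 0}"
    note Z = int_poly_roots_finite[OF h(1)]
    have "\<sigma> z \<in> ?Z" if "z \<in> ?Z" for z
      using graph_poly[OF coeffs_related_int \<sigma>, of z h] graph_zero Z(2) that by auto
    hence "\<sigma> ` ?Z \<subseteq> ?Z" by blast
    moreover have "inj_on \<sigma> ?Z" using inj Z(2) inj_on_subset by blast
    ultimately have "\<sigma> ` ?Z = ?Z" by (simp add: endo_inj_surj Z(1))
    thus ?thesis using h(2) Z(2) by blast
  qed
  hence "bij_betw \<sigma> qbar qbar" using inj \<sigma> graph_qbar by (auto simp: bij_betw_def)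
  hence "\<sigma> \<in> autq" using hom by (simp add: autq_def \<sigma>_def)
  thus ?thesis using eq by blast
qed

lemma hom_graph_extends_to_aut: "hom_graph B \<Longrightarrow> \<exists>\<sigma>\<in>autq. \<forall>(x, y)\<in>B. \<sigma> x = y"
  using total_hom_graph_exists[of B] hom_graph.total_graph_aut by (metis subsetD case_prodI2 case_prodD)

lemma hom_graph_Rats: "hom_graph (Id_on \<rat>)"
  by unfold_locales (auto intro: Rats_add Rats_mult rat_imp_algebraic simp: qbar_def)

lemma fixed_by_autq_imp_rat:
  assumes "x \<in> qbar" and fixed: "\<And>\<sigma>. \<sigma> \<in> autq \<Longrightarrow> \<sigma> x = x"
  shows "x \<in> \<rat>"
proof -
  interpret hom_graph "Id_on \<rat>" by (rule hom_graph_Rats)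
  have related_iff: "coeffs_related u v \<longleftrightarrow> u = v \<and> (\<forall>i. coeff u i \<in> \<rat>)" for u v
    unfolding coeffs_related_def Id_on_iff by (auto simp: poly_eq_iff)
  obtain f g where fg: "min_poly_pair x f g" using min_poly_pair_exists[OF assms(1)] .
  hence f: "g = f" "\<forall>i. coeff f i \<in> \<rat>" "lead_coeff f = 1" "poly f x = 0"
    and min: "\<And>u. (\<forall>i. coeff u i \<in> \<rat>) \<Longrightarrow> u \<noteq> 0 \<Longrightarrow> degree u < degree f \<Longrightarrow> poly u x \<noteq> 0"
    unfolding min_poly_pair_def related_iff by auto
  obtain q where q: "f = [:- x, 1:] * q" using f(4) by (metis dvdE poly_eq_0_iff_dvd)
  have q0: "q \<noteq> 0" using q f(3) by auto
  have deg: "degree f = Suc (degree q)" unfolding q using q0 by (subst degree_mult_eq) auto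
  have "poly (pderiv f) x \<noteq> 0"
  proof (rule min)
    show "\<forall>i. coeff (pderiv f) i \<in> \<rat>" using f(2) by (auto simp: coeff_pderiv)
    show "pderiv f \<noteq> 0" "degree (pderiv f) < degree f"
      using deg by (simp_all add: pderiv_eq_0_iff degree_pderiv)
  qed
  hence simple: "poly q x \<noteq> 0" unfolding q by (subst (asm) pderiv_mult) (simp add: pderiv_pCons)
  have "degree q = 0"
  proof (rule ccontr)
    assume "degree q \<noteq> 0"
    then obtain \<beta> where \<beta>: "poly q \<beta> = 0"
      using fundamental_theorem_of_algebra[of q] constant_degree[of q] by auto
    hence "poly g \<beta> = 0" using f(1) q by simp
    then obtain B' where "hom_graph B'" "(x, \<beta>) \<in> B'" using extend_by_root[OF assms(1) fg] by blast
    then obtain \<sigma> where "\<sigma> \<in> autq" "\<sigma> x = \<beta>" using hom_graph_extends_to_aut by fast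
    thus False using fixed[of \<sigma>] \<beta> simple by simp
  qed
  then obtain c where c: "q = [:c:]" by (auto elim: degree_eq_zeroE)
  have "c = 1" using f(3) deg c q by simp
  hence "coeff f 0 = - x" using q c by simp
  thus ?thesis using f(2) by (metis Rats_minus_iff)
qed

context
  fixes \<sigma> assumes \<sigma>: "\<sigma> \<in> autq"
begin

lemma autq_in: "x \<in> qbar \<Longrightarrow> \<sigma> x \<in> qbar"
  and autq_add: "x \<in> qbar \<Longrightarrow> y \<in> qbar \<Longrightarrow> \<sigma> (x + y) = \<sigma> x + \<sigma> y"
  and autq_mult: "x \<in> qbar \<Longrightarrow> y \<in> qbar \<Longrightarrow> \<sigma> (x * y) = \<sigma> x * \<sigma> y"
  and autq_out: "x \<notin> qbar \<Longrightarrow> \<sigma> x = x"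
  and autq_bij_betw: "bij_betw \<sigma> qbar qbar"
  using \<sigma> unfolding autq_def by (auto dest: bij_betwE)

lemma autq_inj: "\<sigma> x = \<sigma> y \<longleftrightarrow> x = y"
  by (metis autq_bij_betw autq_in autq_out bij_betw_def inj_onD)

lemma autq_bij: "bij \<sigma>"
proof (rule bijI)
  show "inj \<sigma>" using autq_inj by (auto intro: injI)
  show "surj \<sigma>"
  proof -
    have "y \<in> range \<sigma>" for y
    proof (cases "y \<in> qbar")
      case True
      thus ?thesis using autq_bij_betw unfolding bij_betw_def by blast
    next
      case False
      thus ?thesis using autq_out[OF False] by (metis rangeI)
    qed
    thus ?thesis by blast
  qed
qed

lemma autq_0: "\<sigma> 0 = 0" using autq_add[of 0 0] by simp

lemma autq_1: "\<sigma> 1 = 1"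
  using autq_mult[of 1 1] autq_inj[of 1 0] by (simp add: autq_0)

lemma autq_minus: "x \<in> qbar \<Longrightarrow> \<sigma> (- x) = - \<sigma> x"
  using autq_add[of x "-x"] by (auto simp: autq_0 add_eq_0_iff)

lemma autq_diff: "x \<in> qbar \<Longrightarrow> y \<in> qbar \<Longrightarrow> \<sigma> (x - y) = \<sigma> x - \<sigma> y"
  using autq_add[of x "-y"] autq_minus[of y] by auto

lemma autq_of_nat: "\<sigma> (of_nat n) = of_nat n"
  by (induction n) (auto simp: autq_0 autq_1 autq_add qbar_def)

lemma autq_of_int: "\<sigma> (of_int n) = of_int n"
  by (cases n)
    (auto simp: autq_of_nat autq_1 autq_minus autq_add autq_diff qbar_def algebraic_minus simp del: of_nat_Suc)

lemma autq_inverse: "x \<in> qbar \<Longrightarrow> \<sigma> (inverse x) = inverse (\<sigma> x)"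
  using autq_mult[of x "inverse x"] autq_1 by (cases "x = 0") (auto simp: autq_0 inverse_unique qbar_closed)

lemma autq_of_rat: "\<sigma> (of_rat q) = of_rat q"
proof -
  obtain a b where "of_rat q = of_int a * inverse (of_int b :: complex)"
    by (cases q) (simp add: of_rat_rat divide_inverse)
  thus ?thesis by (simp add: autq_mult autq_inverse autq_of_int qbar_closed)
qed

lemma autq_power: "x \<in> qbar \<Longrightarrow> \<sigma> (x ^ k) = \<sigma> x ^ k"
  by (induction k) (auto simp: autq_1 autq_mult qbar_power)

lemma autq_sum: "(\<And>i. i \<in> I \<Longrightarrow> f i \<in> qbar) \<Longrightarrow> \<sigma> (sum f I) = (\<Sum>i\<in>I. \<sigma> (f i))"
  by (induction I rule: infinite_finite_induct) (auto simp: autq_0 autq_add qbar_sum)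

lemma autq_poly:
  assumes "\<And>i. coeff f i \<in> qbar" "\<And>i. \<sigma> (coeff f i) = coeff f i" "x \<in> qbar"
  shows "\<sigma> (poly f x) = poly f (\<sigma> x)"
  using assms by (simp add: poly_altdef autq_sum autq_mult autq_power qbar_closed qbar_power)

lemma autq_inv: "inv' \<sigma> \<in> autq"
proof -
  have b: "bij_betw (inv' \<sigma>) qbar qbar"
  proof -
    have "\<sigma> ` qbar = qbar" using autq_bij_betw by (simp add: bij_betw_def)
    hence "inv' \<sigma> ` qbar = qbar" using autq_bij by (metis bij_is_inj image_inv_f_f)
    thus ?thesis using autq_bij by (metis bij_betw_def bij_imp_bij_inv bij_is_inj inj_on_subset subset_UNIV)
  qed
  have s: "\<sigma> (inv' \<sigma> x) = x" for x using autq_bij by (simp add: bij_is_surj surj_f_inv_f)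
  have i: "inv' \<sigma> x \<in> qbar" if "x \<in> qbar" for x using b that by (auto dest: bij_betwE)
  show ?thesis
    unfolding autq_def mem_Collect_eq
  proof (intro conjI allI impI ballI b)
    show "inv' \<sigma> x = x" if "x \<notin> qbar" for x using autq_out[OF that] s autq_inj by metis
    show "inv' \<sigma> (x + y) = inv' \<sigma> x + inv' \<sigma> y" "inv' \<sigma> (x * y) = inv' \<sigma> x * inv' \<sigma> y"
      if "x \<in> qbar" "y \<in> qbar" for x y
      using autq_add[OF i i, of x y] autq_mult[OF i i, of x y] that s autq_inj by metis+
  qed
qed

lemma autq_inv_apply: "\<sigma> (inv' \<sigma> x) = x" "inv' \<sigma> (\<sigma> x) = x"
  using autq_bij by (simp_all add: bij_is_surj surj_f_inv_f bij_is_inj)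

end

lemma autq_id: "id \<in> autq" by (auto simp: autq_def)

lemma autq_comp: "\<sigma> \<in> autq \<Longrightarrow> \<tau> \<in> autq \<Longrightarrow> \<sigma> \<circ> \<tau> \<in> autq"
  unfolding autq_def mem_Collect_eq
  by (intro conjI allI impI ballI bij_betw_trans) (auto dest: bij_betwE)

lemma autq_funpow: "\<sigma> \<in> autq \<Longrightarrow> \<sigma> ^^ k \<in> autq"
  by (induction k) (auto simp: autq_id[unfolded id_def] id_def autq_comp)

subsection \<open>Polynomials attached to orbits of tuples\<close>

lemma coeff_linear_mult:
  "coeff ([:- c, 1:] * q) k = (case k of 0 \<Rightarrow> 0 | Suc j \<Rightarrow> coeff q j) - c * coeff q k"
  for c :: "'a::comm_ring_1"
  by (simp add: coeff_pCons split: nat.splits)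

lemma coeff_prod_linear_in:
  fixes f :: "'a \<Rightarrow> 'b::comm_ring_1"
  assumes "finite V" "\<And>v. v \<in> V \<Longrightarrow> f v \<in> S"
    and S: "0 \<in> S" "1 \<in> S" "\<And>x y. x \<in> S \<Longrightarrow> y \<in> S \<Longrightarrow> x - y \<in> S"
      "\<And>x y. x \<in> S \<Longrightarrow> y \<in> S \<Longrightarrow> x * y \<in> S"
  shows "coeff (\<Prod>v\<in>V. [:- f v, 1:]) k \<in> S"
  using assms(1,2)
proof (induction V arbitrary: k rule: finite_induct)
  case empty
  thus ?case using S by (auto simp: coeff_pCons one_pCons split: nat.splits)
next
  case (insert v V)
  have "coeff (\<Prod>v\<in>V. [:- f v, 1:]) j \<in> S" for j using insert by auto
  moreover have "f v \<in> S" using insert by auto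
  ultimately show ?case unfolding prod.insert[OF insert(1,2)] coeff_linear_mult
    using S by (auto split: nat.split)
qed

lemma coeff_prod_linear_hom:
  fixes \<tau> :: "'b::comm_ring_1 \<Rightarrow> 'c::comm_ring_1" and f :: "'a \<Rightarrow> 'b"
  assumes "finite V" "\<And>v. v \<in> V \<Longrightarrow> f v \<in> S"
    and S: "0 \<in> S" "1 \<in> S" "\<And>x y. x \<in> S \<Longrightarrow> y \<in> S \<Longrightarrow> x - y \<in> S"
      "\<And>x y. x \<in> S \<Longrightarrow> y \<in> S \<Longrightarrow> x * y \<in> S"
    and \<tau>: "\<And>x y. x \<in> S \<Longrightarrow> y \<in> S \<Longrightarrow> \<tau> (x - y) = \<tau> x - \<tau> y"
      "\<And>x y. x \<in> S \<Longrightarrow> y \<in> S \<Longrightarrow> \<tau> (x * y) = \<tau> x * \<tau> y" "\<tau> 1 = 1"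
  shows "\<tau> (coeff (\<Prod>v\<in>V. [:- f v, 1:]) k) = coeff (\<Prod>v\<in>V. [:- \<tau> (f v), 1:]) k"
  using assms(1,2)
proof (induction V arbitrary: k rule: finite_induct)
  case empty
  have "\<tau> 0 = 0" using \<tau>(1)[of 0 0] S by simp
  thus ?case using \<tau>(3) by (auto simp: coeff_pCons one_pCons split: nat.splits)
next
  case (insert v V)
  let ?Q = "\<Prod>v\<in>V. [:- f v, 1:]"
  have "\<tau> 0 = 0" using \<tau>(1)[of 0 0] S by simp
  have Q: "coeff ?Q k \<in> S" for k
    by (rule coeff_prod_linear_in[OF insert(1)]) (use insert S in auto)
  have v: "f v \<in> S" using insert by simp
  have "\<tau> ((case k of 0 \<Rightarrow> 0 | Suc j \<Rightarrow> coeff ?Q j) - f v * coeff ?Q k)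
    = \<tau> (case k of 0 \<Rightarrow> 0 | Suc j \<Rightarrow> coeff ?Q j) - \<tau> (f v * coeff ?Q k)"
    by (rule \<tau>(1)) (use Q v S in \<open>auto split: nat.splits\<close>)
  also have "\<tau> (f v * coeff ?Q k) = \<tau> (f v) * \<tau> (coeff ?Q k)"
    by (rule \<tau>(2)) (use Q v in auto)
  finally show ?case unfolding prod.insert[OF insert(1,2)] coeff_linear_mult
    using insert \<open>\<tau> 0 = 0\<close> by (auto split: nat.splits)
qed

definition tuple_orbit :: "('a \<Rightarrow> 'a) set \<Rightarrow> nat \<Rightarrow> (nat \<Rightarrow> 'a) \<Rightarrow> (nat \<Rightarrow> 'a) set" where
  "tuple_orbit H N a = (\<lambda>\<tau>. restrict (\<tau> \<circ> a) {..<N}) ` H"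

definition power_form :: "nat \<Rightarrow> int \<Rightarrow> (nat \<Rightarrow> 'a::comm_ring_1) \<Rightarrow> 'a" where
  "power_form N t v = (\<Sum>i<N. of_int t ^ i * v i)"

definition orbit_poly ::
  "('a::comm_ring_1 \<Rightarrow> 'a) set \<Rightarrow> nat \<Rightarrow> (nat \<Rightarrow> 'a) \<Rightarrow> int \<Rightarrow> 'a poly" where
  "orbit_poly H N a t = (\<Prod>v\<in>tuple_orbit H N a. [:- power_form N t v, 1:])"

lemma power_form_restrict: "power_form N t (restrict v {..<N}) = power_form N t v"
  by (simp add: power_form_def)

lemma poly_orbit_poly: "poly (orbit_poly H N a t) x = (\<Prod>v\<in>tuple_orbit H N a. x - power_form N t v)"
  by (simp add: orbit_poly_def poly_prod)

lemma orbit_poly_root: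
  assumes "id \<in> H" "finite (tuple_orbit H N a)"
  shows "poly (orbit_poly H N a t) (power_form N t a) = 0"
proof -
  have "restrict a {..<N} \<in> tuple_orbit H N a"
    using assms(1) unfolding tuple_orbit_def by (intro image_eqI[of _ _ id]) auto
  thus ?thesis unfolding poly_orbit_poly
    using assms(2) by (intro prod_zero bexI[of _ "restrict a {..<N}"]) (simp_all add: power_form_restrict)
qed

lemma autq_power_form:
  assumes \<sigma>: "\<sigma> \<in> autq" and v: "\<And>i. i < N \<Longrightarrow> v i \<in> qbar"
  shows "\<sigma> (power_form N t v) = power_form N t (\<sigma> \<circ> v)"
proof -
  have "\<sigma> (power_form N t v) = (\<Sum>i<N. \<sigma> (of_int t ^ i * v i))"
    unfolding power_form_def using v by (intro autq_sum[OF \<sigma>] qbar_closed qbar_power) auto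
  also have "\<dots> = power_form N t (\<sigma> \<circ> v)" unfolding power_form_def
    by (intro sum.cong) (auto simp: v autq_mult[OF \<sigma>] qbar_power autq_power[OF \<sigma>] autq_of_int[OF \<sigma>])
  finally show ?thesis .
qed

lemma tuple_orbit_bij:
  assumes \<sigma>: "\<sigma> \<in> H" "inj \<sigma>" and comp: "\<And>\<sigma> \<tau>. \<sigma> \<in> H \<Longrightarrow> \<tau> \<in> H \<Longrightarrow> \<sigma> \<circ> \<tau> \<in> H"
    and fin: "finite (tuple_orbit H N a)"
  shows "bij_betw (\<lambda>v. restrict (\<sigma> \<circ> v) {..<N}) (tuple_orbit H N a) (tuple_orbit H N a)"
proof -
  let ?s = "\<lambda>v. restrict (\<sigma> \<circ> v) {..<N}" and ?V = "tuple_orbit H N a"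
  have "?s (restrict (\<tau> \<circ> a) {..<N}) = restrict ((\<sigma> \<circ> \<tau>) \<circ> a) {..<N}" for \<tau> by auto
  hence "?s ` ?V \<subseteq> ?V" using comp[OF \<sigma>(1)] by (force simp: tuple_orbit_def)
  moreover have "inj_on ?s ?V"
  proof (rule inj_onI)
    fix v w assume vw: "v \<in> ?V" "w \<in> ?V" "?s v = ?s w"
    have "v i = w i" if "i < N" for i
      using fun_cong[OF vw(3), of i] that injD[OF \<sigma>(2)] by simp
    moreover have "v \<in> extensional {..<N}" "w \<in> extensional {..<N}" using vw by (auto simp: tuple_orbit_def)
    ultimately show "v = w" by (auto intro!: extensionalityI)
  qed
  ultimately show ?thesis using fin by (simp add: bij_betw_def endo_inj_surj)
qed

lemma coeff_orbit_poly_fixed: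
  assumes H: "H \<subseteq> autq" "\<And>\<sigma> \<tau>. \<sigma> \<in> H \<Longrightarrow> \<tau> \<in> H \<Longrightarrow> \<sigma> \<circ> \<tau> \<in> H"
    and a: "\<And>i. i < N \<Longrightarrow> a i \<in> qbar" and fin: "finite (tuple_orbit H N a)" and \<sigma>: "\<sigma> \<in> H"
  shows "\<sigma> (coeff (orbit_poly H N a t) k) = coeff (orbit_poly H N a t) k"
proof -
  let ?V = "tuple_orbit H N a" and ?s = "\<lambda>v. restrict (\<sigma> \<circ> v) {..<N}"
  have \<sigma>a: "\<sigma> \<in> autq" using H \<sigma> by auto
  have vq: "v i \<in> qbar" if "v \<in> ?V" "i < N" for v i
    using that a H autq_in by (auto simp: tuple_orbit_def)
  have form_q: "power_form N t v \<in> qbar" if "v \<in> ?V" for v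
    unfolding power_form_def using vq[OF that] by (intro qbar_sum qbar_closed qbar_power) auto
  have "\<sigma> (coeff (orbit_poly H N a t) k) = coeff (\<Prod>v\<in>?V. [:- \<sigma> (power_form N t v), 1:]) k"
    unfolding orbit_poly_def
    by (rule coeff_prod_linear_hom[OF fin, of _ qbar])
      (use form_q in \<open>auto simp: autq_diff[OF \<sigma>a] autq_mult[OF \<sigma>a] autq_1[OF \<sigma>a]\<close>)
  also have "(\<Prod>v\<in>?V. [:- \<sigma> (power_form N t v), 1:]) = (\<Prod>v\<in>?V. [:- power_form N t (?s v), 1:])"
    using vq by (intro prod.cong) (simp_all add: autq_power_form[OF \<sigma>a] power_form_restrict)
  also have "\<dots> = orbit_poly H N a t"
    unfolding orbit_poly_def
    by (rule prod.reindex_bij_betw[OF tuple_orbit_bij[OF \<sigma> _ H(2) fin], of "\<lambda>v. [:- power_form N t v, 1:]"])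
      (use autq_inj[OF \<sigma>a] in \<open>auto intro: injI\<close>)
  finally show ?thesis .
qed

section \<open>Permutation groups\<close>

abbreviation transp :: "'a \<Rightarrow> 'a \<Rightarrow> 'a \<Rightarrow> 'a" where "transp \<equiv> Transposition.transpose"

lemma conj_transpose: "bij g \<Longrightarrow> g \<circ> transp a b \<circ> inv' g = transp (g a) (g b)"
  using transpose_comp_eq[of g "g a" "g b"]
  by (simp add: bij_is_inj fun_eq_iff) (metis bij_inv_eq_iff)

lemma commutator_of_three_cycles:
  assumes "distinct [a, b, c, d, e]"
  shows "(transp a b \<circ> transp b d) \<circ> (transp a c \<circ> transp c e) \<circ> (transp b d \<circ> transp a b)
    \<circ> (transp c e \<circ> transp a c) = transp a b \<circ> transp b c" (is "?l = ?r")
proof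
  fix x
  have d: "a \<noteq> b" "a \<noteq> c" "a \<noteq> d" "a \<noteq> e" "b \<noteq> c" "b \<noteq> d" "b \<noteq> e" "c \<noteq> d" "c \<noteq> e" "d \<noteq> e"
    using assms by auto
  consider "x = a" | "x = b" | "x = c" | "x = d" | "x = e"
    | "x \<noteq> a" "x \<noteq> b" "x \<noteq> c" "x \<noteq> d" "x \<noteq> e" by blast
  thus "?l x = ?r x"
    by cases (simp_all add: Transposition.transpose_def d d[symmetric])
qed

lemma ex_permutes_map_eq:
  assumes "distinct xs" "distinct ys" "length xs = length ys" "set xs \<subseteq> S" "set ys \<subseteq> S"
  shows "\<exists>g. g permutes S \<and> map g xs = ys"
  using assms(3,1,2,4,5)
proof (induction xs ys rule: list_induct2)
  case Nil
  show ?case by (auto intro!: exI[of _ id] permutes_id)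
next
  case (Cons x xs y ys)
  then obtain g where g: "g permutes S" "map g xs = ys" by auto
  have "g x \<notin> set ys" using Cons.prems(1) g(2) permutes_inj[OF g(1)] by (auto simp: inj_eq)
  hence "map (transp (g x) y) ys = ys" using Cons.prems(2) by (intro map_idI transpose_apply_other) auto
  hence "map (transp (g x) y \<circ> g) (x # xs) = y # ys" using g(2) by (simp flip: map_map)
  moreover have "transp (g x) y permutes S"
    using Cons.prems permutes_in_image[OF g(1)] by (intro permutes_swap_id) auto
  hence "transp (g x) y \<circ> g permutes S" by (rule permutes_compose[OF g(1)])
  ultimately show ?case by (intro exI conjI)
qed

locale perm_group =
  fixes S :: "'a set" and G :: "('a \<Rightarrow> 'a) set"
  assumes permutes: "g \<in> G \<Longrightarrow> g permutes S" and id_closed: "id \<in> G"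
    and comp_closed: "g \<in> G \<Longrightarrow> h \<in> G \<Longrightarrow> g \<circ> h \<in> G" and inv_closed: "g \<in> G \<Longrightarrow> inv' g \<in> G"
begin

lemma two_transitive_if_stabilizer_transitive:
  assumes "z \<in> S" and trans: "\<And>x. x \<in> S \<Longrightarrow> \<exists>g\<in>G. g z = x"
    and stab: "\<And>x y. x \<in> S - {z} \<Longrightarrow> y \<in> S - {z} \<Longrightarrow> \<exists>g\<in>G. g z = z \<and> g x = y"
    and uv: "u \<in> S" "v \<in> S" "u \<noteq> v" and xy: "x \<in> S" "y \<in> S" "x \<noteq> y"
  shows "\<exists>g\<in>G. g u = x \<and> g v = y"
proof -
  obtain a b where a: "a \<in> G" "a z = u" and b: "b \<in> G" "b z = x" using trans uv xy by metis
  note pa = permutes[OF a(1)] and pb = permutes[OF b(1)]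
  have "inv' a v \<in> S - {z}" "inv' b y \<in> S - {z}"
    using uv xy a b permutes_inverses[OF pa] permutes_inverses[OF pb]
      permutes_in_image[OF permutes_inv[OF pa]] permutes_in_image[OF permutes_inv[OF pb]] by auto
  then obtain w where w: "w \<in> G" "w z = z" "w (inv' a v) = inv' b y" using stab by blast
  have "inv' a u = z" using a permutes_inverses(2)[OF pa] by metis
  hence "(b \<circ> w \<circ> inv' a) u = x" "(b \<circ> w \<circ> inv' a) v = y"
    using w b permutes_inverses(1)[OF pb] by simp_all
  moreover have "b \<circ> w \<circ> inv' a \<in> G" using a(1) b(1) w(1) by (intro comp_closed inv_closed)
  ultimately show ?thesis by blast
qed

lemma symmetric_if_two_transitive:
  assumes "finite S" "transp a b \<in> G"
    and two: "\<And>x y. x \<in> S \<Longrightarrow> y \<in> S \<Longrightarrow> x \<noteq> y \<Longrightarrow> \<exists>g\<in>G. g a = x \<and> g b = y"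
    and p: "p permutes S"
  shows "p \<in> G"
proof -
  have "transp x y \<in> G" if xy: "x \<in> S" "y \<in> S" for x y
  proof (cases "x = y")
    case False
    then obtain g where g: "g \<in> G" "g a = x" "g b = y" using two[OF xy False] by blast
    have "g \<circ> transp a b \<circ> inv' g \<in> G" using g(1) assms(2) by (intro comp_closed inv_closed)
    thus ?thesis using conj_transpose[OF permutes_bij[OF permutes[OF g(1)]], of a b] g by simp
  qed (use id_closed in simp)
  with p \<open>finite S\<close> show ?thesis
    by (induction rule: permutes_induct) (use id_closed comp_closed in blast)+
qed

end

locale normal_perm_group = perm_group +
  assumes conj_closed: "g \<in> G \<Longrightarrow> h permutes S \<Longrightarrow> h \<circ> g \<circ> inv' h \<in> G"
begin

lemma commutator_with_transpose:
  assumes p: "p \<in> G" and xz: "x \<in> S" "z \<in> S"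
  shows "transp (p x) (p z) \<circ> transp x z \<in> G"
proof -
  have "p \<circ> (transp x z \<circ> inv' p \<circ> inv' (transp x z)) \<in> G"
    using p xz by (intro comp_closed conj_closed inv_closed permutes_swap_id)
  also have "p \<circ> (transp x z \<circ> inv' p \<circ> inv' (transp x z)) = (p \<circ> transp x z \<circ> inv' p) \<circ> transp x z"
    by (simp add: o_assoc)
  also have "p \<circ> transp x z \<circ> inv' p = transp (p x) (p z)"
    by (rule conj_transpose[OF permutes_bij[OF permutes[OF p]]])
  finally show ?thesis .
qed

lemma three_cycle_if_double_transpose:
  assumes t: "transp y d \<circ> transp x z \<in> G" and "distinct [x, y, z, d, e]" "z \<in> S" "e \<in> S"
  shows "transp z x \<circ> transp x e \<in> G"
proof -
  let ?h = "transp z e"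
  have "?h \<circ> (transp y d \<circ> transp x z) \<circ> inv' ?h
      = (?h \<circ> transp y d \<circ> inv' ?h) \<circ> (?h \<circ> transp x z \<circ> inv' ?h)"
    by (simp add: fun_eq_iff)
  also have "\<dots> = transp (?h y) (?h d) \<circ> transp (?h x) (?h z)"
    by (simp only: conj_transpose bij_transpose)
  also have "\<dots> = transp y d \<circ> transp x e" using assms(2) by auto
  finally have "transp y d \<circ> transp x e \<in> G"
    using conj_closed[OF t permutes_swap_id[OF assms(3,4)]] by argo
  moreover have "inv' (transp y d \<circ> transp x z) = transp x z \<circ> transp y d" by (simp add: o_inv_distrib)
  hence "transp x z \<circ> transp y d \<in> G" using inv_closed[OF t] by argo
  ultimately have "(transp x z \<circ> transp y d) \<circ> (transp y d \<circ> transp x e) \<in> G"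
    by (rule comp_closed[rotated])
  also have "(transp x z \<circ> transp y d) \<circ> (transp y d \<circ> transp x e) = transp z x \<circ> transp x e"
    by (simp add: fun_eq_iff transpose_commute)
  finally show ?thesis .
qed

lemma some_three_cycle:
  assumes S: "finite S" "card S \<ge> 5" and p: "p \<in> G" "p \<noteq> id"
  shows "\<exists>x y z. {x, y, z} \<subseteq> S \<and> distinct [x, y, z] \<and> transp x y \<circ> transp y z \<in> G"
proof -
  have outside: "\<exists>w\<in>S. w \<notin> set xs" if "length xs \<le> 4" for xs
    using S that card_mono[of "set xs" S] card_length[of xs] by fastforce
  note pS = permutes[OF p(1)]
  obtain x where x: "p x \<noteq> x" using p(2) by (auto simp: fun_eq_iff)
  have xS: "x \<in> S" "p x \<in> S" using x pS permutes_in_image[OF pS] by (auto dest: permutes_not_in)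
  obtain z where z: "z \<in> S" "z \<noteq> x" "z \<noteq> p x" using outside[of "[x, p x]"] by auto
  have zy: "p z \<in> S" "p z \<noteq> p x"
    using z(1,2) permutes_in_image[OF pS] injD[OF permutes_inj[OF pS]] by auto
  have t: "transp (p x) (p z) \<circ> transp x z \<in> G" by (rule commutator_with_transpose[OF p(1) xS(1) z(1)])
  consider (swapped) "p z = x" | (fixed) "p z = z" | (moved) "p z \<noteq> x" "p z \<noteq> z" by blast
  thus ?thesis
  proof cases
    case swapped
    thus ?thesis using t x z xS by (intro exI[of _ "p x"] exI[of _ x] exI[of _ z]) auto
  next
    case fixed
    hence "transp (p x) z \<circ> transp z x \<in> G" using t by (simp add: transpose_commute)
    thus ?thesis using x z xS by (intro exI[of _ "p x"] exI[of _ z] exI[of _ x]) auto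
  next
    case moved
    obtain e where e: "e \<in> S" "e \<notin> set [x, p x, z, p z]" using outside[of "[x, p x, z, p z]"] by auto
    have "transp z x \<circ> transp x e \<in> G"
      by (rule three_cycle_if_double_transpose[OF t _ z(1) e(1)]) (use moved e x z zy in auto)
    thus ?thesis using z e xS by (intro exI[of _ z] exI[of _ x] exI[of _ e]) auto
  qed
qed

lemma contains_three_cycles:
  assumes "finite S" "card S \<ge> 5" "p \<in> G" "p \<noteq> id" and abc: "{a, b, c} \<subseteq> S" "distinct [a, b, c]"
  shows "transp a b \<circ> transp b c \<in> G"
proof -
  obtain x y z where xyz: "{x, y, z} \<subseteq> S" "distinct [x, y, z]" "transp x y \<circ> transp y z \<in> G"
    using some_three_cycle[OF assms(1-4)] by blast
  obtain g where g: "g permutes S" "map g [x, y, z] = [a, b, c]"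
    using ex_permutes_map_eq[of "[x, y, z]" "[a, b, c]" S] xyz abc by auto
  have "g \<circ> (transp x y \<circ> transp y z) \<circ> inv' g = (g \<circ> transp x y \<circ> inv' g) \<circ> (g \<circ> transp y z \<circ> inv' g)"
    using permutes_inverses[OF g(1)] by (simp add: fun_eq_iff)
  also have "\<dots> = transp a b \<circ> transp b c" using conj_transpose[OF permutes_bij[OF g(1)]] g(2) by simp
  finally show ?thesis using conj_closed[OF xyz(3) g(1)] by argo
qed

end

section \<open>Congruences modulo a prime ideal of a subring\<close>

locale subring_prime =
  fixes R P :: "'a::comm_ring_1 set"
  assumes R_one: "1 \<in> R" and R_add: "x \<in> R \<Longrightarrow> y \<in> R \<Longrightarrow> x + y \<in> R"
    and R_mult: "x \<in> R \<Longrightarrow> y \<in> R \<Longrightarrow> x * y \<in> R" and R_minus: "x \<in> R \<Longrightarrow> - x \<in> R"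
    and P_subset_R: "P \<subseteq> R" and P_zero: "0 \<in> P" and P_add: "x \<in> P \<Longrightarrow> y \<in> P \<Longrightarrow> x + y \<in> P"
    and P_mult_left: "x \<in> R \<Longrightarrow> y \<in> P \<Longrightarrow> x * y \<in> P" and one_notin_P: "1 \<notin> P"
    and P_prime: "x \<in> R \<Longrightarrow> y \<in> R \<Longrightarrow> x * y \<in> P \<Longrightarrow> x \<in> P \<or> y \<in> P"
begin

lemma R_zero: "0 \<in> R"
  using P_zero P_subset_R by auto

lemma R_diff: "x \<in> R \<Longrightarrow> y \<in> R \<Longrightarrow> x - y \<in> R"
  using R_add[of x "- y"] R_minus by simp

lemma R_power: "x \<in> R \<Longrightarrow> x ^ k \<in> R"
  by (induction k) (auto simp: R_one R_mult)

lemma R_sum: "(\<And>i. i \<in> I \<Longrightarrow> f i \<in> R) \<Longrightarrow> sum f I \<in> R"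
  by (induction I rule: infinite_finite_induct) (auto simp: R_zero R_add)

lemma R_prod: "(\<And>i. i \<in> I \<Longrightarrow> f i \<in> R) \<Longrightarrow> prod f I \<in> R"
  by (induction I rule: infinite_finite_induct) (auto simp: R_one R_mult)

lemma R_of_nat: "of_nat n \<in> R"
  by (induction n) (auto simp: R_zero R_one R_add)

lemma R_of_int: "of_int n \<in> R"
  by (cases n) (auto simp: R_of_nat R_minus R_add R_one R_diff simp del: of_nat_Suc)

lemma R_poly: "(\<And>i. coeff f i \<in> R) \<Longrightarrow> x \<in> R \<Longrightarrow> poly f x \<in> R"
  unfolding poly_altdef by (intro R_sum R_mult R_power) auto

lemma R_coeff_prod_linear:
  "finite I \<Longrightarrow> (\<And>i. i \<in> I \<Longrightarrow> f i \<in> R) \<Longrightarrow> coeff (\<Prod>i\<in>I. [:- f i, 1:]) k \<in> R"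
  by (rule coeff_prod_linear_in) (use R_zero R_one R_diff R_mult in auto)

lemma P_mult_right: "x \<in> P \<Longrightarrow> y \<in> R \<Longrightarrow> x * y \<in> P"
  using P_mult_left[of y x] by (simp add: mult.commute)

lemma P_minus: "x \<in> P \<Longrightarrow> - x \<in> P"
  using P_mult_left[of "-1" x] R_minus[OF R_one] by simp

lemma P_diff: "x \<in> P \<Longrightarrow> y \<in> P \<Longrightarrow> x - y \<in> P"
  using P_add[of x "- y"] P_minus by simp

lemma P_sum: "(\<And>i. i \<in> I \<Longrightarrow> f i \<in> P) \<Longrightarrow> sum f I \<in> P"
  by (induction I rule: infinite_finite_induct) (auto simp: P_zero P_add)

lemma P_prodE:
  assumes "finite I" "\<And>i. i \<in> I \<Longrightarrow> f i \<in> R" "prod f I \<in> P"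
  obtains i where "i \<in> I" "f i \<in> P"
proof -
  have "\<exists>i\<in>I. f i \<in> P" using assms
  proof (induction I rule: finite_induct)
    case (insert x F)
    have "prod f F \<in> R" "f x \<in> R" using insert by (auto intro: R_prod)
    thus ?case using insert P_prime[of "f x" "prod f F"] by auto
  qed (use one_notin_P in auto)
  thus ?thesis using that by blast
qed

lemma P_power: "x \<in> R \<Longrightarrow> x ^ k \<in> P \<Longrightarrow> x \<in> P"
  by (induction k) (use one_notin_P P_prime R_power in auto)

abbreviation cong_P :: "'a \<Rightarrow> 'a \<Rightarrow> bool" (infix "\<equiv>\<^sub>P" 50) where
  "x \<equiv>\<^sub>P y \<equiv> x - y \<in> P"

lemma cong_refl: "x \<equiv>\<^sub>P x"
  by (simp add: P_zero)

lemma cong_sym: "x \<equiv>\<^sub>P y \<Longrightarrow> y \<equiv>\<^sub>P x"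
  using P_minus[of "x - y"] by simp

lemma cong_trans: "x \<equiv>\<^sub>P y \<Longrightarrow> y \<equiv>\<^sub>P z \<Longrightarrow> x \<equiv>\<^sub>P z"
  using P_add[of "x - y" "y - z"] by simp

lemma cong_add: "x \<equiv>\<^sub>P y \<Longrightarrow> x' \<equiv>\<^sub>P y' \<Longrightarrow> x + x' \<equiv>\<^sub>P y + y'"
  using P_add[of "x - y" "x' - y'"] by (simp add: algebra_simps)

lemma cong_diff: "x \<equiv>\<^sub>P y \<Longrightarrow> x' \<equiv>\<^sub>P y' \<Longrightarrow> x - x' \<equiv>\<^sub>P y - y'"
  using P_diff[of "x - y" "x' - y'"] by (simp add: algebra_simps)

lemma cong_mult: "x \<equiv>\<^sub>P y \<Longrightarrow> x' \<equiv>\<^sub>P y' \<Longrightarrow> x \<in> R \<Longrightarrow> y' \<in> R \<Longrightarrow> x * x' \<equiv>\<^sub>P y * y'"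
  using P_add[OF P_mult_left[of x "x' - y'"] P_mult_right[of "x - y" y']] by (simp add: algebra_simps)

lemma cong_power: "x \<equiv>\<^sub>P y \<Longrightarrow> x \<in> R \<Longrightarrow> y \<in> R \<Longrightarrow> x ^ k \<equiv>\<^sub>P y ^ k"
  by (induction k) (auto simp: P_zero R_power intro!: cong_mult)

lemma cong_sum: "(\<And>i. i \<in> I \<Longrightarrow> f i \<equiv>\<^sub>P g i) \<Longrightarrow> sum f I \<equiv>\<^sub>P sum g I"
  using P_sum[of I "\<lambda>i. f i - g i"] by (simp add: sum_subtractf)

lemma cong_in_P_iff: "x \<equiv>\<^sub>P y \<Longrightarrow> x \<in> P \<longleftrightarrow> y \<in> P"
  using P_add[of "x - y" y] P_diff[of x "x - y"] by auto

lemma cong_poly_arg: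
  assumes "\<And>i. coeff f i \<in> R" "x \<equiv>\<^sub>P y" "x \<in> R" "y \<in> R"
  shows "poly f x \<equiv>\<^sub>P poly f y"
  unfolding poly_altdef using assms by (intro cong_sum cong_mult cong_refl cong_power R_power) auto

lemma cong_poly_coeffs:
  assumes "\<And>i. coeff f i \<equiv>\<^sub>P coeff g i" "x \<in> R"
  shows "poly f x \<equiv>\<^sub>P poly g x"
proof -
  have "poly (f - g) x \<in> P" unfolding poly_altdef
    by (intro P_sum P_mult_right R_power) (use assms in auto)
  thus ?thesis by simp
qed

lemma cong_coeff_prod_linear:
  assumes "finite I" "\<And>i. i \<in> I \<Longrightarrow> f i \<in> R" "\<And>i. i \<in> I \<Longrightarrow> g i \<in> R" "\<And>i. i \<in> I \<Longrightarrow> f i \<equiv>\<^sub>P g i"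
  shows "coeff (\<Prod>i\<in>I. [:- f i, 1:]) k \<equiv>\<^sub>P coeff (\<Prod>i\<in>I. [:- g i, 1:]) k"
  using assms
proof (induction I arbitrary: k rule: finite_induct)
  case empty thus ?case by (simp add: P_zero)
next
  case (insert v I)
  have IH: "coeff (\<Prod>i\<in>I. [:- f i, 1:]) k \<equiv>\<^sub>P coeff (\<Prod>i\<in>I. [:- g i, 1:]) k" for k
    by (rule insert.IH) (use insert.prems in auto)
  have "coeff (\<Prod>i\<in>I. [:- g i, 1:]) k \<in> R" for k by (rule R_coeff_prod_linear) (use insert in auto)
  hence prod: "f v * coeff (\<Prod>i\<in>I. [:- f i, 1:]) k \<equiv>\<^sub>P g v * coeff (\<Prod>i\<in>I. [:- g i, 1:]) k"
    by (intro cong_mult) (use insert.prems IH in auto)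
  show ?case unfolding prod.insert[OF insert(1,2)] coeff_linear_mult
    by (rule cong_diff[OF _ prod]) (use IH P_zero in \<open>auto split: nat.split\<close>)
qed

lemma R_coeff_synthetic_div:
  assumes "\<And>i. coeff f i \<in> R" "c \<in> R"
  shows "coeff (synthetic_div f c) i \<in> R"
  using assms(1)
proof (induction f arbitrary: i rule: pCons_induct)
  case (pCons a f)
  have f: "coeff f i \<in> R" for i using pCons.prems[of "Suc i"] by simp
  thus ?case using pCons.IH R_poly[OF f assms(2)] by (simp add: coeff_pCons split: nat.split)
qed (simp add: R_zero)

lemma coeff_in_P_if_many_roots:
  assumes "\<And>i. coeff f i \<in> R" "finite T" "degree f < card T" "T \<subseteq> R"
    and "\<And>s t. s \<in> T \<Longrightarrow> t \<in> T \<Longrightarrow> s \<equiv>\<^sub>P t \<Longrightarrow> s = t" and "\<And>t. t \<in> T \<Longrightarrow> poly f t \<in> P"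
  shows "coeff f i \<in> P"
  using assms
proof (induction "card T" arbitrary: f T i)
  case (Suc n)
  then obtain t0 where t0: "t0 \<in> T" by (metis card.empty ex_in_conv nat.simps(3))
  define q where "q = synthetic_div f t0"
  have f: "f = pCons (poly f t0) q - smult t0 q"
    using synthetic_div_correct[of f t0] by (simp add: q_def algebra_simps)
  have qR: "coeff q i \<in> R" for i
    unfolding q_def using Suc.prems t0 by (intro R_coeff_synthetic_div) auto
  have qP: "coeff q i \<in> P" for i
  proof (cases "degree f = 0")
    case True
    hence "q = 0" using synthetic_div_eq_0_iff[of f t0] by (simp add: q_def)
    thus ?thesis by (simp add: P_zero)
  next
    case False
    show ?thesis
    proof (rule Suc.hyps(1)[of "T - {t0}"])
      show "n = card (T - {t0})" using Suc t0 by simp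
      show "degree q < card (T - {t0})"
        using Suc.prems t0 False by (simp add: q_def degree_synthetic_div)
      fix t assume t: "t \<in> T - {t0}"
      have "poly f t = poly f t0 + t * poly q t - t0 * poly q t" by (subst f) simp
      hence "poly f t - poly f t0 = (t - t0) * poly q t" by (simp add: algebra_simps)
      moreover have "poly f t - poly f t0 \<in> P" using Suc.prems t t0 by (intro P_diff) auto
      ultimately have "(t - t0) * poly q t \<in> P" by simp
      moreover have "t - t0 \<in> R" "poly q t \<in> R" using t t0 Suc.prems qR by (auto intro!: R_diff R_poly)
      moreover have "t - t0 \<notin> P" using t t0 Suc.prems(5)[of t t0] by auto
      ultimately show "poly q t \<in> P" using P_prime by blast
    qed (use Suc.prems qR in auto)
  qed
  have "coeff f i = (case i of 0 \<Rightarrow> poly f t0 | Suc j \<Rightarrow> coeff q j) - t0 * coeff q i"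
    by (subst f) (simp add: coeff_pCons)
  thus ?case using qP Suc.prems t0 by (auto intro!: P_diff P_mult_left split: nat.splits)
qed simp

lemma R_power_form: "(\<And>i. i < N \<Longrightarrow> u i \<in> R) \<Longrightarrow> power_form N t u \<in> R"
  unfolding power_form_def by (intro R_sum R_mult R_power R_of_int) auto

lemma tuple_cong_if_power_forms_cong:
  assumes "finite T" "card T > N" and Tinj: "\<And>s t. s \<in> T \<Longrightarrow> t \<in> T \<Longrightarrow> of_int s \<equiv>\<^sub>P of_int t \<Longrightarrow> s = t"
    and R: "\<And>i. i < N \<Longrightarrow> v i \<in> R" "\<And>i. i < N \<Longrightarrow> w i \<in> R"
    and cong: "\<And>t. t \<in> T \<Longrightarrow> power_form N t w \<equiv>\<^sub>P power_form N t v" and "i < N"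
  shows "w i \<equiv>\<^sub>P v i"
proof -
  define f where "f = (\<Sum>i<N. monom (w i - v i) i)"
  have coeff_f: "coeff f i = (if i < N then w i - v i else 0)" for i by (auto simp: f_def coeff_sum)
  have poly_f: "poly f (of_int t) = power_form N t w - power_form N t v" for t
    by (simp add: f_def poly_sum poly_monom power_form_def sum_subtractf[symmetric] algebra_simps)
  have "inj_on (of_int :: int \<Rightarrow> 'a) T" using Tinj P_zero by (intro inj_onI) simp
  hence card: "card ((of_int :: int \<Rightarrow> 'a) ` T) = card T" by (rule card_image)
  have "coeff f i \<in> P"
  proof (rule coeff_in_P_if_many_roots)
    show "coeff f i \<in> R" for i using coeff_f R by (auto simp: R_zero R_diff)
    have "degree f \<le> N" by (intro degree_le) (auto simp: coeff_f)
    thus "degree f < card ((of_int :: int \<Rightarrow> 'a) ` T)" using card assms(2) by simp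
  qed (use assms(1) Tinj poly_f cong R_of_int in auto)
  thus ?thesis using \<open>i < N\<close> by (simp add: coeff_f)
qed

text \<open>By the pigeonhole principle one member of \<open>V\<close> serves for many values of \<open>t\<close>.\<close>

lemma tuple_cong_some_if_power_forms:
  assumes V: "finite V" and T: "finite T" "card T > card V * N"
    and Tinj: "\<And>s t. s \<in> T \<Longrightarrow> t \<in> T \<Longrightarrow> of_int s \<equiv>\<^sub>P of_int t \<Longrightarrow> s = t"
    and VR: "\<And>v i. v \<in> V \<Longrightarrow> i < N \<Longrightarrow> v i \<in> R" and wR: "\<And>i. i < N \<Longrightarrow> w i \<in> R"
    and prod: "\<And>t. t \<in> T \<Longrightarrow> (\<Prod>v\<in>V. power_form N t w - power_form N t v) \<in> P"
  obtains v where "v \<in> V" "\<And>i. i < N \<Longrightarrow> w i \<equiv>\<^sub>P v i"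
proof -
  let ?S = "\<lambda>v. {t\<in>T. power_form N t w \<equiv>\<^sub>P power_form N t v}"
  have "\<exists>v\<in>V. power_form N t w \<equiv>\<^sub>P power_form N t v" if "t \<in> T" for t
  proof (rule P_prodE[OF V _ prod[OF that]])
    show "power_form N t w - power_form N t v \<in> R" if "v \<in> V" for v
      using VR that wR by (intro R_diff R_power_form) auto
  qed blast
  hence "T \<subseteq> (\<Union>v\<in>V. ?S v)" by blast
  hence "card T \<le> card (\<Union>v\<in>V. ?S v)" using T V by (intro card_mono) auto
  also have "\<dots> \<le> (\<Sum>v\<in>V. card (?S v))" by (rule card_UN_le[OF V])
  finally have "\<not> (\<forall>v\<in>V. card (?S v) \<le> N)"
    using T(2) sum_bounded_above[of V "\<lambda>v. card (?S v)" N] by fastforce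
  then obtain v where v: "v \<in> V" "card (?S v) > N" by (auto simp: not_le)
  show ?thesis
  proof (rule that[OF v(1)])
    fix i assume "i < N"
    show "w i \<equiv>\<^sub>P v i"
      by (rule tuple_cong_if_power_forms_cong[of "?S v" N v w]) (use T v VR wR Tinj \<open>i < N\<close> in auto)
  qed
qed

end

text \<open>A homomorphism modulo \<open>P\<close>. Below \<open>\<phi>\<close> will be the Frobenius power map on algebraic integers
  and, with \<open>P = {0}\<close>, an automorphism of a field extension.\<close>

locale cong_hom = subring_prime +
  fixes L :: "'a set" and \<phi> :: "'a \<Rightarrow> 'a"
  assumes L_of_int: "of_int z \<in> L" and L_add: "x \<in> L \<Longrightarrow> y \<in> L \<Longrightarrow> x + y \<in> L"
    and L_mult: "x \<in> L \<Longrightarrow> y \<in> L \<Longrightarrow> x * y \<in> L"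
    and hom_in_R: "x \<in> L \<Longrightarrow> \<phi> x \<in> R"
    and hom_add: "x \<in> L \<Longrightarrow> y \<in> L \<Longrightarrow> \<phi> (x + y) \<equiv>\<^sub>P \<phi> x + \<phi> y"
    and hom_mult: "x \<in> L \<Longrightarrow> y \<in> L \<Longrightarrow> \<phi> (x * y) \<equiv>\<^sub>P \<phi> x * \<phi> y"
    and hom_of_int: "\<phi> (of_int z) \<equiv>\<^sub>P of_int z"
begin

lemma L_power: "x \<in> L \<Longrightarrow> x ^ k \<in> L"
  by (induction k) (use L_of_int[of 1] L_mult in auto)

lemma L_sum: "(\<And>i. i \<in> I \<Longrightarrow> f i \<in> L) \<Longrightarrow> sum f I \<in> L"
  by (induction I rule: infinite_finite_induct) (use L_of_int[of 0] L_add in auto)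

lemma L_power_form: "(\<And>i. i < N \<Longrightarrow> a i \<in> L) \<Longrightarrow> power_form N t a \<in> L"
  unfolding power_form_def by (intro L_sum L_mult L_power L_of_int) auto

lemma hom_power: "x \<in> L \<Longrightarrow> \<phi> (x ^ k) \<equiv>\<^sub>P \<phi> x ^ k"
proof (induction k)
  case 0 show ?case using hom_of_int[of 1] by simp
next
  case (Suc k)
  have "\<phi> (x * x ^ k) \<equiv>\<^sub>P \<phi> x * \<phi> (x ^ k)" using Suc.prems L_power by (intro hom_mult)
  moreover have "\<phi> x * \<phi> (x ^ k) \<equiv>\<^sub>P \<phi> x * \<phi> x ^ k"
    using Suc hom_in_R R_power by (intro cong_mult cong_refl) auto
  ultimately have "\<phi> (x * x ^ k) \<equiv>\<^sub>P \<phi> x * \<phi> x ^ k" by (rule cong_trans)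
  thus ?case by simp
qed

lemma hom_sum:
  assumes "finite I" "\<And>i. i \<in> I \<Longrightarrow> f i \<in> L"
  shows "\<phi> (sum f I) \<equiv>\<^sub>P (\<Sum>i\<in>I. \<phi> (f i))"
  using assms
proof (induction I rule: finite_induct)
  case empty show ?case using hom_of_int[of 0] by simp
next
  case (insert a I)
  have "\<phi> (f a + sum f I) \<equiv>\<^sub>P \<phi> (f a) + \<phi> (sum f I)" using insert.prems L_sum[of I f] by (intro hom_add) auto
  moreover have "\<phi> (f a) + \<phi> (sum f I) \<equiv>\<^sub>P \<phi> (f a) + (\<Sum>i\<in>I. \<phi> (f i))"
    using insert by (intro cong_add cong_refl) auto
  ultimately show ?case using insert cong_trans by auto
qed

lemma hom_sum_mult:
  assumes "finite I" "\<And>i. i \<in> I \<Longrightarrow> f i \<in> L" "\<And>i. i \<in> I \<Longrightarrow> g i \<in> L"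
    and "\<And>i. i \<in> I \<Longrightarrow> \<phi> (f i) \<equiv>\<^sub>P f' i" "\<And>i. i \<in> I \<Longrightarrow> \<phi> (g i) \<equiv>\<^sub>P g' i" "\<And>i. i \<in> I \<Longrightarrow> g' i \<in> R"
  shows "\<phi> (\<Sum>i\<in>I. f i * g i) \<equiv>\<^sub>P (\<Sum>i\<in>I. f' i * g' i)"
proof (rule cong_trans[OF hom_sum cong_sum])
  fix i assume "i \<in> I"
  thus "\<phi> (f i * g i) \<equiv>\<^sub>P f' i * g' i"
    using assms hom_in_R by (intro cong_trans[OF hom_mult cong_mult]) auto
qed (use assms L_mult in auto)

lemma hom_poly:
  assumes "\<And>i. coeff f i \<in> L" "\<And>i. \<phi> (coeff f i) \<equiv>\<^sub>P coeff f i" "x \<in> L"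
  shows "\<phi> (poly f x) \<equiv>\<^sub>P poly f (\<phi> x)"
  unfolding poly_altdef using assms L_power hom_power hom_in_R R_power by (intro hom_sum_mult) auto

lemma hom_power_form:
  assumes "\<And>i. i < N \<Longrightarrow> a i \<in> L"
  shows "\<phi> (power_form N t a) \<equiv>\<^sub>P power_form N t (\<phi> \<circ> a)"
  unfolding power_form_def
proof (rule hom_sum_mult)
  show "\<phi> (of_int t ^ i) \<equiv>\<^sub>P of_int t ^ i" for i using hom_of_int[of "t ^ i"] by simp
qed (use assms L_power L_of_int hom_in_R cong_refl in auto)

text \<open>Replacing tuples by the values of generic linear forms reduces a simultaneous conjugacy
  statement to one for the roots of a single polynomial.\<close>

lemma hom_eq_tuple_orbit:
  assumes H: "id \<in> H" "finite (tuple_orbit H N a)"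
    and a: "\<And>i. i < N \<Longrightarrow> a i \<in> L" "\<And>\<sigma> i. \<sigma> \<in> H \<Longrightarrow> i < N \<Longrightarrow> \<sigma> (a i) \<in> R"
    and fixed: "\<And>t k. coeff (orbit_poly H N a t) k \<in> L"
      "\<And>t k. \<phi> (coeff (orbit_poly H N a t) k) \<equiv>\<^sub>P coeff (orbit_poly H N a t) k"
    and T: "finite T" "card T > card (tuple_orbit H N a) * N"
      "\<And>s t. s \<in> T \<Longrightarrow> t \<in> T \<Longrightarrow> of_int s \<equiv>\<^sub>P of_int t \<Longrightarrow> s = t"
  shows "\<exists>\<sigma>\<in>H. \<forall>i<N. \<phi> (a i) \<equiv>\<^sub>P \<sigma> (a i)"
proof -
  let ?V = "tuple_orbit H N a" and ?w = "\<phi> \<circ> a"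
  have VR: "v i \<in> R" if "v \<in> ?V" "i < N" for v i using that a(2) by (auto simp: tuple_orbit_def)
  have wR: "?w i \<in> R" if "i < N" for i using that a(1) hom_in_R by simp
  obtain v where v: "v \<in> ?V" "\<And>i. i < N \<Longrightarrow> ?w i \<equiv>\<^sub>P v i"
  proof (rule tuple_cong_some_if_power_forms[where V = ?V and w = ?w and N = N, OF H(2) T])
    fix t
    let ?Q = "orbit_poly H N a t" and ?x = "power_form N t a"
    have xL: "?x \<in> L" using a(1) by (rule L_power_form)
    have QR: "coeff ?Q k \<in> R" for k
      unfolding orbit_poly_def by (rule R_coeff_prod_linear[OF H(2)]) (use VR R_power_form in auto)
    have "poly ?Q (power_form N t ?w) \<equiv>\<^sub>P poly ?Q (\<phi> ?x)"
      by (rule cong_poly_arg[OF QR cong_sym[OF hom_power_form]])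
        (use a(1) wR R_power_form xL hom_in_R in auto)
    moreover have "\<phi> (poly ?Q ?x) \<equiv>\<^sub>P poly ?Q (\<phi> ?x)" by (rule hom_poly[OF fixed xL])
    moreover have "\<phi> (poly ?Q ?x) \<in> P" using hom_of_int[of 0] orbit_poly_root[OF H] by simp
    ultimately have "poly ?Q (power_form N t ?w) \<in> P" using cong_in_P_iff by blast
    thus "(\<Prod>v\<in>?V. power_form N t ?w - power_form N t v) \<in> P" by (simp add: poly_orbit_poly)
  qed (use VR wR in auto)
  then obtain \<sigma> where "\<sigma> \<in> H" "v = restrict (\<sigma> \<circ> a) {..<N}" by (auto simp: tuple_orbit_def)
  thus ?thesis using v(2) by (intro bexI[of _ \<sigma>]) auto
qed

end

lemma card_tuple_orbit_le:
  assumes "finite Z" "\<And>\<sigma> i. \<sigma> \<in> H \<Longrightarrow> i < N \<Longrightarrow> \<sigma> (a i) \<in> Z"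
  shows "finite (tuple_orbit H N a)" "card (tuple_orbit H N a) \<le> card Z ^ N"
proof -
  have sub: "tuple_orbit H N a \<subseteq> {..<N} \<rightarrow>\<^sub>E Z"
    using assms(2) by (auto simp: tuple_orbit_def PiE_def extensional_def)
  have fin: "finite ({..<N} \<rightarrow>\<^sub>E Z)" by (intro finite_PiE) (use assms(1) in auto)
  show "finite (tuple_orbit H N a)" using finite_subset[OF sub fin] .
  show "card (tuple_orbit H N a) \<le> card Z ^ N" using card_mono[OF fin sub] by (simp add: card_PiE)
qed

lemma cong_hom_eq_conjugation:
  fixes R P L Z :: "complex set"
  assumes "cong_hom R P L \<phi>"
    and H: "H \<subseteq> autq" "id \<in> H" "\<And>\<sigma> \<tau>. \<sigma> \<in> H \<Longrightarrow> \<tau> \<in> H \<Longrightarrow> \<sigma> \<circ> \<tau> \<in> H"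
    and Z: "finite Z" "Z \<subseteq> L \<inter> qbar \<inter> R" "\<And>\<sigma> z. \<sigma> \<in> H \<Longrightarrow> z \<in> Z \<Longrightarrow> \<sigma> z \<in> Z"
    and fixed: "\<And>c. c \<in> qbar \<inter> R \<Longrightarrow> (\<And>\<sigma>. \<sigma> \<in> H \<Longrightarrow> \<sigma> c = c) \<Longrightarrow> c \<in> L \<and> \<phi> c - c \<in> P"
    and T: "finite T" "card T > card Z ^ card Z * card Z"
      "\<And>s t. s \<in> T \<Longrightarrow> t \<in> T \<Longrightarrow> of_int s - of_int t \<in> P \<Longrightarrow> s = t"
  shows "\<exists>\<sigma>\<in>H. \<forall>z\<in>Z. \<phi> z - \<sigma> z \<in> P"
proof -
  interpret cong_hom R P L \<phi> by fact
  let ?N = "card Z"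
  obtain a where a: "bij_betw a {..<?N} Z"
    using ex_bij_betw_nat_finite[OF Z(1)] by (auto simp: atLeast0LessThan)
  have aZ: "a i \<in> Z" if "i < ?N" for i using a that by (auto dest: bij_betwE)
  have orbit: "finite (tuple_orbit H ?N a)" "card (tuple_orbit H ?N a) \<le> ?N ^ ?N"
    using card_tuple_orbit_le[of Z H ?N a] Z(1,3) aZ by blast+
  have vZ: "v i \<in> Z" if "v \<in> tuple_orbit H ?N a" "i < ?N" for v i
    using that aZ Z(3) by (auto simp: tuple_orbit_def)
  have coeff_qR: "coeff (orbit_poly H ?N a t) k \<in> qbar \<inter> R" for t k
    unfolding orbit_poly_def
  proof (rule coeff_prod_linear_in[OF orbit(1)])
    show "power_form ?N t v \<in> qbar \<inter> R" if "v \<in> tuple_orbit H ?N a" for v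
    proof
      show "power_form ?N t v \<in> R" by (rule R_power_form) (use vZ[OF that] Z(2) in auto)
      show "power_form ?N t v \<in> qbar" unfolding power_form_def
        by (intro qbar_sum qbar_closed qbar_power) (use vZ[OF that] Z(2) in auto)
    qed
  qed (auto simp: R_zero R_one R_diff R_mult)
  have "\<sigma> (coeff (orbit_poly H ?N a t) k) = coeff (orbit_poly H ?N a t) k" if "\<sigma> \<in> H" for t k \<sigma>
    using coeff_orbit_poly_fixed[OF H(1,3) _ orbit(1) that] aZ Z(2) by blast
  hence coeff_fixed: "coeff (orbit_poly H ?N a t) k \<in> L
      \<and> \<phi> (coeff (orbit_poly H ?N a t) k) - coeff (orbit_poly H ?N a t) k \<in> P" for t k
    by (intro fixed coeff_qR)
  have "\<exists>\<sigma>\<in>H. \<forall>i<?N. \<phi> (a i) - \<sigma> (a i) \<in> P"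
  proof (rule hom_eq_tuple_orbit[OF H(2) orbit(1) _ _ _ _ T(1)])
    show "card (tuple_orbit H ?N a) * ?N < card T"
      using mult_le_mono1[OF orbit(2), of ?N] T(2) by linarith
  qed (use aZ Z coeff_fixed T(3) in blast)+
  then obtain \<sigma> where \<sigma>: "\<sigma> \<in> H" "\<And>i. i < ?N \<Longrightarrow> \<phi> (a i) - \<sigma> (a i) \<in> P" by blast
  have "\<phi> z - \<sigma> z \<in> P" if "z \<in> Z" for z
  proof -
    obtain i where "i < ?N" "z = a i" using \<open>z \<in> Z\<close> bij_betw_imp_surj_on[OF a] by (metis imageE lessThan_iff)
    thus ?thesis using \<sigma>(2) by blast
  qed
  thus ?thesis using \<sigma>(1) by blast
qed

section \<open>Primes of the ring of algebraic integers and Frobenius elements\<close>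

definition alg_ints :: "complex set" ("\<O>") where "\<O> = {x. algebraic_int x}"

lemma alg_ints_add: "x \<in> \<O> \<Longrightarrow> y \<in> \<O> \<Longrightarrow> x + y \<in> \<O>"
  and alg_ints_mult: "x \<in> \<O> \<Longrightarrow> y \<in> \<O> \<Longrightarrow> x * y \<in> \<O>"
  and alg_ints_minus: "x \<in> \<O> \<Longrightarrow> - x \<in> \<O>"
  and alg_ints_of_int: "of_int z \<in> \<O>"
  by (auto simp: alg_ints_def algebraic_int_add algebraic_int_mult int_imp_algebraic_int)

lemma alg_ints_subset_qbar: "\<O> \<subseteq> qbar"
  by (auto simp: alg_ints_def qbar_def)

lemma alg_ints_Rats_imp_Ints: "x \<in> \<O> \<Longrightarrow> x \<in> \<rat> \<Longrightarrow> x \<in> \<int>"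
  by (simp add: alg_ints_def rational_algebraic_int_is_int)

lemma prime_inverse_notin_alg_ints:
  assumes "prime p" "of_nat p * x = 1"
  shows "x \<notin> \<O>"
proof
  assume "x \<in> \<O>"
  have "x = of_rat (1 / of_nat p)" using assms by (auto simp: of_rat_divide field_simps)
  hence "x \<in> \<int>" using \<open>x \<in> \<O>\<close> by (intro alg_ints_Rats_imp_Ints) auto
  then obtain z where "x = of_int z" by (auto elim: Ints_cases)
  hence "of_int (int p * z) = (1::complex)" using assms by simp
  hence "int p dvd 1" by (metis dvd_triv_left of_int_eq_1_iff)
  thus False using assms by (simp add: prime_nat_iff)
qed

locale prime_above = subring_prime \<O> P for P :: "complex set" +
  fixes p :: nat
  assumes prime_p: "prime p" and p_in_P: "of_nat p \<in> P"

definition ideal_of_alg_ints :: "complex set \<Rightarrow> bool" where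
  "ideal_of_alg_ints I \<longleftrightarrow>
    0 \<in> I \<and> I \<subseteq> \<O> \<and> (\<forall>x\<in>I. \<forall>y\<in>I. x + y \<in> I) \<and> (\<forall>x\<in>\<O>. \<forall>y\<in>I. x * y \<in> I)"

lemma ideal_of_alg_ints_Union_chain:
  assumes C: "C \<noteq> {}" "subset.chain A C" and ideal: "\<And>I. I \<in> C \<Longrightarrow> ideal_of_alg_ints I"
  shows "ideal_of_alg_ints (\<Union>C)"
proof -
  have "x + y \<in> \<Union>C" if xy: "x \<in> \<Union>C" "y \<in> \<Union>C" for x y
  proof -
    obtain I where "I \<in> C" "x \<in> I" "y \<in> I" using finite_subset_Union_chain[of "{x, y}" C A] C xy by auto
    thus ?thesis using ideal unfolding ideal_of_alg_ints_def by blast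
  qed
  moreover have "0 \<in> \<Union>C" using C(1) ideal unfolding ideal_of_alg_ints_def by blast
  moreover have "\<Union>C \<subseteq> \<O>" "\<forall>x\<in>\<O>. \<forall>y\<in>\<Union>C. x * y \<in> \<Union>C"
    using ideal unfolding ideal_of_alg_ints_def by blast+
  ultimately show ?thesis unfolding ideal_of_alg_ints_def by blast
qed

lemma ideal_of_alg_ints_insert:
  assumes I: "ideal_of_alg_ints I" and a: "a \<in> \<O>"
  shows "ideal_of_alg_ints {x + r * a | x r. x \<in> I \<and> r \<in> \<O>}" (is "ideal_of_alg_ints ?J")
    and "insert a I \<subseteq> {x + r * a | x r. x \<in> I \<and> r \<in> \<O>}"
proof -
  have cl: "0 \<in> I" "\<And>x. x \<in> I \<Longrightarrow> x \<in> \<O>" "\<And>x y. x \<in> I \<Longrightarrow> y \<in> I \<Longrightarrow> x + y \<in> I"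
    "\<And>x y. x \<in> \<O> \<Longrightarrow> y \<in> I \<Longrightarrow> x * y \<in> I"
    using I unfolding ideal_of_alg_ints_def by blast+
  have zero: "0 \<in> \<O>" and one: "1 \<in> \<O>" using alg_ints_of_int[of 0] alg_ints_of_int[of 1] by simp_all
  have J: "x + r * a \<in> ?J" if "x \<in> I" "r \<in> \<O>" for x r using that by blast
  show "insert a I \<subseteq> ?J" using J[OF cl(1) one] J[OF _ zero] by auto
  show "ideal_of_alg_ints ?J"
    unfolding ideal_of_alg_ints_def
  proof (intro conjI ballI)
    show "0 \<in> ?J" using J[OF cl(1) zero] by simp
    show "?J \<subseteq> \<O>" using cl(2) a by (auto intro: alg_ints_add alg_ints_mult)
    show "s + t \<in> ?J" if st: "s \<in> ?J" "t \<in> ?J" for s t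
    proof -
      obtain x r y q where "s = x + r * a" "x \<in> I" "r \<in> \<O>" "t = y + q * a" "y \<in> I" "q \<in> \<O>"
        using st by blast
      thus ?thesis using J[of "x + y" "r + q"] cl(3) alg_ints_add by (simp add: algebra_simps)
    qed
    show "s * t \<in> ?J" if st: "s \<in> \<O>" "t \<in> ?J" for s t
    proof -
      obtain y q where "t = y + q * a" "y \<in> I" "q \<in> \<O>" using st by blast
      thus ?thesis using J[of "s * y" "s * q"] cl(4) alg_ints_mult st(1) by (simp add: algebra_simps)
    qed
  qed
qed

lemma maximal_ideal_prime:
  assumes M: "ideal_of_alg_ints M" "1 \<notin> M"
    and max: "\<And>I. ideal_of_alg_ints I \<Longrightarrow> 1 \<notin> I \<Longrightarrow> M \<subseteq> I \<Longrightarrow> I = M"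
  shows "subring_prime \<O> M"
proof
  have cl: "0 \<in> M" "M \<subseteq> \<O>" "\<And>x y. x \<in> M \<Longrightarrow> y \<in> M \<Longrightarrow> x + y \<in> M"
    "\<And>x y. x \<in> \<O> \<Longrightarrow> y \<in> M \<Longrightarrow> x * y \<in> M"
    using M(1) unfolding ideal_of_alg_ints_def by blast+
  show "0 \<in> M" "M \<subseteq> \<O>" "1 \<notin> M" using cl M(2) by auto
  show "1 \<in> \<O>" using alg_ints_of_int[of 1] by simp
  fix x y
  show "x + y \<in> \<O>" "x * y \<in> \<O>" if "x \<in> \<O>" "y \<in> \<O>"
    using that alg_ints_add alg_ints_mult by auto
  show "- x \<in> \<O>" if "x \<in> \<O>" using that by (rule alg_ints_minus)
  show "x + y \<in> M" if "x \<in> M" "y \<in> M" using cl(3) that .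
  show "x * y \<in> M" if "x \<in> \<O>" "y \<in> M" using cl(4) that .
  show "x \<in> M \<or> y \<in> M" if xy: "x \<in> \<O>" "y \<in> \<O>" "x * y \<in> M"
  proof (rule ccontr)
    assume n: "\<not> (x \<in> M \<or> y \<in> M)"
    let ?J = "{m + r * x | m r. m \<in> M \<and> r \<in> \<O>}"
    have "?J \<noteq> M" using ideal_of_alg_ints_insert(2)[OF M(1) xy(1)] n by blast
    hence "1 \<in> ?J" using max ideal_of_alg_ints_insert[OF M(1) xy(1)] by blast
    then obtain m r where m: "1 = m + r * x" "m \<in> M" "r \<in> \<O>" by blast
    have "y = y * (m + r * x)" using m(1) by simp
    also have "\<dots> = y * m + r * (x * y)" by (simp add: algebra_simps)
    also have "\<dots> \<in> M" using cl(3,4) m xy by blast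
    finally show False using n by simp
  qed
qed

lemma prime_above_exists:
  assumes p: "prime p"
  obtains P where "prime_above P p"
proof -
  let ?A = "{I. ideal_of_alg_ints I \<and> of_nat p \<in> I \<and> 1 \<notin> I}"
  have "\<exists>M\<in>?A. \<forall>X\<in>?A. M \<subseteq> X \<longrightarrow> X = M"
  proof (rule subset_Zorn_nonempty)
    let ?I = "{x + r * of_nat p | x r. x \<in> {0} \<and> r \<in> \<O>}"
    have "ideal_of_alg_ints {0}"
      using alg_ints_of_int[of 0] by (auto simp: ideal_of_alg_ints_def)
    moreover have "of_nat p \<in> \<O>" using alg_ints_of_int[of "int p"] by simp
    ultimately have "ideal_of_alg_ints ?I" "insert (of_nat p) {0} \<subseteq> ?I"
      by (rule ideal_of_alg_ints_insert)+
    moreover have "1 \<notin> ?I" using prime_inverse_notin_alg_ints[OF p] by (auto simp: mult.commute)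
    ultimately have "?I \<in> ?A" by blast
    thus "?A \<noteq> {}" by (metis empty_iff)
    fix C assume C: "C \<noteq> {}" "subset.chain ?A C"
    hence "ideal_of_alg_ints (\<Union>C)"
      by (intro ideal_of_alg_ints_Union_chain[OF C]) (auto simp: subset.chain_def)
    thus "\<Union>C \<in> ?A" using C unfolding subset.chain_def by blast
  qed
  then obtain M where M: "ideal_of_alg_ints M" "of_nat p \<in> M" "1 \<notin> M"
    and max: "\<And>X. X \<in> ?A \<Longrightarrow> M \<subseteq> X \<Longrightarrow> X = M" by blast
  have "subring_prime \<O> M" by (rule maximal_ideal_prime[OF M(1,3)]) (use M(2) max in blast)
  hence "prime_above M p" using p M(2) by (simp add: prime_above_def prime_above_axioms_def)
  thus ?thesis by (rule that)
qed

context prime_above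
begin

lemma p_gt_1: "p > 1"
  using prime_p by (simp add: prime_nat_iff)

lemma of_int_in_P_iff: "of_int z \<in> P \<longleftrightarrow> int p dvd z"
proof
  assume "int p dvd z"
  thus "of_int z \<in> P" using P_mult_right[OF p_in_P R_of_int] by (auto elim!: dvdE)
next
  assume z: "of_int z \<in> P"
  show "int p dvd z"
  proof (rule ccontr)
    assume "\<not> int p dvd z"
    hence "coprime (int p) z" using prime_p by (simp add: prime_imp_coprime)
    then obtain u v where "u * int p + v * z = 1" by (metis bezout_int coprime_imp_gcd_eq_1)
    hence "(1::complex) = of_int u * of_nat p + of_int v * of_int z"
      by (metis of_int_1 of_int_add of_int_mult of_int_of_nat_eq)
    also have "\<dots> \<in> P" using z p_in_P by (intro P_add P_mult_left R_of_int)
    finally show False using one_notin_P by simp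
  qed
qed

lemma cong_of_int_iff: "of_int a \<equiv>\<^sub>P of_int b \<longleftrightarrow> int p dvd a - b"
  using of_int_in_P_iff[of "a - b"] by simp

lemma cong_of_int_residues:
  assumes "a \<in> {0..<int p}" "b \<in> {0..<int p}" "of_int a \<equiv>\<^sub>P of_int b"
  shows "a = b"
  using assms unfolding cong_of_int_iff
  by (metis atLeastLessThan_iff mod_eq_dvd_iff mod_pos_pos_trivial)

lemma frobenius_add:
  assumes "x \<in> \<O>" "y \<in> \<O>" shows "(x + y) ^ p \<equiv>\<^sub>P x ^ p + y ^ p"
proof -
  have "(x + y) ^ p = (\<Sum>k\<le>p. of_nat (p choose k) * x ^ k * y ^ (p - k))" by (rule binomial_ring)
  also have "{..p} = insert 0 (insert p {1..<p})" using p_gt_1 by auto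
  finally have "(x + y) ^ p - (x ^ p + y ^ p) = (\<Sum>k=1..<p. of_nat (p choose k) * x ^ k * y ^ (p - k))"
    using p_gt_1 by simp
  also have "\<dots> \<in> P"
  proof (rule P_sum)
    fix k assume k: "k \<in> {1..<p}"
    hence "p dvd (p choose k)" using prime_p by (intro dvd_choose_prime) auto
    hence "of_int (int (p choose k)) \<in> P" by (simp only: of_int_in_P_iff int_dvd_int_iff)
    thus "of_nat (p choose k) * x ^ k * y ^ (p - k) \<in> P"
      using assms by (auto intro!: P_mult_right R_power)
  qed
  finally show ?thesis .
qed

lemma fermat: "of_int z ^ p \<equiv>\<^sub>P of_int z"
proof -
  have nat: "of_nat k ^ p \<equiv>\<^sub>P of_nat k" for k
  proof (induction k)
    case 0
    show ?case using p_gt_1 by (simp add: P_zero power_0_left)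
  next
    case (Suc k)
    have "(of_nat k + 1) ^ p \<equiv>\<^sub>P of_nat k ^ p + 1 ^ p" by (intro frobenius_add R_of_nat R_one)
    moreover have "of_nat k ^ p + 1 ^ p \<equiv>\<^sub>P of_nat k + 1" using Suc by simp
    ultimately have "(of_nat k + 1) ^ p \<equiv>\<^sub>P of_nat k + 1" by (rule cong_trans)
    thus ?case by (simp add: add.commute)
  qed
  define k where "k = nat (z mod int p)"
  have "int k = z mod int p" using p_gt_1 by (simp add: k_def)
  hence "int p dvd z - int k" by (metis minus_mod_eq_mult_div dvd_triv_left)
  hence zk: "of_int z \<equiv>\<^sub>P of_nat k" using cong_of_int_iff[of z "int k"] by simp
  have "of_int z ^ p \<equiv>\<^sub>P of_nat k ^ p" by (intro cong_power zk R_of_int R_of_nat)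
  thus ?thesis using nat[of k] cong_trans cong_sym[OF zk] by blast
qed

lemma cong_int_if_frobenius_fixed:
  assumes "x \<in> \<O>" "x ^ p \<equiv>\<^sub>P x"
  shows "\<exists>a\<in>{0..<int p}. x \<equiv>\<^sub>P of_int a"
proof (rule ccontr)
  assume no_int: "\<not> ?thesis"
  let ?I = "(of_int :: int \<Rightarrow> complex) ` {0..<int p}"
  define f where "f = monom (1::complex) p - [:0, 1:]"
  have coeff_f: "coeff f i = (if i = p then 1 else if i = 1 then - 1 else 0)" for i
    using p_gt_1 by (auto simp: f_def coeff_pCons split: nat.splits)
  have xI: "\<not> x \<equiv>\<^sub>P t" if "t \<in> ?I" for t using no_int that by blast
  hence "x \<notin> ?I" using cong_refl by blast
  have "coeff f p \<in> P"
  proof (rule coeff_in_P_if_many_roots[of _ "insert x ?I"])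
    show "coeff f i \<in> \<O>" for i using coeff_f by (auto simp: R_zero R_one R_minus)
    have "degree f \<le> p" by (intro degree_le) (use p_gt_1 in \<open>auto simp: coeff_f\<close>)
    thus "degree f < card (insert x ?I)" using \<open>x \<notin> ?I\<close> by (simp add: card_image inj_on_def)
    show "poly f t \<in> P" if "t \<in> insert x ?I" for t
      using that assms fermat by (auto simp: f_def poly_monom)
    show "s = t" if "s \<in> insert x ?I" "t \<in> insert x ?I" "s \<equiv>\<^sub>P t" for s t
      using that xI cong_of_int_residues cong_sym by blast
  qed (use assms R_of_int in auto)
  thus False using one_notin_P by (simp add: coeff_f)
qed

lemma cong_hom_frobenius: "cong_hom \<O> P \<O> (\<lambda>x. x ^ p)"
  by unfold_locales (auto simp: R_of_int R_add R_mult R_power frobenius_add fermat power_mult_distrib P_zero)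

end

definition galois_stable :: "complex set \<Rightarrow> bool" where
  "galois_stable Z \<longleftrightarrow> finite Z \<and> Z \<subseteq> qbar \<and> (\<forall>\<sigma>\<in>autq. \<forall>z\<in>Z. \<sigma> z \<in> Z)"

lemma galois_stableD: "galois_stable Z \<Longrightarrow> \<sigma> \<in> autq \<Longrightarrow> z \<in> Z \<Longrightarrow> \<sigma> z \<in> Z"
  by (auto simp: galois_stable_def)

lemma (in prime_above) frobenius_element_exists:
  assumes Z: "galois_stable Z" "Z \<subseteq> \<O>" and big: "p > card Z ^ card Z * card Z"
  obtains \<sigma> where "\<sigma> \<in> autq" "\<And>z. z \<in> Z \<Longrightarrow> \<sigma> z \<equiv>\<^sub>P z ^ p"
proof -
  have "\<exists>\<sigma>\<in>autq. \<forall>z\<in>Z. z ^ p - \<sigma> z \<in> P"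
  proof (rule cong_hom_eq_conjugation[OF cong_hom_frobenius, where T = "{0..<int p}"])
    show "c \<in> \<O> \<and> c ^ p \<equiv>\<^sub>P c" if c: "c \<in> qbar \<inter> \<O>" "\<And>\<sigma>. \<sigma> \<in> autq \<Longrightarrow> \<sigma> c = c" for c
    proof
      have "c \<in> \<int>" using c fixed_by_autq_imp_rat alg_ints_Rats_imp_Ints by blast
      thus "c ^ p \<equiv>\<^sub>P c" using fermat by (auto elim: Ints_cases)
    qed (use c in simp)
    show "card Z ^ card Z * card Z < card {0..<int p}" using big by simp
    show "Z \<subseteq> \<O> \<inter> qbar \<inter> \<O>" using Z(2) alg_ints_subset_qbar by blast
    show "finite Z" "\<And>\<sigma> z. \<sigma> \<in> autq \<Longrightarrow> z \<in> Z \<Longrightarrow> \<sigma> z \<in> Z"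
      using Z(1) by (auto simp: galois_stable_def)
  qed (auto simp: autq_id autq_comp intro: cong_of_int_residues)
  thus ?thesis using that cong_sym by blast
qed

section \<open>Galois action on finite sets of algebraic numbers\<close>

definition fixer :: "complex set \<Rightarrow> (complex \<Rightarrow> complex) set" where
  "fixer Z = {\<sigma>\<in>autq. \<forall>z\<in>Z. \<sigma> z = z}"

lemma fixerD: "\<sigma> \<in> fixer Z \<Longrightarrow> \<sigma> \<in> autq" "\<sigma> \<in> fixer Z \<Longrightarrow> z \<in> Z \<Longrightarrow> \<sigma> z = z"
  by (auto simp: fixer_def)

lemma fixer_subset_imp_agree:
  assumes "fixer Z \<subseteq> fixer W" "\<sigma> \<in> autq" "\<tau> \<in> autq" "\<And>z. z \<in> Z \<Longrightarrow> \<sigma> z = \<tau> z" "w \<in> W"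
  shows "\<sigma> w = \<tau> w"
proof -
  have "inv' \<sigma> \<circ> \<tau> \<in> fixer Z"
    using assms autq_comp autq_inv
    by (auto simp: fixer_def autq_inv_apply[OF assms(2)] simp flip: assms(4))
  hence "inv' \<sigma> (\<tau> w) = w" using assms by (auto simp: fixer_def)
  thus ?thesis by (metis assms(2) autq_inv_apply(1))
qed

lemma fixer_comp: "\<sigma> \<in> fixer Z \<Longrightarrow> \<tau> \<in> fixer Z \<Longrightarrow> \<sigma> \<circ> \<tau> \<in> fixer Z"
  using autq_comp by (auto simp: fixer_def)

lemma fixer_inv: "\<sigma> \<in> fixer Z \<Longrightarrow> inv' \<sigma> \<in> fixer Z"
  using autq_inv autq_inv_apply by (auto simp: fixer_def) metis

lemma fixer_conj:
  assumes "galois_stable Z" "\<sigma> \<in> fixer Z" "\<tau> \<in> autq"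
  shows "\<tau> \<circ> \<sigma> \<circ> inv' \<tau> \<in> fixer Z"
proof -
  have "inv' \<tau> z \<in> Z" if "z \<in> Z" for z using assms that autq_inv galois_stableD by blast
  thus ?thesis using assms autq_comp autq_inv by (auto simp: fixer_def autq_inv_apply)
qed

lemma commutator_in_fixer:
  assumes Z: "galois_stable Z" and "\<sigma> \<in> autq" "\<tau> \<in> autq" and "\<sigma> \<in> fixer Z \<or> \<tau> \<in> fixer Z"
  shows "\<sigma> \<circ> \<tau> \<circ> inv' \<sigma> \<circ> inv' \<tau> \<in> fixer Z"
  using assms(4)
proof
  assume \<sigma>: "\<sigma> \<in> fixer Z"
  have "\<sigma> \<circ> (\<tau> \<circ> inv' \<sigma> \<circ> inv' \<tau>) \<in> fixer Z"
    using \<sigma> assms(3) by (intro fixer_comp fixer_conj[OF Z] fixer_inv)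
  thus ?thesis by (simp add: o_assoc)
next
  assume "\<tau> \<in> fixer Z"
  thus ?thesis using assms(2) by (intro fixer_comp fixer_conj[OF Z] fixer_inv)
qed

definition acts_as :: "nat \<Rightarrow> (nat \<Rightarrow> complex) \<Rightarrow> (complex \<Rightarrow> complex) \<Rightarrow> (nat \<Rightarrow> nat) \<Rightarrow> bool" where
  "acts_as n e \<sigma> g \<longleftrightarrow> \<sigma> \<in> autq \<and> g permutes {1..n} \<and> (\<forall>k\<in>{1..n}. \<sigma> (e k) = e (g k))"

definition full_galois_enum :: "nat \<Rightarrow> (nat \<Rightarrow> complex) \<Rightarrow> bool" where
  "full_galois_enum n e \<longleftrightarrow> inj_on e {1..n} \<and> galois_stable (e ` {1..n})
    \<and> (\<forall>g. g permutes {1..n} \<longrightarrow> (\<exists>\<sigma>. acts_as n e \<sigma> g))"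

lemma acts_as_id: "acts_as n e id id"
  by (simp add: acts_as_def autq_id permutes_id)

lemma acts_as_comp: "acts_as n e \<sigma> g \<Longrightarrow> acts_as n e \<tau> h \<Longrightarrow> acts_as n e (\<sigma> \<circ> \<tau>) (g \<circ> h)"
  using permutes_in_image[of h "{1..n}"] by (auto simp: acts_as_def autq_comp permutes_compose)

lemma acts_as_inv:
  assumes "acts_as n e \<sigma> g" shows "acts_as n e (inv' \<sigma>) (inv' g)"
proof -
  have g: "g permutes {1..n}" and \<sigma>: "\<sigma> \<in> autq" using assms by (auto simp: acts_as_def)
  have "inv' \<sigma> (e k) = e (inv' g k)" if "k \<in> {1..n}" for k
  proof -
    have "inv' g k \<in> {1..n}" using that permutes_in_image[OF permutes_inv[OF g]] by simp
    hence "\<sigma> (e (inv' g k)) = e k" using assms permutes_inverses[OF g] by (auto simp: acts_as_def)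
    thus ?thesis by (metis autq_inv_apply(2)[OF \<sigma>])
  qed
  thus ?thesis using autq_inv[OF \<sigma>] permutes_inv[OF g] by (simp add: acts_as_def)
qed

lemma acts_as_unique:
  assumes "inj_on e {1..n}" "acts_as n e \<sigma> g" "acts_as n e \<sigma> h"
  shows "g = h"
proof
  fix k
  have perm: "g permutes {1..n}" "h permutes {1..n}" using assms by (auto simp: acts_as_def)
  show "g k = h k"
  proof (cases "k \<in> {1..n}")
    case True
    hence "e (g k) = e (h k)" using assms by (auto simp: acts_as_def)
    moreover have "g k \<in> {1..n}" "h k \<in> {1..n}" using True perm by (simp_all only: permutes_in_image)
    ultimately show ?thesis using assms(1) by (auto dest: inj_onD)
  next
    case False
    thus ?thesis using permutes_not_in[OF perm(1)] permutes_not_in[OF perm(2)] by simp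
  qed
qed

lemma acts_as_exists:
  assumes "inj_on e {1..n}" "galois_stable (e ` {1..n})" "\<sigma> \<in> autq"
  obtains g where "acts_as n e \<sigma> g"
proof -
  define g where "g k = (if k \<in> {1..n} then inv_into {1..n} e (\<sigma> (e k)) else k)" for k
  have im: "\<sigma> (e k) \<in> e ` {1..n}" if "k \<in> {1..n}" for k using assms that galois_stableD by blast
  have eg: "e (g k) = \<sigma> (e k)" "g k \<in> {1..n}" if "k \<in> {1..n}" for k
    using im[OF that] that by (auto simp: g_def f_inv_into_f inv_into_into simp del: atLeastAtMost_iff)
  have "g permutes {1..n}"
  proof (rule inj_imp_permutes)
    show "inj_on g {1..n}"
    proof (rule inj_onI)
      fix k l assume kl: "k \<in> {1..n}" "l \<in> {1..n}" "g k = g l"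
      hence "\<sigma> (e k) = \<sigma> (e l)" using eg by metis
      thus "k = l" using kl assms autq_inj[OF assms(3)] by (auto dest: inj_onD)
    qed
  qed (use eg in \<open>auto simp: g_def\<close>)
  thus ?thesis using that[of g] eg assms(3) unfolding acts_as_def by simp
qed

lemma acts_as_id_iff: "acts_as n e \<sigma> id \<longleftrightarrow> \<sigma> \<in> fixer (e ` {1..n})"
  by (auto simp: acts_as_def fixer_def permutes_id)

lemma acts_as_imp_agree:
  assumes "acts_as n e \<sigma> g" "acts_as n e \<tau> g" "fixer (e ` {1..n}) \<subseteq> fixer W" "w \<in> W"
  shows "\<sigma> w = \<tau> w"
  by (rule fixer_subset_imp_agree[OF assms(3)]) (use assms in \<open>auto simp: acts_as_def\<close>)

context
  fixes n e assumes full: "full_galois_enum n e"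
begin

lemma full_galois_enumD: "inj_on e {1..n}" "galois_stable (e ` {1..n})"
  "g permutes {1..n} \<Longrightarrow> \<exists>\<sigma>. acts_as n e \<sigma> g"
  using full by (auto simp: full_galois_enum_def)

lemma full_galois_enum_acts_as: "\<sigma> \<in> autq \<Longrightarrow> \<exists>g. acts_as n e \<sigma> g"
  using acts_as_exists[OF full_galois_enumD(1,2)] by blast

end

lemma acts_as_factors:
  assumes f: "full_galois_enum n f" and sub: "fixer (e ` {1..n}) \<subseteq> fixer (f ` {1..n})"
  shows "\<exists>\<phi>. \<forall>\<sigma> g h. acts_as n e \<sigma> g \<longrightarrow> acts_as n f \<sigma> h \<longrightarrow> \<phi> g = h"
proof (intro exI allI impI)
  fix \<sigma> g h assume \<sigma>: "acts_as n e \<sigma> g" "acts_as n f \<sigma> h"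
  show "(THE h. \<exists>\<sigma>. acts_as n e \<sigma> g \<and> acts_as n f \<sigma> h) = h"
  proof (rule the_equality)
    fix h' assume "\<exists>\<tau>. acts_as n e \<tau> g \<and> acts_as n f \<tau> h'"
    then obtain \<tau> where \<tau>: "acts_as n e \<tau> g" "acts_as n f \<tau> h'" by blast
    have "\<tau> w = \<sigma> w" if "w \<in> f ` {1..n}" for w by (rule acts_as_imp_agree[OF \<tau>(1) \<sigma>(1) sub that])
    hence "acts_as n f \<tau> h" using \<sigma>(2) \<tau>(2) by (auto simp: acts_as_def)
    thus "h' = h" using acts_as_unique[OF full_galois_enumD(1)[OF f] \<tau>(2)] by blast
  qed (use \<sigma> in blast)
qed

lemma fixer_subset_imp_eq:
  assumes e: "full_galois_enum n e" and f: "full_galois_enum n f"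
    and sub: "fixer (e ` {1..n}) \<subseteq> fixer (f ` {1..n})"
  shows "fixer (e ` {1..n}) = fixer (f ` {1..n})"
proof
  let ?P = "{g. g permutes {1..n}}"
  obtain \<phi> where \<phi>: "\<And>\<sigma> g h. acts_as n e \<sigma> g \<Longrightarrow> acts_as n f \<sigma> h \<Longrightarrow> \<phi> g = h"
    using acts_as_factors[OF f sub] by blast
  have surj: "\<phi> ` ?P = ?P"
  proof
    show "\<phi> ` ?P \<subseteq> ?P"
    proof clarify
      fix g assume "g permutes {1..n}"
      then obtain \<sigma> where \<sigma>: "acts_as n e \<sigma> g" using full_galois_enumD(3)[OF e] by blast
      then obtain h where "acts_as n f \<sigma> h"
        using full_galois_enum_acts_as[OF f, of \<sigma>] by (auto simp: acts_as_def)
      thus "\<phi> g permutes {1..n}" using \<phi>[OF \<sigma>] by (auto simp: acts_as_def)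
    qed
    show "?P \<subseteq> \<phi> ` ?P"
    proof
      fix h assume "h \<in> ?P"
      then obtain \<sigma> where \<sigma>: "acts_as n f \<sigma> h" using full_galois_enumD(3)[OF f] by blast
      then obtain g where g: "acts_as n e \<sigma> g"
        using full_galois_enum_acts_as[OF e, of \<sigma>] by (auto simp: acts_as_def)
      hence "g \<in> ?P" by (simp add: acts_as_def)
      thus "h \<in> \<phi> ` ?P" using \<phi>[OF g \<sigma>] by blast
    qed
  qed
  have inj: "inj_on \<phi> ?P" using surj by (intro eq_card_imp_inj_on) (auto simp: finite_permutations)
  show "fixer (f ` {1..n}) \<subseteq> fixer (e ` {1..n})"
  proof
    fix \<sigma> assume \<sigma>: "\<sigma> \<in> fixer (f ` {1..n})"
    obtain g where g: "acts_as n e \<sigma> g" using full_galois_enum_acts_as[OF e fixerD(1)[OF \<sigma>]] by blast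
    have "\<phi> g = \<phi> id" using \<phi>[OF g] \<phi>[OF acts_as_id acts_as_id] \<sigma> acts_as_id_iff by metis
    hence "g = id" using inj g by (auto simp: inj_on_def acts_as_def permutes_id)
    thus "\<sigma> \<in> fixer (e ` {1..n})" using g acts_as_id_iff by blast
  qed
qed (rule sub)

lemma normal_perm_group_of_fixer:
  assumes e: "full_galois_enum n e" and W: "galois_stable W"
  shows "normal_perm_group {1..n} {g. \<exists>\<sigma>\<in>fixer W. acts_as n e \<sigma> g}"
proof unfold_locales
  show "id \<in> {g. \<exists>\<sigma>\<in>fixer W. acts_as n e \<sigma> g}"
    using acts_as_id[of n e] autq_id by (auto simp: fixer_def)
  fix g assume "g \<in> {g. \<exists>\<sigma>\<in>fixer W. acts_as n e \<sigma> g}"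
  then obtain \<sigma> where \<sigma>: "\<sigma> \<in> fixer W" "acts_as n e \<sigma> g" by blast
  thus "g permutes {1..n}" by (simp add: acts_as_def)
  show "inv' g \<in> {g. \<exists>\<sigma>\<in>fixer W. acts_as n e \<sigma> g}" using \<sigma> fixer_inv acts_as_inv by blast
  show "g \<circ> h \<in> {g. \<exists>\<sigma>\<in>fixer W. acts_as n e \<sigma> g}"
    if "h \<in> {g. \<exists>\<sigma>\<in>fixer W. acts_as n e \<sigma> g}" for h
    using that \<sigma> fixer_comp acts_as_comp by blast
  fix h assume "h permutes {1..n}"
  then obtain \<tau> where \<tau>: "acts_as n e \<tau> h" using full_galois_enumD(3)[OF e] by blast
  have "acts_as n e (\<tau> \<circ> \<sigma> \<circ> inv' \<tau>) (h \<circ> g \<circ> inv' h)" using \<sigma> \<tau> by (intro acts_as_comp acts_as_inv)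
  moreover have "\<tau> \<circ> \<sigma> \<circ> inv' \<tau> \<in> fixer W" using fixer_conj[OF W \<sigma>(1)] \<tau> by (simp add: acts_as_def)
  ultimately show "h \<circ> g \<circ> inv' h \<in> {g. \<exists>\<sigma>\<in>fixer W. acts_as n e \<sigma> g}" by blast
qed

lemma three_cycle_realised_in_fixer:
  assumes "n \<ge> 5" and e: "full_galois_enum n e"
    and W: "galois_stable W" "\<not> fixer W \<subseteq> fixer (e ` {1..n})"
    and "{a, b, c} \<subseteq> {1..n}" "distinct [a, b, c]"
  obtains \<sigma> where "\<sigma> \<in> fixer W" "acts_as n e \<sigma> (transp a b \<circ> transp b c)"
proof -
  interpret normal_perm_group "{1..n}" "{g. \<exists>\<sigma>\<in>fixer W. acts_as n e \<sigma> g}"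
    by (rule normal_perm_group_of_fixer[OF e W(1)])
  obtain \<sigma> where \<sigma>: "\<sigma> \<in> fixer W" "\<sigma> \<notin> fixer (e ` {1..n})" using W(2) by blast
  then obtain g where g: "acts_as n e \<sigma> g" using full_galois_enum_acts_as[OF e] fixerD(1) by blast
  have "g \<noteq> id" using g \<sigma>(2) acts_as_id_iff by blast
  hence "transp a b \<circ> transp b c \<in> {g. \<exists>\<sigma>\<in>fixer W. acts_as n e \<sigma> g}"
    using \<sigma>(1) g by (intro contains_three_cycles[of g]) (use assms in auto)
  thus ?thesis using that by blast
qed

text \<open>A three-cycle is a commutator of two three-cycles, one of which can be taken in the fixer of one
  further set while the other one lies in the fixers of all the previous sets.\<close>

lemma three_cycle_realised:
  assumes n: "n \<ge> 5" and e: "full_galois_enum n e" and "finite \<W>"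
    and \<W>: "\<And>W. W \<in> \<W> \<Longrightarrow> galois_stable W \<and> \<not> fixer W \<subseteq> fixer (e ` {1..n})"
    and abc: "{a, b, c} \<subseteq> {1..n}" "distinct [a, b, c]"
  shows "\<exists>\<sigma>. acts_as n e \<sigma> (transp a b \<circ> transp b c) \<and> (\<forall>W\<in>\<W>. \<sigma> \<in> fixer W)"
  using assms(3) \<W> abc
proof (induction \<W> arbitrary: a b c rule: finite_induct)
  case empty
  hence "transp a b \<circ> transp b c permutes {1..n}" by (intro permutes_compose permutes_swap_id) auto
  thus ?case using full_galois_enumD(3)[OF e] by blast
next
  case (insert W \<W>)
  have "\<not> card ({1..n} - {a, b, c}) \<le> Suc 0"
    using n card_Diff_subset[of "{a, b, c}" "{1..n}"] insert.prems by (simp add: card_insert_if)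
  then obtain d d' where d: "d \<in> {1..n} - {a, b, c}" "d' \<in> {1..n} - {a, b, c}" "d \<noteq> d'"
    using card_le_Suc0_iff_eq[of "{1..n} - {a, b, c}"] by blast
  have abd: "{a, b, d} \<subseteq> {1..n}" "distinct [a, b, d]" and acd: "{a, c, d'} \<subseteq> {1..n}" "distinct [a, c, d']"
    using insert.prems(2,3) d by auto
  have "\<exists>\<sigma>. acts_as n e \<sigma> (transp a b \<circ> transp b d) \<and> (\<forall>W\<in>\<W>. \<sigma> \<in> fixer W)"
    by (rule insert.IH[OF insert.prems(1) abd]) blast
  then obtain \<sigma> where \<sigma>: "acts_as n e \<sigma> (transp a b \<circ> transp b d)" "\<And>W. W \<in> \<W> \<Longrightarrow> \<sigma> \<in> fixer W" by blast
  obtain \<tau> where \<tau>: "\<tau> \<in> fixer W" "acts_as n e \<tau> (transp a c \<circ> transp c d')"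
    using three_cycle_realised_in_fixer[OF n e _ _ acd] insert.prems(1) by blast
  let ?\<rho> = "\<sigma> \<circ> \<tau> \<circ> inv' \<sigma> \<circ> inv' \<tau>"
  have "acts_as n e ?\<rho> ((transp a b \<circ> transp b d) \<circ> (transp a c \<circ> transp c d')
      \<circ> inv' (transp a b \<circ> transp b d) \<circ> inv' (transp a c \<circ> transp c d'))"
    using \<sigma>(1) \<tau>(2) by (intro acts_as_comp acts_as_inv)
  also have "inv' (transp a b \<circ> transp b d) = transp b d \<circ> transp a b" by (simp add: o_inv_distrib)
  also have "inv' (transp a c \<circ> transp c d') = transp c d' \<circ> transp a c" by (simp add: o_inv_distrib)
  also have "(transp a b \<circ> transp b d) \<circ> (transp a c \<circ> transp c d') \<circ> (transp b d \<circ> transp a b)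
      \<circ> (transp c d' \<circ> transp a c) = transp a b \<circ> transp b c"
    by (rule commutator_of_three_cycles) (use d insert.prems in auto)
  finally have "acts_as n e ?\<rho> (transp a b \<circ> transp b c)" .
  moreover have "?\<rho> \<in> fixer V" if "V \<in> insert W \<W>" for V
  proof (rule commutator_in_fixer)
    show "galois_stable V" using insert.prems(1)[OF that] by blast
    show "\<sigma> \<in> autq" "\<tau> \<in> autq" using \<sigma>(1) \<tau>(2) by (auto simp: acts_as_def)
    show "\<sigma> \<in> fixer V \<or> \<tau> \<in> fixer V" using that \<sigma>(2) \<tau>(1) by blast
  qed
  ultimately show ?case by blast
qed

lemma even_permutation_realised:
  assumes n: "n \<ge> 5" and e: "full_galois_enum n e" and "finite \<W>"
    and \<W>: "\<And>W. W \<in> \<W> \<Longrightarrow> galois_stable W \<and> \<not> fixer W \<subseteq> fixer (e ` {1..n})"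
    and g: "g \<in> carrier (alt_group n)"
  shows "\<exists>\<sigma>. acts_as n e \<sigma> g \<and> (\<forall>W\<in>\<W>. \<sigma> \<in> fixer W)"
proof -
  have three_cycle: "\<exists>\<sigma>. acts_as n e \<sigma> g \<and> (\<forall>W\<in>\<W>. \<sigma> \<in> fixer W)" if "g \<in> three_cycles n" for g
  proof -
    obtain cs where cs: "g = cycle_of_list cs" "distinct cs" "length cs = 3" "set cs \<subseteq> {1..n}"
      using \<open>g \<in> three_cycles n\<close> by blast
    then obtain a b c where abc: "cs = [a, b, c]" using stupid_lemma by blast
    have "g = transp a b \<circ> transp b c" using cs abc by simp
    thus ?thesis using three_cycle_realised[OF n e \<open>finite \<W>\<close> \<W>, of a b c] cs abc by auto
  qed
  have "g \<in> generate (alt_group n) (three_cycles n)" using g alt_group_carrier_as_three_cycles by blast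
  thus ?thesis
  proof (induction rule: generate.induct)
    case one
    have "id \<in> fixer Z" for Z by (simp add: fixer_def autq_id)
    thus ?case unfolding alt_group_one using acts_as_id by blast
  next
    case (incl h)
    thus ?case by (rule three_cycle)
  next
    case (inv h)
    have "h \<in> carrier (alt_group n)" using inv three_cycles_incl by blast
    hence "inv\<^bsub>alt_group n\<^esub> h = inv' h" by (rule alt_group_inv_equality)
    moreover obtain \<sigma> where "acts_as n e \<sigma> h" "\<forall>W\<in>\<W>. \<sigma> \<in> fixer W" using three_cycle[OF inv] by blast
    hence "acts_as n e (inv' \<sigma>) (inv' h)" "\<forall>W\<in>\<W>. inv' \<sigma> \<in> fixer W" using acts_as_inv fixer_inv by blast+
    ultimately show ?case by auto
  next
    case (eng h1 h2)
    then obtain \<sigma> \<tau> where "acts_as n e \<sigma> h1" "\<forall>W\<in>\<W>. \<sigma> \<in> fixer W"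
      "acts_as n e \<tau> h2" "\<forall>W\<in>\<W>. \<tau> \<in> fixer W" by blast
    thus ?case unfolding alt_group_mult using acts_as_comp fixer_comp by blast
  qed
qed

section \<open>Prescribing Galois groups\<close>

lemma subfield_CD:
  assumes "subfield_C K"
  shows "0 \<in> K" "1 \<in> K" "x \<in> K \<Longrightarrow> y \<in> K \<Longrightarrow> x + y \<in> K" "x \<in> K \<Longrightarrow> y \<in> K \<Longrightarrow> x - y \<in> K"
    "x \<in> K \<Longrightarrow> y \<in> K \<Longrightarrow> x * y \<in> K" "x \<in> K \<Longrightarrow> inverse x \<in> K"
  using assms by (cases "x = 0"; auto simp: subfield_C_def)+

lemma subfield_C_Rats:
  assumes K: "subfield_C K"
  shows "of_rat q \<in> K"
proof -
  have nat: "of_nat k \<in> K" for k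
    by (induction k) (use subfield_CD[OF K] in auto)
  have int: "of_int t \<in> K" for t
    by (cases t rule: int_diff_cases) (use nat subfield_CD(4)[OF K] in auto)
  obtain a b where "q = of_int a / of_int b" by (metis quotient_of_div surj_pair)
  hence "of_rat q = (of_int a / of_int b :: complex)" by (simp add: of_rat_divide)
  thus ?thesis using int subfield_CD(5,6)[OF K] by (metis divide_inverse)
qed

lemma subfield_C_qbar: "subfield_C qbar"
  unfolding subfield_C_def by auto

lemma subfield_C_adjoin: "subfield_C (field_adjoin F S)"
  unfolding field_adjoin_def subfield_C_def by auto

lemma adjoin_superset: "F \<subseteq> field_adjoin F S" "S \<subseteq> field_adjoin F S"
  unfolding field_adjoin_def by auto

lemma adjoin_least: "subfield_C K \<Longrightarrow> F \<subseteq> K \<Longrightarrow> S \<subseteq> K \<Longrightarrow> field_adjoin F S \<subseteq> K"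
  unfolding field_adjoin_def by auto

context
  fixes F W :: "complex set"
  assumes F: "subfield_C F" "F \<subseteq> qbar" and W: "galois_stable W"
begin

lemma adjoin_subset_qbar: "field_adjoin F W \<subseteq> qbar"
  by (rule adjoin_least[OF subfield_C_qbar F(2)]) (use W in \<open>simp add: galois_stable_def\<close>)

lemma autq_agree_on_adjoin:
  assumes "\<sigma> \<in> autq" "\<tau> \<in> autq" "\<And>x. x \<in> F \<union> W \<Longrightarrow> \<sigma> x = \<tau> x" "x \<in> field_adjoin F W"
  shows "\<sigma> x = \<tau> x"
proof -
  have "field_adjoin F W \<subseteq> {x\<in>qbar. \<sigma> x = \<tau> x}"
  proof (rule adjoin_least)
    show "subfield_C {x\<in>qbar. \<sigma> x = \<tau> x}"
      unfolding subfield_C_def using assms(1,2)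
      by (auto simp: autq_0 autq_1 autq_add autq_diff autq_mult autq_inverse)
  qed (use assms(3) F W in \<open>auto simp: galois_stable_def\<close>)
  thus ?thesis using assms(4) by blast
qed

lemma autq_maps_adjoin:
  assumes \<sigma>: "\<sigma> \<in> fixer F" and x: "x \<in> field_adjoin F W"
  shows "\<sigma> x \<in> field_adjoin F W"
proof -
  note L = subfield_CD[OF subfield_C_adjoin[of F W]]
  have \<sigma>a: "\<sigma> \<in> autq" using fixerD(1)[OF \<sigma>] .
  have "field_adjoin F W \<subseteq> {x\<in>qbar. \<sigma> x \<in> field_adjoin F W}"
  proof (rule adjoin_least)
    show "subfield_C {x\<in>qbar. \<sigma> x \<in> field_adjoin F W}"
      unfolding subfield_C_def using \<sigma>a L
      by (auto simp: autq_0 autq_1 autq_add autq_diff autq_mult autq_inverse)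
    show "F \<subseteq> {x\<in>qbar. \<sigma> x \<in> field_adjoin F W}"
      using F fixerD(2)[OF \<sigma>] adjoin_superset(1)[of F W] by auto
    show "W \<subseteq> {x\<in>qbar. \<sigma> x \<in> field_adjoin F W}"
      using W galois_stableD[OF W \<sigma>a] adjoin_superset(2)[of W F] by (auto simp: galois_stable_def)
  qed
  thus ?thesis using x by blast
qed

lemma restrict_fixer_in_gal_auts:
  assumes \<sigma>: "\<sigma> \<in> fixer F"
  shows "restrict \<sigma> (field_adjoin F W) \<in> gal_auts (field_adjoin F W) F" (is "_ \<in> gal_auts ?L F")
  unfolding gal_auts_def
proof (intro CollectI conjI ballI)
  have \<sigma>a: "\<sigma> \<in> autq" using fixerD(1)[OF \<sigma>] .
  note L = subfield_CD[OF subfield_C_adjoin[of F W]]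
  have "bij_betw \<sigma> ?L ?L"
    by (rule bij_betw_byWitness[where f' = "inv' \<sigma>"])
      (use autq_maps_adjoin[OF \<sigma>] autq_maps_adjoin[OF fixer_inv[OF \<sigma>]] autq_inv_apply[OF \<sigma>a] in auto)
  thus "bij_betw (restrict \<sigma> ?L) ?L ?L" by (simp cong: bij_betw_cong)
  show "restrict \<sigma> ?L (x + y) = restrict \<sigma> ?L x + restrict \<sigma> ?L y"
    "restrict \<sigma> ?L (x * y) = restrict \<sigma> ?L x * restrict \<sigma> ?L y" if "x \<in> ?L" "y \<in> ?L" for x y
    using that L(3,5)[of x y] subsetD[OF adjoin_subset_qbar] autq_add[OF \<sigma>a] autq_mult[OF \<sigma>a] by simp_all
  show "restrict \<sigma> ?L x = x" if "x \<in> F" for x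
    using that fixerD(2)[OF \<sigma>] adjoin_superset[of F W] by auto
qed simp

lemma gal_auts_extends:
  assumes \<tau>: "\<tau> \<in> gal_auts (field_adjoin F W) F" (is "_ \<in> gal_auts ?L F")
  obtains \<sigma> where "\<sigma> \<in> fixer F" "\<tau> = restrict \<sigma> ?L"
proof -
  note L = subfield_CD[OF subfield_C_adjoin[of F W]]
  have \<tau>F: "\<tau> x = x" if "x \<in> F" for x using \<tau> that by (simp add: gal_auts_def)
  have FL: "x \<in> ?L" if "x \<in> F" for x using that adjoin_superset by blast
  have "hom_graph {(x, \<tau> x) | x. x \<in> ?L}"
  proof
    show "x \<in> qbar \<and> y \<in> qbar" if "(x, y) \<in> {(x, \<tau> x) | x. x \<in> ?L}" for x y
      using that \<tau> adjoin_subset_qbar by (auto simp: gal_auts_def dest: bij_betwE)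
    show "(of_rat q, of_rat q) \<in> {(x, \<tau> x) | x. x \<in> ?L}" for q
      using subfield_C_Rats[OF F(1)] FL \<tau>F by force
    show "(x + x', y + y') \<in> {(x, \<tau> x) | x. x \<in> ?L}" "(x * x', y * y') \<in> {(x, \<tau> x) | x. x \<in> ?L}"
      if "(x, y) \<in> {(x, \<tau> x) | x. x \<in> ?L}" "(x', y') \<in> {(x, \<tau> x) | x. x \<in> ?L}" for x y x' y'
      using that \<tau> L by (auto simp: gal_auts_def)
    show "y = 0" if "(0, y) \<in> {(x, \<tau> x) | x. x \<in> ?L}" for y
      using that \<tau>F subfield_CD(1)[OF F(1)] by auto
  qed
  then obtain \<sigma> where \<sigma>: "\<sigma> \<in> autq" "\<And>x. x \<in> ?L \<Longrightarrow> \<sigma> x = \<tau> x"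
    using hom_graph_extends_to_aut[of "{(x, \<tau> x) | x. x \<in> ?L}"] by auto
  show ?thesis
  proof (rule that)
    show "\<sigma> \<in> fixer F" using \<sigma> FL \<tau>F by (simp add: fixer_def)
    show "\<tau> = restrict \<sigma> ?L"
      by (rule extensionalityI[of _ ?L]) (use \<tau> \<sigma>(2) in \<open>auto simp: gal_auts_def\<close>)
  qed
qed

lemma gal_mult_restrict:
  assumes "\<tau> \<in> fixer F"
  shows "restrict \<sigma> (field_adjoin F W) \<otimes>\<^bsub>gal (field_adjoin F W) F\<^esub> restrict \<tau> (field_adjoin F W)
    = restrict (\<sigma> \<circ> \<tau>) (field_adjoin F W)"
  using autq_maps_adjoin[OF assms] by (intro ext) (auto simp: gal_def)

context
  fixes n e
  assumes e: "full_galois_enum n e" and WE: "fixer W = fixer (e ` {1..n})"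
begin

lemma acts_as_imp_agree_on_adjoin:
  assumes \<sigma>\<tau>: "\<sigma> \<in> fixer F" "\<tau> \<in> fixer F" "acts_as n e \<sigma> g" "acts_as n e \<tau> g"
    and "x \<in> field_adjoin F W"
  shows "\<sigma> x = \<tau> x"
  using assms(5)
proof (rule autq_agree_on_adjoin[rotated 3])
  show "\<sigma> \<in> autq" "\<tau> \<in> autq" using \<sigma>\<tau> fixerD(1) by blast+
  show "\<sigma> y = \<tau> y" if "y \<in> F \<union> W" for y
    using that
  proof
    assume "y \<in> F"
    thus ?thesis using fixerD(2) \<sigma>\<tau>(1,2) by metis
  next
    assume "y \<in> W"
    thus ?thesis using acts_as_imp_agree[OF \<sigma>\<tau>(3,4)] WE by blast
  qed
qed

lemma agree_on_adjoin_imp_acts_as_eq: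
  assumes \<sigma>\<tau>: "acts_as n e \<sigma> g" "acts_as n e \<tau> h"
    and agree: "\<And>x. x \<in> field_adjoin F W \<Longrightarrow> \<sigma> x = \<tau> x"
  shows "g = h"
proof (rule acts_as_unique[OF full_galois_enumD(1)[OF e] _ \<sigma>\<tau>(2)])
  have "\<sigma> \<in> autq" "\<tau> \<in> autq" using \<sigma>\<tau> by (auto simp: acts_as_def)
  moreover have "\<sigma> w = \<tau> w" if "w \<in> W" for w using agree that adjoin_superset(2)[of W F] by blast
  ultimately have "\<sigma> z = \<tau> z" if "z \<in> e ` {1..n}" for z
    using fixer_subset_imp_agree[of W "e ` {1..n}" \<sigma> \<tau> z] WE that by blast
  thus "acts_as n e \<tau> g" using \<sigma>\<tau> unfolding acts_as_def by (metis imageI)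
qed

text \<open>The Galois group of \<open>F(W)\<close> over \<open>F\<close> acts faithfully on the numbers \<open>e k\<close>, which generate
  the same field as \<open>W\<close>.\<close>

lemma gal_iso_permutations:
  assumes G: "subgroup G (alt_group n)"
    and realised: "\<And>g. g \<in> G \<Longrightarrow> \<exists>\<sigma>\<in>fixer F. acts_as n e \<sigma> g"
    and only: "\<And>\<sigma>. \<sigma> \<in> fixer F \<Longrightarrow> \<exists>g\<in>G. acts_as n e \<sigma> g"
  shows "gal (field_adjoin F W) F \<cong> (alt_group n)\<lparr>carrier := G\<rparr>" (is "gal ?L F \<cong> ?A")
proof -
  obtain s where s: "\<And>g. g \<in> G \<Longrightarrow> s g \<in> fixer F" "\<And>g. g \<in> G \<Longrightarrow> acts_as n e (s g) g"
    using realised by metis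
  let ?h = "\<lambda>g. restrict (s g) ?L"
  have "?h \<in> hom ?A (gal ?L F)"
  proof (rule homI)
    show "?h g \<in> carrier (gal ?L F)" if "g \<in> carrier ?A" for g
      using that s(1) restrict_fixer_in_gal_auts by (simp add: gal_def)
    fix g h assume "g \<in> carrier ?A" "h \<in> carrier ?A"
    hence gh: "g \<in> G" "h \<in> G" by auto
    hence "g \<circ> h \<in> G" using subgroup.m_closed[OF G, of g h] by (simp add: alt_group_mult)
    hence "s (g \<circ> h) x = (s g \<circ> s h) x" if "x \<in> ?L" for x
      using acts_as_imp_agree_on_adjoin[OF _ fixer_comp _ acts_as_comp that] s gh by blast
    hence "?h (g \<circ> h) = restrict (s g \<circ> s h) ?L" by (rule restrict_ext)
    thus "?h (g \<otimes>\<^bsub>?A\<^esub> h) = ?h g \<otimes>\<^bsub>gal ?L F\<^esub> ?h h"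
      using gal_mult_restrict[OF s(1)[OF gh(2)]] by (simp add: alt_group_mult)
  qed
  moreover have "inj_on ?h G"
  proof (rule inj_onI)
    fix g h assume gh: "g \<in> G" "h \<in> G" and "?h g = ?h h"
    hence "s g x = s h x" if "x \<in> ?L" for x using that by (metis restrict_apply')
    thus "g = h" using agree_on_adjoin_imp_acts_as_eq[OF s(2) s(2)] gh by blast
  qed
  moreover have "?h ` G = gal_auts ?L F"
  proof (intro equalityI subsetI)
    show "\<tau> \<in> gal_auts ?L F" if "\<tau> \<in> ?h ` G" for \<tau> using that s(1) restrict_fixer_in_gal_auts by auto
    fix \<tau> assume "\<tau> \<in> gal_auts ?L F"
    then obtain \<sigma> where \<sigma>: "\<sigma> \<in> fixer F" "\<tau> = restrict \<sigma> ?L" using gal_auts_extends by blast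
    then obtain g where g: "g \<in> G" "acts_as n e \<sigma> g" using only by blast
    have "\<tau> = ?h g" unfolding \<sigma>(2)
      using acts_as_imp_agree_on_adjoin[OF \<sigma>(1) s(1) g(2) s(2)] g(1) by (intro restrict_ext)
    thus "\<tau> \<in> ?h ` G" using g(1) by auto
  qed
  ultimately have "?h \<in> iso ?A (gal ?L F)" by (simp add: iso_def bij_betw_def gal_def)
  hence "?A \<cong> gal ?L F" by (auto simp: is_iso_def)
  thus ?thesis by (rule group.iso_sym[OF group.subgroup_imp_group[OF alt_group_is_group G]])
qed

end

end

lemma hom_graph_eventually:
  assumes "\<F> \<noteq> bot" and autq: "\<forall>\<^sub>F \<sigma> in \<F>. \<sigma> \<in> autq"
  shows "hom_graph {(y, z). y \<in> qbar \<and> z \<in> qbar \<and> (\<forall>\<^sub>F \<sigma> in \<F>. \<sigma> y = z)}" (is "hom_graph ?B")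
proof
  show "(of_rat q, of_rat q) \<in> ?B" for q
    using autq by (auto elim!: eventually_mono simp: autq_of_rat)
  show "(x + x', y + y') \<in> ?B" "(x * x', y * y') \<in> ?B" if xy: "(x, y) \<in> ?B" "(x', y') \<in> ?B" for x y x' y'
  proof -
    have "\<forall>\<^sub>F \<sigma> in \<F>. \<sigma> \<in> autq \<and> \<sigma> x = y \<and> \<sigma> x' = y'" using autq xy by (auto intro: eventually_conj)
    hence "\<forall>\<^sub>F \<sigma> in \<F>. \<sigma> (x + x') = y + y' \<and> \<sigma> (x * x') = y * y'"
      using xy by (auto elim!: eventually_mono simp: autq_add autq_mult)
    thus "(x + x', y + y') \<in> ?B" "(x * x', y * y') \<in> ?B" using xy by (auto elim: eventually_mono)
  qed
  show "y = 0" if "(0, y) \<in> ?B" for y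
  proof -
    have "\<forall>\<^sub>F \<sigma> in \<F>. \<sigma> \<in> autq \<and> \<sigma> 0 = y" using that autq by (auto intro: eventually_conj)
    hence "\<forall>\<^sub>F \<sigma> in \<F>. y = 0" by (auto elim!: eventually_mono simp: autq_0)
    thus ?thesis using \<open>\<F> \<noteq> bot\<close> by (simp add: eventually_const)
  qed
qed auto

lemma subfield_C_eventually_fixed:
  assumes autq: "\<forall>\<^sub>F \<sigma> in \<F>. \<sigma> \<in> autq"
  shows "subfield_C {x\<in>qbar. \<forall>\<^sub>F \<sigma> in \<F>. \<sigma> x = x}" (is "subfield_C ?K")
  unfolding subfield_C_def
proof (intro conjI ballI impI)
  show "0 \<in> ?K" "1 \<in> ?K" using autq by (auto elim!: eventually_mono simp: autq_0 autq_1)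
next
  fix x y assume xy: "x \<in> ?K" "y \<in> ?K"
  have "\<forall>\<^sub>F \<sigma> in \<F>. \<sigma> \<in> autq \<and> \<sigma> x = x \<and> \<sigma> y = y" using autq xy by (auto intro: eventually_conj)
  hence "\<forall>\<^sub>F \<sigma> in \<F>. \<sigma> (x + y) = x + y \<and> \<sigma> (x - y) = x - y \<and> \<sigma> (x * y) = x * y"
    using xy by (auto elim!: eventually_mono simp: autq_add autq_diff autq_mult)
  thus "x + y \<in> ?K" "x - y \<in> ?K" "x * y \<in> ?K" using xy by (auto elim: eventually_mono)
next
  fix x assume x: "x \<in> ?K"
  have "\<forall>\<^sub>F \<sigma> in \<F>. \<sigma> \<in> autq \<and> \<sigma> x = x" using autq x by (auto intro: eventually_conj)
  thus "inverse x \<in> ?K" using x by (auto elim!: eventually_mono simp: autq_inverse)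
qed

locale galois_family =
  fixes n :: nat and I :: "'i set" and e :: "'i \<Rightarrow> nat \<Rightarrow> complex" and G :: "'i \<Rightarrow> (nat \<Rightarrow> nat) set"
  assumes n5: "n \<ge> 5" and full: "i \<in> I \<Longrightarrow> full_galois_enum n (e i)"
    and fixer_inj: "i \<in> I \<Longrightarrow> j \<in> I \<Longrightarrow> fixer (e i ` {1..n}) = fixer (e j ` {1..n}) \<Longrightarrow> i = j"
    and subgroup_G: "i \<in> I \<Longrightarrow> subgroup (G i) (alt_group n)"
begin

definition decomposition :: "'i \<Rightarrow> (complex \<Rightarrow> complex) set" where
  "decomposition i = {\<sigma>. \<exists>g\<in>G i. acts_as n (e i) \<sigma> g}"

text \<open>The sets \<open>\<Inter>j\<in>J. decomposition j\<close> for finite \<open>J\<close> generate a filter. The base field consists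
  of the numbers fixed by one of these sets: since the fixers are different, simplicity of the
  alternating group makes the conditions for different indices independent of each other.\<close>

definition constraints :: "(complex \<Rightarrow> complex) filter" where
  "constraints = inf (principal autq) (INF i\<in>I. principal (decomposition i))"

definition base_field :: "complex set" where
  "base_field = {x\<in>qbar. \<forall>\<^sub>F \<sigma> in constraints. \<sigma> x = x}"

lemma id_in_G: "i \<in> I \<Longrightarrow> id \<in> G i"
  using subgroup.one_closed[OF subgroup_G] by (simp add: alt_group_one)

lemma eventually_constraints_iff:
  "eventually P constraints \<longleftrightarrow>
    (\<exists>J\<subseteq>I. finite J \<and> (\<forall>\<sigma>\<in>autq. (\<forall>j\<in>J. \<sigma> \<in> decomposition j) \<longrightarrow> P \<sigma>))"
proof -
  have "eventually P constraints \<longleftrightarrow>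
      eventually (\<lambda>\<sigma>. \<sigma> \<in> autq \<longrightarrow> P \<sigma>) (INF i\<in>I. principal (decomposition i))"
    by (simp add: constraints_def inf_commute[of "principal autq"] eventually_inf_principal)
  also have "\<dots> \<longleftrightarrow> (\<exists>J\<subseteq>I. finite J \<and>
      eventually (\<lambda>\<sigma>. \<sigma> \<in> autq \<longrightarrow> P \<sigma>) (INF j\<in>J. principal (decomposition j)))"
    by (rule eventually_INF)
  also have "\<dots> \<longleftrightarrow> (\<exists>J\<subseteq>I. finite J \<and> (\<forall>\<sigma>\<in>autq. (\<forall>j\<in>J. \<sigma> \<in> decomposition j) \<longrightarrow> P \<sigma>))"
    by (intro ex_cong1 conj_cong refl) (auto simp: INF_principal_finite eventually_principal)
  finally show ?thesis .
qed

lemma eventually_autq: "\<forall>\<^sub>F \<sigma> in constraints. \<sigma> \<in> autq"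
  unfolding eventually_constraints_iff by blast

lemma algebraic_base_field: "algebraic_ext_Q base_field"
  using subfield_C_eventually_fixed[OF eventually_autq]
  by (auto simp: algebraic_ext_Q_def base_field_def qbar_def)

lemma realised_with_finite_constraints:
  assumes J: "finite J" "J \<subseteq> I" and i: "i \<in> I" and g: "g \<in> G i"
  obtains \<sigma> where "acts_as n (e i) \<sigma> g" "\<And>j. j \<in> J \<Longrightarrow> \<sigma> \<in> decomposition j"
proof -
  have "g \<in> carrier (alt_group n)" using subgroup.subset[OF subgroup_G[OF i]] g by blast
  hence "\<exists>\<sigma>. acts_as n (e i) \<sigma> g \<and> (\<forall>W\<in>(\<lambda>j. e j ` {1..n}) ` (J - {i}). \<sigma> \<in> fixer W)"
  proof (rule even_permutation_realised[OF n5 full[OF i], rotated 2])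
    fix W assume "W \<in> (\<lambda>j. e j ` {1..n}) ` (J - {i})"
    then obtain j where j: "j \<in> I" "j \<noteq> i" "W = e j ` {1..n}" using J(2) by blast
    thus "galois_stable W \<and> \<not> fixer W \<subseteq> fixer (e i ` {1..n})"
      using fixer_subset_imp_eq[OF full[OF j(1)] full[OF i]] fixer_inj[OF j(1) i]
        full_galois_enumD(2)[OF full[OF j(1)]] by auto
  qed (use J in auto)
  then obtain \<sigma> where \<sigma>: "acts_as n (e i) \<sigma> g" "\<And>j. j \<in> J - {i} \<Longrightarrow> \<sigma> \<in> fixer (e j ` {1..n})"
    by blast
  have "\<sigma> \<in> decomposition j" if "j \<in> J" for j
  proof (cases "j = i")
    case True
    thus ?thesis using \<sigma> g unfolding decomposition_def by blast
  next
    case False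
    hence "acts_as n (e j) \<sigma> id" using \<sigma>(2) that acts_as_id_iff by blast
    thus ?thesis using id_in_G J that unfolding decomposition_def by blast
  qed
  thus ?thesis using that \<sigma>(1) by blast
qed

lemma fixer_base_field_realises:
  assumes i: "i \<in> I" and g: "g \<in> G i"
  shows "\<exists>\<sigma>\<in>fixer base_field. acts_as n (e i) \<sigma> g"
proof -
  let ?\<F> = "inf constraints (principal {\<sigma>. acts_as n (e i) \<sigma> g})"
  have perm: "g permutes {1..n}"
    using realised_with_finite_constraints[of "{}", OF _ _ i g] by (auto simp: acts_as_def)
  have "?\<F> \<noteq> bot"
  proof
    assume "?\<F> = bot"
    hence "\<forall>\<^sub>F \<sigma> in constraints. \<not> acts_as n (e i) \<sigma> g"
      by (simp add: trivial_limit_def eventually_inf_principal)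
    then obtain J where J: "J \<subseteq> I" "finite J"
      "\<And>\<sigma>. \<sigma> \<in> autq \<Longrightarrow> (\<forall>j\<in>J. \<sigma> \<in> decomposition j) \<Longrightarrow> \<not> acts_as n (e i) \<sigma> g"
      unfolding eventually_constraints_iff by blast
    show False
      by (rule realised_with_finite_constraints[OF J(2,1) i g]) (use J(3) in \<open>auto simp: acts_as_def\<close>)
  qed
  moreover have "\<forall>\<^sub>F \<sigma> in ?\<F>. \<sigma> \<in> autq"
    using eventually_autq by (auto simp: eventually_inf_principal elim: eventually_mono)
  ultimately obtain \<sigma> where \<sigma>: "\<sigma> \<in> autq"
    "\<And>y z. y \<in> qbar \<Longrightarrow> z \<in> qbar \<Longrightarrow> (\<forall>\<^sub>F \<tau> in ?\<F>. \<tau> y = z) \<Longrightarrow> \<sigma> y = z"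
    using hom_graph_extends_to_aut[OF hom_graph_eventually[of ?\<F>]] by auto
  have "\<sigma> x = x" if "x \<in> base_field" for x
    using that by (intro \<sigma>(2)) (auto simp: base_field_def eventually_inf_principal elim: eventually_mono)
  moreover have "\<sigma> (e i k) = e i (g k)" if k: "k \<in> {1..n}" for k
  proof (rule \<sigma>(2))
    have "g k \<in> {1..n}" using k perm by (simp only: permutes_in_image)
    thus "e i k \<in> qbar" "e i (g k) \<in> qbar"
      using k full_galois_enumD(2)[OF full[OF i]] unfolding galois_stable_def by blast+
    show "\<forall>\<^sub>F \<tau> in ?\<F>. \<tau> (e i k) = e i (g k)"
      using k by (auto simp: eventually_inf_principal acts_as_def)
  qed
  ultimately show ?thesis using \<sigma>(1) perm by (intro bexI[of _ \<sigma>]) (auto simp: acts_as_def fixer_def)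
qed

lemma cong_hom_autq: "\<sigma> \<in> autq \<Longrightarrow> cong_hom UNIV {0} qbar \<sigma>"
  by unfold_locales (auto simp: autq_add autq_mult autq_of_int)

lemma fixer_base_field_decomposition:
  assumes i: "i \<in> I" and \<sigma>: "\<sigma> \<in> fixer base_field"
  shows "\<exists>g\<in>G i. acts_as n (e i) \<sigma> g"
proof -
  let ?Z = "e i ` {1..n}"
  have st: "galois_stable ?Z" using full_galois_enumD(2)[OF full[OF i]] .
  have "\<exists>\<tau>\<in>decomposition i. \<forall>z\<in>?Z. \<sigma> z - \<tau> z \<in> {0}"
  proof (rule cong_hom_eq_conjugation[OF cong_hom_autq[OF fixerD(1)[OF \<sigma>]]])
    show "decomposition i \<subseteq> autq" by (auto simp: decomposition_def acts_as_def)
    show "id \<in> decomposition i" using acts_as_id id_in_G[OF i] unfolding decomposition_def by blast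
    show "\<rho> \<circ> \<tau> \<in> decomposition i" if "\<rho> \<in> decomposition i" "\<tau> \<in> decomposition i" for \<rho> \<tau>
      using that acts_as_comp subgroup.m_closed[OF subgroup_G[OF i]]
      unfolding decomposition_def alt_group_mult by blast
    show "finite ?Z" "?Z \<subseteq> qbar \<inter> qbar \<inter> UNIV" using st by (auto simp: galois_stable_def)
    show "\<tau> z \<in> ?Z" if "\<tau> \<in> decomposition i" "z \<in> ?Z" for \<tau> z
      using that galois_stableD[OF st] by (auto simp: decomposition_def acts_as_def)
    show "c \<in> qbar \<and> \<sigma> c - c \<in> {0}"
      if c: "c \<in> qbar \<inter> UNIV" "\<And>\<tau>. \<tau> \<in> decomposition i \<Longrightarrow> \<tau> c = c" for c
    proof -
      have "\<forall>\<^sub>F \<tau> in constraints. \<tau> c = c"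
        unfolding eventually_constraints_iff using c(2) i by (intro exI[of _ "{i}"]) auto
      hence "c \<in> base_field" using c(1) by (simp add: base_field_def)
      thus ?thesis using c(1) fixerD(2)[OF \<sigma>] by simp
    qed
    show "card {0..<int (Suc (card ?Z ^ card ?Z * card ?Z))} > card ?Z ^ card ?Z * card ?Z"
      by (simp only: card_atLeastLessThan_int diff_zero nat_int lessI)
  qed auto
  then obtain \<tau> g where "g \<in> G i" "acts_as n (e i) \<tau> g" "\<And>z. z \<in> ?Z \<Longrightarrow> \<sigma> z = \<tau> z"
    by (auto simp: decomposition_def)
  thus ?thesis using fixerD(1)[OF \<sigma>] by (intro bexI[of _ g]) (auto simp: acts_as_def)
qed

theorem gal_base_field_iso:
  assumes "i \<in> I" "galois_stable W" "fixer W = fixer (e i ` {1..n})"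
  shows "gal (field_adjoin base_field W) base_field \<cong> (alt_group n)\<lparr>carrier := G i\<rparr>"
proof (rule gal_iso_permutations)
  show "subfield_C base_field" "base_field \<subseteq> qbar"
    using algebraic_base_field by (auto simp: algebraic_ext_Q_def qbar_def)
qed (use assms full subgroup_G fixer_base_field_realises fixer_base_field_decomposition in auto)

end

section \<open>Integer matrices modulo primes\<close>

lemma prod_diff_dvd:
  fixes f g :: "'i \<Rightarrow> 'a::comm_ring_1"
  assumes "\<And>i. i \<in> I \<Longrightarrow> c dvd f i - g i"
  shows "c dvd prod f I - prod g I"
  using assms
proof (induction I rule: infinite_finite_induct)
  case (insert i I)
  have "prod f (insert i I) - prod g (insert i I)
      = f i * (prod f I - prod g I) + (f i - g i) * prod g I"
    using insert by (simp add: algebra_simps)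
  thus ?case using insert by simp
qed auto

lemma det_diff_dvd:
  fixes A B :: "'a::comm_ring_1^'n^'n"
  assumes "\<And>i j. c dvd A$i$j - B$i$j"
  shows "c dvd det A - det B"
  unfolding det_def sum_subtractf[symmetric] right_diff_distrib[symmetric]
  by (intro dvd_sum dvd_mult prod_diff_dvd assms)

definition mat_cong :: "nat \<Rightarrow> int^'n^'n \<Rightarrow> int^'n^'n \<Rightarrow> bool" where
  "mat_cong m A B \<longleftrightarrow> (\<forall>i j. int m dvd A$i$j - B$i$j)"

lemma mat_cong_refl: "mat_cong m A A"
  by (simp add: mat_cong_def)

lemma mat_cong_sym: "mat_cong m A B \<Longrightarrow> mat_cong m B A"
  by (simp add: mat_cong_def dvd_diff_commute)

lemma mat_cong_trans: "mat_cong m A B \<Longrightarrow> mat_cong m B C \<Longrightarrow> mat_cong m A C"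
  unfolding mat_cong_def by (metis (no_types, opaque_lifting) diff_add_cancel add_diff_eq dvd_add)

lemma mat_cong_mult:
  assumes "mat_cong m A B" "mat_cong m C D"
  shows "mat_cong m (A ** C) (B ** D)"
proof -
  have "int m dvd A$i$k * C$k$j - B$i$k * D$k$j" for i j k
  proof -
    have "A$i$k * C$k$j - B$i$k * D$k$j = A$i$k * (C$k$j - D$k$j) + (A$i$k - B$i$k) * D$k$j"
      by (simp add: algebra_simps)
    thus ?thesis using assms by (simp add: mat_cong_def)
  qed
  thus ?thesis by (simp add: mat_cong_def matrix_matrix_mult_def sum_subtractf[symmetric] dvd_sum)
qed

lemma mat_cong_det: "mat_cong m A B \<Longrightarrow> int m dvd det A - det B"
  unfolding mat_cong_def by (intro det_diff_dvd) auto

definition elementary_mat :: "'n \<Rightarrow> 'n \<Rightarrow> int \<Rightarrow> int^'n^'n" where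
  "elementary_mat i j t = (\<chi> a b. (if a = b then 1 else 0) + (if a = i \<and> b = j then t else 0))"

lemma elementary_mat_mult: "(elementary_mat i j t ** A)$a$b = A$a$b + (if a = i then t * A$j$b else 0)"
proof -
  have "(elementary_mat i j t ** A)$a$b
      = (\<Sum>k\<in>UNIV. (if a = k then A$k$b else 0) + (if k = j then (if a = i then t * A$k$b else 0) else 0))"
    unfolding elementary_mat_def matrix_matrix_mult_def
    by (simp, intro sum.cong) (auto simp: distrib_right)
  also have "\<dots> = A$a$b + (if a = i then t * A$j$b else 0)" by (simp add: sum.distrib)
  finally show ?thesis .
qed

lemma elementary_mat_mult_elementary_mat:
  "i \<noteq> j \<Longrightarrow> elementary_mat i j t ** elementary_mat i j s = elementary_mat i j (t + s)"
  by (auto simp: vec_eq_iff elementary_mat_mult) (auto simp: elementary_mat_def)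

lemma elementary_mat_0: "elementary_mat i j 0 = mat 1"
  by (simp add: elementary_mat_def mat_def vec_eq_iff)

lemma elementary_mat_commutator:
  assumes "i \<noteq> j" "i \<noteq> k" "j \<noteq> k"
  shows "elementary_mat i k t ** elementary_mat k j 1 ** elementary_mat i k (- t) ** elementary_mat k j (- 1)
    = elementary_mat i j t"
  unfolding matrix_mul_assoc[symmetric] vec_eq_iff elementary_mat_mult using assms
  by (auto simp: elementary_mat_def)

lemma det_elementary_mat:
  assumes "i \<noteq> j" shows "det (elementary_mat i j t) = 1"
proof -
  have "elementary_mat i j t = (\<chi> k. if k = i then row i (mat 1) + t *s row j (mat 1) else row k (mat 1))"
    by (simp add: vec_eq_iff elementary_mat_def row_def mat_def)
  thus ?thesis using det_row_operation[OF assms, of "mat 1" t] by simp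
qed

inductive_set elementary_group :: "(int^'n^'n) set" where
  elementary_one: "mat 1 \<in> elementary_group"
| elementary_step: "A \<in> elementary_group \<Longrightarrow> i \<noteq> j \<Longrightarrow> elementary_mat i j t ** A \<in> elementary_group"

lemma elementary_group_mat: "i \<noteq> j \<Longrightarrow> elementary_mat i j t \<in> elementary_group"
  using elementary_step[OF elementary_one, of i j t] by simp

lemma elementary_group_mult:
  "A \<in> elementary_group \<Longrightarrow> B \<in> elementary_group \<Longrightarrow> A ** B \<in> elementary_group"
  by (induction rule: elementary_group.induct)
    (auto simp: matrix_mul_assoc[symmetric] intro: elementary_step)

lemma elementary_group_inverse:
  "A \<in> elementary_group \<Longrightarrow> \<exists>B\<in>elementary_group. A ** B = mat 1 \<and> B ** A = mat 1"
proof (induction rule: elementary_group.induct)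
  case elementary_one
  show ?case using elementary_group.elementary_one by (intro bexI[of _ "mat 1"]) auto
next
  case (elementary_step A i j t)
  then obtain B where B: "B \<in> elementary_group" "A ** B = mat 1" "B ** A = mat 1" by blast
  let ?E = "elementary_mat i j t" and ?E' = "elementary_mat i j (- t)"
  have E: "?E ** ?E' = mat 1" "?E' ** ?E = mat 1"
    using elementary_step by (simp_all add: elementary_mat_mult_elementary_mat elementary_mat_0)
  have "?E ** A ** (B ** ?E') = mat 1" by (metis B(2) E(1) matrix_mul_assoc matrix_mul_rid)
  moreover have "B ** ?E' ** (?E ** A) = mat 1" by (metis B(3) E(2) matrix_mul_assoc matrix_mul_rid)
  moreover have "B ** ?E' \<in> elementary_group"
    using B elementary_step by (intro elementary_group_mult elementary_group_mat)
  ultimately show ?case by blast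
qed

lemma elementary_group_det: "A \<in> elementary_group \<Longrightarrow> det A = 1"
  by (induction rule: elementary_group.induct) (auto simp: det_mul det_elementary_mat)

lemma elementary_group_subset_SLZ: "elementary_group \<subseteq> SLZ"
  using elementary_group_det by (auto simp: SLZ_def)

definition unit_col :: "'a::comm_ring_1 \<Rightarrow> 'a^'n^'n \<Rightarrow> 'n \<Rightarrow> bool" where
  "unit_col d A s \<longleftrightarrow> (\<forall>i. d dvd A$i$s - (if i = s then 1 else 0))"

lemma unit_col_dvd: "unit_col d A s \<Longrightarrow> i \<noteq> s \<Longrightarrow> d dvd A$i$s"
  unfolding unit_col_def by (metis diff_zero)

lemma unit_col_elementary_mat_mult:
  assumes "unit_col d A s" "j \<noteq> s"
  shows "unit_col d (elementary_mat i j t ** A) s"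
  unfolding unit_col_def
proof
  fix a
  have "(elementary_mat i j t ** A)$a$s - (if a = s then 1 else 0)
      = (A$a$s - (if a = s then 1 else 0)) + (if a = i then t * A$j$s else 0)"
    by (simp add: elementary_mat_mult)
  moreover have "d dvd (if a = i then t * A$j$s else 0)" using unit_col_dvd[OF assms] by simp
  ultimately show "d dvd (elementary_mat i j t ** A)$a$s - (if a = s then 1 else 0)"
    using assms(1) unfolding unit_col_def by (metis dvd_add)
qed

lemma not_dvd_permutation_entry:
  fixes A :: "'a::comm_ring_1^'n^'n"
  assumes "\<not> d dvd (\<Prod>i\<in>UNIV. A$i$\<pi> i)"
  shows "\<not> d dvd A$i$\<pi> i"
  using assms dvd_prodI[of UNIV i "\<lambda>i. A$i$\<pi> i"] dvd_trans by auto

lemma unit_col_permutation_fixes: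
  assumes "unit_col d A s" "\<pi> permutes UNIV" "\<not> d dvd (\<Prod>i\<in>UNIV. A$i$\<pi> i)"
  shows "\<pi> s = s"
proof -
  obtain i where i: "\<pi> i = s" using permutes_surj[OF assms(2)] by (metis surjD)
  have "\<not> d dvd A$i$\<pi> i" using assms(3) by (rule not_dvd_permutation_entry)
  thus ?thesis using unit_col_dvd[OF assms(1)] i by metis
qed

lemma nonzero_entry_outside_unit_cols:
  fixes A :: "'a::comm_ring_1^'n^'n"
  assumes S: "\<And>s. s \<in> S \<Longrightarrow> unit_col d A s" and k: "k \<notin> S" and det: "\<not> d dvd det A"
  shows "\<exists>i. i \<notin> S \<and> \<not> d dvd A$i$k"
proof (rule ccontr)
  assume zero: "\<not> ?thesis"
  have "d dvd (\<Prod>i\<in>UNIV. A$i$\<pi> i)" if \<pi>: "\<pi> permutes UNIV" for \<pi>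
  proof (rule ccontr)
    assume nz: "\<not> ?thesis"
    obtain i where i: "\<pi> i = k" using permutes_surj[OF \<pi>] by (metis surjD)
    have "i \<notin> S" using unit_col_permutation_fixes[OF S \<pi> nz] i k by metis
    thus False using zero not_dvd_permutation_entry[OF nz, of i] i by blast
  qed
  hence "d dvd det A" unfolding det_def by (intro dvd_sum) auto
  thus False using det by blast
qed

lemma det_cong_if_other_cols_unit:
  fixes A :: "'a::comm_ring_1^'n^'n"
  assumes S: "\<And>s. s \<noteq> k \<Longrightarrow> unit_col d A s"
  shows "d dvd det A - A$k$k"
proof -
  let ?term = "\<lambda>\<pi>. of_int (sign \<pi>) * (\<Prod>i\<in>UNIV. A$i$\<pi> i)"
  have "d dvd (\<Sum>\<pi>\<in>{\<pi>. \<pi> permutes UNIV} - {id}. ?term \<pi>)"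
  proof (intro dvd_sum dvd_mult)
    fix \<pi> :: "'n \<Rightarrow> 'n" assume \<pi>: "\<pi> \<in> {\<pi>. \<pi> permutes UNIV} - {id}"
    show "d dvd (\<Prod>i\<in>UNIV. A$i$\<pi> i)"
    proof (rule ccontr)
      assume nz: "\<not> ?thesis"
      have fixes_others: "\<pi> s = s" if "s \<noteq> k" for s
        using unit_col_permutation_fixes[OF S[OF that] _ nz] \<pi> by blast
      hence "\<pi> k = k" using permutes_inj[of \<pi> UNIV] \<pi> by (metis DiffD1 injD mem_Collect_eq)
      hence "\<pi> = id" using fixes_others by (auto simp: fun_eq_iff) metis
      thus False using \<pi> by auto
    qed
  qed
  moreover have "det A = (\<Prod>i\<in>UNIV. A$i$i) + (\<Sum>\<pi>\<in>{\<pi>. \<pi> permutes UNIV} - {id}. ?term \<pi>)"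
    unfolding det_def by (subst sum.remove[of _ id]) (auto simp: finite_permutations permutes_id)
  moreover have "d dvd (\<Prod>i\<in>UNIV. A$i$i) - (\<Prod>i\<in>UNIV. if i = k then A$k$k else 1)"
    by (intro prod_diff_dvd) (use S in \<open>auto simp: unit_col_def\<close>, metis)
  hence "d dvd (\<Prod>i\<in>UNIV. A$i$i) - A$k$k" by simp
  ultimately show ?thesis by (metis (no_types, lifting) add_diff_eq add.commute dvd_add)
qed

lemma clear_column:
  fixes A :: "int^'n^'n"
  assumes "finite T" "k \<notin> T"
  shows "\<exists>B\<in>elementary_group. \<forall>a b. (B ** A)$a$b = A$a$b - (if a \<in> T then A$a$k * A$k$b else 0)"
  using assms
proof (induction T rule: finite_induct)
  case empty
  show ?case using elementary_one by (intro bexI[of _ "mat 1"]) auto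
next
  case (insert i T)
  then obtain B where B: "B \<in> elementary_group"
    "\<And>a b. (B ** A)$a$b = A$a$b - (if a \<in> T then A$a$k * A$k$b else 0)" by auto
  have "elementary_mat i k (- A$i$k) ** B \<in> elementary_group"
    using B insert by (intro elementary_step) auto
  moreover have "(elementary_mat i k (- A$i$k) ** B ** A)$a$b
      = A$a$b - (if a \<in> insert i T then A$a$k * A$k$b else 0)" for a b
    unfolding matrix_mul_assoc[symmetric] elementary_mat_mult B(2) using insert by auto
  ultimately show ?case by blast
qed

context
  fixes p :: nat and S :: "'n::finite set" and A :: "int^'n^'n"
  assumes unit_cols: "\<And>s. s \<in> S \<Longrightarrow> unit_col (int p) A s"
begin

lemma make_entry_nonzero:
  assumes det: "\<not> int p dvd det A" and k: "k \<notin> S" "k' \<notin> S" "k' \<noteq> k"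
  shows "\<exists>B\<in>elementary_group. \<exists>r. r \<notin> S \<and> r \<noteq> k
    \<and> (\<forall>s\<in>S. unit_col (int p) (B ** A) s) \<and> \<not> int p dvd (B ** A)$r$k"
proof (cases "\<exists>r. r \<notin> S \<and> r \<noteq> k \<and> \<not> int p dvd A$r$k")
  case True
  thus ?thesis using elementary_one unit_cols by (intro bexI[of _ "mat 1"]) auto
next
  case False
  hence "\<not> int p dvd A$k$k" using nonzero_entry_outside_unit_cols[OF unit_cols k(1) det] by blast
  moreover have "int p dvd A$k'$k" using False k by blast
  ultimately have "\<not> int p dvd (elementary_mat k' k 1 ** A)$k'$k"
    by (simp add: elementary_mat_mult dvd_add_right_iff)
  moreover have "unit_col (int p) (elementary_mat k' k 1 ** A) s" if "s \<in> S" for s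
    using unit_cols[OF that] that k by (intro unit_col_elementary_mat_mult) auto
  ultimately show ?thesis using k elementary_group_mat[OF k(3)] by blast
qed

lemma make_pivot_one:
  assumes p: "prime p" and r: "r \<notin> S" "r \<noteq> k" "\<not> int p dvd A$r$k"
  shows "\<exists>B\<in>elementary_group. (\<forall>s\<in>S. unit_col (int p) (B ** A) s) \<and> int p dvd (B ** A)$k$k - 1"
proof -
  have "coprime (int p) (A$r$k)" using r(3) p by (simp add: prime_imp_coprime)
  then obtain u v where uv: "u * int p + v * A$r$k = 1" by (metis bezout_int coprime_imp_gcd_eq_1)
  let ?E = "elementary_mat k r ((1 - A$k$k) * v)"
  have "(?E ** A)$k$k - 1 = (1 - A$k$k) * (v * A$r$k - 1)"
    by (simp add: elementary_mat_mult algebra_simps)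
  also have "v * A$r$k - 1 = - (u * int p)" using uv by linarith
  finally have "int p dvd (?E ** A)$k$k - 1" by simp
  moreover have "unit_col (int p) (?E ** A) s" if "s \<in> S" for s
    using unit_cols[OF that] that r(1) by (intro unit_col_elementary_mat_mult) auto
  ultimately show ?thesis using elementary_group_mat[of k r] r(2) by blast
qed

lemma clear_pivot_column:
  assumes k: "k \<notin> S" and pivot: "int p dvd A$k$k - 1"
  shows "\<exists>B\<in>elementary_group. \<forall>s\<in>insert k S. unit_col (int p) (B ** A) s"
proof -
  obtain C where C: "C \<in> elementary_group"
    "\<And>a b. (C ** A)$a$b = A$a$b - (if a \<in> UNIV - {k} then A$a$k * A$k$b else 0)"
    using clear_column[of "UNIV - {k}" k A] by auto
  have "unit_col (int p) (C ** A) k"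
    unfolding unit_col_def
  proof
    fix a
    have "A$a$k - A$a$k * A$k$k = - (A$a$k * (A$k$k - 1))" by (simp add: algebra_simps)
    thus "int p dvd (C ** A)$a$k - (if a = k then 1 else 0)" unfolding C(2) using pivot by auto
  qed
  moreover have "unit_col (int p) (C ** A) s" if s: "s \<in> S" for s
    unfolding unit_col_def
  proof
    fix a
    have "(C ** A)$a$s - (if a = s then 1 else 0)
        = (A$a$s - (if a = s then 1 else 0)) - (if a \<in> UNIV - {k} then A$a$k * A$k$s else 0)"
      by (simp add: C(2))
    moreover have "int p dvd A$a$s - (if a = s then 1 else 0)"
      using unit_cols[OF s] unfolding unit_col_def by blast
    moreover have "int p dvd A$k$s" using unit_col_dvd[OF unit_cols[OF s], of k] s k by metis
    hence "int p dvd (if a \<in> UNIV - {k} then A$a$k * A$k$s else 0)" by simp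
    ultimately show "int p dvd (C ** A)$a$s - (if a = s then 1 else 0)" by (metis dvd_diff)
  qed
  ultimately show ?thesis using C(1) by blast
qed

end

lemma add_unit_col:
  fixes A :: "int^'n^'n"
  assumes p: "prime p" and det: "int p dvd det A - 1"
    and S: "\<And>s. s \<in> S \<Longrightarrow> unit_col (int p) A s" and k: "k \<notin> S"
  shows "\<exists>B\<in>elementary_group. \<forall>s\<in>insert k S. unit_col (int p) (B ** A) s"
proof -
  have "\<not> int p dvd 1" using p by (auto simp: prime_nat_iff)
  hence nd: "\<not> int p dvd det A" using det by (metis dvd_diff_right_iff dvd_diff_commute)
  have "\<exists>B\<in>elementary_group. (\<forall>s\<in>S. unit_col (int p) (B ** A) s) \<and> int p dvd (B ** A)$k$k - 1"
  proof (cases "\<exists>k'. k' \<notin> S \<and> k' \<noteq> k")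
    case True
    then obtain B r where B: "B \<in> elementary_group" "r \<notin> S" "r \<noteq> k"
      "\<And>s. s \<in> S \<Longrightarrow> unit_col (int p) (B ** A) s" "\<not> int p dvd (B ** A)$r$k"
      using make_entry_nonzero[OF S nd k] by blast
    obtain C where "C \<in> elementary_group" "\<forall>s\<in>S. unit_col (int p) (C ** (B ** A)) s"
      "int p dvd (C ** (B ** A))$k$k - 1"
      using make_pivot_one[OF B(4) p B(2,3,5)] by blast
    thus ?thesis using elementary_group_mult[OF _ B(1)] by (metis matrix_mul_assoc)
  next
    case False
    have "int p dvd det A - A$k$k" by (rule det_cong_if_other_cols_unit) (use False S in blast)
    hence "int p dvd A$k$k - 1"
      using det by (metis (no_types, opaque_lifting) diff_add_cancel add_diff_eq dvd_add dvd_diff_commute)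
    thus ?thesis using elementary_one S by (intro bexI[of _ "mat 1"]) auto
  qed
  then obtain B where B: "B \<in> elementary_group" "\<And>s. s \<in> S \<Longrightarrow> unit_col (int p) (B ** A) s"
    "int p dvd (B ** A)$k$k - 1" by blast
  obtain C where "C \<in> elementary_group" "\<forall>s\<in>insert k S. unit_col (int p) (C ** (B ** A)) s"
    using clear_pivot_column[OF B(2) k B(3)] by blast
  thus ?thesis using elementary_group_mult[OF _ B(1)] by (metis matrix_mul_assoc)
qed

lemma elementary_reduction:
  fixes A :: "int^'n^'n"
  assumes p: "prime p"
  shows "int p dvd det A - 1 \<Longrightarrow> (\<And>s. s \<in> S \<Longrightarrow> unit_col (int p) A s)
    \<Longrightarrow> \<exists>B\<in>elementary_group. mat_cong p (B ** A) (mat 1)"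
proof (induction "card (UNIV - S)" arbitrary: A S rule: less_induct)
  case less
  show ?case
  proof (cases "S = UNIV")
    case True
    hence "mat_cong p A (mat 1)" using less.prems(2) by (auto simp: mat_cong_def unit_col_def mat_def)
    thus ?thesis using elementary_one by (intro bexI[of _ "mat 1"]) auto
  next
    case False
    then obtain k where k: "k \<notin> S" by blast
    obtain B where B: "B \<in> elementary_group" "\<And>s. s \<in> insert k S \<Longrightarrow> unit_col (int p) (B ** A) s"
      using add_unit_col[OF p less.prems k] by metis
    have "card (UNIV - insert k S) < card (UNIV - S)" using k by (intro psubset_card_mono) auto
    moreover have "int p dvd det (B ** A) - 1"
      using less.prems(1) by (simp add: det_mul elementary_group_det B(1))
    ultimately obtain C where "C \<in> elementary_group" "mat_cong p (C ** (B ** A)) (mat 1)"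
      using less.hyps[of "insert k S" "B ** A"] B(2) by blast
    thus ?thesis using elementary_group_mult[OF _ B(1)] by (metis matrix_mul_assoc)
  qed
qed

lemma elementary_group_onto_SL_mod_prime:
  assumes "prime p" "int p dvd det A - 1"
  shows "\<exists>B\<in>elementary_group. mat_cong p B A"
proof -
  obtain B where B: "B \<in> elementary_group" "mat_cong p (B ** A) (mat 1)"
    using elementary_reduction[OF assms(1,2), of "{}"] by auto
  obtain C where C: "C \<in> elementary_group" "C ** B = mat 1" using elementary_group_inverse[OF B(1)] by blast
  have "mat_cong p (C ** (B ** A)) (C ** mat 1)" by (intro mat_cong_mult mat_cong_refl B)
  hence "mat_cong p A C" using C by (simp add: matrix_mul_assoc)
  thus ?thesis using C mat_cong_sym by blast
qed

text \<open>The parameters of the elementary factors are multiplied by \<open>c\<close>.\<close>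

lemma elementary_group_scale:
  assumes "A \<in> elementary_group"
  shows "\<exists>B\<in>elementary_group. (\<forall>m. int m dvd c - 1 \<longrightarrow> mat_cong m B A)
    \<and> (\<forall>m. int m dvd c \<longrightarrow> mat_cong m B (mat 1))"
  using assms
proof (induction rule: elementary_group.induct)
  case elementary_one
  show ?case using elementary_group.elementary_one mat_cong_refl by blast
next
  case (elementary_step A i j t)
  then obtain B where B: "B \<in> elementary_group" "\<And>m. int m dvd c - 1 \<Longrightarrow> mat_cong m B A"
    "\<And>m. int m dvd c \<Longrightarrow> mat_cong m B (mat 1)" by blast
  let ?E = "elementary_mat i j (t * c)"
  have "t * c - t = t * (c - 1)" by (simp add: algebra_simps)
  hence "mat_cong m ?E (elementary_mat i j t)" if "int m dvd c - 1" for m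
    using that by (auto simp: mat_cong_def elementary_mat_def)
  hence "mat_cong m (?E ** B) (elementary_mat i j t ** A)" if "int m dvd c - 1" for m
    using that B(2) by (intro mat_cong_mult)
  moreover have "mat_cong m ?E (mat 1)" if "int m dvd c" for m
    using that by (auto simp: mat_cong_def elementary_mat_def mat_def)
  hence "mat_cong m (?E ** B) (mat 1)" if "int m dvd c" for m
    using mat_cong_mult[of m ?E "mat 1" B "mat 1"] that B(3) by simp
  moreover have "?E ** B \<in> elementary_group" using B elementary_step by (intro elementary_group.elementary_step)
  ultimately show ?case by blast
qed

lemma elementary_group_onto_SL_mod_primes:
  fixes A :: "nat \<Rightarrow> int^'n^'n"
  assumes "finite J" "\<And>p. p \<in> J \<Longrightarrow> prime p" "\<And>p. p \<in> J \<Longrightarrow> int p dvd det (A p) - 1"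
  shows "\<exists>B\<in>elementary_group. \<forall>p\<in>J. mat_cong p B (A p)"
  using assms
proof (induction J rule: finite_induct)
  case empty
  show ?case using elementary_one by blast
next
  case (insert q J)
  then obtain B0 where B0: "B0 \<in> elementary_group" "\<And>p. p \<in> J \<Longrightarrow> mat_cong p B0 (A p)" by auto
  obtain B1 where B1: "B1 \<in> elementary_group" "mat_cong q B1 (A q)"
    using elementary_group_onto_SL_mod_prime[of q "A q"] insert by auto
  have "coprime q (\<Prod>J)" using insert by (intro prod_coprime_right primes_coprime) auto
  hence "coprime (int q) (int (\<Prod>J))" by (simp only: coprime_int_iff)
  then obtain u v where uv: "u * int q + v * int (\<Prod>J) = 1" by (metis bezout_int coprime_imp_gcd_eq_1)
  let ?c0 = "u * int q" and ?c1 = "v * int (\<Prod>J)"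
  have c: "?c0 - 1 = - ?c1" "?c1 - 1 = - ?c0" using uv by linarith+
  obtain C0 where C0: "C0 \<in> elementary_group" "\<And>m. int m dvd ?c0 - 1 \<Longrightarrow> mat_cong m C0 B0"
    "\<And>m. int m dvd ?c0 \<Longrightarrow> mat_cong m C0 (mat 1)"
    using elementary_group_scale[OF B0(1), of ?c0] by blast
  obtain C1 where C1: "C1 \<in> elementary_group" "\<And>m. int m dvd ?c1 - 1 \<Longrightarrow> mat_cong m C1 B1"
    "\<And>m. int m dvd ?c1 \<Longrightarrow> mat_cong m C1 (mat 1)"
    using elementary_group_scale[OF B1(1), of ?c1] by blast
  have "mat_cong q (C0 ** C1) (mat 1 ** B1)"
    by (intro mat_cong_mult C0(3) C1(2)) (simp_all add: c(2) del: of_nat_prod)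
  hence "mat_cong q (C0 ** C1) (A q)" using B1(2) mat_cong_trans by auto
  moreover have "mat_cong p (C0 ** C1) (A p)" if p: "p \<in> J" for p
  proof -
    have "p dvd \<Prod>J" using p insert(1) by (intro dvd_prod_eqI[of _ p]) auto
    hence "int p dvd int (\<Prod>J)" by (simp only: int_dvd_int_iff)
    hence "int p dvd ?c0 - 1" "int p dvd ?c1" unfolding c by simp_all
    hence "mat_cong p (C0 ** C1) (B0 ** mat 1)" using C0(2)[of p] C1(3)[of p] by (intro mat_cong_mult)
    thus ?thesis using B0(2)[OF p] mat_cong_trans by auto
  qed
  ultimately show ?case using elementary_group_mult[OF C0(1) C1(1)] by blast
qed

section \<open>Equidistribution of the random walk modulo primes\<close>

primrec walk_avg :: "'s set \<Rightarrow> ('x \<Rightarrow> 's \<Rightarrow> 'x) \<Rightarrow> nat \<Rightarrow> ('x \<Rightarrow> real) \<Rightarrow> 'x \<Rightarrow> real" where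
  "walk_avg \<Sigma> \<rho> 0 f x = f x"
| "walk_avg \<Sigma> \<rho> (Suc k) f x = (\<Sum>s\<in>\<Sigma>. walk_avg \<Sigma> \<rho> k f (\<rho> x s)) / real (card \<Sigma>)"

lemma card_words_eq_walk_avg:
  assumes "finite \<Sigma>"
  shows "real (card {xs. set xs \<subseteq> \<Sigma> \<and> length xs = k \<and> P (foldl \<rho> x xs)}) / real (card \<Sigma>) ^ k
     = walk_avg \<Sigma> \<rho> k (\<lambda>y. if P y then 1 else 0) x"
proof (induction k arbitrary: x)
  case 0
  have "{xs. set xs \<subseteq> \<Sigma> \<and> length xs = 0 \<and> P (foldl \<rho> x xs)} = (if P x then {[]} else {})" by auto
  thus ?case by simp
next
  case (Suc k)
  let ?W = "\<lambda>k x. {xs. set xs \<subseteq> \<Sigma> \<and> length xs = k \<and> P (foldl \<rho> x xs)}"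
  have fin: "finite (?W k x)" for x
    by (rule finite_subset[OF _ finite_lists_length_eq[OF assms, of k]]) auto
  have "?W (Suc k) x = (\<Union>s\<in>\<Sigma>. Cons s ` ?W k (\<rho> x s))"
    by (auto simp: length_Suc_conv image_iff)
  also have "card \<dots> = (\<Sum>s\<in>\<Sigma>. card (Cons s ` ?W k (\<rho> x s)))"
    by (rule card_UN_disjoint) (use assms fin in auto)
  also have "\<dots> = (\<Sum>s\<in>\<Sigma>. card (?W k (\<rho> x s)))" by (simp add: card_image)
  finally have "real (card (?W (Suc k) x)) / real (card \<Sigma>) ^ Suc k
      = (\<Sum>s\<in>\<Sigma>. real (card (?W k (\<rho> x s))) / real (card \<Sigma>) ^ k) / real (card \<Sigma>)"
    by (simp add: sum_divide_distrib mult.commute)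
  thus ?case using Suc.IH by simp
qed

locale permutation_walk =
  fixes \<Sigma> :: "'s set" and \<rho> :: "'x \<Rightarrow> 's \<Rightarrow> 'x" and S :: "'x set"
  assumes finite_steps: "finite \<Sigma>" and steps_nonempty: "\<Sigma> \<noteq> {}" and finite_states: "finite S"
    and step_closed: "x \<in> S \<Longrightarrow> s \<in> \<Sigma> \<Longrightarrow> \<rho> x s \<in> S"
    and step_inj: "s \<in> \<Sigma> \<Longrightarrow> inj_on (\<lambda>x. \<rho> x s) S"
begin

lemma card_steps_pos: "real (card \<Sigma>) > 0"
  using finite_steps steps_nonempty by (simp add: card_gt_0_iff)

lemma walk_avg_add: "walk_avg \<Sigma> \<rho> (a + b) f x = walk_avg \<Sigma> \<rho> a (walk_avg \<Sigma> \<rho> b f) x"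
  by (induction a arbitrary: x) auto

lemma walk_avg_le: "(\<And>y. y \<in> S \<Longrightarrow> f y \<le> M) \<Longrightarrow> x \<in> S \<Longrightarrow> walk_avg \<Sigma> \<rho> k f x \<le> M"
proof (induction k arbitrary: x)
  case (Suc k)
  have "(\<Sum>s\<in>\<Sigma>. walk_avg \<Sigma> \<rho> k f (\<rho> x s)) \<le> (\<Sum>s\<in>\<Sigma>. M)"
    using Suc step_closed by (intro sum_mono) auto
  thus ?case using card_steps_pos by (simp add: divide_le_eq mult.commute)
qed auto

lemma walk_avg_ge: "(\<And>y. y \<in> S \<Longrightarrow> M \<le> f y) \<Longrightarrow> x \<in> S \<Longrightarrow> M \<le> walk_avg \<Sigma> \<rho> k f x"
proof (induction k arbitrary: x)
  case (Suc k)
  have "(\<Sum>s\<in>\<Sigma>. M) \<le> (\<Sum>s\<in>\<Sigma>. walk_avg \<Sigma> \<rho> k f (\<rho> x s))"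
    using Suc step_closed by (intro sum_mono) auto
  thus ?case using card_steps_pos by (simp add: le_divide_eq mult.commute)
qed auto

lemma walk_avg_le_along_word:
  "set xs \<subseteq> \<Sigma> \<Longrightarrow> x \<in> S \<Longrightarrow> (\<And>y. y \<in> S \<Longrightarrow> f y \<le> M) \<Longrightarrow>
   walk_avg \<Sigma> \<rho> (length xs) f x \<le> M - (M - f (foldl \<rho> x xs)) / real (card \<Sigma>) ^ length xs"
proof (induction xs arbitrary: x)
  case (Cons s xs)
  let ?c = "real (card \<Sigma>)" and ?w = "walk_avg \<Sigma> \<rho> (length xs) f"
  let ?d = "(M - f (foldl \<rho> (\<rho> x s) xs)) / ?c ^ length xs"
  have s: "s \<in> \<Sigma>" "\<rho> x s \<in> S" using Cons.prems step_closed by auto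
  have "(\<Sum>t\<in>\<Sigma>. ?w (\<rho> x t)) = ?w (\<rho> x s) + (\<Sum>t\<in>\<Sigma> - {s}. ?w (\<rho> x t))"
    using s finite_steps by (simp add: sum.remove)
  also have "\<dots> \<le> (M - ?d) + (\<Sum>t\<in>\<Sigma> - {s}. M)"
    using Cons s step_closed walk_avg_le by (intro add_mono sum_mono) auto
  also have "\<dots> = ?c * M - ?d"
    using s finite_steps card_steps_pos
    by (simp add: of_nat_diff algebra_simps Suc_leI card_gt_0_iff)
  finally have "(\<Sum>t\<in>\<Sigma>. ?w (\<rho> x t)) / ?c \<le> (?c * M - ?d) / ?c"
    using card_steps_pos by (intro divide_right_mono) auto
  also have "\<dots> = M - (M - f (foldl \<rho> x (s # xs))) / ?c ^ length (s # xs)"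
    using card_steps_pos by (simp add: field_simps)
  finally show ?case by simp
qed auto

lemma sum_walk_avg: "(\<Sum>x\<in>S. walk_avg \<Sigma> \<rho> k f x) = (\<Sum>x\<in>S. f x)"
proof (induction k)
  case (Suc k)
  have bij: "bij_betw (\<lambda>x. \<rho> x s) S S" if "s \<in> \<Sigma>" for s
    unfolding bij_betw_def
    using step_inj[OF that] endo_inj_surj[OF finite_states _ step_inj[OF that]] step_closed that by blast
  have "(\<Sum>x\<in>S. walk_avg \<Sigma> \<rho> (Suc k) f x)
      = (\<Sum>x\<in>S. \<Sum>s\<in>\<Sigma>. walk_avg \<Sigma> \<rho> k f (\<rho> x s)) / real (card \<Sigma>)"
    by (simp add: sum_divide_distrib)
  also have "(\<Sum>x\<in>S. \<Sum>s\<in>\<Sigma>. walk_avg \<Sigma> \<rho> k f (\<rho> x s)) = (\<Sum>s\<in>\<Sigma>. \<Sum>x\<in>S. walk_avg \<Sigma> \<rho> k f (\<rho> x s))"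
    by (rule sum.swap)
  also have "\<dots> = (\<Sum>s\<in>\<Sigma>. \<Sum>x\<in>S. walk_avg \<Sigma> \<rho> k f x)"
    by (intro sum.cong refl sum.reindex_bij_betw bij)
  finally show ?case using Suc card_steps_pos by simp
qed simp

context
  fixes m :: nat and f :: "'x \<Rightarrow> real"
  assumes connected: "\<And>x y. x \<in> S \<Longrightarrow> y \<in> S \<Longrightarrow> \<exists>xs. length xs = m \<and> set xs \<subseteq> \<Sigma> \<and> foldl \<rho> x xs = y"
    and f: "\<And>x. x \<in> S \<Longrightarrow> 0 \<le> f x" "\<And>x. x \<in> S \<Longrightarrow> f x \<le> 1"
begin

lemma walk_avg_oscillation:
  assumes "x \<in> S" "y \<in> S"
  shows "walk_avg \<Sigma> \<rho> (j * m + r) f x - walk_avg \<Sigma> \<rho> (j * m + r) f y \<le> (1 - 1 / real (card \<Sigma>) ^ m) ^ j"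
  using assms
proof (induction j arbitrary: x y)
  case 0
  have "walk_avg \<Sigma> \<rho> r f x \<le> 1" "0 \<le> walk_avg \<Sigma> \<rho> r f y" using 0 f walk_avg_le walk_avg_ge by auto
  thus ?case by simp
next
  case (Suc j)
  let ?g = "walk_avg \<Sigma> \<rho> (j * m + r) f" and ?\<delta> = "1 / real (card \<Sigma>) ^ m"
  have "real (card \<Sigma>) \<ge> 1" using card_steps_pos by simp
  hence \<delta>: "?\<delta> \<le> 1" by simp
  have ne: "S \<noteq> {}" using Suc.prems by auto
  obtain x1 where x1: "x1 \<in> S" "\<And>z. z \<in> S \<Longrightarrow> ?g z \<le> ?g x1"
    using obtains_MAX[OF finite_states ne, of ?g] Max_ge[OF finite_imageI[OF finite_states], of _ ?g]
    by (metis imageI)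
  obtain y1 where y1: "y1 \<in> S" "\<And>z. z \<in> S \<Longrightarrow> ?g y1 \<le> ?g z"
    using obtains_MIN[OF finite_states ne, of ?g] Min_le[OF finite_imageI[OF finite_states], of _ ?g]
    by (metis imageI)
  obtain xs where xs: "length xs = m" "set xs \<subseteq> \<Sigma>" "foldl \<rho> x xs = y1"
    using connected Suc.prems y1 by blast
  have "walk_avg \<Sigma> \<rho> m ?g x \<le> ?g x1 - (?g x1 - ?g y1) * ?\<delta>"
    using walk_avg_le_along_word[OF xs(2) Suc.prems(1) x1(2)] xs by simp
  moreover have "?g y1 \<le> walk_avg \<Sigma> \<rho> m ?g y"
    using walk_avg_ge[of "?g y1" ?g y m] y1 Suc.prems by blast
  ultimately have "walk_avg \<Sigma> \<rho> m ?g x - walk_avg \<Sigma> \<rho> m ?g y \<le> (?g x1 - ?g y1) * (1 - ?\<delta>)"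
    by (simp add: algebra_simps)
  also have "\<dots> \<le> (1 - ?\<delta>) ^ j * (1 - ?\<delta>)"
    using Suc.IH[OF x1(1) y1(1)] \<delta> by (intro mult_right_mono) auto
  finally show ?case using walk_avg_add[of m "j * m + r" f] by (simp add: add.assoc mult.commute)
qed

lemma walk_equidistributed:
  assumes "m > 0" "\<epsilon> > 0"
  shows "\<exists>K. \<forall>k\<ge>K. \<forall>x\<in>S. walk_avg \<Sigma> \<rho> k f x \<le> (\<Sum>y\<in>S. f y) / real (card S) + \<epsilon>"
proof -
  define \<delta> where "\<delta> = 1 / real (card \<Sigma>) ^ m"
  have "real (card \<Sigma>) \<ge> 1" using card_steps_pos by simp
  hence \<delta>: "0 < \<delta>" "\<delta> \<le> 1" using card_steps_pos by (auto simp: \<delta>_def)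
  obtain j0 where j0: "(1 - \<delta>) ^ j0 < \<epsilon>" using real_arch_pow_inv[of \<epsilon> "1 - \<delta>"] \<delta> \<open>\<epsilon> > 0\<close> by auto
  show ?thesis
  proof (intro exI[of _ "j0 * m"] allI impI ballI)
    fix k x assume k: "k \<ge> j0 * m" and x: "x \<in> S"
    have "j0 \<le> k div m" using k \<open>m > 0\<close> by (metis div_le_mono nonzero_mult_div_cancel_right not_gr_zero)
    hence "(1 - \<delta>) ^ (k div m) \<le> (1 - \<delta>) ^ j0" using \<delta> by (intro power_decreasing) auto
    hence close: "walk_avg \<Sigma> \<rho> k f x - walk_avg \<Sigma> \<rho> k f y \<le> \<epsilon>" if "y \<in> S" for y
      using walk_avg_oscillation[OF x that, of "k div m" "k mod m"] j0 unfolding \<delta>_def by simp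
    have card_S: "real (card S) > 0" using x finite_states by (auto simp: card_gt_0_iff)
    have "real (card S) * walk_avg \<Sigma> \<rho> k f x
        = (\<Sum>y\<in>S. (walk_avg \<Sigma> \<rho> k f x - walk_avg \<Sigma> \<rho> k f y)) + (\<Sum>y\<in>S. f y)"
      using sum_walk_avg[of k f] by (simp add: sum_subtractf)
    also have "(\<Sum>y\<in>S. (walk_avg \<Sigma> \<rho> k f x - walk_avg \<Sigma> \<rho> k f y)) \<le> (\<Sum>y\<in>S. \<epsilon>)"
      using close by (intro sum_mono)
    finally show "walk_avg \<Sigma> \<rho> k f x \<le> (\<Sum>y\<in>S. f y) / real (card S) + \<epsilon>"
      using card_S by (simp add: field_simps)
  qed
qed

end

end

lemma card_vec:
  fixes T :: "'n::finite \<Rightarrow> 'a set"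
  shows "card {v :: 'a^'n. \<forall>i. v$i \<in> T i} = (\<Prod>i\<in>UNIV. card (T i))"
    and "(\<And>i. finite (T i)) \<Longrightarrow> finite {v :: 'a^'n. \<forall>i. v$i \<in> T i}"
proof -
  have bij: "bij_betw vec_lambda (PiE UNIV T) {v :: 'a^'n. \<forall>i. v$i \<in> T i}"
    by (rule bij_betw_byWitness[where f' = vec_nth]) (auto simp: PiE_iff)
  show "card {v :: 'a^'n. \<forall>i. v$i \<in> T i} = (\<Prod>i\<in>UNIV. card (T i))"
    using bij_betw_same_card[OF bij] by (simp add: card_PiE)
  show "finite {v :: 'a^'n. \<forall>i. v$i \<in> T i}" if "\<And>i. finite (T i)"
    using bij_betw_finite[OF bij] that by (simp add: finite_PiE)
qed

text \<open>Matrices over the field of \<open>p\<close> elements are represented by their entries in \<open>{0..<p}\<close>.\<close>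

definition residue_mats :: "nat \<Rightarrow> (int^'n^'n) set" where
  "residue_mats p = {A. \<forall>i j. A$i$j \<in> {0..<int p}}"

definition SL_mod :: "nat \<Rightarrow> (int^'n^'n) set" where
  "SL_mod p = {A\<in>residue_mats p. int p dvd det A - 1}"

definition reduce_mod :: "nat \<Rightarrow> int^'n^'n \<Rightarrow> int^'n^'n" where
  "reduce_mod p A = (\<chi> i j. A$i$j mod int p)"

lemma residue_mats_eq_vec:
  "residue_mats p = {A :: int^'n^'n. \<forall>i. A$i \<in> {v. \<forall>j. v$j \<in> {0..<int p}}}"
  by (auto simp: residue_mats_def)

lemma finite_residue_mats: "finite (residue_mats p)"
  unfolding residue_mats_eq_vec by (intro card_vec(2)) auto

lemma finite_SL_mod: "finite (SL_mod p)"
  by (rule finite_subset[OF _ finite_residue_mats]) (auto simp: SL_mod_def)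

lemma reduce_mod_cong: "mat_cong p (reduce_mod p A) A"
  by (simp add: mat_cong_def reduce_mod_def mod_eq_dvd_iff[symmetric])

lemma reduce_mod_in_residue_mats: "p > 0 \<Longrightarrow> reduce_mod p A \<in> residue_mats p"
  by (simp add: residue_mats_def reduce_mod_def)

lemma reduce_mod_eq_iff: "reduce_mod p A = reduce_mod p B \<longleftrightarrow> mat_cong p A B"
  by (simp add: mat_cong_def reduce_mod_def vec_eq_iff mod_eq_dvd_iff)

lemma reduce_mod_id: "A \<in> residue_mats p \<Longrightarrow> reduce_mod p A = A"
  by (simp add: residue_mats_def reduce_mod_def vec_eq_iff)

lemma reduce_mod_in_SL_mod:
  assumes "p > 0" "int p dvd det A - 1" shows "reduce_mod p A \<in> SL_mod p"
proof -
  have "int p dvd det (reduce_mod p A) - det A" by (rule mat_cong_det[OF reduce_mod_cong])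
  hence "int p dvd det (reduce_mod p A) - 1" using dvd_add[OF _ assms(2)] by fastforce
  thus ?thesis using reduce_mod_in_residue_mats assms by (auto simp: SL_mod_def)
qed

definition word_prod :: "(int^'n^'n) list \<Rightarrow> int^'n^'n" where
  "word_prod xs = foldl (**) (mat 1) xs"

lemma foldl_mat_mult: "foldl (**) A xs = A ** word_prod xs" for A :: "int^'n^'n"
  unfolding word_prod_def
proof (induction xs arbitrary: A)
  case (Cons x xs)
  show ?case using Cons[of "A ** x"] Cons[of x] by (simp add: matrix_mul_assoc)
qed simp

lemma word_prod_append: "word_prod (xs @ ys) = word_prod xs ** word_prod ys"
  unfolding word_prod_def foldl_append by (rule foldl_mat_mult[unfolded word_prod_def])

lemma word_prod_Nil [simp]: "word_prod [] = mat 1"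
  by (simp add: word_prod_def)

lemma word_prod_Cons: "word_prod (x # xs) = x ** word_prod xs"
  using foldl_mat_mult[of x xs] by (simp add: word_prod_def)

locale generated_SLZ =
  fixes \<Sigma> :: "(int^'n^'n) set" and J :: "nat set"
  assumes n3: "CARD('n) \<ge> 3" and finite_gens: "finite \<Sigma>" and gens_SLZ: "\<Sigma> \<subseteq> SLZ"
    and gen: "gen_by \<Sigma> = SLZ" and finite_J: "finite J" and prime_J: "p \<in> J \<Longrightarrow> prime p"
begin

definition cong_J :: "int^'n^'n \<Rightarrow> int^'n^'n \<Rightarrow> bool" (infix "\<sim>\<^sub>J" 50) where
  "A \<sim>\<^sub>J B \<longleftrightarrow> (\<forall>p\<in>J. mat_cong p A B)"

lemma cong_J_refl: "A \<sim>\<^sub>J A"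
  unfolding cong_J_def using mat_cong_refl by blast

lemma cong_J_sym: "A \<sim>\<^sub>J B \<Longrightarrow> B \<sim>\<^sub>J A"
  unfolding cong_J_def using mat_cong_sym by blast

lemma cong_J_trans [trans]: "A \<sim>\<^sub>J B \<Longrightarrow> B \<sim>\<^sub>J C \<Longrightarrow> A \<sim>\<^sub>J C"
  unfolding cong_J_def by (auto intro: mat_cong_trans[of _ A B C])

lemma cong_J_mult: "A \<sim>\<^sub>J B \<Longrightarrow> C \<sim>\<^sub>J D \<Longrightarrow> A ** C \<sim>\<^sub>J B ** D"
  unfolding cong_J_def by (auto intro: mat_cong_mult)

definition residues :: "int^'n^'n \<Rightarrow> nat \<Rightarrow> int^'n^'n" where
  "residues A = (\<lambda>p\<in>J. reduce_mod p A)"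

abbreviation SL_mod_J :: "(nat \<Rightarrow> int^'n^'n) set" where
  "SL_mod_J \<equiv> PiE J SL_mod"

lemma residues_eq_iff: "residues A = residues B \<longleftrightarrow> A \<sim>\<^sub>J B"
proof
  assume "residues A = residues B"
  hence "residues A p = residues B p" for p by simp
  thus "A \<sim>\<^sub>J B" unfolding cong_J_def reduce_mod_eq_iff[symmetric] residues_def by (metis restrict_apply')
next
  assume "A \<sim>\<^sub>J B"
  thus "residues A = residues B"
    unfolding cong_J_def reduce_mod_eq_iff[symmetric] residues_def by (intro restrict_ext) blast
qed

lemma residues_in: "det A = 1 \<Longrightarrow> residues A \<in> SL_mod_J"
  unfolding residues_def
  by (intro restrict_PiE_iff[THEN iffD2] ballI reduce_mod_in_SL_mod) (auto dest: prime_J prime_gt_0_nat)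

lemma finite_SL_mod_J: "finite SL_mod_J"
  using finite_J finite_SL_mod by (intro finite_PiE) auto

lemma residues_onto:
  assumes "x \<in> SL_mod_J" shows "\<exists>B\<in>elementary_group. residues B = x"
proof -
  have "int p dvd det (x p) - 1" if "p \<in> J" for p using assms that by (auto simp: SL_mod_def PiE_iff)
  then obtain B where B: "B \<in> elementary_group" "\<And>p. p \<in> J \<Longrightarrow> mat_cong p B (x p)"
    using elementary_group_onto_SL_mod_primes[OF finite_J prime_J, of x] by blast
  have "residues B p = x p" for p
  proof (cases "p \<in> J")
    case True
    hence "reduce_mod p B = reduce_mod p (x p)" using B reduce_mod_eq_iff by blast
    also have "\<dots> = x p" using assms True by (intro reduce_mod_id) (auto simp: SL_mod_def PiE_iff)
    finally show ?thesis using True by (simp add: residues_def)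
  next
    case False
    thus ?thesis using PiE_arb[OF assms False] by (simp add: residues_def)
  qed
  thus ?thesis using B by blast
qed

lemma inverse_mod_J:
  assumes "det A = 1" shows "\<exists>B. A ** B \<sim>\<^sub>J mat 1 \<and> B ** A \<sim>\<^sub>J mat 1"
proof -
  obtain C where C: "C \<in> elementary_group" "C \<sim>\<^sub>J A"
    using residues_onto[OF residues_in[OF assms]] residues_eq_iff by blast
  obtain B where B: "C ** B = mat 1" "B ** C = mat 1" using elementary_group_inverse[OF C(1)] by blast
  have "A ** B \<sim>\<^sub>J C ** B" "B ** A \<sim>\<^sub>J B ** C"
    using C(2) cong_J_sym by (intro cong_J_mult cong_J_refl; blast)+
  thus ?thesis unfolding B by blast
qed

lemma cong_J_cancel_left:
  assumes "det A = 1" "A ** B \<sim>\<^sub>J A ** C" shows "B \<sim>\<^sub>J C"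
proof -
  obtain A' where A': "A' ** A \<sim>\<^sub>J mat 1" using inverse_mod_J[OF assms(1)] by blast
  have "mat 1 ** B \<sim>\<^sub>J A' ** A ** B" by (intro cong_J_mult cong_J_refl cong_J_sym[OF A'])
  also have "A' ** A ** B = A' ** (A ** B)" by (simp add: matrix_mul_assoc)
  also have "\<dots> \<sim>\<^sub>J A' ** (A ** C)" by (intro cong_J_mult cong_J_refl assms(2))
  also have "A' ** (A ** C) = A' ** A ** C" by (simp add: matrix_mul_assoc)
  also have "\<dots> \<sim>\<^sub>J mat 1 ** C" by (intro cong_J_mult cong_J_refl A')
  finally show ?thesis by simp
qed

lemma cong_J_cancel_right:
  assumes "det A = 1" "B ** A \<sim>\<^sub>J C ** A" shows "B \<sim>\<^sub>J C"
proof -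
  obtain A' where A': "A ** A' \<sim>\<^sub>J mat 1" using inverse_mod_J[OF assms(1)] by blast
  have "B ** mat 1 \<sim>\<^sub>J B ** (A ** A')" by (intro cong_J_mult cong_J_refl cong_J_sym[OF A'])
  also have "B ** (A ** A') = (B ** A) ** A'" by (simp add: matrix_mul_assoc)
  also have "\<dots> \<sim>\<^sub>J (C ** A) ** A'" by (intro cong_J_mult cong_J_refl assms(2))
  also have "(C ** A) ** A' = C ** (A ** A')" by (simp add: matrix_mul_assoc)
  also have "\<dots> \<sim>\<^sub>J C ** mat 1" by (intro cong_J_mult cong_J_refl A')
  finally show ?thesis by simp
qed

lemma det_gen: "s \<in> \<Sigma> \<Longrightarrow> det s = 1"
  using gens_SLZ by (auto simp: SLZ_def)

lemma det_word_prod: "set xs \<subseteq> \<Sigma> \<Longrightarrow> det (word_prod xs) = 1"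
  by (induction xs) (auto simp: word_prod_Cons det_mul det_gen)

lemma ex_distinct_index: "\<exists>k::'n. k \<noteq> i \<and> k \<noteq> j"
proof -
  have "card {i, j} < CARD('n)" using n3 by (simp add: card_insert_if)
  thus ?thesis by (metis (full_types) UNIV_eq_I insertCI less_irrefl)
qed

lemma gens_nonempty: "\<Sigma> \<noteq> {}"
proof
  assume empty: "\<Sigma> = {}"
  have trivial: "x = mat 1" if "x \<in> gen_by \<Sigma>" for x
    using that empty by (induction rule: gen_by.induct) auto
  obtain i j :: 'n where ij: "i \<noteq> j" using ex_distinct_index by metis
  have "elementary_mat i j 1 \<in> gen_by \<Sigma>"
    using elementary_group_mat[OF ij] elementary_group_subset_SLZ gen by blast
  hence "elementary_mat i j 1 $ i $ j = mat 1 $ i $ j" using trivial by metis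
  thus False using ij by (simp add: elementary_mat_def mat_def)
qed

lemma word_prod_replicate_add:
  "word_prod (replicate (a + b) s) = word_prod (replicate a s) ** word_prod (replicate b s)"
  by (simp add: replicate_add word_prod_append)

lemma gen_order:
  assumes s: "s \<in> \<Sigma>" shows "\<exists>e>0. word_prod (replicate e s) \<sim>\<^sub>J mat 1"
proof -
  let ?w = "\<lambda>k. word_prod (replicate k s)"
  have det: "det (?w k) = 1" for k using s by (intro det_word_prod) auto
  have "range (\<lambda>k. residues (?w k)) \<subseteq> SL_mod_J" using det residues_in by blast
  hence "finite (range (\<lambda>k. residues (?w k)))" using finite_SL_mod_J finite_subset by blast
  hence "\<not> inj (\<lambda>k. residues (?w k))" using range_inj_infinite by blast
  then obtain a b where ab: "a < b" "?w b \<sim>\<^sub>J ?w a"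
    unfolding inj_def residues_eq_iff by (metis cong_J_sym nat_neq_iff)
  have "?w a ** ?w (b - a) \<sim>\<^sub>J ?w a ** mat 1"
    using ab word_prod_replicate_add[of a "b - a" s] by simp
  hence "?w (b - a) \<sim>\<^sub>J mat 1" by (rule cong_J_cancel_left[OF det])
  thus ?thesis using ab(1) by (intro exI[of _ "b - a"]) auto
qed

lemma gens_exponent: "\<exists>e>0. \<forall>s\<in>\<Sigma>. word_prod (replicate e s) \<sim>\<^sub>J mat 1"
proof -
  obtain f where f: "\<And>s. s \<in> \<Sigma> \<Longrightarrow> f s > 0 \<and> word_prod (replicate (f s) s) \<sim>\<^sub>J mat 1"
    using gen_order by metis
  have multiple: "word_prod (replicate (a * c) s) \<sim>\<^sub>J mat 1"
    if "word_prod (replicate a s) \<sim>\<^sub>J mat 1" for a c s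
  proof (induction c)
    case (Suc c)
    have "word_prod (replicate (a * Suc c) s) = word_prod (replicate a s) ** word_prod (replicate (a * c) s)"
      by (simp add: word_prod_replicate_add)
    also have "\<dots> \<sim>\<^sub>J mat 1 ** mat 1" by (intro cong_J_mult that Suc)
    finally show ?case by simp
  qed (simp add: cong_J_refl)
  show ?thesis
  proof (intro exI[of _ "prod f \<Sigma>"] conjI ballI)
    show "prod f \<Sigma> > 0" using f by (simp add: prod_pos)
    fix s assume s: "s \<in> \<Sigma>"
    have "prod f \<Sigma> = f s * prod f (\<Sigma> - {s})" using s finite_gens by (simp add: prod.remove)
    thus "word_prod (replicate (prod f \<Sigma>) s) \<sim>\<^sub>J mat 1" using multiple f[OF s] by simp
  qed
qed

definition reachable :: "nat \<Rightarrow> int^'n^'n \<Rightarrow> bool" where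
  "reachable k g \<longleftrightarrow> (\<exists>xs. length xs = k \<and> set xs \<subseteq> \<Sigma> \<and> word_prod xs \<sim>\<^sub>J g)"

lemma reachable_word: "set xs \<subseteq> \<Sigma> \<Longrightarrow> word_prod xs \<sim>\<^sub>J g \<Longrightarrow> reachable (length xs) g"
  unfolding reachable_def by blast

lemma reachable_mult:
  assumes "reachable k g" "reachable l h" shows "reachable (k + l) (g ** h)"
proof -
  obtain xs ys where "length xs = k" "set xs \<subseteq> \<Sigma>" "word_prod xs \<sim>\<^sub>J g"
    "length ys = l" "set ys \<subseteq> \<Sigma>" "word_prod ys \<sim>\<^sub>J h"
    using assms unfolding reachable_def by blast
  thus ?thesis unfolding reachable_def
    by (intro exI[of _ "xs @ ys"]) (simp add: word_prod_append cong_J_mult)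
qed

lemma reachable_cong: "reachable k g \<Longrightarrow> g \<sim>\<^sub>J h \<Longrightarrow> reachable k h"
  unfolding reachable_def using cong_J_trans by blast

context
  fixes e :: nat
  assumes e_pos: "e > 0" and exponent: "s \<in> \<Sigma> \<Longrightarrow> word_prod (replicate e s) \<sim>\<^sub>J mat 1"
begin

lemma reachable_one: "reachable e (mat 1)"
proof -
  obtain s where "s \<in> \<Sigma>" using gens_nonempty by blast
  thus ?thesis using reachable_word[of "replicate e s"] exponent e_pos by simp
qed

lemma gen_mult_inverse: "s \<in> \<Sigma> \<Longrightarrow> s ** word_prod (replicate (e - 1) s) \<sim>\<^sub>J mat 1"
  using exponent[of s] e_pos by (cases e) (auto simp: word_prod_Cons)

lemma reachable_if_generated: "g \<in> gen_by \<Sigma> \<Longrightarrow> \<exists>k. reachable k g"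
proof (induction rule: gen_by.induct)
  case gen_one
  show ?case using reachable_one by blast
next
  case (gen_mult x s)
  have "reachable 1 s" using reachable_word[of "[s]" s] gen_mult by (simp add: cong_J_refl word_prod_Cons)
  thus ?case using gen_mult reachable_mult by blast
next
  case (gen_inv x s y)
  let ?r = "replicate (e - 1) s"
  have "s ** word_prod ?r \<sim>\<^sub>J s ** y" using gen_inv gen_mult_inverse by simp
  hence "word_prod ?r \<sim>\<^sub>J y" by (rule cong_J_cancel_left[OF det_gen[OF gen_inv(2)]])
  hence "reachable (e - 1) y" using reachable_word[of ?r y] gen_inv(2)
    by (auto simp: set_replicate_conv_if split: if_splits)
  thus ?case using gen_inv reachable_mult by blast
qed

lemma inverse_word:
  "set xs \<subseteq> \<Sigma> \<Longrightarrow> \<exists>ys. length ys = (e - 1) * length xs \<and> set ys \<subseteq> \<Sigma> \<and> word_prod xs ** word_prod ys \<sim>\<^sub>J mat 1"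
proof (induction xs)
  case Nil
  show ?case by (simp add: cong_J_refl)
next
  case (Cons s xs)
  then obtain ys where ys: "length ys = (e - 1) * length xs" "set ys \<subseteq> \<Sigma>"
    "word_prod xs ** word_prod ys \<sim>\<^sub>J mat 1" by auto
  let ?r = "replicate (e - 1) s"
  have "word_prod (s # xs) ** word_prod (ys @ ?r) = s ** (word_prod xs ** word_prod ys) ** word_prod ?r"
    unfolding word_prod_append word_prod_Cons by (simp add: matrix_mul_assoc)
  also have "\<dots> \<sim>\<^sub>J s ** mat 1 ** word_prod ?r" by (intro cong_J_mult cong_J_refl ys)
  also have "s ** mat 1 ** word_prod ?r = s ** word_prod ?r" by simp
  also have "\<dots> \<sim>\<^sub>J mat 1" using gen_mult_inverse Cons.prems by auto
  finally show ?case using ys Cons.prems by (intro exI[of _ "ys @ ?r"]) auto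
qed

lemma reachable_inverse:
  assumes "reachable k g" "h ** g = mat 1" shows "reachable ((e - 1) * k) h"
proof -
  obtain xs where xs: "length xs = k" "set xs \<subseteq> \<Sigma>" "word_prod xs \<sim>\<^sub>J g"
    using assms(1) unfolding reachable_def by blast
  obtain ys where ys: "length ys = (e - 1) * k" "set ys \<subseteq> \<Sigma>" "word_prod xs ** word_prod ys \<sim>\<^sub>J mat 1"
    using inverse_word[OF xs(2)] xs(1) by auto
  have "word_prod ys = h ** (g ** word_prod ys)" using assms(2) by (simp add: matrix_mul_assoc)
  also have "\<dots> \<sim>\<^sub>J h ** (word_prod xs ** word_prod ys)"
    by (intro cong_J_mult cong_J_refl cong_J_sym[OF xs(3)])
  also have "\<dots> \<sim>\<^sub>J h ** mat 1" by (intro cong_J_mult cong_J_refl ys)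
  finally show ?thesis unfolding reachable_def using ys by auto
qed

text \<open>The words for a commutator can be chosen of length divisible by \<open>e\<close>. Since \<open>SL\<^sub>n\<close> is
  generated by commutators, the walk has no periodicity.\<close>

lemma reachable_commutator:
  assumes gh: "g \<in> SLZ" "h \<in> SLZ" and inv: "g' ** g = mat 1" "h' ** h = mat 1"
  shows "\<exists>c. reachable (e * c) (g ** h ** g' ** h')"
proof -
  obtain k l where kl: "reachable k g" "reachable l h"
    using reachable_if_generated gh unfolding gen by blast
  have "reachable (k + l + (e - 1) * k + (e - 1) * l) (g ** h ** g' ** h')"
    by (intro reachable_mult kl reachable_inverse[OF kl(1) inv(1)] reachable_inverse[OF kl(2) inv(2)])
  moreover have "k + l + (e - 1) * k + (e - 1) * l = e * (k + l)"
    using e_pos by (cases e) (auto simp: algebra_simps)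
  ultimately show ?thesis by auto
qed

lemma reachable_elementary_mat:
  fixes i j :: 'n
  assumes "i \<noteq> j" shows "\<exists>c. reachable (e * c) (elementary_mat i j t)"
proof -
  obtain k where k: "k \<noteq> i" "k \<noteq> j" using ex_distinct_index by blast
  have "\<exists>c. reachable (e * c)
      (elementary_mat i k t ** elementary_mat k j 1 ** elementary_mat i k (- t) ** elementary_mat k j (- 1))"
  proof (rule reachable_commutator)
    show "elementary_mat i k t \<in> SLZ" "elementary_mat k j 1 \<in> SLZ"
      using k by (auto intro!: subsetD[OF elementary_group_subset_SLZ] elementary_group_mat)
  qed (use k in \<open>auto simp: elementary_mat_mult_elementary_mat elementary_mat_0\<close>)
  thus ?thesis using elementary_mat_commutator[of i j k t] assms k by auto
qed

lemma reachable_elementary_group: "B \<in> elementary_group \<Longrightarrow> \<exists>c. reachable (e * c) B"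
proof (induction rule: elementary_group.induct)
  case elementary_one
  show ?case using reachable_one by (intro exI[of _ 1]) simp
next
  case (elementary_step A i j t)
  then obtain c d where "reachable (e * c) (elementary_mat i j t)" "reachable (e * d) A"
    using reachable_elementary_mat by blast
  hence "reachable (e * (c + d)) (elementary_mat i j t ** A)" using reachable_mult by (simp add: distrib_left)
  thus ?case by blast
qed

lemma reachable_mono:
  assumes "reachable (e * c) g" "c \<le> d" shows "reachable (e * d) g"
  using assms(2)
proof (induction d rule: dec_induct)
  case (step d)
  have "reachable (e * d + e) (g ** mat 1)" by (intro reachable_mult step.IH reachable_one)
  thus ?case by (simp add: algebra_simps)
qed (rule assms(1))

end

lemma elementary_group_uniformly_reachable: "\<exists>m>0. \<forall>B\<in>elementary_group. reachable m B"
proof -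
  obtain e where e: "e > 0" "\<And>s. s \<in> \<Sigma> \<Longrightarrow> word_prod (replicate e s) \<sim>\<^sub>J mat 1"
    using gens_exponent by blast
  have "\<exists>c. \<forall>B. residues B = x \<longrightarrow> reachable (e * c) B" if x: "x \<in> SL_mod_J" for x
  proof -
    obtain B where B: "B \<in> elementary_group" "residues B = x" using residues_onto[OF x] by blast
    obtain c where c: "reachable (e * c) B" using reachable_elementary_group[OF e B(1)] by blast
    have "reachable (e * c) B'" if "residues B' = x" for B'
      using reachable_cong[OF c] that B(2) residues_eq_iff by metis
    thus ?thesis by blast
  qed
  then obtain c where c: "\<And>x B. x \<in> SL_mod_J \<Longrightarrow> residues B = x \<Longrightarrow> reachable (e * c x) B" by metis
  define C where "C = (\<Sum>x\<in>SL_mod_J. c x)"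
  have "reachable (e * Suc C) B" if B: "B \<in> elementary_group" for B
  proof -
    have x: "residues B \<in> SL_mod_J" using residues_in elementary_group_det B by blast
    have "c (residues B) \<le> C" unfolding C_def using finite_SL_mod_J x by (intro member_le_sum) auto
    thus ?thesis using reachable_mono[OF e c[OF x refl], of "Suc C"] by simp
  qed
  thus ?thesis using e(1) by (intro exI[of _ "e * Suc C"]) auto
qed

definition residue_step :: "(nat \<Rightarrow> int^'n^'n) \<Rightarrow> int^'n^'n \<Rightarrow> nat \<Rightarrow> int^'n^'n" where
  "residue_step x s = (\<lambda>p\<in>J. reduce_mod p (x p ** s))"

lemma residue_step_residues: "residue_step (residues A) s = residues (A ** s)"
proof -
  have "reduce_mod p (reduce_mod p A ** s) = reduce_mod p (A ** s)" for p
    unfolding reduce_mod_eq_iff by (intro mat_cong_mult mat_cong_refl reduce_mod_cong)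
  thus ?thesis by (auto simp: residue_step_def residues_def fun_eq_iff)
qed

lemma foldl_residue_step: "foldl residue_step (residues A) xs = residues (A ** word_prod xs)"
proof (induction xs arbitrary: A)
  case (Cons x xs)
  thus ?case by (simp only: foldl_Cons residue_step_residues word_prod_Cons matrix_mul_assoc)
qed simp

lemma permutation_walk_residues: "permutation_walk \<Sigma> residue_step SL_mod_J"
proof (rule permutation_walk.intro[OF finite_gens gens_nonempty finite_SL_mod_J])
  fix x s assume "x \<in> SL_mod_J" "s \<in> \<Sigma>"
  then obtain A where A: "A \<in> elementary_group" "residues A = x" using residues_onto by blast
  have "det (A ** s) = 1"
    using elementary_group_det[OF A(1)] det_gen[OF \<open>s \<in> \<Sigma>\<close>] by (simp add: det_mul)
  thus "residue_step x s \<in> SL_mod_J" using A(2) residues_in residue_step_residues by metis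
next
  fix s assume s: "s \<in> \<Sigma>"
  show "inj_on (\<lambda>x. residue_step x s) SL_mod_J"
  proof (rule inj_onI)
    fix x y assume "x \<in> SL_mod_J" "y \<in> SL_mod_J" and eq: "residue_step x s = residue_step y s"
    then obtain A B where AB: "residues A = x" "residues B = y" using residues_onto by meson
    have "A ** s \<sim>\<^sub>J B ** s" using eq unfolding AB[symmetric] residue_step_residues residues_eq_iff .
    thus "x = y" using cong_J_cancel_right[OF det_gen[OF s]] AB residues_eq_iff by blast
  qed
qed

lemma residue_walk_connected:
  assumes m: "\<And>B. B \<in> elementary_group \<Longrightarrow> reachable m B" and xy: "x \<in> SL_mod_J" "y \<in> SL_mod_J"
  shows "\<exists>xs. length xs = m \<and> set xs \<subseteq> \<Sigma> \<and> foldl residue_step x xs = y"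
proof -
  obtain A B where A: "A \<in> elementary_group" "residues A = x"
    and B: "B \<in> elementary_group" "residues B = y" using residues_onto xy by meson
  obtain A' where A': "A' \<in> elementary_group" "A ** A' = mat 1" using elementary_group_inverse[OF A(1)] by blast
  obtain xs where xs: "length xs = m" "set xs \<subseteq> \<Sigma>" "word_prod xs \<sim>\<^sub>J A' ** B"
    using m[OF elementary_group_mult[OF A'(1) B(1)]] unfolding reachable_def by blast
  have "A ** word_prod xs \<sim>\<^sub>J A ** (A' ** B)" by (intro cong_J_mult cong_J_refl xs)
  also have "A ** (A' ** B) = B" using A' by (simp add: matrix_mul_assoc)
  finally have "foldl residue_step x xs = y"
    unfolding A(2)[symmetric] B(2)[symmetric] foldl_residue_step residues_eq_iff .
  thus ?thesis using xs by blast
qed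

lemma walk_prob_residues_le:
  assumes T: "T \<subseteq> SL_mod_J" and "\<epsilon> > 0"
  shows "\<exists>K. \<forall>k\<ge>K. walk_prob \<Sigma> k (\<lambda>X. residues X \<in> T) \<le> real (card T) / real (card SL_mod_J) + \<epsilon>"
proof -
  interpret permutation_walk \<Sigma> residue_step SL_mod_J by (rule permutation_walk_residues)
  obtain m where m: "m > 0" "\<And>B. B \<in> elementary_group \<Longrightarrow> reachable m B"
    using elementary_group_uniformly_reachable by blast
  let ?f = "\<lambda>y. if y \<in> T then 1 else 0 :: real"
  have "\<exists>K. \<forall>k\<ge>K. \<forall>x\<in>SL_mod_J. walk_avg \<Sigma> residue_step k ?f x
      \<le> (\<Sum>y\<in>SL_mod_J. ?f y) / real (card SL_mod_J) + \<epsilon>"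
    by (rule walk_equidistributed[OF residue_walk_connected[OF m(2)] _ _ m(1) \<open>\<epsilon> > 0\<close>]) auto
  moreover have "(\<Sum>y\<in>SL_mod_J. ?f y) = real (card T)"
    using T finite_SL_mod_J by (simp add: sum.If_cases Int_absorb1)
  moreover have "walk_prob \<Sigma> k (\<lambda>X. residues X \<in> T) = walk_avg \<Sigma> residue_step k ?f (residues (mat 1))" for k
    unfolding walk_prob_def card_words_eq_walk_avg[OF finite_gens, symmetric] foldl_residue_step word_prod_def
    by simp
  moreover have "residues (mat 1) \<in> SL_mod_J" by (rule residues_in) simp
  ultimately show ?thesis by metis
qed

lemma walk_avoids_product:
  assumes G: "\<And>p. p \<in> J \<Longrightarrow> G p \<subseteq> SL_mod p"
    and c: "\<And>p. p \<in> J \<Longrightarrow> real (card (G p)) \<ge> c * real (card (SL_mod p :: (int^'n^'n) set))"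
    and "\<epsilon> > 0"
  shows "\<exists>K. \<forall>k\<ge>K. walk_prob \<Sigma> k (\<lambda>X. \<forall>p\<in>J. reduce_mod p X \<notin> G p) \<le> (1 - c) ^ card J + \<epsilon>"
proof -
  let ?S = "\<lambda>p. SL_mod p :: (int^'n^'n) set" and ?T = "PiE J (\<lambda>p. SL_mod p - G p)"
  have "real (card ?T) / real (card SL_mod_J) = (\<Prod>p\<in>J. real (card (?S p - G p)) / real (card (?S p)))"
    using finite_J by (simp add: card_PiE prod_dividef)
  also have "\<dots> \<le> (\<Prod>p\<in>J. 1 - c)"
  proof (rule prod_mono)
    fix p assume p: "p \<in> J"
    have "reduce_mod p (mat 1) \<in> ?S p"
      using reduce_mod_in_SL_mod[OF prime_gt_0_nat[OF prime_J[OF p]], of "mat 1"] by simp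
    hence pos: "card (?S p) > 0" using finite_SL_mod card_gt_0_iff by blast
    have "real (card (?S p - G p)) = real (card (?S p)) - real (card (G p))"
      using card_Diff_subset[OF finite_subset[OF G[OF p] finite_SL_mod] G[OF p]]
        card_mono[OF finite_SL_mod G[OF p]] by simp
    hence "real (card (?S p - G p)) \<le> (1 - c) * real (card (?S p))"
      using c[OF p] by (simp add: algebra_simps)
    thus "0 \<le> real (card (?S p - G p)) / real (card (?S p))
        \<and> real (card (?S p - G p)) / real (card (?S p)) \<le> 1 - c"
      using pos by (simp add: divide_le_eq)
  qed
  finally have ratio: "real (card ?T) / real (card SL_mod_J) \<le> (1 - c) ^ card J" by simp
  have "(\<forall>p\<in>J. reduce_mod p (word_prod xs) \<notin> G p) \<longleftrightarrow> residues (word_prod xs) \<in> ?T" if "set xs \<subseteq> \<Sigma>" for xs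
    using residues_in[OF det_word_prod[OF that]] by (auto simp: residues_def PiE_iff)
  hence "{xs. set xs \<subseteq> \<Sigma> \<and> length xs = k \<and> (\<forall>p\<in>J. reduce_mod p (word_prod xs) \<notin> G p)}
      = {xs. set xs \<subseteq> \<Sigma> \<and> length xs = k \<and> residues (word_prod xs) \<in> ?T}" for k by blast
  hence "walk_prob \<Sigma> k (\<lambda>X. \<forall>p\<in>J. reduce_mod p X \<notin> G p) = walk_prob \<Sigma> k (\<lambda>X. residues X \<in> ?T)" for k
    unfolding walk_prob_def word_prod_def by simp
  moreover have "?T \<subseteq> SL_mod_J" by (intro PiE_mono) auto
  then obtain K where "\<And>k. k \<ge> K \<Longrightarrow>
      walk_prob \<Sigma> k (\<lambda>X. residues X \<in> ?T) \<le> real (card ?T) / real (card SL_mod_J) + \<epsilon>"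
    using walk_prob_residues_le[OF _ \<open>\<epsilon> > 0\<close>] by blast
  ultimately have "walk_prob \<Sigma> k (\<lambda>X. \<forall>p\<in>J. reduce_mod p X \<notin> G p) \<le> (1 - c) ^ card J + \<epsilon>" if "k \<ge> K" for k
    using ratio that by force
  thus ?thesis by blast
qed

end

section \<open>Counting polynomials of given factorisation type\<close>

abbreviation of_int_poly :: "int poly \<Rightarrow> complex poly" where "of_int_poly \<equiv> map_poly of_int"

definition monic_poly :: "nat \<Rightarrow> (nat \<Rightarrow> int) \<Rightarrow> int poly" where
  "monic_poly n c = monom 1 n + (\<Sum>i<n. monom (c i) i)"

lemma coeff_monic_poly: "coeff (monic_poly n c) i = (if i < n then c i else if i = n then 1 else 0)"
  by (auto simp: monic_poly_def coeff_sum)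

lemma coeff_prod_linear_top:
  fixes f :: "'i \<Rightarrow> 'a::idom"
  assumes "finite I"
  shows "coeff (\<Prod>k\<in>I. [:- f k, 1:]) (card I) = 1" "i > card I \<Longrightarrow> coeff (\<Prod>k\<in>I. [:- f k, 1:]) i = 0"
proof -
  have deg: "degree (\<Prod>k\<in>I. [:- f k, 1:]) = card I" by (subst degree_prod_eq_sum_degree) auto
  have "lead_coeff (\<Prod>k\<in>I. [:- f k, 1:]) = 1" by (simp add: lead_coeff_prod)
  thus "coeff (\<Prod>k\<in>I. [:- f k, 1:]) (card I) = 1" by (simp add: deg)
  show "i > card I \<Longrightarrow> coeff (\<Prod>k\<in>I. [:- f k, 1:]) i = 0" using deg by (simp add: coeff_eq_0)
qed

context subring_prime
begin

lemma root_cong_if_coeffs_cong: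
  assumes I: "finite I" "finite J" and R: "\<And>i. i \<in> I \<Longrightarrow> x i \<in> R" "\<And>j. j \<in> J \<Longrightarrow> y j \<in> R"
    and cong: "\<And>k. coeff (\<Prod>i\<in>I. [:- x i, 1:]) k \<equiv>\<^sub>P coeff (\<Prod>j\<in>J. [:- y j, 1:]) k"
    and "i \<in> I"
  obtains j where "j \<in> J" "x i \<equiv>\<^sub>P y j"
proof -
  have "poly (\<Prod>i\<in>I. [:- x i, 1:]) (x i) \<equiv>\<^sub>P poly (\<Prod>j\<in>J. [:- y j, 1:]) (x i)"
    by (rule cong_poly_coeffs[OF cong R(1)[OF \<open>i \<in> I\<close>]])
  moreover have "poly (\<Prod>i\<in>I. [:- x i, 1:]) (x i) = 0"
    using I(1) \<open>i \<in> I\<close> by (auto simp: poly_prod intro!: prod_zero)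
  ultimately have "poly (\<Prod>j\<in>J. [:- y j, 1:]) (x i) \<in> P"
    using cong_in_P_iff P_zero by metis
  hence "(\<Prod>j\<in>J. x i - y j) \<in> P" by (simp add: poly_prod)
  moreover have "x i - y j \<in> R" if "j \<in> J" for j using R \<open>i \<in> I\<close> that R_diff by blast
  ultimately show ?thesis using P_prodE[OF I(2), of "\<lambda>j. x i - y j"] that by blast
qed

lemma card_root_tuples_le:
  assumes R: "\<And>v k. v \<in> V \<Longrightarrow> k < n \<Longrightarrow> B v k \<in> R"
    and cong: "\<And>v w i. v \<in> V \<Longrightarrow> w \<in> V \<Longrightarrow>
      coeff (\<Prod>k<n. [:- B v k, 1:]) i \<equiv>\<^sub>P coeff (\<Prod>k<n. [:- B w k, 1:]) i"
    and inj: "\<And>v w. v \<in> V \<Longrightarrow> w \<in> V \<Longrightarrow> (\<And>k. k < n \<Longrightarrow> B v k \<equiv>\<^sub>P B w k) \<Longrightarrow> v = w"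
  shows "card V \<le> n ^ n"
proof (cases "V = {}")
  case False
  then obtain v0 where v0: "v0 \<in> V" by blast
  have "\<exists>l<n. B v k \<equiv>\<^sub>P B v0 l" if v: "v \<in> V" "k < n" for v k
    by (rule root_cong_if_coeffs_cong[of "{..<n}" "{..<n}" "B v" "B v0" k]) (use v v0 R cong in auto)
  then obtain \<kappa> where \<kappa>: "\<And>v k. v \<in> V \<Longrightarrow> k < n \<Longrightarrow> \<kappa> v k < n \<and> B v k \<equiv>\<^sub>P B v0 (\<kappa> v k)" by metis
  have "inj_on (\<lambda>v. restrict (\<kappa> v) {..<n}) V"
  proof (rule inj_onI)
    fix v w assume vw: "v \<in> V" "w \<in> V" and "restrict (\<kappa> v) {..<n} = restrict (\<kappa> w) {..<n}"
    hence "\<kappa> v k = \<kappa> w k" if "k < n" for k using that by (metis lessThan_iff restrict_apply')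
    hence "B v k \<equiv>\<^sub>P B w k" if "k < n" for k using \<kappa> vw that cong_trans cong_sym by metis
    thus "v = w" by (rule inj[OF vw])
  qed
  moreover have "restrict (\<kappa> v) {..<n} \<in> {..<n} \<rightarrow>\<^sub>E {..<n}" if "v \<in> V" for v
    using \<kappa>[OF that] by (simp add: restrict_PiE_iff)
  hence "(\<lambda>v. restrict (\<kappa> v) {..<n}) ` V \<subseteq> {..<n} \<rightarrow>\<^sub>E {..<n}" by blast
  ultimately have "card V \<le> card ({..<n} \<rightarrow>\<^sub>E {..<n})" by (rule card_inj_on_le) (simp add: finite_PiE)
  thus ?thesis by (simp add: card_PiE)
qed simp

end

definition cycle_succ :: "nat \<Rightarrow> nat \<Rightarrow> nat" where
  "cycle_succ m k = (if k < m then (if Suc k < m then Suc k else 0) else k)"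

lemma bij_cycle_succ: assumes "m \<le> n" shows "bij_betw (cycle_succ m) {..<n} {..<n}"
proof -
  have "inj_on (cycle_succ m) {..<n}" by (rule inj_onI) (auto simp: cycle_succ_def split: if_splits)
  moreover have "cycle_succ m ` {..<n} \<subseteq> {..<n}" using assms by (auto simp: cycle_succ_def)
  ultimately show ?thesis by (simp add: bij_betw_def endo_inj_surj)
qed

context prime_above
begin

lemma frobenius_diff:
  assumes "x \<in> \<O>" "y \<in> \<O>" shows "(x - y) ^ p \<equiv>\<^sub>P x ^ p - y ^ p"
proof -
  have "(x - y + y) ^ p \<equiv>\<^sub>P (x - y) ^ p + y ^ p" using assms by (intro frobenius_add R_diff)
  hence "x ^ p - y ^ p \<equiv>\<^sub>P (x - y) ^ p" by (simp add: algebra_simps)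
  thus ?thesis by (rule cong_sym)
qed

lemma coeff_prod_linear_power:
  assumes "finite I" "\<And>i. i \<in> I \<Longrightarrow> f i \<in> \<O>"
  shows "coeff (\<Prod>i\<in>I. [:- f i, 1:]) k ^ p \<equiv>\<^sub>P coeff (\<Prod>i\<in>I. [:- (f i ^ p), 1:]) k"
  using assms
proof (induction I arbitrary: k rule: finite_induct)
  case empty
  show ?case using p_gt_1 by (cases k) (auto simp: P_zero coeff_pCons one_pCons power_0_left)
next
  case (insert v I)
  let ?A = "\<Prod>i\<in>I. [:- f i, 1:]" and ?B = "\<Prod>i\<in>I. [:- (f i ^ p), 1:]"
  let ?shift = "\<lambda>q. case k of 0 \<Rightarrow> 0 | Suc j \<Rightarrow> coeff q j"
  have IH: "coeff ?A k ^ p \<equiv>\<^sub>P coeff ?B k" for k by (rule insert.IH) (use insert.prems in auto)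
  have A: "coeff ?A k \<in> \<O>" for k by (rule R_coeff_prod_linear) (use insert in auto)
  have B: "coeff ?B k \<in> \<O>" for k by (rule R_coeff_prod_linear) (use insert in \<open>auto intro: R_power\<close>)
  have v: "f v \<in> \<O>" using insert by simp
  have "(?shift ?A - f v * coeff ?A k) ^ p \<equiv>\<^sub>P ?shift ?A ^ p - (f v * coeff ?A k) ^ p"
    using A v R_zero by (intro frobenius_diff R_mult) (auto split: nat.split)
  moreover have "?shift ?A ^ p - (f v * coeff ?A k) ^ p \<equiv>\<^sub>P ?shift ?B - f v ^ p * coeff ?B k"
  proof (rule cong_diff)
    show "?shift ?A ^ p \<equiv>\<^sub>P ?shift ?B"
      using IH P_zero p_gt_1 by (auto split: nat.split simp: power_0_left)
    show "(f v * coeff ?A k) ^ p \<equiv>\<^sub>P f v ^ p * coeff ?B k"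
      unfolding power_mult_distrib using IH v B by (intro cong_mult cong_refl R_power) auto
  qed
  ultimately show ?case unfolding prod.insert[OF insert(1,2)] coeff_linear_mult by (rule cong_trans)
qed

lemma coeff_prod_linear_cong_int:
  assumes I: "finite I" "bij_betw \<pi> I I" and \<beta>: "\<And>k. k \<in> I \<Longrightarrow> \<beta> k \<in> \<O>"
    and frob: "\<And>k. k \<in> I \<Longrightarrow> \<beta> k ^ p \<equiv>\<^sub>P \<beta> (\<pi> k)"
  shows "\<exists>a\<in>{0..<int p}. coeff (\<Prod>k\<in>I. [:- \<beta> k, 1:]) i \<equiv>\<^sub>P of_int a"
proof (rule cong_int_if_frobenius_fixed)
  show "coeff (\<Prod>k\<in>I. [:- \<beta> k, 1:]) i \<in> \<O>" using I \<beta> by (intro R_coeff_prod_linear)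
  have "coeff (\<Prod>k\<in>I. [:- \<beta> k, 1:]) i ^ p \<equiv>\<^sub>P coeff (\<Prod>k\<in>I. [:- (\<beta> k ^ p), 1:]) i"
    by (rule coeff_prod_linear_power) (use I \<beta> in auto)
  moreover have "coeff (\<Prod>k\<in>I. [:- (\<beta> k ^ p), 1:]) i \<equiv>\<^sub>P coeff (\<Prod>k\<in>I. [:- \<beta> (\<pi> k), 1:]) i"
    by (rule cong_coeff_prod_linear) (use I \<beta> frob bij_betwE[OF I(2)] R_power in auto)
  moreover have "(\<Prod>k\<in>I. [:- \<beta> (\<pi> k), 1:]) = (\<Prod>k\<in>I. [:- \<beta> k, 1:])"
    by (rule prod.reindex_bij_betw[OF I(2), of "\<lambda>k. [:- \<beta> k, 1:]"])
  ultimately show "coeff (\<Prod>k\<in>I. [:- \<beta> k, 1:]) i ^ p \<equiv>\<^sub>P coeff (\<Prod>k\<in>I. [:- \<beta> k, 1:]) i"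
    using cong_trans[of "coeff (\<Prod>k\<in>I. [:- \<beta> k, 1:]) i ^ p"] by auto
qed

text \<open>Modulo \<open>P\<close>, the first \<open>m\<close> roots form one Frobenius orbit and the other roots lie in the prime
  field. The roots are different, and those in the prime field are different from \<open>\<plusminus>1\<close>.\<close>

definition frob_roots :: "nat \<Rightarrow> nat \<Rightarrow> (nat \<Rightarrow> complex) \<Rightarrow> bool" where
  "frob_roots n m \<beta> \<longleftrightarrow> (\<forall>k<n. \<beta> k \<in> \<O>) \<and> (\<forall>k<n. \<forall>l<n. \<beta> k \<equiv>\<^sub>P \<beta> l \<longrightarrow> k = l)
    \<and> (\<forall>k<n. \<beta> k ^ p \<equiv>\<^sub>P \<beta> (cycle_succ m k))
    \<and> (\<forall>k\<in>{m..<n}. \<exists>a::int. \<beta> k \<equiv>\<^sub>P of_int a \<and> \<not> int p dvd a - 1 \<and> \<not> int p dvd a + 1)"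

definition frob_type :: "nat \<Rightarrow> nat \<Rightarrow> int poly \<Rightarrow> bool" where
  "frob_type n m f \<longleftrightarrow> (\<exists>\<beta>. frob_roots n m \<beta>
    \<and> (\<forall>i. coeff (of_int_poly f) i \<equiv>\<^sub>P coeff (\<Prod>k<n. [:- \<beta> k, 1:]) i))"

lemma frob_roots_poly:
  assumes \<beta>: "frob_roots n m \<beta>" and "m \<le> n"
  obtains c where "c \<in> {..<n} \<rightarrow>\<^sub>E {0..<int p}"
    "\<And>i. coeff (of_int_poly (monic_poly n c)) i \<equiv>\<^sub>P coeff (\<Prod>k<n. [:- \<beta> k, 1:]) i"
proof -
  have "\<exists>a\<in>{0..<int p}. coeff (\<Prod>k<n. [:- \<beta> k, 1:]) i \<equiv>\<^sub>P of_int a" for i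
    by (rule coeff_prod_linear_cong_int[OF _ bij_cycle_succ[OF \<open>m \<le> n\<close>]])
      (use \<beta> in \<open>auto simp: frob_roots_def\<close>)
  then obtain c where c: "\<And>i. c i \<in> {0..<int p}" "\<And>i. coeff (\<Prod>k<n. [:- \<beta> k, 1:]) i \<equiv>\<^sub>P of_int (c i)"
    by metis
  show ?thesis
  proof (rule that[of "restrict c {..<n}"])
    show "restrict c {..<n} \<in> {..<n} \<rightarrow>\<^sub>E {0..<int p}" using c(1) by simp
    fix i
    consider "i < n" | "i = n" | "i > n" by linarith
    thus "coeff (of_int_poly (monic_poly n (restrict c {..<n}))) i \<equiv>\<^sub>P coeff (\<Prod>k<n. [:- \<beta> k, 1:]) i"
      using cong_sym[OF c(2)[of i]] coeff_prod_linear_top[where I = "{..<n}" and f = \<beta>]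
      by cases (simp_all add: coeff_map_poly coeff_monic_poly P_zero)
  qed
qed

lemma root_of_unity_in_alg_ints: "z ^ N = 1 \<Longrightarrow> N > 0 \<Longrightarrow> z \<in> \<O>"
  unfolding alg_ints_def mem_Collect_eq
  by (rule algebraic_int_root[of 1 "monom 1 N"]) (auto simp: poly_monom degree_monom_eq coeff_monom)

lemma root_of_unity_notin_P:
  assumes "z ^ N = 1" "N > 0" shows "z \<notin> P"
proof
  assume "z \<in> P"
  hence "z * z ^ (N - 1) \<in> P" using root_of_unity_in_alg_ints[OF assms] by (intro P_mult_right R_power)
  thus False using assms one_notin_P by (simp add: power_eq_if)
qed

lemma roots_of_unity_cong_imp_eq:
  assumes z: "z ^ N = 1" "w ^ N = 1" "N > 0" "\<not> p dvd N" and "z \<equiv>\<^sub>P w"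
  shows "z = w"
proof -
  define u where "u = z * w ^ (N - 1)"
  have w: "w * w ^ (N - 1) = 1" using z by (simp add: power_eq_if)
  have "u ^ N = z ^ N * (w ^ N) ^ (N - 1)"
    by (simp add: u_def power_mult_distrib power_mult[symmetric] mult.commute)
  hence uN: "u ^ N = 1" using z by simp
  have "u - 1 = (z - w) * w ^ (N - 1)" using w by (simp add: u_def algebra_simps)
  hence u1: "u \<equiv>\<^sub>P 1" using assms(5) root_of_unity_in_alg_ints[OF z(2,3)] by (auto intro!: P_mult_right R_power)
  have "u = 1"
  proof (rule ccontr)
    assume "u \<noteq> 1"
    hence "(\<Sum>j<N. u ^ j) = 0" using geometric_sum[of u N] uN by simp
    moreover have "(\<Sum>j<N. u ^ j) \<equiv>\<^sub>P (\<Sum>j<N. 1 ^ j)"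
      using cong_power[OF u1 root_of_unity_in_alg_ints[OF uN z(3)] R_one] by (intro cong_sum) auto
    ultimately have "of_int (int N) \<in> P" using cong_in_P_iff[of 0 "of_nat N"] P_zero by simp
    thus False using of_int_in_P_iff[of "int N"] z(4) by simp
  qed
  moreover have "z * (w * w ^ (N - 1)) = u * w" by (simp add: u_def mult_ac)
  ultimately show ?thesis unfolding w by simp
qed

text \<open>The Teichmueller representatives of the nonzero elements of the field with \<open>p ^ d\<close> elements.\<close>

definition teich :: "nat \<Rightarrow> complex set" where
  "teich d = {z. z ^ (p ^ d - 1) = 1}"

lemma prime_power_ge_2: "d > 0 \<Longrightarrow> p ^ d \<ge> 2"
  using p_gt_1 self_le_power[of p d] by linarith

lemma teich_exponent: "d > 0 \<Longrightarrow> p ^ d - 1 > 0" "d > 0 \<Longrightarrow> \<not> p dvd p ^ d - 1"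
proof -
  assume d: "d > 0"
  show "p ^ d - 1 > 0" using prime_power_ge_2[OF d] by simp
  show "\<not> p dvd p ^ d - 1"
  proof
    assume "p dvd p ^ d - 1"
    hence "p dvd p ^ d - (p ^ d - 1)" by (rule dvd_diff_nat[OF dvd_power[OF disjI1[OF d]]])
    moreover have "p ^ d - (p ^ d - 1) = 1" using prime_power_ge_2[OF d] by simp
    ultimately have "p dvd 1" by metis
    thus False using p_gt_1 by simp
  qed
qed

lemma finite_teich: "d > 0 \<Longrightarrow> finite (teich d)"
  using teich_exponent(1) by (simp add: teich_def finite_roots_unity Suc_leI)

lemma card_teich: "d > 0 \<Longrightarrow> card (teich d) = p ^ d - 1"
  using teich_exponent(1) by (simp add: teich_def card_roots_unity_eq)

lemma teich_in_alg_ints: "d > 0 \<Longrightarrow> z \<in> teich d \<Longrightarrow> z \<in> \<O>"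
  using root_of_unity_in_alg_ints teich_exponent(1) by (simp add: teich_def)

lemma teich_notin_P: "d > 0 \<Longrightarrow> z \<in> teich d \<Longrightarrow> z \<notin> P"
  using root_of_unity_notin_P teich_exponent(1) by (simp add: teich_def)

lemma teich_cong_imp_eq: "d > 0 \<Longrightarrow> z \<in> teich d \<Longrightarrow> w \<in> teich d \<Longrightarrow> z \<equiv>\<^sub>P w \<Longrightarrow> z = w"
  unfolding teich_def mem_Collect_eq using roots_of_unity_cong_imp_eq teich_exponent by blast

lemma teich_power: "z \<in> teich d \<Longrightarrow> z ^ k \<in> teich d"
  by (simp add: teich_def power_mult[symmetric] mult.commute[of k]) (simp add: power_mult)

lemma teich_iff: assumes "z \<noteq> 0" shows "z \<in> teich d \<longleftrightarrow> z ^ (p ^ d) = z"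
proof -
  have "p ^ d = Suc (p ^ d - 1)" using p_gt_1 by simp
  hence "z ^ (p ^ d) = z ^ (p ^ d - 1) * z" by (metis power_Suc2)
  thus ?thesis using assms by (simp add: teich_def)
qed

lemma teich_nonzero: "d > 0 \<Longrightarrow> z \<in> teich d \<Longrightarrow> z \<noteq> 0"
  using teich_notin_P P_zero by blast

lemma teich_fixed: "d > 0 \<Longrightarrow> z \<in> teich d \<Longrightarrow> z ^ (p ^ d) = z"
  using teich_iff[OF teich_nonzero] by blast

lemma teich_frobenius_inj:
  assumes "z \<in> teich m" "w \<in> teich m" "z ^ (p ^ k) = w ^ (p ^ k)" "k \<le> m" "m > 0"
  shows "z = w"
proof -
  have "z ^ (p ^ m) = (z ^ (p ^ k)) ^ (p ^ (m - k))" "w ^ (p ^ m) = (w ^ (p ^ k)) ^ (p ^ (m - k))"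
    using assms(4) by (simp_all add: power_mult[symmetric] power_add[symmetric])
  thus ?thesis using assms teich_fixed by metis
qed

lemma teich_conjugates_distinct:
  assumes z: "z \<in> teich m" "\<And>d. d \<in> {1..<m} \<Longrightarrow> z \<notin> teich d" and "k < l" "l < m"
  shows "z ^ (p ^ k) \<noteq> z ^ (p ^ l)"
proof
  assume "z ^ (p ^ k) = z ^ (p ^ l)"
  hence "(z ^ (p ^ (l - k))) ^ (p ^ k) = z ^ (p ^ k)"
    using \<open>k < l\<close> by (simp add: power_mult[symmetric] power_add[symmetric])
  hence "z ^ (p ^ (l - k)) = z"
    by (rule teich_frobenius_inj[OF teich_power[OF z(1)] z(1)]) (use assms(3,4) in auto)
  hence "z \<in> teich (l - k)" using teich_iff teich_nonzero[OF _ z(1)] assms(3,4) by simp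
  moreover have "l - k \<in> {1..<m}" using assms(3,4) by auto
  ultimately show False using z(2) by blast
qed

definition norm_exp :: "nat \<Rightarrow> nat" where
  "norm_exp m = (\<Sum>i<m. p ^ i)"

lemma norm_exp_mult: "norm_exp m * (p - 1) + 1 = p ^ m"
proof (induction m)
  case (Suc m)
  have "norm_exp (Suc m) * (p - 1) + 1 = p ^ m + p ^ m * (p - 1)"
    using Suc by (simp add: norm_exp_def algebra_simps)
  also have "\<dots> = p ^ Suc m" using p_gt_1 by (simp add: algebra_simps)
  finally show ?case .
qed (simp add: norm_exp_def)

lemma norm_exp_bounds: assumes "m > 0" shows "0 < norm_exp m" "norm_exp m \<le> 2 * p ^ (m - 1)"
proof -
  have "norm_exp m * (p - 1) \<noteq> 0" using norm_exp_mult[of m] prime_power_ge_2[OF assms] by linarith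
  thus "0 < norm_exp m" by simp
  have "norm_exp (Suc k) \<le> 2 * p ^ k" for k
  proof (induction k)
    case (Suc k)
    have "2 * p ^ k \<le> p ^ Suc k" using p_gt_1 by simp
    moreover have "norm_exp (Suc (Suc k)) = norm_exp (Suc k) + p ^ Suc k"
      unfolding norm_exp_def by (rule sum.lessThan_Suc)
    ultimately show ?case using Suc by linarith
  qed (simp add: norm_exp_def)
  thus "norm_exp m \<le> 2 * p ^ (m - 1)" using assms by (metis Suc_diff_1)
qed

lemma teich_norm_eq_prod: "z ^ norm_exp m = (\<Prod>i<m. z ^ (p ^ i))" for z :: complex
  by (simp add: norm_exp_def power_sum)

lemma teich_norm_frobenius:
  assumes z: "z \<in> teich m" shows "(z ^ norm_exp m) ^ p = z ^ norm_exp m"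
proof -
  have "norm_exp m * p = norm_exp m * (p - 1) + norm_exp m"
    using p_gt_1 by (metis Suc_diff_1 add.commute mult_Suc_right order_less_trans zero_less_one)
  hence "norm_exp m * p = (p ^ m - 1) + norm_exp m" using norm_exp_mult[of m] by linarith
  hence "(z ^ norm_exp m) ^ p = z ^ (p ^ m - 1) * z ^ norm_exp m"
    by (simp add: power_mult[symmetric] power_add)
  thus ?thesis using z by (simp add: teich_def)
qed

lemma card_proper_teich: assumes "m > 0" shows "card (\<Union>d\<in>{1..<m}. teich d) \<le> m * p ^ (m - 1)"
proof -
  have "card (\<Union>d\<in>{1..<m}. teich d) \<le> (\<Sum>d\<in>{1..<m}. card (teich d))" by (rule card_UN_le) simp
  also have "\<dots> \<le> (\<Sum>d\<in>{1..<m}. p ^ (m - 1))"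
  proof (rule sum_mono)
    fix d assume d: "d \<in> {1..<m}"
    have "card (teich d) \<le> p ^ d" using d by (simp add: card_teich)
    also have "\<dots> \<le> p ^ (m - 1)" by (rule power_increasing) (use d p_gt_1 in auto)
    finally show "card (teich d) \<le> p ^ (m - 1)" .
  qed
  also have "\<dots> \<le> m * p ^ (m - 1)" by simp
  finally show ?thesis .
qed

lemma card_teich_norm_eq:
  assumes m: "m > 0" and w: "\<not> int p dvd w"
  shows "card {z\<in>teich m. z ^ norm_exp m * of_int w \<equiv>\<^sub>P 1} \<le> 2 * p ^ (m - 1)" (is "card ?Z \<le> _")
proof (rule ccontr)
  assume "\<not> card ?Z \<le> 2 * p ^ (m - 1)"
  hence many: "norm_exp m < card ?Z" using norm_exp_bounds[OF m] by linarith
  define f where "f = monom (of_int w :: complex) (norm_exp m) - [:1:]"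
  have coeff_f: "coeff f i = (if i = norm_exp m then of_int w else 0) - (if i = 0 then 1 else 0)" for i
    by (auto simp: f_def coeff_pCons split: nat.split)
  have "coeff f (norm_exp m) \<in> P"
  proof (rule coeff_in_P_if_many_roots)
    show "coeff f i \<in> \<O>" for i by (auto simp: coeff_f R_of_int R_one R_minus R_zero intro!: R_diff)
    show "finite ?Z" using finite_teich[OF m] by simp
    have "degree f \<le> norm_exp m" by (intro degree_le) (auto simp: coeff_f)
    thus "degree f < card ?Z" using many by simp
    show "poly f t \<in> P" if "t \<in> ?Z" for t using that by (simp add: f_def poly_monom mult.commute)
  qed (use teich_in_alg_ints[OF m] teich_cong_imp_eq[OF m] in auto)
  hence "of_int w \<in> P" using norm_exp_bounds[OF m] by (simp add: coeff_f)
  thus False using w of_int_in_P_iff by blast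
qed

definition teich_generators :: "nat \<Rightarrow> int set \<Rightarrow> complex set" where
  "teich_generators m W = {z\<in>teich m. (\<forall>d\<in>{1..<m}. z \<notin> teich d)
    \<and> (\<forall>w\<in>W. \<not> z ^ norm_exp m * of_int w \<equiv>\<^sub>P 1)}"

lemma card_teich_generators:
  assumes m: "0 < m" "m < n" and W: "finite W" "card W \<le> n" "\<And>w. w \<in> W \<Longrightarrow> \<not> int p dvd w"
    and big: "p \<ge> 8 * n"
  shows "p ^ m \<le> 2 * card (teich_generators m W)"
proof -
  let ?G = "teich_generators m W" and ?D = "\<Union>d\<in>{1..<m}. teich d"
  let ?N = "\<lambda>w. {z\<in>teich m. z ^ norm_exp m * of_int w \<equiv>\<^sub>P 1}"
  have fin: "finite ?G" "finite ?D" "finite (\<Union>w\<in>W. ?N w)"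
    using finite_teich m W(1) by (auto simp: teich_generators_def)
  have "teich m \<subseteq> ?G \<union> (?D \<union> (\<Union>w\<in>W. ?N w))" by (auto simp: teich_generators_def)
  hence "card (teich m) \<le> card (?G \<union> (?D \<union> (\<Union>w\<in>W. ?N w)))" using fin by (intro card_mono) auto
  also have "\<dots> \<le> card ?G + (card ?D + card (\<Union>w\<in>W. ?N w))"
    using card_Un_le[of ?G "?D \<union> (\<Union>w\<in>W. ?N w)"] card_Un_le[of ?D "\<Union>w\<in>W. ?N w"] by linarith
  also have "card (\<Union>w\<in>W. ?N w) \<le> (\<Sum>w\<in>W. card (?N w))" by (rule card_UN_le[OF W(1)])
  also have "\<dots> \<le> (\<Sum>w\<in>W. 2 * p ^ (m - 1))"
    by (rule sum_mono) (use card_teich_norm_eq[OF m(1)] W(3) in blast)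
  also have "\<dots> = card W * (2 * p ^ (m - 1))" by simp
  also have "\<dots> \<le> n * (2 * p ^ (m - 1))" using W(2) by (rule mult_right_mono) simp
  also have "card ?D \<le> m * p ^ (m - 1)" by (rule card_proper_teich[OF m(1)])
  also have "\<dots> \<le> n * p ^ (m - 1)" using m(2) by (intro mult_right_mono) auto
  finally have "p ^ m - 1 \<le> card ?G + 3 * (n * p ^ (m - 1))" using card_teich[OF m(1)] by simp
  moreover have "8 * (n * p ^ (m - 1)) \<le> p ^ m"
  proof -
    have "8 * n * p ^ (m - 1) \<le> p * p ^ (m - 1)" using big by (rule mult_right_mono) simp
    also have "\<dots> = p ^ m" using m by (simp add: power_eq_if)
    finally show ?thesis by (simp add: mult.assoc)
  qed
  moreover have "n * p ^ (m - 1) \<ge> 1" using m p_gt_1 by (simp add: Suc_le_eq)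
  ultimately show ?thesis by linarith
qed

definition teich_tuple :: "nat \<Rightarrow> complex \<Rightarrow> (nat \<Rightarrow> int) \<Rightarrow> nat \<Rightarrow> complex" where
  "teich_tuple m z b k = (if k < m then z ^ (p ^ k) else of_int (b (k - m)))"

lemma prod_teich_tuple:
  "(\<Prod>k<m + L. teich_tuple m z b k) = z ^ norm_exp m * of_int (\<Prod>j<L. b j)"
  unfolding teich_norm_eq_prod teich_tuple_def by (induction L) (auto simp: mult_ac)

definition admissible :: "nat \<Rightarrow> (nat \<Rightarrow> int) \<Rightarrow> bool" where
  "admissible L b \<longleftrightarrow> (\<forall>i<L. \<forall>j<L. int p dvd b i - b j \<longrightarrow> i = j)
    \<and> (\<forall>j<L. \<not> int p dvd b j - 1 \<and> \<not> int p dvd b j + 1)"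

context
  fixes m L :: nat and z :: complex and b :: "nat \<Rightarrow> int"
  assumes m: "2 \<le> m" and z: "z \<in> teich m" and primitive: "\<And>d. d \<in> {1..<m} \<Longrightarrow> z \<notin> teich d"
    and b: "admissible L b"
begin

lemma teich_tuple_in_alg_ints: "teich_tuple m z b k \<in> \<O>"
  using teich_in_alg_ints[OF _ z] m by (auto simp: teich_tuple_def R_power R_of_int)

lemma teich_tuple_frobenius: "teich_tuple m z b k ^ p \<equiv>\<^sub>P teich_tuple m z b (cycle_succ m k)"
proof (cases "k < m")
  case True
  have "(z ^ p ^ k) ^ p = z ^ p ^ Suc k" by (simp add: power_mult[symmetric] mult.commute)
  moreover have "z ^ p ^ Suc k = z" if "\<not> Suc k < m"
    using that True teich_fixed[OF _ z] by (metis Suc_lessI not_less_eq gr_zeroI not_less0)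
  ultimately show ?thesis using True m by (auto simp: teich_tuple_def cycle_succ_def P_zero)
next
  case False
  thus ?thesis using fermat by (auto simp: teich_tuple_def cycle_succ_def)
qed

lemma teich_tuple_cong_imp_power_eq:
  assumes "k < m" "l < m" "teich_tuple m z b k \<equiv>\<^sub>P teich_tuple m z b l"
  shows "z ^ (p ^ k) = z ^ (p ^ l)"
  using assms teich_cong_imp_eq[OF _ teich_power[OF z] teich_power[OF z]] m by (simp add: teich_tuple_def)

lemma teich_tuple_cong_imp_eq:
  assumes kl: "k < m + L" "l < m + L" "k \<le> l" and cong: "teich_tuple m z b k \<equiv>\<^sub>P teich_tuple m z b l"
  shows "k = l"
proof -
  let ?\<beta> = "teich_tuple m z b"
  note conjugates = teich_conjugates_distinct[OF z primitive]
  consider (both_conjugates) "l < m" | (mixed) "k < m" "m \<le> l" | (both_integers) "m \<le> k" using kl by linarith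
  thus ?thesis
  proof cases
    case both_conjugates
    thus ?thesis using teich_tuple_cong_imp_power_eq[OF _ _ cong] conjugates[of k l] kl(3) by fastforce
  next
    case mixed
    hence "?\<beta> l ^ p \<equiv>\<^sub>P ?\<beta> l" using fermat by (simp add: teich_tuple_def)
    hence "?\<beta> k ^ p \<equiv>\<^sub>P ?\<beta> l"
      by (rule cong_trans[OF cong_power[OF cong teich_tuple_in_alg_ints teich_tuple_in_alg_ints]])
    hence "?\<beta> k ^ p \<equiv>\<^sub>P ?\<beta> k" by (rule cong_trans[OF _ cong_sym[OF cong]])
    hence "?\<beta> (cycle_succ m k) \<equiv>\<^sub>P ?\<beta> k" by (rule cong_trans[OF cong_sym[OF teich_tuple_frobenius]])
    moreover have succ: "cycle_succ m k < m" "cycle_succ m k \<noteq> k" using mixed m by (auto simp: cycle_succ_def)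
    ultimately have "z ^ (p ^ cycle_succ m k) = z ^ (p ^ k)" using mixed teich_tuple_cong_imp_power_eq by blast
    thus ?thesis using conjugates mixed succ by (metis nat_neq_iff)
  next
    case both_integers
    hence "int p dvd b (k - m) - b (l - m)" using kl(3) cong cong_of_int_iff by (simp add: teich_tuple_def)
    moreover have "k - m < L" "l - m < L" using kl both_integers by auto
    ultimately have "k - m = l - m" using b unfolding admissible_def by blast
    thus ?thesis using both_integers kl(3) by simp
  qed
qed

lemma frob_roots_teich_tuple: "frob_roots (m + L) m (teich_tuple m z b)"
proof -
  let ?\<beta> = "teich_tuple m z b"
  have "k = l" if "k < m + L" "l < m + L" "?\<beta> k \<equiv>\<^sub>P ?\<beta> l" for k l
    using teich_tuple_cong_imp_eq[of k l] teich_tuple_cong_imp_eq[of l k] that cong_sym[OF that(3)]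
    by (metis nle_le)
  moreover have "\<exists>a. ?\<beta> k \<equiv>\<^sub>P of_int a \<and> \<not> int p dvd a - 1 \<and> \<not> int p dvd a + 1" if "k \<in> {m..<m + L}" for k
  proof -
    have "k - m < L" using that by auto
    thus ?thesis using b that cong_refl unfolding admissible_def
      by (intro exI[of _ "b (k - m)"]) (auto simp: teich_tuple_def)
  qed
  ultimately show ?thesis unfolding frob_roots_def using teich_tuple_in_alg_ints teich_tuple_frobenius by simp
qed

end

lemma card_inj_residues:
  assumes "L < n" "p \<ge> 8 * n"
  shows "p ^ L \<le> 4 ^ L * card {a \<in> {..<L} \<rightarrow>\<^sub>E {2..int p - 2}. inj_on a {..<L}}"
proof -
  have "p ^ L = (\<Prod>i\<in>{0..<L}. p)" by simp
  also have "\<dots> \<le> (\<Prod>i\<in>{0..<L}. 4 * (p - 3 - i))" using assms by (intro prod_mono) auto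
  also have "\<dots> = 4 ^ L * (\<Prod>i\<in>{0..<L}. p - 3 - i)" by (simp add: prod.distrib)
  also have "(\<Prod>i\<in>{0..<L}. p - 3 - i) = card {a \<in> {..<L} \<rightarrow>\<^sub>E {2..int p - 2}. inj_on a {..<L}}"
  proof -
    have "card {2..int p - 2} = p - 3" by simp
    thus ?thesis by (simp only: card_inj_on_subset_funcset finite_lessThan finite_atLeastAtMost_int subset_refl
        card_lessThan diff_self_eq_0 power_0 mult_1)
  qed
  finally show ?thesis .
qed

lemma inverse_int_exists:
  assumes u: "u \<in> \<O>" "u \<notin> P" "u ^ p \<equiv>\<^sub>P u"
  obtains l where "u * of_int l \<equiv>\<^sub>P 1"
proof -
  obtain b where b: "u \<equiv>\<^sub>P of_int b" using cong_int_if_frobenius_fixed[OF u(1,3)] by blast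
  hence "\<not> int p dvd b" using u(2) of_int_in_P_iff cong_in_P_iff by blast
  hence "coprime (int p) b" using prime_p by (simp add: prime_imp_coprime)
  then obtain r l where "r * int p + l * b = 1" by (metis bezout_int coprime_imp_gcd_eq_1)
  hence "b * l - 1 = - r * int p" by (simp add: algebra_simps)
  hence "of_int b * of_int l \<equiv>\<^sub>P 1" using cong_of_int_iff[of "b * l" 1] by simp
  moreover have "u * of_int l \<equiv>\<^sub>P of_int b * of_int l" by (rule cong_mult[OF b cong_refl u(1) R_of_int])
  ultimately show ?thesis using that cong_trans by blast
qed

lemma admissible_residues:
  assumes a: "a \<in> {..<L} \<rightarrow>\<^sub>E {2..int p - 2}" "inj_on a {..<L}"
  shows "admissible L a" and "\<not> int p dvd (\<Prod>j<L. a j)"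
proof -
  have range: "2 \<le> a j" "a j \<le> int p - 2" if "j < L" for j using PiE_mem[OF a(1), of j] that by simp_all
  have ndvd: "\<not> int p dvd a j + c" if "j < L" "c \<in> {- 1, 0, 1}" for j c
    using zdvd_imp_le[of "int p" "a j + c"] range[OF that(1)] that(2) by auto
  have "i = j" if ij: "i < L" "j < L" "int p dvd a i - a j" for i j
  proof -
    have "a i = a j"
      by (rule cong_of_int_residues) (use ij range[of i] range[of j] cong_of_int_iff in auto)
    thus ?thesis using a(2) ij by (auto dest: inj_onD)
  qed
  thus "admissible L a" using ndvd[of _ "- 1"] ndvd[of _ 1] by (simp add: admissible_def)
  show "\<not> int p dvd (\<Prod>j<L. a j)"
    using prime_dvd_prod_iff[of "{..<L}" "int p" a] prime_p ndvd[of _ 0] by auto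
qed

text \<open>The last root, which makes the product of all the roots equal to \<open>1\<close>, is to differ from \<open>\<plusminus>1\<close> and
  from the other roots in the prime field.\<close>

definition excluded :: "nat \<Rightarrow> (nat \<Rightarrow> int) \<Rightarrow> int set" where
  "excluded L a = insert 1 (insert (- 1) (a ` {..<L}))"

lemma card_excluded: "finite (excluded L a)" "card (excluded L a) \<le> L + 2"
  using card_image_le[of "{..<L}" a] by (auto simp: excluded_def card_insert_if)

lemma admissible_extend:
  assumes "admissible L a" "\<And>w. w \<in> excluded L a \<Longrightarrow> \<not> int p dvd l - w"
  shows "admissible (Suc L) (a(L := l))"
proof -
  have l: "\<not> int p dvd l - 1" "\<not> int p dvd l + 1" "\<And>j. j < L \<Longrightarrow> \<not> int p dvd l - a j"
    using assms(2)[of 1] assms(2)[of "- 1"] assms(2) by (auto simp: excluded_def)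
  have l': "\<not> int p dvd a j - l" if "j < L" for j using l(3)[OF that] by (simp add: dvd_diff_commute)
  show ?thesis
    using assms(1) l l' unfolding admissible_def by (auto simp: less_Suc_eq)
qed

lemma last_root_exists:
  assumes m: "m > 0" and A: "\<not> int p dvd A" and z: "z \<in> teich_generators m ((\<lambda>w. A * w) ` W)"
  obtains l where "z ^ norm_exp m * of_int (A * l) \<equiv>\<^sub>P 1" "\<And>w. w \<in> W \<Longrightarrow> \<not> int p dvd l - w"
proof -
  let ?u = "z ^ norm_exp m * of_int A"
  have zt: "z \<in> teich m" using z by (simp add: teich_generators_def)
  have N: "z ^ norm_exp m \<in> \<O>" "z ^ norm_exp m \<notin> P"
    using teich_in_alg_ints[OF m] teich_notin_P[OF m] teich_power[OF zt] by blast+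
  have u: "?u \<in> \<O>" using N(1) by (intro R_mult R_of_int)
  have "?u \<notin> P" using P_prime[OF N(1) R_of_int, of A] N(2) A of_int_in_P_iff by blast
  moreover have "?u ^ p \<equiv>\<^sub>P ?u"
    unfolding power_mult_distrib teich_norm_frobenius[OF zt]
    by (rule cong_mult[OF cong_refl fermat N(1) R_of_int])
  ultimately obtain l where l: "?u * of_int l \<equiv>\<^sub>P 1" using inverse_int_exists[OF u] by blast
  show ?thesis
  proof (rule that)
    show "z ^ norm_exp m * of_int (A * l) \<equiv>\<^sub>P 1" using l by (simp add: mult.assoc)
    fix w assume w: "w \<in> W"
    show "\<not> int p dvd l - w"
    proof
      assume "int p dvd l - w"
      hence "of_int w \<equiv>\<^sub>P of_int l" using cong_of_int_iff[of w l] by (simp add: dvd_diff_commute)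
      hence "?u * of_int w \<equiv>\<^sub>P ?u * of_int l" by (rule cong_mult[OF cong_refl _ u R_of_int])
      hence "z ^ norm_exp m * of_int (A * w) \<equiv>\<^sub>P 1" using cong_trans[OF _ l] by (simp add: mult.assoc)
      thus False using z w by (auto simp: teich_generators_def)
    qed
  qed
qed

definition root_params :: "nat \<Rightarrow> nat \<Rightarrow> ((nat \<Rightarrow> int) \<times> complex) set" where
  "root_params m L = (SIGMA a:{a \<in> {..<L} \<rightarrow>\<^sub>E {2..int p - 2}. inj_on a {..<L}}.
    teich_generators m ((\<lambda>w. (\<Prod>j<L. a j) * w) ` excluded L a))"

lemma finite_root_params: "m > 0 \<Longrightarrow> finite (root_params m L)"
proof -
  assume "m > 0"
  have "finite {a \<in> {..<L} \<rightarrow>\<^sub>E {2..int p - 2}. inj_on a {..<L}}"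
    by (rule finite_subset[of _ "{..<L} \<rightarrow>\<^sub>E {2..int p - 2}"]) (auto intro: finite_PiE)
  moreover have "finite (teich_generators m W)" for W
    using finite_teich[OF \<open>m > 0\<close>] by (simp add: teich_generators_def)
  ultimately show ?thesis unfolding root_params_def by blast
qed

lemma card_root_params:
  assumes m: "2 \<le> m" and big: "p \<ge> 8 * Suc (m + L)"
  shows "p ^ (m + L) \<le> 2 * 4 ^ L * card (root_params m L)"
proof -
  let ?A = "{a \<in> {..<L} \<rightarrow>\<^sub>E {2..int p - 2}. inj_on a {..<L}}"
  let ?G = "\<lambda>a. teich_generators m ((\<lambda>w. (\<Prod>j<L. a j) * w) ` excluded L a)"
  have fin: "finite ?A" "\<forall>a\<in>?A. finite (?G a)"
    using finite_root_params[of m L] m finite_teich[of m]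
    by (auto simp: teich_generators_def intro: finite_subset[of _ "{..<L} \<rightarrow>\<^sub>E {2..int p - 2}"] finite_PiE)
  have "p ^ m \<le> 2 * card (?G a)" if a: "a \<in> ?A" for a
  proof (rule card_teich_generators[where n = "Suc (m + L)"])
    show "card ((\<lambda>w. (\<Prod>j<L. a j) * w) ` excluded L a) \<le> Suc (m + L)"
      using card_image_le[OF card_excluded(1)] card_excluded(2)[of L a] m
      by (metis add.commute add_Suc_right add_le_mono1 le_SucI order_trans)
    have A: "\<not> int p dvd (\<Prod>j<L. a j)" using a admissible_residues(2) by simp
    hence "\<not> int p dvd a j" if "j < L" for j
      using that dvd_trans[OF _ dvd_prodI[of "{..<L}" j a]] by auto
    hence "\<not> int p dvd w" if "w \<in> excluded L a" for w
      using that p_gt_1 by (auto simp: excluded_def)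
    thus "\<not> int p dvd w" if "w \<in> (\<lambda>w. (\<Prod>j<L. a j) * w) ` excluded L a" for w
      using that prime_p A by (auto simp: prime_dvd_mult_iff)
  qed (use m big card_excluded(1) in auto)
  hence "(\<Sum>a\<in>?A. p ^ m) \<le> (\<Sum>a\<in>?A. 2 * card (?G a))" by (rule sum_mono)
  also have "\<dots> = 2 * card (root_params m L)"
    unfolding root_params_def using fin by (simp add: card_SigmaI sum_distrib_left)
  finally have G: "card ?A * p ^ m \<le> 2 * card (root_params m L)" by simp
  have "p ^ (m + L) = p ^ L * p ^ m" by (simp add: power_add)
  also have "\<dots> \<le> 4 ^ L * card ?A * p ^ m"
    using card_inj_residues[of L "Suc (m + L)"] big by (intro mult_right_mono) auto
  also have "\<dots> \<le> 4 ^ L * (2 * card (root_params m L))" using G by (simp add: mult.assoc)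
  finally show ?thesis by (simp add: mult_ac)
qed

lemma frob_roots_of_params:
  assumes m: "2 \<le> m" and v: "(a, z) \<in> root_params m L"
  obtains \<beta> where "frob_roots (Suc (m + L)) m \<beta>" "\<beta> 0 = z" "\<And>j. j < L \<Longrightarrow> \<beta> (m + j) = of_int (a j)"
    "(\<Prod>k<Suc (m + L). \<beta> k) \<equiv>\<^sub>P 1"
proof -
  have a: "a \<in> {..<L} \<rightarrow>\<^sub>E {2..int p - 2}" "inj_on a {..<L}"
    and z: "z \<in> teich_generators m ((\<lambda>w. (\<Prod>j<L. a j) * w) ` excluded L a)"
    using v by (auto simp: root_params_def)
  obtain l where l: "z ^ norm_exp m * of_int ((\<Prod>j<L. a j) * l) \<equiv>\<^sub>P 1"
    "\<And>w. w \<in> excluded L a \<Longrightarrow> \<not> int p dvd l - w"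
    using last_root_exists[OF _ admissible_residues(2)[OF a] z] m by auto
  have z_gen: "z \<in> teich m" "\<And>d. d \<in> {1..<m} \<Longrightarrow> z \<notin> teich d"
    using z unfolding teich_generators_def by blast+
  show ?thesis
  proof (rule that)
    show "frob_roots (Suc (m + L)) m (teich_tuple m z (a(L := l)))"
      using frob_roots_teich_tuple[OF m z_gen admissible_extend[OF admissible_residues(1)[OF a] l(2)]] by simp
    show "(\<Prod>k<Suc (m + L). teich_tuple m z (a(L := l)) k) \<equiv>\<^sub>P 1"
      using l(1) prod_teich_tuple[of m z "a(L := l)" "Suc L"] by simp
  qed (use m in \<open>auto simp: teich_tuple_def\<close>)
qed

lemma root_params_eq:
  assumes m: "m > 0" and v: "(a, z) \<in> root_params m L" "(a', z') \<in> root_params m L"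
    and cong: "z \<equiv>\<^sub>P z'" "\<And>j. j < L \<Longrightarrow> of_int (a j) \<equiv>\<^sub>P of_int (a' j)"
  shows "a = a' \<and> z = z'"
proof
  have a: "a \<in> {..<L} \<rightarrow>\<^sub>E {2..int p - 2}" "a' \<in> {..<L} \<rightarrow>\<^sub>E {2..int p - 2}"
    and z: "z \<in> teich m" "z' \<in> teich m"
    using v by (auto simp: root_params_def teich_generators_def)
  show "z = z'" by (rule teich_cong_imp_eq[OF m z cong(1)])
  show "a = a'"
  proof (rule PiE_ext[OF a])
    fix j assume j: "j \<in> {..<L}"
    hence "a j \<in> {0..<int p}" "a' j \<in> {0..<int p}" using PiE_mem[OF a(1) j] PiE_mem[OF a(2) j] by auto
    thus "a j = a' j" using cong(2) j by (intro cong_of_int_residues) auto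
  qed
qed

lemma frob_type_poly_exists:
  assumes "frob_roots n m \<beta>" "m \<le> n" "n > 0" and prod: "(\<Prod>k<n. \<beta> k) \<equiv>\<^sub>P 1"
  obtains c where "c \<in> {..<n} \<rightarrow>\<^sub>E {0..<int p}" "int p dvd c 0 - (- 1) ^ n"
    "\<And>i. coeff (of_int_poly (monic_poly n c)) i \<equiv>\<^sub>P coeff (\<Prod>k<n. [:- \<beta> k, 1:]) i"
proof -
  obtain c where c: "c \<in> {..<n} \<rightarrow>\<^sub>E {0..<int p}"
    "\<And>i. coeff (of_int_poly (monic_poly n c)) i \<equiv>\<^sub>P coeff (\<Prod>k<n. [:- \<beta> k, 1:]) i"
    using frob_roots_poly[OF assms(1,2)] by blast
  have "coeff (\<Prod>k<n. [:- \<beta> k, 1:]) 0 = (- 1) ^ n * (\<Prod>k<n. \<beta> k)"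
    unfolding poly_0_coeff_0[symmetric] by (simp add: poly_prod prod_uminus)
  moreover have "(- 1) ^ n * (\<Prod>k<n. \<beta> k) \<equiv>\<^sub>P (- 1) ^ n * 1"
    by (intro cong_mult cong_refl prod R_power R_minus R_one)
  ultimately have "of_int (c 0) \<equiv>\<^sub>P of_int ((- 1) ^ n)"
    using cong_trans[OF c(2)[of 0]] \<open>n > 0\<close> by (simp add: coeff_map_poly coeff_monic_poly)
  hence "int p dvd c 0 - (- 1) ^ n" using cong_of_int_iff by blast
  thus ?thesis using that c by blast
qed

lemma card_fiber_frob_type_le:
  assumes V: "finite V" "\<And>v. v \<in> V \<Longrightarrow> frob_roots n m (\<beta> v)"
    and coeff: "\<And>v i. v \<in> V \<Longrightarrow> coeff (of_int_poly (monic_poly n (c v))) i \<equiv>\<^sub>P coeff (\<Prod>k<n. [:- \<beta> v k, 1:]) i"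
    and inj: "\<And>v w. v \<in> V \<Longrightarrow> w \<in> V \<Longrightarrow> (\<And>k. k < n \<Longrightarrow> \<beta> v k \<equiv>\<^sub>P \<beta> w k) \<Longrightarrow> v = w"
  shows "card V \<le> card (c ` V) * n ^ n"
proof -
  have fiber: "card {v\<in>V. c v = d} \<le> n ^ n" for d
  proof (rule card_root_tuples_le[of _ n \<beta>])
    fix v w i assume vw: "v \<in> {v\<in>V. c v = d}" "w \<in> {v\<in>V. c v = d}"
    have "coeff (of_int_poly (monic_poly n d)) i \<equiv>\<^sub>P coeff (\<Prod>k<n. [:- \<beta> u k, 1:]) i"
      if "u \<in> {v\<in>V. c v = d}" for u using coeff[of u i] that by simp
    thus "coeff (\<Prod>k<n. [:- \<beta> v k, 1:]) i \<equiv>\<^sub>P coeff (\<Prod>k<n. [:- \<beta> w k, 1:]) i"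
      using vw cong_sym cong_trans by blast
  qed (use V inj in \<open>auto simp: frob_roots_def\<close>)
  have "card V = card (\<Union>d\<in>c ` V. {v\<in>V. c v = d})" by (rule arg_cong[of _ _ card]) blast
  also have "\<dots> \<le> (\<Sum>d\<in>c ` V. card {v\<in>V. c v = d})" using V(1) by (intro card_UN_le) simp
  also have "\<dots> \<le> (\<Sum>d\<in>c ` V. n ^ n)" using fiber by (rule sum_mono)
  finally show ?thesis by simp
qed

lemma many_frob_types:
  assumes m: "2 \<le> m" "m < n" and big: "p \<ge> 8 * n"
  obtains F where "F \<subseteq> {..<n} \<rightarrow>\<^sub>E {0..<int p}" "\<And>c. c \<in> F \<Longrightarrow> frob_type n m (monic_poly n c)"
    "\<And>c. c \<in> F \<Longrightarrow> int p dvd c 0 - (- 1) ^ n" "p ^ (n - 1) \<le> card F * (2 * 4 ^ n * n ^ n)"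
proof -
  obtain L where n: "n = Suc (m + L)" using m(2) less_iff_Suc_add by metis
  let ?V = "root_params m L"
  have "\<exists>\<beta>. frob_roots n m \<beta> \<and> \<beta> 0 = snd v \<and> (\<forall>j<L. \<beta> (m + j) = of_int (fst v j)) \<and> (\<Prod>k<n. \<beta> k) \<equiv>\<^sub>P 1"
    if "v \<in> ?V" for v
    using frob_roots_of_params[OF m(1), of "fst v" "snd v" L] that unfolding n by (metis prod.collapse)
  then obtain \<beta> where \<beta>: "\<And>v. v \<in> ?V \<Longrightarrow> frob_roots n m (\<beta> v)" "\<And>v. v \<in> ?V \<Longrightarrow> \<beta> v 0 = snd v"
    "\<And>v j. v \<in> ?V \<Longrightarrow> j < L \<Longrightarrow> \<beta> v (m + j) = of_int (fst v j)" "\<And>v. v \<in> ?V \<Longrightarrow> (\<Prod>k<n. \<beta> v k) \<equiv>\<^sub>P 1"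
    by metis
  have "\<exists>c. c \<in> {..<n} \<rightarrow>\<^sub>E {0..<int p} \<and> int p dvd c 0 - (- 1) ^ n
      \<and> (\<forall>i. coeff (of_int_poly (monic_poly n c)) i \<equiv>\<^sub>P coeff (\<Prod>k<n. [:- \<beta> v k, 1:]) i)" if "v \<in> ?V" for v
    using frob_type_poly_exists[OF \<beta>(1)[OF that] _ _ \<beta>(4)[OF that]] m by (metis less_imp_le gr0I not_less0)
  then obtain c where c: "\<And>v. v \<in> ?V \<Longrightarrow> c v \<in> {..<n} \<rightarrow>\<^sub>E {0..<int p}"
    "\<And>v. v \<in> ?V \<Longrightarrow> int p dvd c v 0 - (- 1) ^ n"
    "\<And>v i. v \<in> ?V \<Longrightarrow> coeff (of_int_poly (monic_poly n (c v))) i \<equiv>\<^sub>P coeff (\<Prod>k<n. [:- \<beta> v k, 1:]) i"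
    by metis
  have "card ?V \<le> card (c ` ?V) * n ^ n"
  proof (rule card_fiber_frob_type_le[OF finite_root_params \<beta>(1) c(3)])
    fix v w assume vw: "v \<in> ?V" "w \<in> ?V" and cong: "\<And>k. k < n \<Longrightarrow> \<beta> v k \<equiv>\<^sub>P \<beta> w k"
    have "fst v = fst w \<and> snd v = snd w"
    proof (rule root_params_eq)
      show "snd v \<equiv>\<^sub>P snd w" using cong[of 0] \<beta>(2) vw n by simp
      show "of_int (fst v j) \<equiv>\<^sub>P of_int (fst w j)" if "j < L" for j
        using cong[of "m + j"] \<beta>(3) vw n that by simp
    qed (use m vw in simp_all)
    thus "v = w" by (simp add: prod_eq_iff)
  qed (use m in auto)
  moreover have "p ^ (n - 1) \<le> 2 * 4 ^ L * card ?V" using card_root_params[OF m(1), of L] big n by simp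
  ultimately have "p ^ (n - 1) \<le> 2 * 4 ^ L * (card (c ` ?V) * n ^ n)"
    by (meson mult_le_mono2 order_trans)
  also have "\<dots> \<le> 2 * 4 ^ n * (card (c ` ?V) * n ^ n)"
    using n by (intro mult_right_mono mult_left_mono power_increasing) auto
  finally show ?thesis
  proof (intro that[of "c ` ?V"])
    show "frob_type n m (monic_poly n d)" if "d \<in> c ` ?V" for d
      using that \<beta>(1) c(3) unfolding frob_type_def by blast
  qed (use c in \<open>auto simp: mult_ac\<close>)
qed

end

section \<open>Counting matrices with given characteristic polynomial\<close>

lemma det_hom:
  fixes h :: "'a::comm_ring_1 \<Rightarrow> 'b::comm_ring_1" and A :: "'a^'n^'n"
  assumes add: "\<And>x y. h (x + y) = h x + h y" and mult: "\<And>x y. h (x * y) = h x * h y" and one: "h 1 = 1"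
  shows "h (det A) = det (\<chi> i j. h (A$i$j))"
proof -
  have zero: "h 0 = 0" using add[of 0 0] by simp
  have minus: "h (- x) = - h x" for x using add[of x "-x"] zero by (simp add: add_eq_0_iff)
  have sum: "h (sum f I) = (\<Sum>i\<in>I. h (f i))" for f and I :: "('n \<Rightarrow> 'n) set"
    by (induction I rule: infinite_finite_induct) (auto simp: zero add)
  have prod: "h (prod f I) = (\<Prod>i\<in>I. h (f i))" for f and I :: "'n set"
    by (induction I rule: infinite_finite_induct) (auto simp: one mult)
  have sign: "h (of_int (sign \<pi>)) = of_int (sign \<pi>)" for \<pi> :: "'n \<Rightarrow> 'n"
    by (cases \<pi> rule: sign_cases) (auto simp: one minus)
  show ?thesis unfolding det_def sum mult sign prod by simp
qed

lemma dvd_det_if_dvd_row: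
  fixes A :: "'a::comm_ring_1^'n^'n"
  assumes "\<And>j. d dvd A$i$j" shows "d dvd det A"
  unfolding det_def
proof (intro dvd_sum dvd_mult)
  fix \<pi>
  show "d dvd (\<Prod>i\<in>UNIV. A$i$\<pi> i)"
    using assms[of "\<pi> i"] dvd_prodI[of UNIV i "\<lambda>i. A$i$\<pi> i"] dvd_trans by auto
qed

definition char_mat :: "int^'n^'n \<Rightarrow> int poly^'n^'n" where
  "char_mat A = (\<chi> i j. (if i = j then [:0, 1:] else 0) - [:A$i$j:])"

definition int_char_poly :: "int^'n^'n \<Rightarrow> int poly" where
  "int_char_poly A = det (char_mat A)"

lemma of_int_poly_hom: "of_int_poly (f + g) = of_int_poly f + of_int_poly g"
  "of_int_poly (f * g) = of_int_poly f * of_int_poly g" "of_int_poly 1 = 1"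
  by (auto simp: poly_eq_iff coeff_map_poly coeff_mult)

lemma char_poly_int_eq: "char_poly_int A = of_int_poly (int_char_poly A)"
proof -
  have "of_int_poly (int_char_poly A) = det (\<chi> i j. of_int_poly (char_mat A$i$j))"
    unfolding int_char_poly_def by (rule det_hom) (auto simp: of_int_poly_hom)
  also have "(\<chi> i j. of_int_poly (char_mat A$i$j))
      = (\<chi> i j. (if i = j then [:0, 1:] else 0) - [: of_int (A $ i $ j) :])"
    by (simp add: vec_eq_iff char_mat_def poly_eq_iff coeff_map_poly coeff_pCons split: nat.splits)
  finally show ?thesis by (simp add: char_poly_int_def)
qed

lemma poly_int_char_poly: "poly (int_char_poly A) t = det (mat t - A)"
proof -
  have "poly (int_char_poly A) t = det (\<chi> i j. poly (char_mat A$i$j) t)"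
    unfolding int_char_poly_def by (rule det_hom) auto
  also have "(\<chi> i j. poly (char_mat A$i$j) t) = mat t - A"
    by (simp add: vec_eq_iff char_mat_def mat_def)
  finally show ?thesis .
qed

lemma det_uminus: "det (- A) = (- 1) ^ CARD('n) * det A" for A :: "'a::comm_ring_1^'n^'n"
proof -
  have "det (- A) = (\<Sum>\<pi>\<in>{\<pi>. \<pi> permutes UNIV}. (- 1) ^ CARD('n) * (of_int (sign \<pi>) * (\<Prod>i\<in>UNIV. A$i$\<pi> i)))"
    unfolding det_def by (intro sum.cong) (auto simp: prod_uminus)
  thus ?thesis unfolding det_def by (simp add: sum_distrib_left)
qed

lemma int_char_poly_coeff_0: "coeff (int_char_poly A) 0 = (- 1) ^ CARD('n) * det A" for A :: "int^'n^'n"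
proof -
  have "coeff (int_char_poly A) 0 = det (mat 0 - A)"
    by (simp only: poly_0_coeff_0[symmetric] poly_int_char_poly)
  also have "mat 0 - A = - A" by (simp add: vec_eq_iff mat_def)
  finally show ?thesis by (simp add: det_uminus)
qed

lemma degree_int_char_poly: "degree (int_char_poly A) = CARD('n)"
  and lead_coeff_int_char_poly: "lead_coeff (int_char_poly A) = 1" for A :: "int^'n^'n"
proof -
  let ?q = "\<lambda>\<pi>. of_int (sign \<pi>) * (\<Prod>i\<in>UNIV. char_mat A$i$\<pi> i)"
  let ?d = "\<Prod>i\<in>UNIV. [:- A$i$i, 1:]"
  let ?rest = "\<Sum>\<pi>\<in>{\<pi>. \<pi> permutes UNIV} - {id}. ?q \<pi>"
  have split: "int_char_poly A = ?d + ?rest"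
    unfolding int_char_poly_def det_def
    by (subst sum.remove[of _ id]) (auto simp: finite_permutations permutes_id char_mat_def)
  have deg_d: "degree ?d = CARD('n)" by (subst degree_prod_eq_sum_degree) auto
  have "degree ?rest \<le> CARD('n) - 1"
  proof (rule degree_sum_le)
    fix \<pi> :: "'n \<Rightarrow> 'n" assume "\<pi> \<in> {\<pi>. \<pi> permutes UNIV} - {id}"
    then obtain k where k: "\<pi> k \<noteq> k" by (auto simp: fun_eq_iff)
    have entry: "degree (char_mat A$i$\<pi> i) \<le> (if i = k then 0 else 1)" for i
      using k by (auto simp: char_mat_def)
    have "degree (?q \<pi>) \<le> degree (\<Prod>i\<in>UNIV. char_mat A$i$\<pi> i)"
      using degree_mult_le[of "of_int (sign \<pi>)" "\<Prod>i\<in>UNIV. char_mat A$i$\<pi> i"] by (simp add: degree_of_int)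
    also have "\<dots> \<le> (\<Sum>i\<in>UNIV. degree (char_mat A$i$\<pi> i))"
      using degree_prod_sum_le[of UNIV "\<lambda>i. char_mat A$i$\<pi> i"] by (simp add: o_def)
    also have "\<dots> \<le> (\<Sum>i\<in>UNIV. if i = k then 0 else 1)" by (intro sum_mono entry)
    also have "\<dots> = CARD('n) - 1" by (simp add: sum.If_cases Compl_eq_Diff_UNIV)
    finally show "degree (?q \<pi>) \<le> CARD('n) - 1" .
  qed (simp add: finite_permutations)
  moreover have "CARD('n) > 0" by simp
  ultimately have deg_rest: "degree ?rest < degree ?d" using deg_d by linarith
  show "degree (int_char_poly A) = CARD('n)"
    unfolding split using degree_add_eq_left[OF deg_rest] deg_d by simp
  have "lead_coeff ?d = 1" by (simp add: lead_coeff_prod)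
  thus "lead_coeff (int_char_poly A) = 1"
    unfolding split using degree_add_eq_left[OF deg_rest] deg_rest by (simp add: coeff_eq_0)
qed

lemma int_char_poly_cong:
  assumes "mat_cong p A B" shows "int p dvd coeff (int_char_poly A) i - coeff (int_char_poly B) i"
proof -
  have "[:int p:] dvd int_char_poly A - int_char_poly B"
    unfolding int_char_poly_def
  proof (rule det_diff_dvd)
    fix i j
    have "char_mat A$i$j - char_mat B$i$j = [:- (A$i$j - B$i$j):]" by (simp add: char_mat_def)
    moreover have "int p dvd - (A$i$j - B$i$j)" using assms unfolding mat_cong_def by (metis dvd_minus_iff)
    ultimately show "[:int p:] dvd char_mat A$i$j - char_mat B$i$j"
      by (simp only: const_poly_dvd_const_poly_iff)
  qed
  thus ?thesis unfolding const_poly_dvd_iff by simp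
qed

lemma subring_prime_int_multiples: "prime p \<Longrightarrow> subring_prime UNIV {z. int p dvd z}"
  by unfold_locales (auto simp: prime_dvd_mult_iff dest: not_prime_unit)

lemma dvd_diff_residues_imp_eq: "a \<in> {0..<int p} \<Longrightarrow> b \<in> {0..<int p} \<Longrightarrow> int p dvd a - b \<Longrightarrow> a = b"
  by (metis atLeastLessThan_iff mod_eq_dvd_iff mod_pos_pos_trivial)

lemma dvd_coeff_if_dvd_values:
  assumes "prime p" "degree f < p" "\<And>t. int p dvd poly f t"
  shows "int p dvd coeff f i"
proof -
  interpret subring_prime UNIV "{z. int p dvd z}" by (rule subring_prime_int_multiples[OF assms(1)])
  have "coeff f i \<in> {z. int p dvd z}"
    by (rule coeff_in_P_if_many_roots[where T = "{0..<int p}"]) (use assms dvd_diff_residues_imp_eq in auto)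
  thus ?thesis by simp
qed

lemma int_char_poly_conj:
  fixes h h' C :: "int^'n^'n"
  assumes p: "prime p" "CARD('n) < p" and inv: "mat_cong p (h ** h') (mat 1)"
  shows "int p dvd coeff (int_char_poly (h ** C ** h')) i - coeff (int_char_poly C) i"
proof -
  have dvd_values: "int p dvd poly (int_char_poly (h ** C ** h') - int_char_poly C) t" for t
  proof -
    have mat_t: "mat t$i$j = t * mat 1$i$j" for i j :: 'n by (simp add: mat_def)
    have "(h ** mat t)$i$j = t * h$i$j" for i j
      by (simp add: matrix_matrix_mult_def mat_def mult.commute if_distrib cong: if_cong)
    hence scaled: "(h ** mat t ** h')$i$j = t * (h ** h')$i$j" for i j
      by (simp add: matrix_matrix_mult_def[of _ h'] sum_distrib_left mult.assoc)
    have "(h ** (mat t - C) ** h')$i$j = (h ** mat t ** h')$i$j - (h ** C ** h')$i$j" for i j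
      by (simp add: matrix_matrix_mult_def left_diff_distrib right_diff_distrib sum_subtractf)
    hence "(mat t - h ** C ** h')$i$j - (h ** (mat t - C) ** h')$i$j = t * (mat 1$i$j - (h ** h')$i$j)" for i j
      unfolding vector_minus_component scaled mat_t by (simp add: right_diff_distrib)
    hence "mat_cong p (mat t - h ** C ** h') (h ** (mat t - C) ** h')"
      using mat_cong_sym[OF inv] by (simp add: mat_cong_def)
    hence left: "int p dvd det (mat t - h ** C ** h') - det (h ** (mat t - C) ** h')" by (rule mat_cong_det)
    have "int p dvd det h * det h' - 1" using mat_cong_det[OF inv] by (simp add: det_mul)
    hence "int p dvd (det h * det h' - 1) * det (mat t - C)" by simp
    hence "int p dvd det (h ** (mat t - C) ** h') - det (mat t - C)" by (simp add: det_mul algebra_simps)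
    from dvd_add[OF left this] show ?thesis by (simp add: poly_int_char_poly)
  qed
  have "degree (int_char_poly (h ** C ** h') - int_char_poly C) < p"
    using degree_diff_le_max[of "int_char_poly (h ** C ** h')" "int_char_poly C"] p(2)
    by (simp add: degree_int_char_poly)
  hence "int p dvd coeff (int_char_poly (h ** C ** h') - int_char_poly C) i"
    by (rule dvd_coeff_if_dvd_values[OF p(1) _ dvd_values])
  thus ?thesis by simp
qed

lemma monic_dvd_imp_eq:
  fixes f g :: "'a::idom poly"
  assumes "f dvd g" "lead_coeff f = 1" "lead_coeff g = 1" "degree f = degree g"
  shows "g = f"
proof -
  obtain q where q: "g = f * q" using assms(1) by (elim dvdE)
  have "f \<noteq> 0" "q \<noteq> 0" using assms q by auto
  hence "degree q = 0" using assms(4) q by (simp add: degree_mult_eq)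
  moreover have "lead_coeff q = 1" using assms(2,3) q by (simp add: lead_coeff_mult)
  ultimately have "q = 1" by (metis degree_eq_zeroE coeff_pCons_0 degree_pCons_0 one_pCons)
  thus ?thesis using q by simp
qed

lemma monic_poly_monic: "degree (monic_poly n c) = n" "lead_coeff (monic_poly n c) = 1"
proof -
  show deg: "degree (monic_poly n c) = n"
    by (intro antisym degree_le le_degree) (auto simp: coeff_monic_poly)
  show "lead_coeff (monic_poly n c) = 1" by (simp add: deg coeff_monic_poly)
qed

context
  fixes r :: "'n::finite \<Rightarrow> nat"
  assumes r: "bij_betw r UNIV {..<CARD('n)}"
begin

lemma rank_less: "r i < CARD('n)"
  using r by (auto dest: bij_betwE)

lemma rank_inj: "r i = r j \<longleftrightarrow> i = j"
  using r by (auto simp: bij_betw_def inj_on_def)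

lemma rank_surj: "k < CARD('n) \<Longrightarrow> \<exists>i. r i = k"
  using bij_betw_imp_surj_on[OF r] by (metis imageE lessThan_iff)

definition companion_mat :: "(nat \<Rightarrow> int) \<Rightarrow> int^'n^'n" where
  "companion_mat c = (\<chi> i j. if Suc (r j) < CARD('n) then (if r i = Suc (r j) then 1 else 0) else - c (r i))"

definition power_row_mat :: "int poly^'n^'n" where
  "power_row_mat = (\<chi> i j. if r i = 0 then monom 1 (r j) else if i = j then 1 else 0)"

lemma det_power_row_mat: "det power_row_mat = 1"
proof -
  obtain i0 where i0: "r i0 = 0" using rank_surj[of 0] by auto
  have "unit_col 0 (transpose power_row_mat) s" if "s \<noteq> i0" for s
    using that i0 rank_inj[of s i0] by (simp add: unit_col_def transpose_def power_row_mat_def)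
  hence "0 dvd det (transpose power_row_mat) - transpose power_row_mat$i0$i0"
    by (rule det_cong_if_other_cols_unit)
  moreover have "transpose power_row_mat$i0$i0 = 1" using i0 by (simp add: transpose_def power_row_mat_def)
  ultimately show ?thesis by simp
qed

lemma power_row_mat_mult_char_mat:
  assumes i0: "r i0 = 0"
  shows "(power_row_mat ** char_mat (companion_mat c))$i0$j
    = (if Suc (r j) < CARD('n) then 0 else monic_poly CARD('n) c)"
proof -
  let ?n = "CARD('n)"
  let ?e = "\<lambda>k. if Suc (r j) < ?n then (if k = Suc (r j) then 1 else 0) else [:- c k:]"
  have "(power_row_mat ** char_mat (companion_mat c))$i0$j
      = (\<Sum>k\<in>UNIV. (if k = j then monom 1 (Suc (r j)) else 0) - monom 1 (r k) * ?e (r k))"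
    unfolding matrix_matrix_mult_def vec_lambda_beta
    by (intro sum.cong) (auto simp: power_row_mat_def i0 char_mat_def companion_mat_def one_pCons algebra_simps
      smult_monom monom_Suc)
  also have "\<dots> = monom 1 (Suc (r j)) - (\<Sum>k\<in>UNIV. monom 1 (r k) * ?e (r k))" by (simp add: sum_subtractf)
  also have "(\<Sum>k\<in>UNIV. monom 1 (r k) * ?e (r k)) = (\<Sum>k<?n. monom 1 k * ?e k)"
    by (rule sum.reindex_bij_betw[OF r])
  also have "monom 1 (Suc (r j)) - (\<Sum>k<?n. monom 1 k * ?e k)
      = (if Suc (r j) < ?n then 0 else monic_poly ?n c)"
  proof (cases "Suc (r j) < ?n")
    case True
    hence "(\<Sum>k<?n. monom 1 k * ?e k) = (\<Sum>k<?n. if k = Suc (r j) then monom 1 k else 0)"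
      by (intro sum.cong) auto
    thus ?thesis using True by simp
  next
    case False
    hence "Suc (r j) = ?n" using rank_less[of j] by simp
    moreover have "(\<Sum>k<?n. monom 1 k * [:- c k:]) = - (\<Sum>k<?n. monom (c k) k)"
      unfolding sum_negf[symmetric] by (intro sum.cong) (auto simp: smult_monom minus_monom)
    ultimately show ?thesis using False by (simp add: monic_poly_def)
  qed
  finally show ?thesis .
qed

lemma int_char_poly_companion_mat: "int_char_poly (companion_mat c) = monic_poly CARD('n) c"
proof (rule monic_dvd_imp_eq[OF _ monic_poly_monic(2) lead_coeff_int_char_poly])
  obtain i0 where i0: "r i0 = 0" using rank_surj[of 0] by auto
  have "monic_poly CARD('n) c dvd det (power_row_mat ** char_mat (companion_mat c))"
    by (rule dvd_det_if_dvd_row[of _ _ i0]) (simp add: power_row_mat_mult_char_mat[OF i0])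
  thus "monic_poly CARD('n) c dvd int_char_poly (companion_mat c)"
    by (simp add: det_mul det_power_row_mat int_char_poly_def)
qed (simp only: monic_poly_monic(1) degree_int_char_poly)

lemma det_companion_mat: "det (companion_mat c) = (- 1) ^ CARD('n) * c 0"
proof -
  have "c 0 = (- 1) ^ CARD('n) * det (companion_mat c)"
    using int_char_poly_coeff_0[of "companion_mat c"]
    unfolding int_char_poly_companion_mat coeff_monic_poly by simp
  thus ?thesis by (simp add: power_mult_distrib[symmetric] mult.assoc[symmetric])
qed

lemma companion_mat_cong_imp_eq:
  assumes cd: "c \<in> {..<CARD('n)} \<rightarrow>\<^sub>E {0..<int p}" "d \<in> {..<CARD('n)} \<rightarrow>\<^sub>E {0..<int p}"
    and cong: "mat_cong p (companion_mat c) (companion_mat d)"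
  shows "c = d"
proof (rule PiE_ext[OF cd])
  fix k assume k: "k \<in> {..<CARD('n)}"
  obtain i where i: "r i = k" using rank_surj k by blast
  obtain j where j: "r j = CARD('n) - 1" using rank_surj[of "CARD('n) - 1"] by auto
  have "int p dvd companion_mat d$i$j - companion_mat c$i$j"
    using mat_cong_sym[OF cong] by (simp add: mat_cong_def)
  hence "int p dvd c k - d k" using i j by (simp add: companion_mat_def)
  thus "c k = d k" using PiE_mem[OF cd(1) k] PiE_mem[OF cd(2) k] by (intro dvd_diff_residues_imp_eq)
qed

lemma mult_companion_mat_col:
  assumes j: "r j = Suc (r j')" shows "(M ** companion_mat c)$i$j' = M$i$j"
proof -
  have "Suc (r j') < CARD('n)" using rank_less[of j] j by simp
  hence "(M ** companion_mat c)$i$j' = (\<Sum>l\<in>UNIV. if l = j then M$i$l else 0)"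
    unfolding matrix_matrix_mult_def companion_mat_def vec_lambda_beta
    by (intro sum.cong) (auto simp: j[symmetric] rank_inj)
  thus ?thesis by simp
qed

text \<open>If \<open>A h = h C\<close>, then \<open>h\<close> sends \<open>e\<^sub>k\<^sub>+\<^sub>1 = C e\<^sub>k\<close> to \<open>A (h e\<^sub>k)\<close>. Hence \<open>A\<close> and the first column of
  \<open>h\<close> determine \<open>h\<close>.\<close>

lemma mat_cong_if_intertwine:
  assumes h: "mat_cong p (A ** h) (h ** companion_mat c)" and g: "mat_cong p (A ** g) (g ** companion_mat d)"
    and col: "\<And>i j. r j = 0 \<Longrightarrow> int p dvd h$i$j - g$i$j"
  shows "mat_cong p h g"
proof -
  have "\<forall>i j. r j = k \<longrightarrow> int p dvd h$i$j - g$i$j" for k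
  proof (induction k)
    case 0
    show ?case using col by blast
  next
    case (Suc k)
    show ?case
    proof (intro allI impI)
      fix i j assume j: "r j = Suc k"
      obtain j' where j': "r j' = k" using rank_surj[of k] rank_less[of j] j by auto
      have "int p dvd (\<Sum>l\<in>UNIV. A$i$l * h$l$j' - A$i$l * g$l$j')"
        using Suc j' by (intro dvd_sum) (simp flip: right_diff_distrib)
      hence diff: "int p dvd (A ** h)$i$j' - (A ** g)$i$j'"
        by (simp add: matrix_matrix_mult_def[of A] sum_subtractf)
      have "int p dvd (A ** h)$i$j' - h$i$j" "int p dvd (A ** g)$i$j' - g$i$j"
        using h g mult_companion_mat_col[of j j' _ _ i] j j' unfolding mat_cong_def by metis+
      moreover have "h$i$j - g$i$j
          = ((A ** h)$i$j' - (A ** g)$i$j') - ((A ** h)$i$j' - h$i$j) + ((A ** g)$i$j' - g$i$j)" by simp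
      ultimately show "int p dvd h$i$j - g$i$j" using diff by (metis dvd_add dvd_diff)
    qed
  qed
  thus ?thesis by (simp add: mat_cong_def)
qed

end

definition diag_at :: "'n \<Rightarrow> int \<Rightarrow> int^'n^'n" where
  "diag_at i0 u = (\<chi> i j. if i = j then (if i = i0 then u else 1) else 0)"

lemma det_diag_at: "det (diag_at i0 u) = u" for i0 :: "'n::finite"
proof -
  have "det (diag_at i0 u) = (\<Prod>i\<in>UNIV. diag_at i0 u$i$i)" by (rule det_diagonal) (simp add: diag_at_def)
  also have "\<dots> = (\<Prod>i\<in>UNIV. if i = i0 then u else 1)" by (simp add: diag_at_def)
  finally show ?thesis by simp
qed

lemma unit_mod_prime:
  assumes "prime p" "\<not> int p dvd d" obtains u where "int p dvd u * d - 1"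
proof -
  have "coprime (int p) d" using assms by (simp add: prime_imp_coprime)
  then obtain s t where "s * int p + t * d = 1" by (metis bezout_int coprime_imp_gcd_eq_1)
  hence "t * d - 1 = - s * int p" by (simp add: algebra_simps)
  thus ?thesis using that[of t] by simp
qed

lemma right_inverse_mod_prime:
  fixes h :: "int^'n^'n"
  assumes p: "prime p" and h: "\<not> int p dvd det h"
  obtains h' where "mat_cong p (h ** h') (mat 1)" "\<not> int p dvd det h'"
proof -
  obtain u where u: "int p dvd u * det h - 1" using unit_mod_prime[OF p h] .
  let ?D = "diag_at undefined u"
  have "det (h ** ?D) - 1 = u * det h - 1" by (simp add: det_mul det_diag_at mult.commute)
  then obtain B where B: "B \<in> elementary_group" "mat_cong p B (h ** ?D)"
    using elementary_group_onto_SL_mod_prime[OF p, of "h ** ?D"] u by auto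
  obtain B' where B': "B ** B' = mat 1" using elementary_group_inverse[OF B(1)] by blast
  have inv: "mat_cong p (h ** (?D ** B')) (mat 1)"
    using mat_cong_mult[OF mat_cong_sym[OF B(2)] mat_cong_refl[of p B']] B' by (simp add: matrix_mul_assoc)
  have "\<not> int p dvd 1" using p by (auto simp: prime_nat_iff)
  moreover have "int p dvd det h * det (?D ** B') - 1" using mat_cong_det[OF inv] by (simp add: det_mul)
  ultimately have "\<not> int p dvd det (?D ** B')" by (metis dvd_diff_right_iff dvd_mult dvd_diff_commute)
  thus ?thesis using that inv by blast
qed

lemma inverse_mod_prime:
  fixes h :: "int^'n^'n"
  assumes p: "prime p" and h: "\<not> int p dvd det h"
  shows "\<exists>h'. mat_cong p (h ** h') (mat 1) \<and> mat_cong p (h' ** h) (mat 1)"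
proof -
  obtain h' where h': "mat_cong p (h ** h') (mat 1)" "\<not> int p dvd det h'"
    using right_inverse_mod_prime[OF p h] .
  obtain k where k: "mat_cong p (h' ** k) (mat 1)" using right_inverse_mod_prime[OF p h'(2)] .
  have "mat_cong p (h ** mat 1) (h ** (h' ** k))" by (intro mat_cong_mult mat_cong_refl mat_cong_sym[OF k])
  moreover have "mat_cong p ((h ** h') ** k) (mat 1 ** k)" by (intro mat_cong_mult mat_cong_refl h')
  ultimately have "mat_cong p h k" using mat_cong_trans by (auto simp: matrix_mul_assoc)
  hence "mat_cong p (h' ** h) (h' ** k)" by (intro mat_cong_mult mat_cong_refl)
  thus ?thesis using h'(1) k mat_cong_trans by blast
qed

lemma mat_cong_cancel_left:
  fixes h A B :: "int^'n^'n"
  assumes p: "prime p" and h: "\<not> int p dvd det h" and cong: "mat_cong p (h ** A) (h ** B)"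
  shows "mat_cong p A B"
proof -
  obtain h' where h': "mat_cong p (h' ** h) (mat 1)" using inverse_mod_prime[OF p h] by blast
  have cancel: "mat_cong p (h' ** (h ** M)) M" for M
    using mat_cong_mult[OF h' mat_cong_refl[of p M]] by (simp add: matrix_mul_assoc)
  have "mat_cong p (h' ** (h ** A)) (h' ** (h ** B))" by (intro mat_cong_mult mat_cong_refl cong)
  thus ?thesis using cancel mat_cong_sym mat_cong_trans by blast
qed

lemma mat_cong_residue_mats_imp_eq:
  "A \<in> residue_mats p \<Longrightarrow> B \<in> residue_mats p \<Longrightarrow> mat_cong p A B \<Longrightarrow> A = B"
  using reduce_mod_id reduce_mod_eq_iff by metis

definition GL_mod :: "nat \<Rightarrow> (int^'n^'n) set" where
  "GL_mod p = {h\<in>residue_mats p. \<not> int p dvd det h}"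

lemma reduce_mod_in_GL_mod:
  assumes "p > 0" "\<not> int p dvd det A" shows "reduce_mod p A \<in> GL_mod p"
proof -
  have "\<not> int p dvd det (reduce_mod p A)"
    using mat_cong_det[OF reduce_mod_cong, of p A] assms(2) by (metis dvd_diff_right_iff dvd_diff_commute)
  thus ?thesis using reduce_mod_in_residue_mats[OF assms(1)] by (simp add: GL_mod_def)
qed

lemma card_SL_mod_le_GL_mod:
  assumes p: "prime p"
  shows "card (SL_mod p :: (int^'n^'n) set) * (p - 1) \<le> card (GL_mod p :: (int^'n^'n) set)"
proof -
  fix i0 :: 'n
  let ?SL = "SL_mod p :: (int^'n^'n) set" and ?GL = "GL_mod p :: (int^'n^'n) set"
  let ?f = "\<lambda>(A, u). reduce_mod p (diag_at i0 u ** A)"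
  have ndvd: "\<not> int p dvd u" if "u \<in> {1..<int p}" for u using that zdvd_imp_le[of "int p" u] by auto
  have "inj_on ?f (?SL \<times> {1..<int p})"
  proof (rule inj_onI, clarify)
    fix A A' and u u' assume A: "A \<in> ?SL" "A' \<in> ?SL" and u: "u \<in> {1..<int p}" "u' \<in> {1..<int p}"
      and "reduce_mod p (diag_at i0 u ** A) = reduce_mod p (diag_at i0 u' ** A')"
    hence cong: "mat_cong p (diag_at i0 u ** A) (diag_at i0 u' ** A')" by (simp add: reduce_mod_eq_iff)
    have "int p dvd u * det A - u' * det A'" using mat_cong_det[OF cong] by (simp add: det_mul det_diag_at)
    moreover have "int p dvd det A - 1" "int p dvd det A' - 1" using A by (auto simp: SL_mod_def)
    moreover have "u - u' = (u * det A - u' * det A') - u * (det A - 1) + u' * (det A' - 1)"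
      by (simp add: algebra_simps)
    ultimately have "int p dvd u - u'" by (metis dvd_add dvd_diff dvd_mult)
    hence uu: "u = u'" using u by (intro dvd_diff_residues_imp_eq) auto
    have "\<not> int p dvd det (diag_at i0 u)" using ndvd[OF u(1)] by (simp add: det_diag_at)
    hence "mat_cong p A A'" using mat_cong_cancel_left[OF p] cong uu by blast
    thus "A = A' \<and> u = u'" using A uu mat_cong_residue_mats_imp_eq by (auto simp: SL_mod_def)
  qed
  moreover have "?f ` (?SL \<times> {1..<int p}) \<subseteq> ?GL"
  proof (rule image_subsetI, clarify)
    fix A u assume A: "A \<in> ?SL" and u: "u \<in> {1..<int p}"
    have "\<not> int p dvd det A"
    proof
      assume "int p dvd det A"
      hence "int p dvd det A - (det A - 1)" by (rule dvd_diff) (use A in \<open>simp add: SL_mod_def\<close>)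
      moreover have "det A - (det A - 1) = 1" by simp
      ultimately have "int p dvd 1" by metis
      thus False using prime_gt_1_nat[OF p] by simp
    qed
    hence "\<not> int p dvd det (diag_at i0 u ** A)"
      using ndvd[OF u] p by (simp add: det_mul det_diag_at prime_dvd_mult_iff)
    thus "reduce_mod p (diag_at i0 u ** A) \<in> ?GL" by (rule reduce_mod_in_GL_mod[OF prime_gt_0_nat[OF p]])
  qed
  moreover have "finite ?GL" by (rule finite_subset[OF _ finite_residue_mats[of p]]) (auto simp: GL_mod_def)
  ultimately have "card (?SL \<times> {1..<int p}) \<le> card ?GL" by (rule card_inj_on_le)
  thus ?thesis using prime_gt_0_nat[OF p] by (simp add: card_cartesian_product nat_diff_distrib)
qed

definition mats_with_char_poly :: "nat \<Rightarrow> (nat \<Rightarrow> int) set \<Rightarrow> (int^'n^'n) set" where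
  "mats_with_char_poly p F =
    {A\<in>SL_mod p. \<exists>c\<in>F. \<forall>i. int p dvd coeff (int_char_poly A) i - coeff (monic_poly CARD('n) c) i}"

context
  fixes r :: "'n::finite \<Rightarrow> nat" and p :: nat
  assumes r: "bij_betw r UNIV {..<CARD('n)}" and p: "prime p" "CARD('n) < p"
begin

lemma conj_companion_mat_in_mats_with_char_poly:
  fixes h h' :: "int^'n^'n"
  assumes inv: "mat_cong p (h ** h') (mat 1)" and c: "c \<in> F" "int p dvd c 0 - (- 1) ^ CARD('n)"
  shows "reduce_mod p (h ** companion_mat r c ** h') \<in> mats_with_char_poly p F"
proof -
  let ?C = "companion_mat r c" and ?n = "CARD('n)"
  let ?A = "h ** ?C ** h'"
  have "int p dvd det h * det h' - 1" using mat_cong_det[OF inv] by (simp add: det_mul)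
  moreover have "det ?C - 1 = (- 1) ^ ?n * (c 0 - (- 1) ^ ?n)"
    by (simp add: det_companion_mat[OF r] right_diff_distrib power_mult_distrib[symmetric])
  hence "int p dvd det ?C - 1" using c(2) by simp
  moreover have "det ?A - 1 = (det h * det h' - 1) * det ?C + (det ?C - 1)" by (simp add: det_mul algebra_simps)
  ultimately have "int p dvd det ?A - 1" by (metis dvd_add dvd_mult2)
  hence "reduce_mod p ?A \<in> SL_mod p" by (rule reduce_mod_in_SL_mod[OF prime_gt_0_nat[OF p(1)]])
  moreover have "int p dvd coeff (int_char_poly (reduce_mod p ?A)) i - coeff (monic_poly ?n c) i" for i
  proof -
    have "int p dvd coeff (int_char_poly (reduce_mod p ?A)) i - coeff (int_char_poly ?A) i"
      by (rule int_char_poly_cong[OF reduce_mod_cong])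
    moreover have "int p dvd coeff (int_char_poly ?A) i - coeff (monic_poly ?n c) i"
      using int_char_poly_conj[OF p inv, of ?C i] by (simp add: int_char_poly_companion_mat[OF r])
    ultimately show ?thesis
      using dvd_add[of "int p" "coeff (int_char_poly (reduce_mod p ?A)) i - coeff (int_char_poly ?A) i"]
      by fastforce
  qed
  ultimately show ?thesis using c(1) by (auto simp: mats_with_char_poly_def)
qed

lemma conj_companion_mat_determines:
  fixes h g h' g' :: "int^'n^'n"
  assumes hg: "h \<in> GL_mod p" "g \<in> GL_mod p"
    and cd: "c \<in> {..<CARD('n)} \<rightarrow>\<^sub>E {0..<int p}" "d \<in> {..<CARD('n)} \<rightarrow>\<^sub>E {0..<int p}"
    and inv: "mat_cong p (h' ** h) (mat 1)" "mat_cong p (g' ** g) (mat 1)"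
    and cong: "mat_cong p (h ** companion_mat r c ** h') (g ** companion_mat r d ** g')"
    and col: "\<And>i j. r j = 0 \<Longrightarrow> h$i$j = g$i$j"
  shows "h = g \<and> c = d"
proof -
  let ?A = "h ** companion_mat r c ** h'"
  have intertwine: "mat_cong p (M ** k' ** k) M" if "mat_cong p (k' ** k) (mat 1)" for M k k' :: "int^'n^'n"
    using mat_cong_mult[OF mat_cong_refl[of p M] that] by (simp add: matrix_mul_assoc)
  have Ah: "mat_cong p (?A ** h) (h ** companion_mat r c)" by (rule intertwine[OF inv(1)])
  have "mat_cong p (?A ** g) (g ** companion_mat r d ** g' ** g)" by (intro mat_cong_mult mat_cong_refl cong)
  hence Ag: "mat_cong p (?A ** g) (g ** companion_mat r d)"
    using mat_cong_trans[OF _ intertwine[OF inv(2)]] by blast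
  have "mat_cong p h g" by (rule mat_cong_if_intertwine[OF r Ah Ag]) (simp add: col)
  hence "h = g" using hg mat_cong_residue_mats_imp_eq by (auto simp: GL_mod_def)
  moreover have "mat_cong p (h ** companion_mat r c) (h ** companion_mat r d)"
    using mat_cong_trans[OF mat_cong_sym[OF Ah]] Ag \<open>h = g\<close> by blast
  hence "mat_cong p (companion_mat r c) (companion_mat r d)"
    using mat_cong_cancel_left[OF p(1)] hg(1) by (auto simp: GL_mod_def)
  ultimately show ?thesis using companion_mat_cong_imp_eq[OF r cd] by blast
qed

lemma card_GL_mod_mult_le:
  assumes F: "F \<subseteq> {..<CARD('n)} \<rightarrow>\<^sub>E {0..<int p}"
    and const: "\<And>c. c \<in> F \<Longrightarrow> int p dvd c 0 - (- 1) ^ CARD('n)"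
  shows "card (GL_mod p :: (int^'n^'n) set) * card F
    \<le> card (mats_with_char_poly p F :: (int^'n^'n) set) * p ^ CARD('n)"
proof -
  let ?GL = "GL_mod p :: (int^'n^'n) set" and ?M = "mats_with_char_poly p F :: (int^'n^'n) set"
  let ?V = "{v :: int^'n. \<forall>i. v$i \<in> {0..<int p}}"
  obtain i0 where i0: "r i0 = 0" using rank_surj[OF r, of 0] by auto
  have "\<forall>h\<in>?GL. \<exists>h'. mat_cong p (h ** h') (mat 1) \<and> mat_cong p (h' ** h) (mat 1)"
    using inverse_mod_prime[OF p(1)] by (auto simp: GL_mod_def)
  then obtain iv where iv: "\<And>h. h \<in> ?GL \<Longrightarrow> mat_cong p (h ** iv h) (mat 1)"
    "\<And>h. h \<in> ?GL \<Longrightarrow> mat_cong p (iv h ** h) (mat 1)" by metis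
  let ?f = "\<lambda>(h, c). (reduce_mod p (h ** companion_mat r c ** iv h), \<chi> i. h$i$i0)"
  have "inj_on ?f (?GL \<times> F)"
  proof (rule inj_onI, clarify)
    fix h g :: "int^'n^'n" and c d assume h: "h \<in> ?GL" "g \<in> ?GL" and c: "c \<in> F" "d \<in> F"
      and eq: "reduce_mod p (h ** companion_mat r c ** iv h) = reduce_mod p (g ** companion_mat r d ** iv g)"
        "(\<chi> i. h$i$i0) = (\<chi> i. g$i$i0)"
    show "h = g \<and> c = d"
    proof (rule conj_companion_mat_determines[OF h _ _ iv(2)[OF h(1)] iv(2)[OF h(2)]])
      show "mat_cong p (h ** companion_mat r c ** iv h) (g ** companion_mat r d ** iv g)"
        using eq(1) by (simp add: reduce_mod_eq_iff)
      show "h$i$j = g$i$j" if "r j = 0" for i j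
        using eq(2) that i0 rank_inj[OF r, of j i0] by (simp add: vec_eq_iff)
    qed (use c F in auto)
  qed
  moreover have "?f ` (?GL \<times> F) \<subseteq> ?M \<times> ?V"
  proof (rule image_subsetI)
    fix x assume "x \<in> ?GL \<times> F"
    then obtain h c where x: "x = (h, c)" and h: "h \<in> ?GL" and c: "c \<in> F" by blast
    hence "reduce_mod p (h ** companion_mat r c ** iv h) \<in> ?M"
      using conj_companion_mat_in_mats_with_char_poly iv(1) const by blast
    moreover have "(\<chi> i. h$i$i0) \<in> ?V" using h by (simp add: GL_mod_def residue_mats_def)
    ultimately show "?f x \<in> ?M \<times> ?V" unfolding x by simp
  qed
  moreover have "finite (?M \<times> ?V)"
    using finite_SL_mod[of p] card_vec(2)[of "\<lambda>_. {0..<int p}"]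
    by (auto simp: mats_with_char_poly_def intro: finite_subset)
  ultimately have "card (?GL \<times> F) \<le> card (?M \<times> ?V)" by (rule card_inj_on_le)
  moreover have "card ?V = p ^ CARD('n)" using card_vec(1)[of "\<lambda>_ :: 'n. {0..<int p}"] by simp
  ultimately show ?thesis by (simp add: card_cartesian_product)
qed

end

lemma card_mats_with_char_poly:
  assumes p: "prime p" "CARD('n) < p" and F: "F \<subseteq> {..<CARD('n)} \<rightarrow>\<^sub>E {0..<int p}"
    and const: "\<And>c. c \<in> F \<Longrightarrow> int p dvd c 0 - (- 1) ^ CARD('n)"
  shows "card (SL_mod p :: (int^'n^'n) set) * card F
    \<le> 2 * p ^ (CARD('n) - 1) * card (mats_with_char_poly p F :: (int^'n^'n) set)"
proof -
  let ?n = "CARD('n)"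
  let ?s = "card (SL_mod p :: (int^'n^'n) set)" and ?M = "card (mats_with_char_poly p F :: (int^'n^'n) set)"
  obtain r :: "'n \<Rightarrow> nat" where r: "bij_betw r UNIV {..<?n}"
    using ex_bij_betw_finite_nat[of "UNIV :: 'n set"] by (auto simp: atLeast0LessThan)
  have p2: "p \<le> 2 * (p - 1)" "p > 0" using prime_ge_2_nat[OF p(1)] by auto
  have "?s * card F * p \<le> 2 * (?s * (p - 1) * card F)"
    using mult_le_mono2[OF p2(1), of "?s * card F"] by (simp add: mult_ac)
  also have "\<dots> \<le> 2 * (card (GL_mod p :: (int^'n^'n) set) * card F)"
    using card_SL_mod_le_GL_mod[OF p(1), where 'n = 'n] by (intro mult_le_mono mult_le_mono1) auto
  also have "\<dots> \<le> 2 * (?M * p ^ ?n)" using card_GL_mod_mult_le[OF r p F] const by simp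
  also have "p ^ ?n = p ^ (?n - 1) * p" by (simp add: power_eq_if)
  finally have "?s * card F * p \<le> (2 * p ^ (?n - 1) * ?M) * p" by (simp add: mult_ac)
  thus ?thesis using p2(2) by simp
qed

section \<open>Galois action on the roots of a polynomial of given factorisation type\<close>

definition complex_roots :: "int poly \<Rightarrow> complex set" where
  "complex_roots f = {z. poly (of_int_poly f) z = 0}"

lemma lead_coeff_of_int_poly: "lead_coeff f = 1 \<Longrightarrow> lead_coeff (of_int_poly f) = 1"
  by (simp add: degree_map_poly coeff_map_poly)

context
  fixes f :: "int poly" assumes monic: "lead_coeff f = 1"
begin

lemma finite_complex_roots: "finite (complex_roots f)"
  and card_complex_roots: "card (complex_roots f) \<le> degree f"
proof -
  have nz: "of_int_poly f \<noteq> 0" using lead_coeff_of_int_poly[OF monic] by auto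
  show "finite (complex_roots f)" unfolding complex_roots_def by (rule poly_roots_finite[OF nz])
  show "card (complex_roots f) \<le> degree f"
    unfolding complex_roots_def using card_poly_roots_bound[OF nz] by (simp add: degree_map_poly)
qed

lemma complex_roots_alg_ints: "complex_roots f \<subseteq> \<O>"
  using algebraic_int.intros[of "of_int_poly f"] lead_coeff_of_int_poly[OF monic]
  by (auto simp: complex_roots_def alg_ints_def coeff_map_poly)

lemma galois_stable_complex_roots: "galois_stable (complex_roots f)"
  unfolding galois_stable_def
proof (intro conjI ballI finite_complex_roots)
  show qbar: "complex_roots f \<subseteq> qbar" using complex_roots_alg_ints alg_ints_subset_qbar by blast
  fix \<sigma> z assume \<sigma>: "\<sigma> \<in> autq" and z: "z \<in> complex_roots f"
  have "\<sigma> (poly (of_int_poly f) z) = poly (of_int_poly f) (\<sigma> z)"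
    by (rule autq_poly[OF \<sigma>]) (use qbar z in \<open>auto simp: coeff_map_poly autq_of_int[OF \<sigma>]\<close>)
  thus "\<sigma> z \<in> complex_roots f" using z autq_0[OF \<sigma>] by (simp add: complex_roots_def)
qed

lemma rational_complex_root:
  assumes "\<bar>coeff f 0\<bar> = 1" "z \<in> complex_roots f" "z \<in> \<rat>"
  shows "z = 1 \<or> z = - 1"
proof -
  obtain b where b: "z = of_int b"
    using alg_ints_Rats_imp_Ints[of z] complex_roots_alg_ints assms(2,3) by (auto elim: Ints_cases)
  have "poly (of_int_poly f) (of_int b) = (of_int (poly f b) :: complex)"
    by (simp add: poly_altdef coeff_map_poly degree_map_poly)
  hence "poly f b = 0" using assms(2) b by (simp add: complex_roots_def)
  moreover obtain c q where f: "f = pCons c q" by (cases f)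
  ultimately have "c = - (b * poly q b)" by simp
  hence "b dvd coeff f 0" unfolding f by simp
  hence "\<bar>b\<bar> = 1" using assms(1) by (metis dvd_abs_iff zdvd1_eq)
  thus ?thesis using b by (cases "b \<ge> 0") auto
qed

end

context prime_above
begin

lemma cong_complex_root_exists:
  assumes f: "lead_coeff f = 1" and x: "x \<in> \<O>" "poly (of_int_poly f) x \<in> P"
  obtains z where "z \<in> complex_roots f" "x \<equiv>\<^sub>P z"
proof -
  let ?o = "\<lambda>z. Polynomial.order z (of_int_poly f)"
  have "(\<Prod>z\<in>complex_roots f. [:- z, 1:] ^ ?o z) = of_int_poly f"
    using complex_poly_decompose[of "of_int_poly f"] lead_coeff_of_int_poly[OF f]
    by (simp add: complex_roots_def)
  hence "poly (\<Prod>z\<in>complex_roots f. [:- z, 1:] ^ ?o z) x \<in> P" using x(2) by simp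
  hence prod: "(\<Prod>z\<in>complex_roots f. (x - z) ^ ?o z) \<in> P" by (simp add: poly_prod poly_power)
  have diff: "x - z \<in> \<O>" if "z \<in> complex_roots f" for z
    using that x(1) complex_roots_alg_ints[OF f] R_diff by blast
  obtain z where "z \<in> complex_roots f" "(x - z) ^ ?o z \<in> P"
    by (rule P_prodE[OF finite_complex_roots[OF f] R_power[OF diff] prod])
  thus ?thesis using that P_power diff by blast
qed

lemma frob_rootsE:
  assumes "frob_roots n m \<beta>" "k \<in> {m..<n}"
  obtains a where "\<beta> k \<equiv>\<^sub>P of_int a" "\<not> int p dvd a - 1" "\<not> int p dvd a + 1"
proof -
  have "\<forall>k\<in>{m..<n}. \<exists>a. \<beta> k \<equiv>\<^sub>P of_int a \<and> \<not> int p dvd a - 1 \<and> \<not> int p dvd a + 1"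
    using assms(1) by (simp add: frob_roots_def)
  thus ?thesis using that assms(2) by meson
qed

lemma frob_roots_cong:
  assumes \<beta>: "frob_roots n m \<beta>" and "m \<le> n" and \<gamma>: "\<And>k. k < n \<Longrightarrow> \<gamma> k \<in> \<O>" "\<And>k. k < n \<Longrightarrow> \<beta> k \<equiv>\<^sub>P \<gamma> k"
  shows "frob_roots n m \<gamma>"
proof -
  have "\<gamma> k ^ p \<equiv>\<^sub>P \<gamma> (cycle_succ m k)" if k: "k < n" for k
  proof -
    have succ: "cycle_succ m k < n" using bij_betwE[OF bij_cycle_succ[OF \<open>m \<le> n\<close>]] k by auto
    have "\<gamma> k ^ p \<equiv>\<^sub>P \<beta> k ^ p" using cong_power[OF cong_sym[OF \<gamma>(2)]] \<gamma>(1) \<beta> k by (auto simp: frob_roots_def)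
    moreover have "\<beta> k ^ p \<equiv>\<^sub>P \<beta> (cycle_succ m k)" using \<beta> k by (auto simp: frob_roots_def)
    ultimately show ?thesis using cong_trans \<gamma>(2)[OF succ] by blast
  qed
  moreover have "k = l" if "k < n" "l < n" "\<gamma> k \<equiv>\<^sub>P \<gamma> l" for k l
  proof -
    have "\<beta> k \<equiv>\<^sub>P \<beta> l" using cong_trans[OF cong_trans[OF \<gamma>(2) that(3)] cong_sym[OF \<gamma>(2)]] that by blast
    thus ?thesis using \<beta> that by (simp add: frob_roots_def)
  qed
  moreover have "\<exists>a. \<gamma> k \<equiv>\<^sub>P of_int a \<and> \<not> int p dvd a - 1 \<and> \<not> int p dvd a + 1" if k: "k \<in> {m..<n}" for k
  proof -
    obtain a where "\<beta> k \<equiv>\<^sub>P of_int a" "\<not> int p dvd a - 1" "\<not> int p dvd a + 1"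
      using frob_rootsE[OF \<beta> k] .
    thus ?thesis using cong_trans[OF cong_sym[OF \<gamma>(2)[of k]]] k by (intro exI[of _ a]) simp
  qed
  ultimately show ?thesis using \<gamma>(1) unfolding frob_roots_def by simp
qed

lemma frob_type_complex_roots:
  assumes f: "lead_coeff f = 1" "degree f = n" and type: "frob_type n m f" and "m \<le> n"
  obtains \<gamma> where "frob_roots n m \<gamma>" "bij_betw \<gamma> {..<n} (complex_roots f)"
proof -
  obtain \<beta> where \<beta>: "frob_roots n m \<beta>"
    and coeffs: "\<And>i. coeff (of_int_poly f) i \<equiv>\<^sub>P coeff (\<Prod>k<n. [:- \<beta> k, 1:]) i"
    using type unfolding frob_type_def by blast
  have "\<exists>z. z \<in> complex_roots f \<and> \<beta> k \<equiv>\<^sub>P z" if k: "k < n" for k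
  proof -
    have \<beta>k: "\<beta> k \<in> \<O>" using \<beta> k by (simp add: frob_roots_def)
    have "poly (of_int_poly f) (\<beta> k) \<equiv>\<^sub>P poly (\<Prod>j<n. [:- \<beta> j, 1:]) (\<beta> k)"
      by (rule cong_poly_coeffs[OF coeffs \<beta>k])
    moreover have "poly (\<Prod>j<n. [:- \<beta> j, 1:]) (\<beta> k) = 0" using k by (auto simp: poly_prod)
    ultimately have "poly (of_int_poly f) (\<beta> k) \<in> P" by simp
    thus ?thesis using cong_complex_root_exists[OF f(1) \<beta>k] by blast
  qed
  then obtain \<gamma> where \<gamma>: "\<And>k. k < n \<Longrightarrow> \<gamma> k \<in> complex_roots f" "\<And>k. k < n \<Longrightarrow> \<beta> k \<equiv>\<^sub>P \<gamma> k" by metis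
  have frob: "frob_roots n m \<gamma>"
    by (rule frob_roots_cong[OF \<beta> \<open>m \<le> n\<close>]) (use \<gamma> complex_roots_alg_ints[OF f(1)] in blast)+
  hence inj: "inj_on \<gamma> {..<n}" using cong_refl by (auto simp: frob_roots_def intro!: inj_onI)
  have "\<gamma> ` {..<n} = complex_roots f"
  proof (rule card_subset_eq[OF finite_complex_roots[OF f(1)]])
    show sub: "\<gamma> ` {..<n} \<subseteq> complex_roots f" using \<gamma>(1) by auto
    show "card (\<gamma> ` {..<n}) = card (complex_roots f)"
      using card_mono[OF finite_complex_roots[OF f(1)] sub] card_complex_roots[OF f(1)] card_image[OF inj] f(2)
      by simp
  qed
  thus ?thesis using that frob inj by (simp add: bij_betw_def)
qed

lemma frobenius_acts_as_cycle:
  assumes \<gamma>: "frob_roots n m \<gamma>" "bij_betw \<gamma> {..<n} Z" and "m \<le> n" and Z: "galois_stable Z"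
    and \<sigma>: "\<sigma> \<in> autq" "\<And>z. z \<in> Z \<Longrightarrow> \<sigma> z \<equiv>\<^sub>P z ^ p" and k: "k < n"
  shows "\<sigma> (\<gamma> k) = \<gamma> (cycle_succ m k)"
proof -
  have \<gamma>k: "\<gamma> k \<in> Z" using \<gamma>(2) k by (auto dest: bij_betwE)
  then obtain j where j: "j < n" "\<sigma> (\<gamma> k) = \<gamma> j"
    using galois_stableD[OF Z \<sigma>(1)] bij_betw_imp_surj_on[OF \<gamma>(2)] by (metis imageE lessThan_iff)
  have "\<gamma> k ^ p \<equiv>\<^sub>P \<gamma> (cycle_succ m k)" using \<gamma>(1) k by (simp add: frob_roots_def)
  hence "\<gamma> j \<equiv>\<^sub>P \<gamma> (cycle_succ m k)" using cong_trans[OF \<sigma>(2)[OF \<gamma>k]] j(2) by simp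
  moreover have "cycle_succ m k < n" using bij_betwE[OF bij_cycle_succ[OF \<open>m \<le> n\<close>]] k by auto
  ultimately show ?thesis using \<gamma>(1) j unfolding frob_roots_def by blast
qed

lemma frob_roots_irrational:
  assumes \<gamma>: "frob_roots n m \<gamma>" and f: "lead_coeff f = 1" "\<bar>coeff f 0\<bar> = 1"
    and k: "k \<in> {m..<n}" "\<gamma> k \<in> complex_roots f"
  shows "\<gamma> k \<notin> \<rat>"
proof
  assume "\<gamma> k \<in> \<rat>"
  hence "\<gamma> k = of_int 1 \<or> \<gamma> k = of_int (- 1)" using rational_complex_root[OF f k(2)] by simp
  moreover obtain a where "\<gamma> k \<equiv>\<^sub>P of_int a" "\<not> int p dvd a - 1" "\<not> int p dvd a + 1"
    using frob_rootsE[OF \<gamma> k(1)] .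
  ultimately show False
    using cong_of_int_iff[of 1 a] cong_of_int_iff[of "- 1" a] dvd_minus_iff[of "int p" "a + 1"]
    by (auto simp: dvd_diff_commute)
qed

lemma frob_type_frobenius:
  assumes f: "lead_coeff f = 1" "degree f = n" "\<bar>coeff f 0\<bar> = 1" and type: "frob_type n m f"
    and "m \<le> n" and big: "p > n ^ n * n"
  obtains \<gamma> \<sigma> where "\<sigma> \<in> autq" "bij_betw \<gamma> {..<n} (complex_roots f)"
    "\<And>k. k < n \<Longrightarrow> \<sigma> (\<gamma> k) = \<gamma> (cycle_succ m k)" "\<And>k. k \<in> {m..<n} \<Longrightarrow> \<gamma> k \<notin> \<rat>"
proof -
  obtain \<gamma> where \<gamma>: "frob_roots n m \<gamma>" "bij_betw \<gamma> {..<n} (complex_roots f)"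
    using frob_type_complex_roots[OF f(1,2) type \<open>m \<le> n\<close>] .
  have "card (complex_roots f) = n" using bij_betw_same_card[OF \<gamma>(2)] by simp
  then obtain \<sigma> where \<sigma>: "\<sigma> \<in> autq" "\<And>z. z \<in> complex_roots f \<Longrightarrow> \<sigma> z \<equiv>\<^sub>P z ^ p"
    using frobenius_element_exists[OF galois_stable_complex_roots[OF f(1)] complex_roots_alg_ints[OF f(1)]] big
    by metis
  show ?thesis
  proof (rule that[OF \<sigma>(1) \<gamma>(2)])
    show "\<sigma> (\<gamma> k) = \<gamma> (cycle_succ m k)" if "k < n" for k
      using frobenius_acts_as_cycle[OF \<gamma> \<open>m \<le> n\<close> galois_stable_complex_roots[OF f(1)] \<sigma> that] .
    show "\<gamma> k \<notin> \<rat>" if "k \<in> {m..<n}" for k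
      using frob_roots_irrational[OF \<gamma>(1) f(1,3) that] \<gamma>(2) that by (auto dest: bij_betwE)
  qed
qed

lemma frobenius_square_in_fixer_iff:
  assumes Z: "galois_stable Z" "Z \<subseteq> \<O>" and distinct: "\<And>x y. x \<in> Z \<Longrightarrow> y \<in> Z \<Longrightarrow> x \<equiv>\<^sub>P y \<Longrightarrow> x = y"
    and \<sigma>: "\<sigma> \<in> autq" "\<And>z. z \<in> Z \<Longrightarrow> \<sigma> z \<equiv>\<^sub>P z ^ p"
  shows "\<sigma> \<circ> \<sigma> \<in> fixer Z \<longleftrightarrow> (\<forall>z\<in>Z. z ^ (p ^ 2) \<equiv>\<^sub>P z)"
proof -
  have "\<sigma> (\<sigma> z) = z \<longleftrightarrow> z ^ (p ^ 2) \<equiv>\<^sub>P z" if z: "z \<in> Z" for z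
  proof -
    have \<sigma>z: "\<sigma> z \<in> Z" "\<sigma> (\<sigma> z) \<in> Z" using galois_stableD[OF Z(1) \<sigma>(1)] z by blast+
    have "\<sigma> z ^ p \<equiv>\<^sub>P (z ^ p) ^ p" using cong_power[OF \<sigma>(2)[OF z]] Z(2) z \<sigma>z(1) R_power by blast
    hence "\<sigma> (\<sigma> z) \<equiv>\<^sub>P z ^ (p ^ 2)"
      using cong_trans[OF \<sigma>(2)[OF \<sigma>z(1)]] by (simp add: power2_eq_square power_mult)
    thus ?thesis using distinct[OF \<sigma>z(2) z] cong_sym cong_trans by metis
  qed
  thus ?thesis using autq_comp[OF \<sigma>(1) \<sigma>(1)] by (simp add: fixer_def)
qed

lemma cycle_square_in_fixer_iff:
  assumes \<gamma>: "bij_betw \<gamma> {..<n} Z" and \<sigma>: "\<sigma> \<in> autq" "\<And>k. k < n \<Longrightarrow> \<sigma> (\<gamma> k) = \<gamma> (cycle_succ m k)"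
    and m: "2 \<le> m" "m \<le> n"
  shows "\<sigma> \<circ> \<sigma> \<in> fixer Z \<longleftrightarrow> m = 2"
proof -
  have succ: "cycle_succ m k < n" if "k < n" for k using bij_betwE[OF bij_cycle_succ[OF m(2)]] that by auto
  have "\<sigma> \<circ> \<sigma> \<in> fixer Z \<longleftrightarrow> (\<forall>z\<in>\<gamma> ` {..<n}. \<sigma> (\<sigma> z) = z)"
    using autq_comp[OF \<sigma>(1) \<sigma>(1)] \<gamma> by (simp add: fixer_def bij_betw_def)
  also have "\<dots> \<longleftrightarrow> (\<forall>k<n. \<gamma> (cycle_succ m (cycle_succ m k)) = \<gamma> k)" using \<sigma>(2) succ by auto
  also have "\<dots> \<longleftrightarrow> (\<forall>k<n. cycle_succ m (cycle_succ m k) = k)"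
    using inj_on_eq_iff[OF bij_betw_imp_inj_on[OF \<gamma>]] succ by simp
  also have "\<dots> \<longleftrightarrow> m = 2"
  proof
    assume "\<forall>k<n. cycle_succ m (cycle_succ m k) = k"
    hence "cycle_succ m (cycle_succ m 0) = 0" using m by simp
    thus "m = 2" using m by (auto simp: cycle_succ_def split: if_splits)
  qed (auto simp: cycle_succ_def)
  finally show ?thesis .
qed

text \<open>The square of a Frobenius element tells the two fixers apart: its action is nontrivial on one
  set of roots and trivial on the other.\<close>

lemma frob_type_fixer_ne:
  assumes f: "lead_coeff f = 1" "degree f = n" and h: "lead_coeff h = 1" "degree h = n" and n: "n \<ge> 4"
    and type: "frob_type n (if \<forall>z\<in>complex_roots h. z ^ (p ^ 2) \<equiv>\<^sub>P z then n - 1 else 2) f"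
    and distinct: "\<And>x y. x \<in> complex_roots h \<Longrightarrow> y \<in> complex_roots h \<Longrightarrow> x \<equiv>\<^sub>P y \<Longrightarrow> x = y"
    and big: "p > (2 * n) ^ (2 * n) * (2 * n)"
  shows "fixer (complex_roots f) \<noteq> fixer (complex_roots h)"
proof
  assume eq: "fixer (complex_roots f) = fixer (complex_roots h)"
  let ?Z = "complex_roots f \<union> complex_roots h"
  define m where "m = (if \<forall>z\<in>complex_roots h. z ^ (p ^ 2) \<equiv>\<^sub>P z then n - 1 else 2)"
  have m: "2 \<le> m" "m \<le> n" using n by (auto simp: m_def)
  note stable = galois_stable_complex_roots[OF f(1)] galois_stable_complex_roots[OF h(1)]
  have Z: "galois_stable ?Z" "?Z \<subseteq> \<O>"
    using stable complex_roots_alg_ints[OF f(1)] complex_roots_alg_ints[OF h(1)]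
    by (auto simp: galois_stable_def)
  have "card ?Z \<le> 2 * n"
    using card_Un_le[of "complex_roots f" "complex_roots h"] card_complex_roots[OF f(1)]
      card_complex_roots[OF h(1)] f h by simp
  hence "card ?Z ^ card ?Z * card ?Z \<le> (2 * n) ^ (2 * n) * (2 * n)"
    using n by (intro mult_le_mono order.trans[OF power_mono power_increasing]) auto
  hence "card ?Z ^ card ?Z * card ?Z < p" using big by linarith
  then obtain \<sigma> where \<sigma>: "\<sigma> \<in> autq" "\<And>z. z \<in> ?Z \<Longrightarrow> \<sigma> z \<equiv>\<^sub>P z ^ p"
    using frobenius_element_exists[OF Z] by metis
  obtain \<gamma> where \<gamma>: "frob_roots n m \<gamma>" "bij_betw \<gamma> {..<n} (complex_roots f)"
    using frob_type_complex_roots[OF f] type m(2) unfolding m_def by blast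
  have "m = 2 \<longleftrightarrow> \<sigma> \<circ> \<sigma> \<in> fixer (complex_roots f)"
    using cycle_square_in_fixer_iff[OF \<gamma>(2) \<sigma>(1) frobenius_acts_as_cycle[OF \<gamma> m(2) stable(1) \<sigma>(1)] m] \<sigma>(2)
    by blast
  also have "\<dots> \<longleftrightarrow> (\<forall>z\<in>complex_roots h. z ^ (p ^ 2) \<equiv>\<^sub>P z)"
    unfolding eq
    by (rule frobenius_square_in_fixer_iff[OF stable(2) complex_roots_alg_ints[OF h(1)] distinct \<sigma>(1)])
      (use \<sigma>(2) in auto)
  finally show False using n by (auto simp: m_def split: if_splits)
qed

lemma frob_type_cong:
  assumes "\<And>i. int p dvd coeff f i - coeff g i" "frob_type n m f"
  shows "frob_type n m g"
proof -
  have "coeff (of_int_poly g) i \<equiv>\<^sub>P coeff (of_int_poly f) i" for i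
    using cong_sym[of "of_int (coeff f i)" "of_int (coeff g i)"] assms(1)[of i] cong_of_int_iff
    by (simp add: coeff_map_poly)
  thus ?thesis using assms(2) cong_trans unfolding frob_type_def by blast
qed

end

lemma algebraic_nonzero_const_coeff:
  assumes "algebraic d" "d \<noteq> 0"
  obtains q where "poly (of_int_poly q) d = 0" "coeff q 0 \<noteq> 0"
proof -
  obtain q where "q \<noteq> 0" "poly (of_int_poly q) d = 0" using assms(1) by (rule algebraicE')
  hence "\<exists>q. poly (of_int_poly q) d = 0 \<and> coeff q 0 \<noteq> 0"
  proof (induction q rule: pCons_induct)
    case (pCons c q)
    show ?case
    proof (cases "c = 0")
      case True
      hence "q \<noteq> 0" "poly (of_int_poly q) d = 0" using pCons assms(2) by (auto simp: map_poly_pCons)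
      thus ?thesis by (rule pCons.IH)
    next
      case False
      thus ?thesis using pCons.prems by (intro exI[of _ "pCons c q"]) simp
    qed
  qed simp
  thus ?thesis using that by blast
qed

lemma nonzero_alg_int_in_few_primes:
  assumes d: "d \<in> \<O>" "d \<noteq> 0"
  obtains c :: int where "c \<noteq> 0" "\<And>p P. prime_above P p \<Longrightarrow> d \<in> P \<Longrightarrow> int p dvd c"
proof -
  have "algebraic d" using d(1) alg_ints_subset_qbar by (auto simp: qbar_def)
  then obtain q where q: "poly (of_int_poly q) d = 0" "coeff q 0 \<noteq> 0"
    using algebraic_nonzero_const_coeff d(2) by blast
  have "int p dvd coeff q 0" if "prime_above P p" and dP: "d \<in> P" for p P
  proof -
    interpret prime_above P p by fact
    have "poly (of_int_poly q) 0 - poly (of_int_poly q) d \<in> P"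
      by (rule cong_poly_arg) (use d(1) dP P_minus in \<open>auto simp: coeff_map_poly R_of_int R_zero\<close>)
    thus ?thesis using q(1) by (simp add: poly_0_coeff_0 coeff_map_poly of_int_in_P_iff)
  qed
  thus ?thesis using that q(2) by blast
qed

lemma nonzero_mod_large_primes:
  assumes "finite D" "D \<subseteq> \<O>" "0 \<notin> D"
  shows "\<exists>B. \<forall>p P. p > B \<longrightarrow> prime_above P p \<longrightarrow> D \<inter> P = {}"
  using assms
proof (induction D rule: finite_induct)
  case (insert d D)
  then obtain B where B: "\<And>p P. p > B \<Longrightarrow> prime_above P p \<Longrightarrow> D \<inter> P = {}" by auto
  obtain c where c: "c \<noteq> 0" "\<And>p P. prime_above P p \<Longrightarrow> d \<in> P \<Longrightarrow> int p dvd c"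
    using nonzero_alg_int_in_few_primes[of d] insert.prems by auto
  have "insert d D \<inter> P = {}" if p: "p > max B (nat \<bar>c\<bar>)" "prime_above P p" for p P
  proof -
    have "d \<notin> P"
    proof
      assume "d \<in> P"
      hence "int p dvd \<bar>c\<bar>" using c(2)[OF p(2)] by simp
      thus False using zdvd_imp_le[of "int p" "\<bar>c\<bar>"] c(1) p(1) by linarith
    qed
    thus ?thesis using B[of p P] p by simp
  qed
  thus ?case by blast
qed simp

lemma distinct_mod_large_primes:
  assumes Z: "finite Z" "Z \<subseteq> \<O>"
  shows "\<exists>B. \<forall>p P. p > B \<longrightarrow> prime_above P p \<longrightarrow> (\<forall>x\<in>Z. \<forall>y\<in>Z. x - y \<in> P \<longrightarrow> x = y)"
proof -
  let ?D = "(\<lambda>(x, y). x - y) ` (Z \<times> Z) - {0}"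
  have "x - y \<in> \<O>" if "x \<in> Z" "y \<in> Z" for x y
    using alg_ints_add[of x "- y"] alg_ints_minus Z(2) that by auto
  hence "?D \<subseteq> \<O>" by auto
  then obtain B where B: "\<forall>p P. p > B \<longrightarrow> prime_above P p \<longrightarrow> ?D \<inter> P = {}"
    using nonzero_mod_large_primes[of ?D] Z(1) by blast
  have "x = y" if "p > B" "prime_above P p" "x \<in> Z" "y \<in> Z" "x - y \<in> P" for p P x y
    using B that by force
  thus ?thesis by blast
qed

lemma perm_group_restrict_autq:
  assumes Z: "galois_stable Z" shows "perm_group Z ((\<lambda>\<sigma>. restrict_id \<sigma> Z) ` autq)"
proof -
  have comp: "restrict_id \<sigma> Z \<circ> restrict_id \<tau> Z = restrict_id (\<sigma> \<circ> \<tau>) Z" if "\<tau> \<in> autq" for \<sigma> \<tau>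
    using galois_stableD[OF Z that] by (auto simp: restrict_id_def fun_eq_iff)
  have id: "restrict_id id Z = id" by (auto simp: restrict_id_def)
  have inverse: "restrict_id \<sigma> Z \<circ> restrict_id (inv' \<sigma>) Z = id"
    "restrict_id (inv' \<sigma>) Z \<circ> restrict_id \<sigma> Z = id" if "\<sigma> \<in> autq" for \<sigma>
    unfolding comp[OF that] comp[OF autq_inv[OF that]]
    using autq_inv_apply[OF that] by (auto simp: restrict_id_def fun_eq_iff)
  show ?thesis
  proof
    show "id \<in> (\<lambda>\<sigma>. restrict_id \<sigma> Z) ` autq" using id autq_id by (metis imageI)
    fix g assume "g \<in> (\<lambda>\<sigma>. restrict_id \<sigma> Z) ` autq"
    then obtain \<sigma> where \<sigma>: "\<sigma> \<in> autq" "g = restrict_id \<sigma> Z" by blast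
    have "bij g" unfolding \<sigma>(2) using o_bij[OF inverse(2,1)] \<sigma>(1) by blast
    thus "g permutes Z" unfolding permutes_def bij_iff using \<sigma>(2) by (auto simp: restrict_id_def)
    have "inv' g = restrict_id (inv' \<sigma>) Z" unfolding \<sigma>(2) using inverse \<sigma>(1) by (intro inv_unique_comp)
    thus "inv' g \<in> (\<lambda>\<sigma>. restrict_id \<sigma> Z) ` autq" using autq_inv \<sigma>(1) by auto
    show "g \<circ> h \<in> (\<lambda>\<sigma>. restrict_id \<sigma> Z) ` autq" if h: "h \<in> (\<lambda>\<sigma>. restrict_id \<sigma> Z) ` autq" for h
    proof -
      obtain \<tau> where \<tau>: "\<tau> \<in> autq" "h = restrict_id \<tau> Z" using h by blast
      show ?thesis unfolding \<sigma>(2) \<tau>(2) comp[OF \<tau>(1)] by (intro imageI autq_comp \<sigma>(1) \<tau>(1))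
    qed
  qed
qed

lemma cycle_funpow:
  assumes cycle: "\<And>k. k < m \<Longrightarrow> \<sigma> (\<gamma> k) = \<gamma> (cycle_succ m k)" and k: "k < m"
  shows "(\<sigma> ^^ j) (\<gamma> k) = \<gamma> ((k + j) mod m)"
proof (induction j)
  case (Suc j)
  have less: "(k + j) mod m < m" using k by simp
  have "(\<sigma> ^^ Suc j) (\<gamma> k) = \<gamma> (cycle_succ m ((k + j) mod m))" using Suc cycle[OF less] by simp
  also have "cycle_succ m ((k + j) mod m) = (k + Suc j) mod m" using less by (simp add: cycle_succ_def mod_Suc)
  finally show ?case .
qed (use k in simp)

context
  fixes Z n \<gamma> \<sigma>
  assumes Z: "galois_stable Z" and n: "n > 0" and \<gamma>: "bij_betw \<gamma> {..<n} Z" and \<sigma>: "\<sigma> \<in> autq"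
    and cycle: "k < n \<Longrightarrow> \<sigma> (\<gamma> k) = \<gamma> (cycle_succ (n - 1) k)"
begin

lemma cycle_fixes_last: "(\<sigma> ^^ j) (\<gamma> (n - 1)) = \<gamma> (n - 1)"
  by (induction j) (use cycle[of "n - 1"] n in \<open>auto simp: cycle_succ_def\<close>)

lemma cycle_transitive_on_others:
  assumes xy: "x \<in> Z - {\<gamma> (n - 1)}" "y \<in> Z - {\<gamma> (n - 1)}"
  shows "\<exists>\<rho>\<in>autq. \<rho> (\<gamma> (n - 1)) = \<gamma> (n - 1) \<and> \<rho> x = y"
proof -
  have index: "\<exists>k<n - 1. u = \<gamma> k" if u: "u \<in> Z - {\<gamma> (n - 1)}" for u
  proof -
    obtain k where k: "k < n" "u = \<gamma> k" using u bij_betw_imp_surj_on[OF \<gamma>] by (metis DiffD1 imageE lessThan_iff)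
    thus ?thesis using u by (metis Diff_iff Suc_diff_1 insertI1 less_Suc_eq n)
  qed
  obtain k l where kl: "k < n - 1" "x = \<gamma> k" "l < n - 1" "y = \<gamma> l" using index xy by metis
  have "(\<sigma> ^^ (n - 1 - k + l)) (\<gamma> k) = \<gamma> ((k + (n - 1 - k + l)) mod (n - 1))"
    by (rule cycle_funpow) (use cycle kl(1) in auto)
  also have "k + (n - 1 - k + l) = l + (n - 1)" using kl by simp
  also have "(l + (n - 1)) mod (n - 1) = l" using kl(3) by (simp only: mod_add_self2 mod_less)
  finally have "(\<sigma> ^^ (n - 1 - k + l)) x = y" using kl(2,4) by simp
  thus ?thesis using autq_funpow[OF \<sigma>] cycle_fixes_last by blast
qed

lemma transitive_if_last_irrational:
  assumes irr: "\<gamma> (n - 1) \<notin> \<rat>" and x: "x \<in> Z"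
  shows "\<exists>\<rho>\<in>autq. \<rho> (\<gamma> (n - 1)) = x"
proof (cases "x = \<gamma> (n - 1)")
  case True
  thus ?thesis using autq_id by (intro bexI[of _ id]) auto
next
  case False
  have last: "\<gamma> (n - 1) \<in> Z" using \<gamma> n by (auto dest: bij_betwE)
  then obtain \<rho> where \<rho>: "\<rho> \<in> autq" "\<rho> (\<gamma> (n - 1)) \<noteq> \<gamma> (n - 1)"
    using fixed_by_autq_imp_rat[of "\<gamma> (n - 1)"] irr Z by (auto simp: galois_stable_def)
  obtain \<rho>' where \<rho>': "\<rho>' \<in> autq" "\<rho>' (\<rho> (\<gamma> (n - 1))) = x"
    using cycle_transitive_on_others[of "\<rho> (\<gamma> (n - 1))" x] galois_stableD[OF Z \<rho>(1) last] \<rho>(2) x False by blast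
  thus ?thesis using autq_comp[OF \<rho>'(1) \<rho>(1)] by (intro bexI[of _ "\<rho>' \<circ> \<rho>"]) auto
qed

end

lemma restrict_id_eq_transpose:
  assumes n: "n \<ge> 2" and \<delta>: "bij_betw \<delta> {..<n} Z" and \<tau>: "\<And>k. k < n \<Longrightarrow> \<tau> (\<delta> k) = \<delta> (cycle_succ 2 k)"
  shows "restrict_id \<tau> Z = transp (\<delta> 0) (\<delta> 1)"
proof
  fix z
  have in_Z: "\<delta> 0 \<in> Z" "\<delta> 1 \<in> Z" using bij_betwE[OF \<delta>] n by auto
  show "restrict_id \<tau> Z z = transp (\<delta> 0) (\<delta> 1) z"
  proof (cases "z \<in> Z")
    case True
    then obtain k where k: "k < n" "z = \<delta> k" using bij_betw_imp_surj_on[OF \<delta>] by (metis imageE lessThan_iff)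
    consider "k = 0" | "k = 1" | (fixed) "2 \<le> k" by linarith
    thus ?thesis
    proof cases
      case fixed
      hence "\<delta> k \<noteq> \<delta> 0" "\<delta> k \<noteq> \<delta> 1" using k n bij_betw_imp_inj_on[OF \<delta>] by (auto dest: inj_onD)
      thus ?thesis using \<tau>[OF k(1)] k True fixed by (simp add: restrict_id_def cycle_succ_def)
    qed (use \<tau>[OF k(1)] k True in \<open>simp_all add: restrict_id_def cycle_succ_def\<close>)
  next
    case False
    hence "z \<noteq> \<delta> 0" "z \<noteq> \<delta> 1" using in_Z by auto
    thus ?thesis using False by (simp add: restrict_id_def)
  qed
qed

lemma galois_action_symmetric:
  assumes Z: "galois_stable Z" and n: "n \<ge> 2"
    and \<gamma>: "bij_betw \<gamma> {..<n} Z" "\<gamma> (n - 1) \<notin> \<rat>"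
    and \<sigma>: "\<sigma> \<in> autq" "\<And>k. k < n \<Longrightarrow> \<sigma> (\<gamma> k) = \<gamma> (cycle_succ (n - 1) k)"
    and \<delta>: "bij_betw \<delta> {..<n} Z"
    and \<tau>: "\<tau> \<in> autq" "\<And>k. k < n \<Longrightarrow> \<tau> (\<delta> k) = \<delta> (cycle_succ 2 k)"
    and \<pi>: "\<pi> permutes Z"
  shows "\<exists>\<rho>\<in>autq. \<forall>z\<in>Z. \<rho> z = \<pi> z"
proof -
  let ?G = "(\<lambda>\<sigma>. restrict_id \<sigma> Z) ` autq" and ?z = "\<gamma> (n - 1)"
  interpret perm_group Z ?G by (rule perm_group_restrict_autq[OF Z])
  have n0: "n > 0" using n by simp
  have z: "?z \<in> Z" using \<gamma>(1) n by (auto dest: bij_betwE)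
  have \<delta>01: "\<delta> 0 \<in> Z" "\<delta> 1 \<in> Z" "\<delta> 0 \<noteq> \<delta> 1"
    using bij_betwE[OF \<delta>] inj_onD[OF bij_betw_imp_inj_on[OF \<delta>], of 0 1] n by auto
  have "\<pi> \<in> ?G"
  proof (rule symmetric_if_two_transitive[OF _ _ _ \<pi>])
    show "finite Z" using Z by (simp add: galois_stable_def)
    show "transp (\<delta> 0) (\<delta> 1) \<in> ?G" using restrict_id_eq_transpose[OF n \<delta> \<tau>(2)] \<tau>(1) by (metis imageI)
    show "\<exists>g\<in>?G. g (\<delta> 0) = x \<and> g (\<delta> 1) = y" if xy: "x \<in> Z" "y \<in> Z" "x \<noteq> y" for x y
    proof (rule two_transitive_if_stabilizer_transitive[OF z _ _ \<delta>01 xy])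
      show "\<exists>g\<in>?G. g ?z = u" if "u \<in> Z" for u
        using transitive_if_last_irrational[OF Z n0 \<gamma>(1) \<sigma> \<gamma>(2) that] z by (auto simp: restrict_id_def)
      show "\<exists>g\<in>?G. g ?z = ?z \<and> g u = v" if "u \<in> Z - {?z}" "v \<in> Z - {?z}" for u v
        using cycle_transitive_on_others[OF Z n0 \<gamma>(1) \<sigma> that] z that(1) by (auto simp: restrict_id_def)
    qed
  qed
  thus ?thesis by (auto simp: restrict_id_def)
qed

lemma full_galois_enum_exists:
  assumes Z: "galois_stable Z" "card Z = n"
    and full: "\<And>\<pi>. \<pi> permutes Z \<Longrightarrow> \<exists>\<rho>\<in>autq. \<forall>z\<in>Z. \<rho> z = \<pi> z"
  obtains e where "full_galois_enum n e" "e ` {1..n} = Z"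
proof -
  obtain e where e: "bij_betw e {1..n} Z"
    using ex_bij_betw_nat_finite_1[of Z] Z by (auto simp: galois_stable_def)
  have inj: "inj_on e {1..n}" and im: "e ` {1..n} = Z" using e by (auto simp: bij_betw_def)
  have "\<exists>\<sigma>. acts_as n e \<sigma> g" if g: "g permutes {1..n}" for g
  proof -
    define \<pi> where "\<pi> = restrict_id (e \<circ> g \<circ> inv_into {1..n} e) Z"
    have \<pi>_e: "\<pi> (e k) = e (g k)" if k: "k \<in> {1..n}" for k
      using inv_into_f_f[OF inj k] im k by (auto simp: \<pi>_def restrict_id_def)
    have "bij_betw (e \<circ> g \<circ> inv_into {1..n} e) Z Z"
      by (intro bij_betw_trans[OF bij_betw_inv_into[OF e]] bij_betw_trans[OF permutes_imp_bij[OF g]] e)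
    hence "\<pi> permutes Z" unfolding \<pi>_def by (rule permutes_restrict_id)
    then obtain \<rho> where "\<rho> \<in> autq" "\<forall>z\<in>Z. \<rho> z = \<pi> z" using full by blast
    hence "acts_as n e \<rho> g" unfolding acts_as_def using \<pi>_e im g by auto
    thus ?thesis by blast
  qed
  thus ?thesis using that[of e] inj im Z(1) unfolding full_galois_enum_def by simp
qed

section \<open>Frobenius types of matrices\<close>

definition prime_over :: "nat \<Rightarrow> complex set" where
  "prime_over p = (SOME P. prime_above P p)"

lemma prime_above_prime_over: "prime p \<Longrightarrow> prime_above (prime_over p) p"
  unfolding prime_over_def by (rule someI_ex) (meson prime_above_exists)

definition mat_frob_type :: "nat \<Rightarrow> nat \<Rightarrow> int^'n^'n \<Rightarrow> bool" where
  "mat_frob_type m p A \<longleftrightarrow> prime_above.frob_type (prime_over p) p CARD('n) m (int_char_poly A)"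

lemma mat_frob_type_cong:
  assumes "prime p" "mat_cong p A B" "mat_frob_type m p A" shows "mat_frob_type m p B"
  using prime_above.frob_type_cong[OF prime_above_prime_over[OF assms(1)] int_char_poly_cong[OF assms(2)]]
    assms(3)
  unfolding mat_frob_type_def .

lemma card_mat_frob_type:
  assumes p: "prime p" "p \<ge> 8 * CARD('n)" and m: "2 \<le> m" "m < CARD('n)"
  shows "card (SL_mod p :: (int^'n^'n) set)
    \<le> 4 * 4 ^ CARD('n) * CARD('n) ^ CARD('n) * card {A\<in>SL_mod p :: (int^'n^'n) set. mat_frob_type m p A}"
proof -
  let ?n = "CARD('n)" and ?s = "card (SL_mod p :: (int^'n^'n) set)"
  let ?M = "{A\<in>SL_mod p :: (int^'n^'n) set. mat_frob_type m p A}"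
  let ?D = "2 * 4 ^ ?n * ?n ^ ?n"
  interpret prime_above "prime_over p" p by (rule prime_above_prime_over[OF p(1)])
  obtain F where F: "F \<subseteq> {..<?n} \<rightarrow>\<^sub>E {0..<int p}" "\<And>c. c \<in> F \<Longrightarrow> frob_type ?n m (monic_poly ?n c)"
    "\<And>c. c \<in> F \<Longrightarrow> int p dvd c 0 - (- 1) ^ ?n" "p ^ (?n - 1) \<le> card F * ?D"
    by (rule many_frob_types[OF m p(2)]) (rule that)
  have "mats_with_char_poly p F \<subseteq> ?M"
  proof
    fix A :: "int^'n^'n" assume "A \<in> mats_with_char_poly p F"
    then obtain c where c: "A \<in> SL_mod p" "c \<in> F"
      "\<And>i. int p dvd coeff (int_char_poly A) i - coeff (monic_poly ?n c) i"
      by (auto simp: mats_with_char_poly_def)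
    have "frob_type ?n m (int_char_poly A)"
      by (rule frob_type_cong[OF _ F(2)[OF c(2)]]) (use c(3) in \<open>simp add: dvd_diff_commute\<close>)
    thus "A \<in> ?M" using c(1) by (simp add: mat_frob_type_def)
  qed
  hence le: "card (mats_with_char_poly p F :: (int^'n^'n) set) \<le> card ?M"
    by (intro card_mono) (simp_all add: finite_SL_mod)
  have "?n < p" using p(2) zero_less_card_finite[where 'a = 'n] by linarith
  have "?s * p ^ (?n - 1) \<le> ?s * card F * ?D" using F(4) by (simp only: mult.assoc mult_le_mono2)
  also have "?s * card F \<le> 2 * p ^ (?n - 1) * card (mats_with_char_poly p F :: (int^'n^'n) set)"
    by (rule card_mats_with_char_poly[OF p(1) \<open>?n < p\<close> F(1)]) (use F(3) in simp)
  also have "\<dots> \<le> 2 * p ^ (?n - 1) * card ?M" using le by (rule mult_le_mono2)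
  finally have "?s * p ^ (?n - 1) \<le> (2 * ?D * card ?M) * p ^ (?n - 1)" by (simp add: mult_ac)
  thus ?thesis using prime_gt_0_nat[OF p(1)] by (simp add: mult.assoc)
qed

definition root_fixer :: "int^'n^'n \<Rightarrow> (complex \<Rightarrow> complex) set" where
  "root_fixer A = fixer (complex_roots (int_char_poly A))"

definition full_galois_action :: "int^'n^'n \<Rightarrow> bool" where
  "full_galois_action A \<longleftrightarrow>
    (\<exists>e. full_galois_enum CARD('n) e \<and> e ` {1..CARD('n)} = complex_roots (int_char_poly A))"

lemma full_galois_action_if_frob_types:
  fixes X :: "int^'n^'n"
  assumes n: "CARD('n) \<ge> 2" and X: "X \<in> SLZ"
    and p: "prime p" "p > CARD('n) ^ CARD('n) * CARD('n)" "mat_frob_type (CARD('n) - 1) p X"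
    and q: "prime q" "q > CARD('n) ^ CARD('n) * CARD('n)" "mat_frob_type 2 q X"
  shows "full_galois_action X"
proof -
  let ?n = "CARD('n)" and ?f = "int_char_poly X"
  have "\<bar>coeff ?f 0\<bar> = 1" using X by (simp add: int_char_poly_coeff_0 SLZ_def power_abs)
  note f = lead_coeff_int_char_poly[of X] degree_int_char_poly[of X] this
  obtain \<gamma> \<sigma> where \<sigma>: "\<sigma> \<in> autq" and \<gamma>: "bij_betw \<gamma> {..<?n} (complex_roots ?f)"
    and cycle: "\<And>k. k < ?n \<Longrightarrow> \<sigma> (\<gamma> k) = \<gamma> (cycle_succ (?n - 1) k)"
    and irrational: "\<And>k. k \<in> {?n - 1..<?n} \<Longrightarrow> \<gamma> k \<notin> \<rat>"
    using prime_above.frob_type_frobenius[OF prime_above_prime_over[OF p(1)] f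
        p(3)[unfolded mat_frob_type_def] _ p(2)]
    by (metis diff_le_self)
  obtain \<delta> \<tau> where \<tau>: "\<tau> \<in> autq" and \<delta>: "bij_betw \<delta> {..<?n} (complex_roots ?f)"
    and swap: "\<And>k. k < ?n \<Longrightarrow> \<tau> (\<delta> k) = \<delta> (cycle_succ 2 k)"
    using prime_above.frob_type_frobenius[OF prime_above_prime_over[OF q(1)] f
        q(3)[unfolded mat_frob_type_def] n q(2)]
    by metis
  have stable: "galois_stable (complex_roots ?f)" by (rule galois_stable_complex_roots[OF f(1)])
  have last: "\<gamma> (?n - 1) \<notin> \<rat>" using irrational[of "?n - 1"] n by simp
  have card: "card (complex_roots ?f) = ?n" using bij_betw_same_card[OF \<gamma>] by simp
  show ?thesis
    unfolding full_galois_action_def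
    using full_galois_enum_exists[OF stable card
        galois_action_symmetric[OF stable n \<gamma> last \<sigma> cycle \<delta> \<tau> swap]] by metis
qed

definition separating_type :: "int^'n^'n \<Rightarrow> nat \<Rightarrow> nat" where
  "separating_type A p =
    (if \<forall>z\<in>complex_roots (int_char_poly A). z ^ (p ^ 2) - z \<in> prime_over p then CARD('n) - 1 else 2)"

lemma separating_type_fixer_ne:
  fixes A :: "int^'n^'n"
  assumes n: "CARD('n) \<ge> 4"
  shows "\<exists>B. \<forall>p (X :: int^'n^'n). p > B \<longrightarrow> prime p \<longrightarrow> mat_frob_type (separating_type A p) p X
    \<longrightarrow> root_fixer X \<noteq> root_fixer A"
proof -
  let ?h = "int_char_poly A" and ?N = "(2 * CARD('n)) ^ (2 * CARD('n)) * (2 * CARD('n))"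
  obtain B where B: "\<forall>p P. p > B \<longrightarrow> prime_above P p \<longrightarrow>
      (\<forall>x\<in>complex_roots ?h. \<forall>y\<in>complex_roots ?h. x - y \<in> P \<longrightarrow> x = y)"
    using distinct_mod_large_primes[of "complex_roots ?h"] finite_complex_roots[OF lead_coeff_int_char_poly]
      complex_roots_alg_ints[OF lead_coeff_int_char_poly] by meson
  have "root_fixer X \<noteq> root_fixer A"
    if p: "p > max B ?N" "prime p" and type: "mat_frob_type (separating_type A p) p X"
    for p and X :: "int^'n^'n"
    unfolding root_fixer_def
  proof (rule prime_above.frob_type_fixer_ne[OF prime_above_prime_over[OF p(2)]
        lead_coeff_int_char_poly degree_int_char_poly lead_coeff_int_char_poly degree_int_char_poly n])
    show "prime_above.frob_type (prime_over p) p CARD('n) (if \<forall>z\<in>complex_roots ?h. z ^ p\<^sup>2 - z \<in> prime_over p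
        then CARD('n) - 1 else 2) (int_char_poly X)"
      using type unfolding mat_frob_type_def separating_type_def .
    show "x = y" if "x \<in> complex_roots ?h" "y \<in> complex_roots ?h" "x - y \<in> prime_over p" for x y
      using B prime_above_prime_over[OF p(2)] p(1) that by (meson max_less_iff_conj)
    show "p > ?N" using p(1) by simp
  qed
  thus ?thesis by blast
qed

section \<open>Asymptotic properties of the random walk\<close>

definition walk_values :: "(int^'n^'n) set \<Rightarrow> nat \<Rightarrow> (int^'n^'n) set" where
  "walk_values \<Sigma> k = foldl (**) (mat 1) ` {xs. set xs \<subseteq> \<Sigma> \<and> length xs = k}"

lemma finite_walk_values: "finite \<Sigma> \<Longrightarrow> finite (walk_values \<Sigma> k)"
  unfolding walk_values_def by (intro finite_imageI finite_lists_length_eq)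

lemma walk_values_SLZ:
  assumes "\<Sigma> \<subseteq> SLZ" shows "walk_values \<Sigma> k \<subseteq> (SLZ :: (int^'n^'n) set)"
proof -
  have "det (foldl (**) A xs) = det A" if "set xs \<subseteq> \<Sigma>" for xs and A :: "int^'n^'n"
    using that assms by (induction xs arbitrary: A) (auto simp: det_mul SLZ_def)
  thus ?thesis by (auto simp: walk_values_def SLZ_def)
qed

lemma walk_prob_mono:
  assumes "finite \<Sigma>" "\<And>X. X \<in> walk_values \<Sigma> k \<Longrightarrow> P X \<Longrightarrow> Q X"
  shows "walk_prob \<Sigma> k P \<le> walk_prob \<Sigma> k Q"
proof -
  have "card {xs. set xs \<subseteq> \<Sigma> \<and> length xs = k \<and> P (foldl (**) (mat 1) xs)}
      \<le> card {xs. set xs \<subseteq> \<Sigma> \<and> length xs = k \<and> Q (foldl (**) (mat 1) xs)}"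
    by (intro card_mono finite_subset[OF _ finite_lists_length_eq[OF assms(1), of k]])
      (use assms(2) in \<open>auto simp: walk_values_def\<close>)
  thus ?thesis unfolding walk_prob_def by (simp add: divide_right_mono)
qed

lemma walk_prob_disj: "walk_prob \<Sigma> k (\<lambda>X. P X \<or> Q X) \<le> walk_prob \<Sigma> k P + walk_prob \<Sigma> k Q"
proof -
  let ?W = "\<lambda>P. {xs. set xs \<subseteq> \<Sigma> \<and> length xs = k \<and> P (foldl (**) (mat 1) xs)}"
  have "?W (\<lambda>X. P X \<or> Q X) = ?W P \<union> ?W Q" by auto
  hence "card (?W (\<lambda>X. P X \<or> Q X)) \<le> card (?W P) + card (?W Q)" by (simp add: card_Un_le)
  hence "real (card (?W (\<lambda>X. P X \<or> Q X))) \<le> real (card (?W P)) + real (card (?W Q))" by linarith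
  thus ?thesis unfolding walk_prob_def by (simp add: divide_right_mono flip: add_divide_distrib)
qed

lemma walk_prob_compl:
  assumes "finite \<Sigma>" "\<Sigma> \<noteq> {}" shows "walk_prob \<Sigma> k P = 1 - walk_prob \<Sigma> k (\<lambda>X. \<not> P X)"
proof -
  let ?W = "\<lambda>P. {xs. set xs \<subseteq> \<Sigma> \<and> length xs = k \<and> P (foldl (**) (mat 1) xs)}"
  have fin: "finite (?W P)" for P
    by (rule finite_subset[OF _ finite_lists_length_eq[OF assms(1), of k]]) auto
  have "{xs. set xs \<subseteq> \<Sigma> \<and> length xs = k} = ?W P \<union> ?W (\<lambda>X. \<not> P X)" by auto
  hence "card \<Sigma> ^ k = card (?W P \<union> ?W (\<lambda>X. \<not> P X))" using card_lists_length_eq[OF assms(1), of k] by simp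
  also have "\<dots> = card (?W P) + card (?W (\<lambda>X. \<not> P X))" by (rule card_Un_disjoint[OF fin fin]) auto
  finally have "real (card \<Sigma>) ^ k = real (card (?W P)) + real (card (?W (\<lambda>X. \<not> P X)))"
    by (simp flip: of_nat_add of_nat_power)
  moreover have "real (card \<Sigma>) ^ k > 0" using assms by (simp add: card_gt_0_iff)
  ultimately show ?thesis unfolding walk_prob_def by (simp add: field_simps)
qed

definition walk_eventually :: "(int^'n^'n) set \<Rightarrow> (int^'n^'n \<Rightarrow> bool) \<Rightarrow> bool" where
  "walk_eventually \<Sigma> P \<longleftrightarrow> (\<lambda>k. walk_prob \<Sigma> k (\<lambda>X. \<not> P X)) \<longlonglongrightarrow> 0"

lemma walk_eventually_if_le:
  assumes le: "\<And>k. walk_prob \<Sigma> k (\<lambda>X. \<not> P X) \<le> b k" and b: "b \<longlonglongrightarrow> 0"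
  shows "walk_eventually \<Sigma> P"
  unfolding walk_eventually_def
proof (rule tendsto_sandwich[OF _ _ tendsto_const b])
  show "\<forall>\<^sub>F k in sequentially. 0 \<le> walk_prob \<Sigma> k (\<lambda>X. \<not> P X)" by (simp add: walk_prob_def)
qed (simp add: le)

lemma walk_eventually_mono:
  assumes "finite \<Sigma>" "\<Sigma> \<subseteq> SLZ" "walk_eventually \<Sigma> P" "\<And>X. X \<in> SLZ \<Longrightarrow> P X \<Longrightarrow> Q X"
  shows "walk_eventually \<Sigma> Q"
proof (rule walk_eventually_if_le)
  show "walk_prob \<Sigma> k (\<lambda>X. \<not> Q X) \<le> walk_prob \<Sigma> k (\<lambda>X. \<not> P X)" for k
    by (rule walk_prob_mono[OF assms(1)]) (use assms(4) walk_values_SLZ[OF assms(2)] in blast)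
qed (use assms(3) in \<open>simp add: walk_eventually_def\<close>)

lemma walk_eventually_conj:
  assumes "walk_eventually \<Sigma> P" "walk_eventually \<Sigma> Q" shows "walk_eventually \<Sigma> (\<lambda>X. P X \<and> Q X)"
proof (rule walk_eventually_if_le)
  show "walk_prob \<Sigma> k (\<lambda>X. \<not> (P X \<and> Q X)) \<le> walk_prob \<Sigma> k (\<lambda>X. \<not> P X) + walk_prob \<Sigma> k (\<lambda>X. \<not> Q X)" for k
    using walk_prob_disj[of \<Sigma> k "\<lambda>X. \<not> P X" "\<lambda>X. \<not> Q X"] by simp
qed (use assms in \<open>auto simp: walk_eventually_def intro: tendsto_add_zero\<close>)

lemma walk_eventually_Ball:
  assumes "finite I" "\<And>i. i \<in> I \<Longrightarrow> walk_eventually \<Sigma> (Q i)" shows "walk_eventually \<Sigma> (\<lambda>X. \<forall>i\<in>I. Q i X)"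
  using assms
proof (induction I rule: finite_induct)
  case empty
  show ?case by (simp add: walk_eventually_def walk_prob_def)
next
  case (insert i I)
  thus ?case using walk_eventually_conj[of \<Sigma> "Q i"] by simp
qed

definition generic_over :: "(int^'n^'n) set \<Rightarrow> int^'n^'n \<Rightarrow> bool" where
  "generic_over \<Theta> X \<longleftrightarrow> full_galois_action X \<and> (\<forall>A\<in>\<Theta>. root_fixer X \<noteq> root_fixer A)"

context
  fixes \<Sigma> :: "(int^'n^'n) set"
  assumes n4: "CARD('n) \<ge> 4" and fin: "finite \<Sigma>" and sub: "\<Sigma> \<subseteq> SLZ" and gen: "gen_by \<Sigma> = SLZ"
begin

lemma walk_avoids_frob_types:
  fixes t :: "nat \<Rightarrow> nat"
  assumes t: "\<And>p. 2 \<le> t p" "\<And>p. t p < CARD('n)" and "\<epsilon> > 0"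
  obtains J K where "\<And>p. p \<in> J \<Longrightarrow> prime p \<and> p > B"
    "\<And>k. k \<ge> K \<Longrightarrow> walk_prob \<Sigma> k (\<lambda>X. \<forall>p\<in>J. \<not> mat_frob_type (t p) p (reduce_mod p X)) < \<epsilon>"
proof -
  let ?D = "4 * 4 ^ CARD('n) * CARD('n) ^ CARD('n)" and ?S = "\<lambda>p. SL_mod p :: (int^'n^'n) set"
  let ?G = "\<lambda>p. {A\<in>?S p. mat_frob_type (t p) p A}"
  define c where "c = 1 / real ?D"
  have "?D > 0" by simp
  hence D: "real ?D \<ge> 1" by linarith
  hence c: "0 < c" "c \<le> 1" by (simp_all add: c_def del: of_nat_mult of_nat_power)
  obtain j where j: "(1 - c) ^ j < \<epsilon> / 2" using real_arch_pow_inv[of "\<epsilon> / 2" "1 - c"] \<open>\<epsilon> > 0\<close> c by auto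
  have "infinite ({p. prime p} - {..max B (8 * CARD('n))})"
    using primes_infinite by (simp add: Diff_infinite_finite)
  then obtain J where J: "finite J" "card J = j" "J \<subseteq> {p. prime p} - {..max B (8 * CARD('n))}"
    using infinite_arbitrarily_large by blast
  have primes: "prime p" "p > B" "p \<ge> 8 * CARD('n)" if "p \<in> J" for p using J(3) that by auto
  interpret generated_SLZ \<Sigma> J
    by (rule generated_SLZ.intro) (use n4 fin sub gen J(1) primes in auto)
  have density: "c * real (card (?S p)) \<le> real (card (?G p))" if "p \<in> J" for p
  proof -
    have "card (?S p) \<le> ?D * card (?G p)" by (rule card_mat_frob_type[OF primes(1,3)[OF that] t])
    hence "real (card (?S p)) \<le> real ?D * real (card (?G p))" by (simp only: of_nat_le_iff flip: of_nat_mult)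
    thus ?thesis using D by (simp add: c_def field_simps del: of_nat_mult of_nat_power)
  qed
  have "\<exists>K. \<forall>k\<ge>K. walk_prob \<Sigma> k (\<lambda>X. \<forall>p\<in>J. reduce_mod p X \<notin> ?G p) \<le> (1 - c) ^ card J + \<epsilon> / 2"
    by (rule walk_avoids_product) (use density \<open>\<epsilon> > 0\<close> in auto)
  then obtain K where
    K: "\<And>k. k \<ge> K \<Longrightarrow> walk_prob \<Sigma> k (\<lambda>X. \<forall>p\<in>J. reduce_mod p X \<notin> ?G p) \<le> (1 - c) ^ card J + \<epsilon> / 2"
    by meson
  have "walk_prob \<Sigma> k (\<lambda>X. \<forall>p\<in>J. \<not> mat_frob_type (t p) p (reduce_mod p X)) < \<epsilon>" if "k \<ge> K" for k
  proof -
    have "walk_prob \<Sigma> k (\<lambda>X. \<forall>p\<in>J. \<not> mat_frob_type (t p) p (reduce_mod p X))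
        \<le> walk_prob \<Sigma> k (\<lambda>X. \<forall>p\<in>J. reduce_mod p X \<notin> ?G p)"
      by (rule walk_prob_mono[OF fin]) blast
    thus ?thesis using K[OF that] j unfolding J(2) by linarith
  qed
  thus ?thesis using that primes by blast
qed

lemma walk_eventually_frob_type:
  fixes t :: "nat \<Rightarrow> nat"
  assumes t: "\<And>p. 2 \<le> t p" "\<And>p. t p < CARD('n)"
  shows "walk_eventually \<Sigma> (\<lambda>X. \<exists>p>B. prime p \<and> mat_frob_type (t p) p X)"
  unfolding walk_eventually_def
proof (rule LIMSEQ_I)
  let ?P = "\<lambda>X. \<exists>p>B. prime p \<and> mat_frob_type (t p) p X"
  fix \<epsilon> :: real assume "\<epsilon> > 0"
  obtain J K where J: "\<And>p. p \<in> J \<Longrightarrow> prime p \<and> p > B"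
    and K: "\<And>k. k \<ge> K \<Longrightarrow> walk_prob \<Sigma> k (\<lambda>X. \<forall>p\<in>J. \<not> mat_frob_type (t p) p (reduce_mod p X)) < \<epsilon>"
    by (rule walk_avoids_frob_types[OF t \<open>\<epsilon> > 0\<close>, of B]) (rule that)
  have "norm (walk_prob \<Sigma> k (\<lambda>X. \<not> ?P X) - 0) < \<epsilon>" if "k \<ge> K" for k
  proof -
    have "walk_prob \<Sigma> k (\<lambda>X. \<not> ?P X) \<le> walk_prob \<Sigma> k (\<lambda>X. \<forall>p\<in>J. \<not> mat_frob_type (t p) p (reduce_mod p X))"
    proof (rule walk_prob_mono[OF fin], intro ballI notI)
      fix X p assume none: "\<not> ?P X" and p: "p \<in> J" "mat_frob_type (t p) p (reduce_mod p X)"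
      have "mat_frob_type (t p) p X" using mat_frob_type_cong[OF _ reduce_mod_cong p(2)] J[OF p(1)] by simp
      thus False using none J[OF p(1)] by auto
    qed
    moreover have "walk_prob \<Sigma> k (\<lambda>X. \<not> ?P X) \<ge> 0" by (simp add: walk_prob_def)
    ultimately show ?thesis using K[OF that] by simp
  qed
  thus "\<exists>K. \<forall>k\<ge>K. norm (walk_prob \<Sigma> k (\<lambda>X. \<not> ?P X) - 0) < \<epsilon>" by blast
qed

lemma walk_eventually_full_galois_action: "walk_eventually \<Sigma> full_galois_action"
proof (rule walk_eventually_mono[OF fin sub walk_eventually_conj])
  let ?n = "CARD('n)"
  let ?P = "\<lambda>m (X :: int^'n^'n). \<exists>p>?n ^ ?n * ?n. prime p \<and> mat_frob_type m p X"
  show "walk_eventually \<Sigma> (?P (?n - 1))" "walk_eventually \<Sigma> (?P 2)"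
    by (rule walk_eventually_frob_type; use n4 in simp)+
  fix X :: "int^'n^'n" assume "X \<in> SLZ" and types: "?P (?n - 1) X \<and> ?P 2 X"
  obtain p q where "prime p" "p > ?n ^ ?n * ?n" "mat_frob_type (?n - 1) p X"
    "prime q" "q > ?n ^ ?n * ?n" "mat_frob_type 2 q X" using types by blast
  thus "full_galois_action X" using full_galois_action_if_frob_types[OF _ \<open>X \<in> SLZ\<close>] n4 by simp
qed

lemma walk_eventually_root_fixer_ne:
  fixes A :: "int^'n^'n" shows "walk_eventually \<Sigma> (\<lambda>X. root_fixer X \<noteq> root_fixer A)"
proof -
  obtain B where B: "\<forall>p (X :: int^'n^'n). p > B \<longrightarrow> prime p \<longrightarrow> mat_frob_type (separating_type A p) p X
      \<longrightarrow> root_fixer X \<noteq> root_fixer A"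
    using separating_type_fixer_ne[OF n4] by blast
  have "walk_eventually \<Sigma> (\<lambda>X. \<exists>p>B. prime p \<and> mat_frob_type (separating_type A p) p X)"
    by (rule walk_eventually_frob_type) (use n4 in \<open>auto simp: separating_type_def\<close>)
  thus ?thesis by (rule walk_eventually_mono[OF fin sub]) (use B in blast)
qed

lemma walk_generic_over:
  assumes "finite \<Theta>" "\<epsilon> > 0"
  obtains k where "walk_prob \<Sigma> k (\<lambda>X. \<not> generic_over \<Theta> X) < \<epsilon>"
proof -
  have "walk_eventually \<Sigma> (generic_over \<Theta>)"
    unfolding generic_over_def
    by (intro walk_eventually_conj walk_eventually_Ball walk_eventually_full_galois_action
        walk_eventually_root_fixer_ne assms(1))
  hence "\<forall>\<^sub>F k in sequentially. walk_prob \<Sigma> k (\<lambda>X. \<not> generic_over \<Theta> X) < \<epsilon>"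
    unfolding walk_eventually_def using assms(2) by (rule order_tendstoD)
  thus ?thesis using that eventually_happens' sequentially_bot by blast
qed

lemma walk_generic_stages:
  obtains \<kappa> \<Theta> where "\<And>r s. r < s \<Longrightarrow> walk_values \<Sigma> (\<kappa> r) \<subseteq> \<Theta> s"
    "\<And>s. walk_prob \<Sigma> (\<kappa> s) (\<lambda>X. \<not> generic_over (\<Theta> s) X) \<le> 1 / 2 ^ s"
proof -
  let ?P = "\<lambda>s x. finite (fst x) \<and> walk_prob \<Sigma> (snd x) (\<lambda>X. \<not> generic_over (fst x) X) \<le> 1 / 2 ^ s"
  let ?Q = "\<lambda>s x y. fst y = fst x \<union> walk_values \<Sigma> (snd x)"
  have stage: "\<exists>y. ?P s y \<and> fst y = \<Theta>" if \<Theta>: "finite \<Theta>" for s \<Theta>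
  proof -
    obtain k where "walk_prob \<Sigma> k (\<lambda>X. \<not> generic_over \<Theta> X) < 1 / 2 ^ s"
      using walk_generic_over[OF \<Theta>, of "1 / 2 ^ s"] by auto
    thus ?thesis using \<Theta> by (intro exI[of _ "(\<Theta>, k)"]) simp
  qed
  have "\<exists>f. \<forall>s. ?P s (f s) \<and> ?Q s (f s) (f (Suc s))"
  proof (rule dependent_nat_choice)
    show "\<exists>x. ?P 0 x" using stage[of "{}" 0] by auto
    fix x s assume "?P s x"
    hence "finite (fst x \<union> walk_values \<Sigma> (snd x))" using finite_walk_values[OF fin] by simp
    thus "\<exists>y. ?P (Suc s) y \<and> ?Q s x y" by (rule stage)
  qed
  then obtain f where f: "\<And>s. ?P s (f s)" "\<And>s. ?Q s (f s) (f (Suc s))" by meson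
  have mono: "fst (f r) \<subseteq> fst (f s)" if "r \<le> s" for r s
    by (rule lift_Suc_mono_le[of "\<lambda>s. fst (f s)", OF _ that]) (subst f(2), rule Un_upper1)
  show ?thesis
  proof (rule that[of "\<lambda>s. snd (f s)" "\<lambda>s. fst (f s)"])
    show "walk_values \<Sigma> (snd (f r)) \<subseteq> fst (f s)" if "r < s" for r s
      using mono[of "Suc r" s] that unfolding f(2)[of r] by simp
    show "walk_prob \<Sigma> (snd (f s)) (\<lambda>X. \<not> generic_over (fst (f s)) X) \<le> 1 / 2 ^ s" for s
      using f(1) by blast
  qed
qed

end

section \<open>Realising the prescribed Galois groups\<close>

lemma galois_groups_realisation:
  fixes \<Gamma> :: "nat \<Rightarrow> (int^'n^'n) set"
  assumes n5: "CARD('n) \<ge> 5" and full: "\<And>s X. X \<in> \<Gamma> s \<Longrightarrow> full_galois_action X"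
    and distinct: "\<And>r s X Y. X \<in> \<Gamma> r \<Longrightarrow> Y \<in> \<Gamma> s \<Longrightarrow> r < s \<Longrightarrow> root_fixer X \<noteq> root_fixer Y"
    and H: "\<And>s. subgroup (H s) (alt_group CARD('n))"
  obtains F where "algebraic_ext_Q F"
    "\<And>s X. X \<in> \<Gamma> s \<Longrightarrow> gal (split_field F X) F \<cong> (alt_group CARD('n))\<lparr>carrier := H s\<rparr>"
proof -
  define I where "I = (\<Union>s. root_fixer ` \<Gamma> s)"
  have same_stage: "r = s" if "X \<in> \<Gamma> r" "Y \<in> \<Gamma> s" "root_fixer X = root_fixer Y" for X Y r s
    using distinct[of X r Y s] distinct[of Y s X r] that by (metis nat_neq_iff)
  have "\<forall>i\<in>I. \<exists>s e. i \<in> root_fixer ` \<Gamma> s \<and> full_galois_enum CARD('n) e \<and> fixer (e ` {1..CARD('n)}) = i"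
    using full unfolding I_def full_galois_action_def root_fixer_def by fastforce
  then obtain stage e where stage: "\<And>i. i \<in> I \<Longrightarrow> i \<in> root_fixer ` \<Gamma> (stage i)"
    and e: "\<And>i. i \<in> I \<Longrightarrow> full_galois_enum CARD('n) (e i)"
    and fixer_e: "\<And>i. i \<in> I \<Longrightarrow> fixer (e i ` {1..CARD('n)}) = i" by metis
  interpret galois_family "CARD('n)" I e "\<lambda>i. H (stage i)"
    by (rule galois_family.intro) (use n5 e fixer_e H in auto)
  have "gal (split_field base_field X) base_field \<cong> (alt_group CARD('n))\<lparr>carrier := H s\<rparr>"
    if X: "X \<in> \<Gamma> s" for s X
  proof -
    have i: "root_fixer X \<in> I" using X by (auto simp: I_def)
    have "stage (root_fixer X) = s" using stage[OF i] same_stage X by auto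
    moreover have "split_field base_field X = field_adjoin base_field (complex_roots (int_char_poly X))"
      by (simp add: split_field_def complex_roots_def char_poly_int_eq)
    moreover have "fixer (complex_roots (int_char_poly X)) = fixer (e (root_fixer X) ` {1..CARD('n)})"
      using fixer_e[OF i] by (simp add: root_fixer_def)
    ultimately show ?thesis
      using gal_base_field_iso[OF i galois_stable_complex_roots[OF lead_coeff_int_char_poly]] by metis
  qed
  thus ?thesis using that algebraic_base_field by blast
qed

lemma random_walk_galois_groups_realisation:
  fixes \<Sigma> :: "(int^'n^'n) set"
  assumes n5: "CARD('n) \<ge> 5" and \<Sigma>: "finite \<Sigma>" "\<Sigma> \<subseteq> SLZ" "gen_by \<Sigma> = SLZ"
    and H: "\<And>s. subgroup (H s) (alt_group CARD('n))"
  obtains F \<kappa> where "algebraic_ext_Q F"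
    "\<And>s. walk_prob \<Sigma> (\<kappa> s) (\<lambda>X. gal (split_field F X) F \<cong> (alt_group CARD('n))\<lparr>carrier := H s\<rparr>) \<ge> 1 - 1 / 2 ^ s"
proof -
  have n4: "CARD('n) \<ge> 4" using n5 by simp
  obtain \<kappa> \<Theta> where \<Theta>: "\<And>r s. r < s \<Longrightarrow> walk_values \<Sigma> (\<kappa> r) \<subseteq> \<Theta> s"
    and prob: "\<And>s. walk_prob \<Sigma> (\<kappa> s) (\<lambda>X. \<not> generic_over (\<Theta> s) X) \<le> 1 / 2 ^ s"
    by (rule walk_generic_stages[OF n4 \<Sigma>]) (rule that)
  define \<Gamma> where "\<Gamma> s = {X \<in> walk_values \<Sigma> (\<kappa> s). generic_over (\<Theta> s) X}" for s
  obtain F where F: "algebraic_ext_Q F"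
    and iso: "\<And>s X. X \<in> \<Gamma> s \<Longrightarrow> gal (split_field F X) F \<cong> (alt_group CARD('n))\<lparr>carrier := H s\<rparr>"
  proof (rule galois_groups_realisation[OF n5 _ _ H])
    show "full_galois_action X" if "X \<in> \<Gamma> s" for s X
      using that by (simp add: \<Gamma>_def generic_over_def)
    show "root_fixer X \<noteq> root_fixer Y" if X: "X \<in> \<Gamma> r" and Y: "Y \<in> \<Gamma> s" and "r < s" for r s X Y
    proof -
      have "X \<in> \<Theta> s" using X \<Theta>[OF \<open>r < s\<close>] by (auto simp: \<Gamma>_def)
      thus ?thesis using Y by (auto simp: \<Gamma>_def generic_over_def)
    qed
  qed (rule that)
  interpret generated_SLZ \<Sigma> "{}" by (rule generated_SLZ.intro) (use n5 \<Sigma> in auto)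
  have "walk_prob \<Sigma> (\<kappa> s) (\<lambda>X. gal (split_field F X) F \<cong> (alt_group CARD('n))\<lparr>carrier := H s\<rparr>)
      \<ge> 1 - 1 / 2 ^ s" for s
  proof -
    let ?E = "\<lambda>X. gal (split_field F X) F \<cong> (alt_group CARD('n))\<lparr>carrier := H s\<rparr>"
    have "walk_prob \<Sigma> (\<kappa> s) (\<lambda>X. \<not> ?E X) \<le> walk_prob \<Sigma> (\<kappa> s) (\<lambda>X. \<not> generic_over (\<Theta> s) X)"
      by (rule walk_prob_mono[OF \<Sigma>(1)]) (use iso in \<open>auto simp: \<Gamma>_def\<close>)
    thus ?thesis using prob[of s] walk_prob_compl[OF \<Sigma>(1) gens_nonempty, of "\<kappa> s" ?E] by linarith
  qed
  thus ?thesis using that F by blast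
qed

theorem theorem6:
  fixes \<Sigma> :: "(int ^'n^'n) set"
  assumes n5: "CARD('n) \<ge> 5"
    and fin: "finite \<Sigma>"
    and sub: "\<Sigma> \<subseteq> SLZ"
    and gen: "gen_by \<Sigma> = SLZ"
  shows "\<forall>G1 G2. subgroup G1 (alt_group CARD('n)) \<longrightarrow> subgroup G2 (alt_group CARD('n)) \<longrightarrow>
    (\<exists>F. algebraic_ext_Q F \<and> (\<exists>ns ks :: nat \<Rightarrow> nat. \<forall>i\<ge>1.
       walk_prob \<Sigma> (ns i) (\<lambda>X. gal (split_field F X) F \<cong> (alt_group CARD('n))\<lparr>carrier := G1\<rparr>)
         \<ge> 1 - 1 / 2 ^ i
     \<and> walk_prob \<Sigma> (ks i) (\<lambda>X. gal (split_field F X) F \<cong> (alt_group CARD('n))\<lparr>carrier := G2\<rparr>)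
         \<ge> 1 - 1 / 2 ^ i))"
proof (intro allI impI, goal_cases realise)
  case (realise G1 G2)
  define H where "H s = (if even s then G1 else G2)" for s :: nat
  have "subgroup (H s) (alt_group CARD('n))" for s using realise by (simp add: H_def)
  then obtain F \<kappa> where F: "algebraic_ext_Q F" and prob: "\<And>s. walk_prob \<Sigma> (\<kappa> s)
      (\<lambda>X. gal (split_field F X) F \<cong> (alt_group CARD('n))\<lparr>carrier := H s\<rparr>) \<ge> 1 - 1 / 2 ^ s"
    by (rule random_walk_galois_groups_realisation[OF n5 fin sub gen]) (rule that)
  have mono: "1 - 1 / 2 ^ i \<le> 1 - 1 / (2::real) ^ s" if "i \<le> s" for i s :: nat
    using power_increasing[OF that, of "2::real"] by (simp add: frac_le)
  have prob_le: "1 - 1 / 2 ^ i \<le> walk_prob \<Sigma> (\<kappa> s)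
      (\<lambda>X. gal (split_field F X) F \<cong> (alt_group CARD('n))\<lparr>carrier := H s\<rparr>)" if "i \<le> s" for i s
    using order.trans[OF mono[OF that] prob] .
  show ?case
  proof (intro exI conjI allI impI)
    fix i :: nat
    show "1 - 1 / 2 ^ i \<le> walk_prob \<Sigma> (\<kappa> (2 * i))
        (\<lambda>X. gal (split_field F X) F \<cong> (alt_group CARD('n))\<lparr>carrier := G1\<rparr>)"
      using prob_le[of i "2 * i"] by (simp add: H_def)
    show "1 - 1 / 2 ^ i \<le> walk_prob \<Sigma> (\<kappa> (2 * i + 1))
        (\<lambda>X. gal (split_field F X) F \<cong> (alt_group CARD('n))\<lparr>carrier := G2\<rparr>)"
      using prob_le[of i "2 * i + 1"] by (simp add: H_def)
  qed (rule F)
qed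

end
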